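(* Let $\rho\ge\sigma>1$ be such that $1+\frac1{\rho^2}-\frac2{\sigma^2}>0$, and let $\psi=\omega=\varphi_\rho/\varphi_\sigma$. Let $F(\boldsymbol y)=G(u_h^s(\cdot,\boldsymbol y))$, $\boldsymbol y\in\mathbb R^s$, be the functional of the finite element solution of the log-normal diffusion problem described in the context and let $F_\sigma=F\,\varphi_1/\varphi_\sigma$, so that $\int_{\mathbb R^s}F(\boldsymbol y)\varphi_1(\boldsymbol y)\,d\boldsymbol y=\int_{\mathbb R^s}F_\sigma(\boldsymbol y)\varphi_\sigma(\boldsymbol y)\,d\boldsymbol y$. Let $\boldsymbol\gamma=\{\gamma_{\mathfrak u}\}_{\mathfrak u\subseteq[s]}$ be positive real weights. Then for all $s\in\mathbb N$, all $\delta\in(0,1-\sigma^2/\rho^2)$, with $\beta=1-\sigma^2/\rho^2-\delta$, and every $m\in\mathbb N$, a shifted interlaced polynomial lattice point set $\mathcal P^{\rm sh}_{m,s}\subset(0,1)^s$ of order $2$ with $N=2^m$ points can be constructed by a component-by-component algorithm minimizing the criterion $B_s$ (see context), such that for all $\lambda\in(\frac1{1+\beta},1]$ there exists a quantity $C(s,\delta,\lambda)>0$, not depending on $m$, with $$\Big|\int_{\mathbb R^s}F_\sigma(\boldsymbol y)\varphi_\sigma(\boldsymbol y)\,d\boldsymbol y-\frac1N\sum_{\boldsymbol x\in\mathcal P^{\rm sh}_{m,s}}F_\sigma(\Phi_\sigma^{-1}(\boldsymbol x))\Big|\le\frac{C(s,\delta,\lambda)}{N^{1/\lambda}}\,\|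F_\sigma\|_{\boldsymbol\gamma,\varphi_\sigma,\varphi_\rho/\varphi_\sigma,\varphi_\rho/\varphi_\sigma}.$$
   Context: Notation: $\mathbb N=\{1,2,\dots\}$, $\mathbb N_0=\mathbb N\cup\{0\}$, $[s]=\{1,\dots,s\}$. For $\tau>0$, $\varphi_\tau(x)=\frac1{\sqrt{2\pi}\tau}e^{-x^2/(2\tau^2)}$, $\varphi_\tau(\boldsymbol x)=\prod_{j=1}^s\varphi_\tau(x_j)$; $\Phi_\tau$ is the CDF of the univariate $\varphi_\tau$ and $\Phi_\tau^{-1}$ is applied coordinate-wise. PDE setting: $D\subset\mathbb R^d$ is a bounded domain, $V=H_0^1(D)$ with $\|v\|_V=\|\nabla v\|_{L_2(D)}$, $V'$ its dual, $f\in V'$, $G\in V'$ a bounded linear functional, $V_h\subset V$ a finite element subspace. For $\boldsymbol y\in\mathbb R^s$ let $a(\boldsymbol x,\boldsymbol y)=a_*(\boldsymbol x)+a_0(\boldsymbol x)\exp\big(\sum_{j=1}^s\sqrt{\mu_j}\,\xi_j(\boldsymbol x)y_j\big)$ with $a_*,a_0$ continuous on $\overline D$, $a_*\ge0$, $a_0>0$ on $\overline D$, $\mu_j\ge0$ and $\xi_j$ continuous on $\overline D$. $u_h^s(\cdot,\boldsymbol y)\in V_h$ is the Galerkin solution of $-\nabla\cdot(a\nabla u)=f$ with homogeneous Dirichlet boundary condition: $\int_Da(\boldsymbol x,\boldsymbol y)\nabla u_h^s(\boldsymbol x,\boldsymbol y)\cdot\nabla v(\boldsymbol x)\,d\boldsymbol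 x=\langle f,v\rangle$ for all $v\in V_h$. Norm: for smooth $H:\mathbb R^s\to\mathbb R$, a density $\varphi$ on $\mathbb R$, positive weight functions $\psi,\omega$ on $\mathbb R$, and $\emptyset\ne\mathfrak u\subseteq[s]$, $\mathfrak v\subseteq\mathfrak u$, $$\|H\|_{\mathfrak u,\mathfrak v}=\sum_{\mathfrak w\subseteq\mathfrak v}\int_{\mathbb R^{|\mathfrak u|}}\Big|\int_{\mathbb R^{s-|\mathfrak u|}}\frac{\partial^{|\mathfrak u|+|\mathfrak w|}H}{\partial\boldsymbol x_{\mathfrak w}\partial\boldsymbol x_{\mathfrak u}}(\boldsymbol x)\prod_{j\in[s]\setminus\mathfrak u}\varphi(x_j)\,d\boldsymbol x_{[s]\setminus\mathfrak u}\Big|\prod_{j\in\mathfrak w}\psi(x_j)\prod_{j\in\mathfrak v\setminus\mathfrak w}\omega(x_j)\,d\boldsymbol x_{\mathfrak u}$$ (derivative twice in $x_j$ for $j\in\mathfrak w$, once for $j\in\mathfrak u\setminus\mathfrak w$), and $\|H\|_{\boldsymbol\gamma,\varphi,\psi,\omega}=\max_{\emptyset\ne\mathfrak u\subseteq[s],\,\mathfrak v\subseteq\mathfrak u}\gamma_{\mathfrak u}^{-1}\|H\|_{\mathfrak u,\mathfrak v}$. Walsh functions: for $k=\sum_{i\ge0}\kappa_i2^i$ and $x=\sum_{i\ge1}\xi_i2^{-i}\in[0,1)$ (binary digits, infinitely many $\xi_i\ne1$), $\mathrm{wal}_k(x)=(-1)^{\sum_i\kappa_i\xi_{i+1}}$.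 For integers $a_1>a_2\ge0$, $k=2^{a_1}+2^{a_2}$, $m'\in\{0,\dots,2^{a_2}-1\}$: $w_{k,m',2}(x)=2^{a_2/2}\mathbf 1_{[m'/2^{a_2},(m'+1)/2^{a_2})}(x)\mathrm{wal}_k(x)$ on $[0,1)$, $W_{k,m',2}(x)=\int_0^xw_{k,m',2}(y)\,dy$, $\widetilde W_{k,m',2}(x)=\int_0^xW_{k,m',2}(y)\,dy$, $\widetilde W^{(\varphi)}_{k,m',2}(x)=\widetilde W_{k,m',2}(\Phi(x))$ where $\Phi$ is the CDF of $\varphi$. Constant $C_1$: $C_1=\max(C,\frac12)$, where $C>0$ is a constant such that, with $\varphi=\varphi_\sigma$, $\psi=\omega=\varphi_\rho/\varphi_\sigma$ and the given $\beta$, for all such $k=2^{a_1}+2^{a_2}$ and $m'$ both $\sup_x\frac{|\widetilde W^{(\varphi)}_{k,m',2}(x)|}{\varphi(x)\psi(x)}$ and $\sup_x\frac{|\widetilde W^{(\varphi)}_{k,m',2}(x)\varphi'(x)|}{\varphi^2(x)\omega(x)}$ are at most $C\,2^{a_2/2}2^{-a_1-\beta a_2}$. Polynomial lattices: $G_m=\{q\in\mathbb Z_2[x]\setminus\{0\}:\deg q<m\}$, $P\in\mathbb Z_2[x]$ is irreducible of degree $m$; $n=\sum_r\eta_r2^r\in\mathbb N_0$ is identified with $n(x)=\sum_r\eta_rx^r$; $v_m(\sum_{\ell\ge w}t_\ell x^{-\ell})=\sum_{\ell=\max(1,w)}^mt_\ell2^{-\ell}$. For $\boldsymbol q\in G_m^{2s}$,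 $\boldsymbol y_n=(v_m(n(x)q_j(x)/P(x)))_{j=1}^{2s}$, $0\le n<2^m$. Digit interlacing $D(x_1,x_2)=\sum_{i\ge1}(\xi_{1,i}2^{-(2i-1)}+\xi_{2,i}2^{-2i})$ with $x_j=\sum_i\xi_{j,i}2^{-i}$, $D(x_1,\dots,x_{2s})=(D(x_1,x_2),\dots,D(x_{2s-1},x_{2s}))$, $\mathcal P_{m,s}=\{D(\boldsymbol y_n):0\le n<2^m\}$. $\mathcal P^{\rm sh}_{m,s}$ is $\mathcal P_{m,s}+2^{-2m-1}(1,\dots,1)$, or more generally $\{\boldsymbol x\oplus\boldsymbol\delta':\boldsymbol x\in\mathcal P_{m,s}\}$ with $\boldsymbol\delta'\in[0,1)^s$ such that this set lies in $(0,1)^s$, $\oplus$ being digit-wise binary addition modulo 2. Criterion: $\mathfrak u(\mathfrak v)=\{\lceil j/2\rceil:j\in\mathfrak v\}$ for $\emptyset\neq\mathfrak v\subseteq[2s]$; $\mu(k)=\lfloor\log_2k\rfloor$, $\mu(\boldsymbol k_{\mathfrak v})=\sum_{j\in\mathfrak v}\mu(k_j)$; $\mathrm{tr}_m(k)=\sum_{i<m}\kappa_i2^i$ for $k=\sum_i\kappa_i 2^i$; $S^\perp_{\mathfrak v}(\boldsymbol q)=\{\boldsymbol k_{\mathfrak v}\in\mathbb N^{|\mathfrak v|}:\sum_{j\in\mathfrak v}\mathrm{tr}_m(k_j)(x)q_j(x)\equiv0\pmod{P(x)}\}$; $$B_s(\boldsymbol q)=\sum_{\emptyset\ne\mathfrak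 v\subseteq[2s]}\gamma_{\mathfrak u(\mathfrak v)}(C_12^{2+\beta})^{|\mathfrak u(\mathfrak v)|}\sum_{\boldsymbol k_{\mathfrak v}\in S^\perp_{\mathfrak v}(\boldsymbol q)}2^{-(1+\beta)\mu(\boldsymbol k_{\mathfrak v})}.$$ Component-by-component: $q_1=1$ and, for $d=2,\dots,2s$, $q_d\in G_m$ minimizes the same expression with the outer sum restricted to $\mathfrak v\subseteq[d]$, the previous components being fixed. *)

theory Defs
  imports
    "HOL-Probability.Probability"
    "HOL-Library.Z2"
    "HOL-Computational_Algebra.Formal_Laurent_Series"
begin

text \<open>
  Points of $\mathbb{R}^s$ are functions in \<open>{1..s} \<rightarrow>\<^sub>E UNIV\<close>, the carrier of
  \<open>\<Pi>\<^sub>M j\<in>{1..s}. lborel\<close>; coordinates are numbered from 1, so that \<open>{1..s}\<close> is the set $[s]$.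
\<close>

abbreviation gauss :: "real \<Rightarrow> real \<Rightarrow> real"
  where "gauss \<tau> \<equiv> normal_density 0 \<tau>"

definition gauss_prod :: "nat \<Rightarrow> real \<Rightarrow> (nat \<Rightarrow> real) \<Rightarrow> real"
  where "gauss_prod s \<tau> y = (\<Prod>j\<in>{1..s}. gauss \<tau> (y j))"

definition dens_cdf :: "(real \<Rightarrow> real) \<Rightarrow> real \<Rightarrow> real"
  where "dens_cdf \<phi> = cdf (density lborel (\<lambda>x. ennreal (\<phi> x)))"

definition gauss_quantile :: "nat \<Rightarrow> real \<Rightarrow> (nat \<Rightarrow> real) \<Rightarrow> (nat \<Rightarrow> real)"
  where "gauss_quantile s \<tau> x = (\<lambda>j\<in>{1..s}. inv (dens_cdf (gauss \<tau>)) (x j))"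

definition partial_deriv :: "nat \<Rightarrow> ((nat \<Rightarrow> real) \<Rightarrow> real) \<Rightarrow> (nat \<Rightarrow> real) \<Rightarrow> real"
  where "partial_deriv j H x = deriv (\<lambda>t. H (x(j := t))) (x j)"

definition mixed_deriv :: "nat set \<Rightarrow> ((nat \<Rightarrow> real) \<Rightarrow> real) \<Rightarrow> (nat \<Rightarrow> real) \<Rightarrow> real"
  where "mixed_deriv u H = foldr partial_deriv (sorted_list_of_set u) H"

text \<open>The outer integral is taken in \<open>ennreal\<close>, so that a divergent norm has the value \<open>\<infinity>\<close>.\<close>

definition norm_uv ::
    "nat \<Rightarrow> (real \<Rightarrow> real) \<Rightarrow> (real \<Rightarrow> real) \<Rightarrow> (real \<Rightarrow> real) \<Rightarrow> nat set \<Rightarrow> nat set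
      \<Rightarrow> ((nat \<Rightarrow> real) \<Rightarrow> real) \<Rightarrow> ennreal"
  where "norm_uv s \<phi> \<psi> \<omega> u v H =
    (\<Sum>w\<in>Pow v. \<integral>\<^sup>+ x.
        ennreal (\<bar>\<integral> z. mixed_deriv w (mixed_deriv u H) (merge u ({1..s} - u) (x, z))
                      * (\<Prod>j\<in>{1..s} - u. \<phi> (z j))
                    \<partial>(\<Pi>\<^sub>M j\<in>{1..s} - u. lborel)\<bar>
                 * (\<Prod>j\<in>w. \<psi> (x j)) * (\<Prod>j\<in>v - w. \<omega> (x j)))
      \<partial>(\<Pi>\<^sub>M j\<in>u. lborel))"

definition weighted_norm ::
    "nat \<Rightarrow> (nat set \<Rightarrow> real) \<Rightarrow> (real \<Rightarrow> real) \<Rightarrow> (real \<Rightarrow> real) \<Rightarrow> (real \<Rightarrow> real)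
      \<Rightarrow> ((nat \<Rightarrow> real) \<Rightarrow> real) \<Rightarrow> ennreal"
  where "weighted_norm s \<gamma> \<phi> \<psi> \<omega> H =
    Max {ennreal (inverse (\<gamma> u)) * norm_uv s \<phi> \<psi> \<omega> u v H | u v.
           u \<noteq> {} \<and> u \<subseteq> {1..s} \<and> v \<subseteq> u}"

text \<open>
  \<open>bdigit i x\<close> is the coefficient of $2^{-i}$ in the binary expansion of \<open>x \<in> {0..<1}\<close> that
  does not end in ones.
\<close>

definition bdigit :: "nat \<Rightarrow> real \<Rightarrow> nat"
  where "bdigit i x = nat \<lfloor>2 ^ i * x\<rfloor> mod 2"

definition wal :: "nat \<Rightarrow> real \<Rightarrow> real"
  where "wal k x = (-1) ^ (\<Sum>i | bit k i. bdigit (Suc i) x)"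

definition walsh_w :: "nat \<Rightarrow> nat \<Rightarrow> nat \<Rightarrow> real \<Rightarrow> real"
  where "walsh_w a1 a2 m' x =
    2 powr (real a2 / 2) * indicator {real m' / 2 ^ a2 ..< (real m' + 1) / 2 ^ a2} x
      * wal (2 ^ a1 + 2 ^ a2) x"

definition walsh_W :: "nat \<Rightarrow> nat \<Rightarrow> nat \<Rightarrow> real \<Rightarrow> real"
  where "walsh_W a1 a2 m' x = integral {0..x} (walsh_w a1 a2 m')"

definition walsh_W2 :: "nat \<Rightarrow> nat \<Rightarrow> nat \<Rightarrow> real \<Rightarrow> real"
  where "walsh_W2 a1 a2 m' x = integral {0..x} (walsh_W a1 a2 m')"

definition walsh_W2_dens :: "(real \<Rightarrow> real) \<Rightarrow> nat \<Rightarrow> nat \<Rightarrow> nat \<Rightarrow> real \<Rightarrow> real"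
  where "walsh_W2_dens \<phi> a1 a2 m' x = walsh_W2 a1 a2 m' (dens_cdf \<phi> x)"

definition walsh_constant ::
    "(real \<Rightarrow> real) \<Rightarrow> (real \<Rightarrow> real) \<Rightarrow> (real \<Rightarrow> real) \<Rightarrow> real \<Rightarrow> real \<Rightarrow> bool"
  where "walsh_constant \<phi> \<psi> \<omega> \<beta> C \<longleftrightarrow>
    0 < C \<and>
    (\<forall>a1 a2 m'. a2 < a1 \<and> m' < 2 ^ a2 \<longrightarrow>
      (\<forall>x. \<bar>walsh_W2_dens \<phi> a1 a2 m' x\<bar> / (\<phi> x * \<psi> x)
             \<le> C * 2 powr (real a2 / 2) * 2 powr (- real a1 - \<beta> * real a2)) \<and>
      (\<forall>x. \<bar>walsh_W2_dens \<phi> a1 a2 m' x * deriv \<phi> x\<bar> / ((\<phi> x)\<^sup>2 * \<omega> x)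
             \<le> C * 2 powr (real a2 / 2) * 2 powr (- real a1 - \<beta> * real a2)))"

text \<open>The type \<^typ>\<open>bit\<close> is the field with two elements, while the constant \<^const>\<open>bit\<close>
  extracts binary digits of natural numbers.\<close>

definition nat_poly :: "nat \<Rightarrow> bit poly"
  where "nat_poly n = (\<Sum>r | bit n r. monom 1 r)"

definition gen_polys :: "nat \<Rightarrow> bit poly set"
  where "gen_polys m = {q. q \<noteq> 0 \<and> degree q < m}"

text \<open>
  Laurent series in $x^{-1}$ are represented by \<open>fls\<close>, whose formal variable stands for
  $x^{-1}$; a polynomial in $x$ is therefore evaluated at \<open>fls_X_inv\<close>.
\<close>

definition poly_laurent :: "bit poly \<Rightarrow> bit fls"
  where "poly_laurent p = poly (map_poly fls_const p) fls_X_inv"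

definition v_map :: "nat \<Rightarrow> bit fls \<Rightarrow> real"
  where "v_map m t = (\<Sum>l = 1..m. of_bit (fls_nth t (int l)) / 2 ^ l)"

definition lattice_point :: "nat \<Rightarrow> bit poly \<Rightarrow> (nat \<Rightarrow> bit poly) \<Rightarrow> nat \<Rightarrow> nat \<Rightarrow> real"
  where "lattice_point m P q n j =
    v_map m (poly_laurent (nat_poly n * q j) / poly_laurent P)"

definition interlace2 :: "real \<Rightarrow> real \<Rightarrow> real"
  where "interlace2 x1 x2 =
    (\<Sum>i. real (bdigit (Suc i) x1) / 2 ^ (2 * Suc i - 1) + real (bdigit (Suc i) x2) / 2 ^ (2 * Suc i))"

definition interlace :: "nat \<Rightarrow> (nat \<Rightarrow> real) \<Rightarrow> (nat \<Rightarrow> real)"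
  where "interlace s x = (\<lambda>j\<in>{1..s}. interlace2 (x (2 * j - 1)) (x (2 * j)))"

definition interlaced_lattice ::
    "nat \<Rightarrow> nat \<Rightarrow> bit poly \<Rightarrow> (nat \<Rightarrow> bit poly) \<Rightarrow> (nat \<Rightarrow> real) set"
  where "interlaced_lattice s m P q = (\<lambda>n. interlace s (lattice_point m P q n)) ` {..<2 ^ m}"

definition digit_add :: "real \<Rightarrow> real \<Rightarrow> real"
  where "digit_add x y = (\<Sum>i. real ((bdigit (Suc i) x + bdigit (Suc i) y) mod 2) / 2 ^ Suc i)"

definition is_shift_of :: "nat \<Rightarrow> nat \<Rightarrow> (nat \<Rightarrow> real) set \<Rightarrow> (nat \<Rightarrow> real) set \<Rightarrow> bool"
  where "is_shift_of s m X Y \<longleftrightarrow>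
    Y = (\<lambda>x. \<lambda>j\<in>{1..s}. x j + 1 / 2 ^ (2 * m + 1)) ` X \<or>
    (\<exists>\<Delta> \<in> {1..s} \<rightarrow>\<^sub>E {0..<1}.
       Y = (\<lambda>x. \<lambda>j\<in>{1..s}. digit_add (x j) (\<Delta> j)) ` X \<and> Y \<subseteq> {1..s} \<rightarrow>\<^sub>E {0<..<1})"

definition u_of :: "nat set \<Rightarrow> nat set"
  where "u_of v = (\<lambda>j. nat \<lceil>real j / 2\<rceil>) ` v"

text \<open>\<open>take_bit m k\<close> is the truncation of \<open>k\<close> to its \<open>m\<close> least significant binary digits.\<close>

definition dual_net :: "nat \<Rightarrow> bit poly \<Rightarrow> nat set \<Rightarrow> (nat \<Rightarrow> bit poly) \<Rightarrow> (nat \<Rightarrow> nat) set"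
  where "dual_net m P v q =
    {k \<in> v \<rightarrow>\<^sub>E {1..}. P dvd (\<Sum>j\<in>v. nat_poly (take_bit m (k j)) * q j)}"

text \<open>
  With \<open>d = 2 * s\<close> this is the full criterion $B_s$; for smaller \<open>d\<close> it depends on
  \<open>q 1, ..., q d\<close> only.
\<close>

definition criterion ::
    "(nat set \<Rightarrow> real) \<Rightarrow> real \<Rightarrow> real \<Rightarrow> nat \<Rightarrow> bit poly \<Rightarrow> nat \<Rightarrow> (nat \<Rightarrow> bit poly) \<Rightarrow> real"
  where "criterion \<gamma> C1 \<beta> m P d q =
    (\<Sum>v | v \<noteq> {} \<and> v \<subseteq> {1..d}.
       \<gamma> (u_of v) * (C1 * 2 powr (2 + \<beta>)) ^ card (u_of v)
       * (\<Sum>\<^sub>\<infinity>k\<in>dual_net m P v q. 2 powr (- (1 + \<beta>) * real_of_int (\<Sum>j\<in>v. \<lfloor>log 2 (real (k j))\<rfloor>))))"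

definition cbc_vector ::
    "(nat set \<Rightarrow> real) \<Rightarrow> real \<Rightarrow> real \<Rightarrow> nat \<Rightarrow> nat \<Rightarrow> bit poly \<Rightarrow> (nat \<Rightarrow> bit poly) \<Rightarrow> bool"
  where "cbc_vector \<gamma> C1 \<beta> s m P q \<longleftrightarrow>
    q 1 = 1 \<and>
    (\<forall>d\<in>{2..2 * s}. q d \<in> gen_polys m \<and>
       (\<forall>p\<in>gen_polys m. criterion \<gamma> C1 \<beta> m P d q \<le> criterion \<gamma> C1 \<beta> m P d (q(d := p))))"

definition cbc_shifted_point_set ::
    "(nat set \<Rightarrow> real) \<Rightarrow> real \<Rightarrow> real \<Rightarrow> nat \<Rightarrow> nat \<Rightarrow> (nat \<Rightarrow> real) set \<Rightarrow> bool"
  where "cbc_shifted_point_set \<gamma> C1 \<beta> s m X \<longleftrightarrow>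
    (\<exists>P q. irreducible P \<and> degree P = m \<and> cbc_vector \<gamma> C1 \<beta> s m P q \<and>
       is_shift_of s m (interlaced_lattice s m P q) X)"

text \<open>
  Elements of $L_2(D)$, $H^1(D)$ and $H_0^1(D)$ are represented by functions rather than by
  classes of functions that agree almost everywhere.
\<close>

primrec Ck :: "nat \<Rightarrow> ('d::euclidean_space \<Rightarrow> real) \<Rightarrow> bool"
  where
    "Ck 0 g \<longleftrightarrow> continuous_on UNIV g"
  | "Ck (Suc k) g \<longleftrightarrow>
       (\<forall>x. g differentiable (at x)) \<and> (\<forall>b\<in>Basis. Ck k (\<lambda>x. frechet_derivative g (at x) b))"

definition test_function :: "'d::euclidean_space set \<Rightarrow> ('d \<Rightarrow> real) \<Rightarrow> bool"
  where "test_function D g \<longleftrightarrow>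
    (\<forall>k. Ck k g) \<and> compact (closure {x. g x \<noteq> 0}) \<and> closure {x. g x \<noteq> 0} \<subseteq> D"

definition grad :: "('d::euclidean_space \<Rightarrow> real) \<Rightarrow> 'd \<Rightarrow> 'd"
  where "grad g x = (\<Sum>b\<in>Basis. frechet_derivative g (at x) b *\<^sub>R b)"

definition in_L2 :: "'d::euclidean_space set \<Rightarrow> ('d \<Rightarrow> 'b::euclidean_space) \<Rightarrow> bool"
  where "in_L2 D g \<longleftrightarrow>
    g \<in> borel_measurable (lebesgue_on D) \<and> integrable (lebesgue_on D) (\<lambda>x. (norm (g x))\<^sup>2)"

definition norm_L2 :: "'d::euclidean_space set \<Rightarrow> ('d \<Rightarrow> 'b::euclidean_space) \<Rightarrow> real"
  where "norm_L2 D g = sqrt (\<integral>x. (norm (g x))\<^sup>2 \<partial>lebesgue_on D)"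

definition is_weak_grad :: "'d::euclidean_space set \<Rightarrow> ('d \<Rightarrow> real) \<Rightarrow> ('d \<Rightarrow> 'd) \<Rightarrow> bool"
  where "is_weak_grad D v g \<longleftrightarrow>
    in_L2 D g \<and>
    (\<forall>t. test_function D t \<longrightarrow> (\<forall>b\<in>Basis.
       (\<integral>x. v x * (grad t x \<bullet> b) \<partial>lebesgue_on D) = - (\<integral>x. (g x \<bullet> b) * t x \<partial>lebesgue_on D)))"

definition H1 :: "'d::euclidean_space set \<Rightarrow> ('d \<Rightarrow> real) set"
  where "H1 D = {v. in_L2 D v \<and> (\<exists>g. is_weak_grad D v g)}"

definition wgrad :: "'d::euclidean_space set \<Rightarrow> ('d \<Rightarrow> real) \<Rightarrow> 'd \<Rightarrow> 'd"
  where "wgrad D v = (SOME g. is_weak_grad D v g)"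

definition H10 :: "'d::euclidean_space set \<Rightarrow> ('d \<Rightarrow> real) set"
  where "H10 D = {v \<in> H1 D. \<exists>t. (\<forall>n. test_function D (t n)) \<and>
    (\<lambda>n. norm_L2 D (\<lambda>x. v x - t n x)) \<longlonglongrightarrow> 0 \<and>
    (\<lambda>n. norm_L2 D (\<lambda>x. wgrad D v x - grad (t n) x)) \<longlonglongrightarrow> 0}"

definition norm_V :: "'d::euclidean_space set \<Rightarrow> ('d \<Rightarrow> real) \<Rightarrow> real"
  where "norm_V D v = norm_L2 D (wgrad D v)"

text \<open>Boundedness implies that a functional does not distinguish functions that agree almost
  everywhere.\<close>

definition dual_V :: "'d::euclidean_space set \<Rightarrow> (('d \<Rightarrow> real) \<Rightarrow> real) set"
  where "dual_V D = {f.
    (\<forall>u\<in>H10 D. \<forall>v\<in>H10 D. \<forall>a b. f (\<lambda>x. a * u x + b * v x) = a * f u + b * f v) \<and>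
    (\<exists>K. \<forall>v\<in>H10 D. \<bar>f v\<bar> \<le> K * norm_V D v)}"

definition fe_subspace :: "'d::euclidean_space set \<Rightarrow> ('d \<Rightarrow> real) set \<Rightarrow> bool"
  where "fe_subspace D Vh \<longleftrightarrow>
    (\<exists>(n::nat) e. (\<forall>i<n. e i \<in> H10 D) \<and> Vh = {(\<lambda>x. \<Sum>i<n. c i * e i x) | c. True})"

definition lognormal_coeff ::
    "nat \<Rightarrow> ('d \<Rightarrow> real) \<Rightarrow> ('d \<Rightarrow> real) \<Rightarrow> (nat \<Rightarrow> real) \<Rightarrow> (nat \<Rightarrow> 'd \<Rightarrow> real)
      \<Rightarrow> 'd \<Rightarrow> (nat \<Rightarrow> real) \<Rightarrow> real"
  where "lognormal_coeff s a_star a0 \<mu> \<xi> x y =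
    a_star x + a0 x * exp (\<Sum>j\<in>{1..s}. sqrt (\<mu> j) * \<xi> j x * y j)"

definition lognormal_problem ::
    "nat \<Rightarrow> 'd::euclidean_space set \<Rightarrow> ('d \<Rightarrow> real) set
      \<Rightarrow> (('d \<Rightarrow> real) \<Rightarrow> real) \<Rightarrow> (('d \<Rightarrow> real) \<Rightarrow> real)
      \<Rightarrow> ('d \<Rightarrow> real) \<Rightarrow> ('d \<Rightarrow> real) \<Rightarrow> (nat \<Rightarrow> real) \<Rightarrow> (nat \<Rightarrow> 'd \<Rightarrow> real) \<Rightarrow> bool"
  where "lognormal_problem s D Vh f G a_star a0 \<mu> \<xi> \<longleftrightarrow>
    open D \<and> connected D \<and> D \<noteq> {} \<and> bounded D \<and>
    fe_subspace D Vh \<and> f \<in> dual_V D \<and> G \<in> dual_V D \<and>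
    continuous_on (closure D) a_star \<and> (\<forall>x\<in>closure D. 0 \<le> a_star x) \<and>
    continuous_on (closure D) a0 \<and> (\<forall>x\<in>closure D. 0 < a0 x) \<and>
    (\<forall>j\<in>{1..s}. 0 \<le> \<mu> j \<and> continuous_on (closure D) (\<xi> j))"

definition galerkin_solution ::
    "'d::euclidean_space set \<Rightarrow> ('d \<Rightarrow> real) set \<Rightarrow> (('d \<Rightarrow> real) \<Rightarrow> real)
      \<Rightarrow> ('d \<Rightarrow> real) \<Rightarrow> ('d \<Rightarrow> real) \<Rightarrow> bool"
  where "galerkin_solution D Vh f a u \<longleftrightarrow>
    u \<in> Vh \<and> (\<forall>v\<in>Vh. (\<integral>x. a x * (wgrad D u x \<bullet> wgrad D v x) \<partial>lebesgue_on D) = f v)"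

end

theory Submission
  imports
    Defs
    "HOL-Computational_Algebra.Polynomial_Factorial"
begin

text \<open>
  The function $F_\sigma$ is a Gaussian factor times a function whose derivatives of all orders
  grow at most exponentially: the Galerkin solution arises from its stiffness matrix by Gaussian
  elimination, and the pivots are bounded below by coercivity. The averages of
  $F_\sigma \circ \Phi_\sigma^{-1}$ over small dyadic cells, which converge to the values at the
  nodes, are finite Walsh sums. The coefficient of index $k$ is transformed by two integrations by parts in each coordinate, one for each of the two top digits that interlacing
  assigns to that coordinate, and is thereby bounded by the weighted norm times
  $2^{-(1+\beta)\mu(k)}$. The shift only changes signs, so the quadrature error is at most a
  multiple of the criterion $B_s$. Jensen's inequality $(\sum a_k)^\lambda \le \sum a_k^\lambda$ and
  averaging over each component of the generating vector bound $B_s^\lambda$ by a constant over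
  $2^m$.
\<close>

subsection \<open>Irreducible polynomials over the field with two elements\<close>

text \<open>Convergence of the full Walsh series is avoided: for each cutoff of 2^L indices per
  coordinate the error is bounded by the same right-hand side, and only then does L tend to
  infinity. An index whose even and odd digits are both present offers two sign changes with enough
  decay for two integrations; any other nonzero index is integrated once. This explains the subset
  \<open>v\<close> of \<open>u\<close> in \<open>norm_uv\<close>. The gap \<delta> between \<beta>
  and 1 - \<sigma>^2 / \<rho>^2 leaves a spare Gaussian factor, which absorbs the linear factor from
  the derivative of the density. The coefficient bound carries its own constant
  \<open>transform_const\<close>; passing to the constant of the criterion costs a power Q^s,
  independent of m. The condition \<lambda> > 1 / (1 + \<beta>) makes the \<lambda>-th powers of the
  weights summable. On the side of the PDE, \<open>wgrad\<close> is a mere choice and the functions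
  spanning the finite element space may be dependent; hence the almost everywhere uniqueness of weak
  gradients, proved with bump functions, and the elimination on a maximal family with independent
  gradients.\<close>

definition polys_of_degree :: "nat \<Rightarrow> bit poly set"
  where "polys_of_degree n = {f. f \<noteq> 0 \<and> degree f = n}"

lemma polys_of_degree_0: "polys_of_degree 0 = {1}"
proof -
  have "f = 1" if "f \<noteq> 0" "degree f = 0" for f :: "bit poly"
  proof -
    obtain a where a: "f = [:a:]" using \<open>degree f = 0\<close> by (rule degree_eq_zeroE)
    then have "a = 1" using \<open>f \<noteq> 0\<close> by (cases a) auto
    then show ?thesis using a by simp
  qed
  then show ?thesis unfolding polys_of_degree_def by auto
qed

lemma polys_of_degree_Suc:
  "polys_of_degree (Suc n) = pCons 0 ` polys_of_degree n \<union> pCons 1 ` polys_of_degree n"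
proof (intro equalityI subsetI)
  fix f assume f: "f \<in> polys_of_degree (Suc n)"
  obtain a g where fg: "f = pCons a g" by (cases f) auto
  then have "g \<in> polys_of_degree n" using f unfolding polys_of_degree_def by (auto split: if_splits)
  then show "f \<in> pCons 0 ` polys_of_degree n \<union> pCons 1 ` polys_of_degree n" using fg by (cases a) auto
qed (auto simp: polys_of_degree_def)

lemma card_polys_of_degree: "finite (polys_of_degree n) \<and> card (polys_of_degree n) = 2 ^ n"
proof (induction n)
  case 0
  show ?case by (simp add: polys_of_degree_0)
next
  case (Suc n)
  have inj: "inj_on (pCons a) S" for a :: bit and S by (simp add: inj_on_def)
  have "pCons 0 ` polys_of_degree n \<inter> pCons 1 ` polys_of_degree n = {}" by auto
  then show ?case unfolding polys_of_degree_Suc using Suc by (simp add: card_Un_disjoint card_image[OF inj])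
qed

text \<open>Division by Q is a bijection onto the polynomials of degree n - degree Q.\<close>

lemma card_multiples_of_degree:
  assumes Q: "Q \<noteq> (0::bit poly)"
  shows "card {f \<in> polys_of_degree n. Q dvd f} = (if degree Q \<le> n then 2 ^ (n - degree Q) else 0)"
proof (cases "degree Q \<le> n")
  case True
  have "{f \<in> polys_of_degree n. Q dvd f} = (*) Q ` polys_of_degree (n - degree Q)"
  proof (intro equalityI subsetI)
    fix f assume "f \<in> {f \<in> polys_of_degree n. Q dvd f}"
    then obtain g where g: "f = Q * g" "f \<noteq> 0" "degree f = n" unfolding polys_of_degree_def by auto
    then have "g \<in> polys_of_degree (n - degree Q)" unfolding polys_of_degree_def by (auto simp: degree_mult_eq)
    then show "f \<in> (*) Q ` polys_of_degree (n - degree Q)" using g by blast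
  qed (use Q True in \<open>auto simp: polys_of_degree_def degree_mult_eq\<close>)
  moreover have "inj_on ((*) Q) S" for S using Q by (simp add: inj_on_def)
  ultimately show ?thesis using True by (simp add: card_image card_polys_of_degree)
next
  case False
  have "{f \<in> polys_of_degree n. Q dvd f} = {}"
    using False dvd_imp_degree_le[of Q] unfolding polys_of_degree_def by auto
  then show ?thesis using False by (simp only: card.empty if_False)
qed

lemma bit_poly_unit: "is_unit (u :: bit poly) \<Longrightarrow> u = 1"
proof -
  assume u: "is_unit u"
  then have "u \<noteq> 0" by auto
  then have "u \<in> polys_of_degree 0" using u is_unit_iff_degree[of u] unfolding polys_of_degree_def by simp
  then show ?thesis unfolding polys_of_degree_0 by (rule singletonD)
qed

lemma irreducible_degree_pos: "irreducible (P :: bit poly) \<Longrightarrow> 0 < degree P"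
proof -
  assume "irreducible P"
  then have "P \<noteq> 0" "\<not> is_unit P" unfolding irreducible_def by blast+
  then show ?thesis using is_unit_iff_degree[of P] by simp
qed

lemma exists_irreducible_divisor:
  "0 < degree (f :: bit poly) \<Longrightarrow> \<exists>Q. irreducible Q \<and> Q dvd f"
proof (induction "degree f" arbitrary: f rule: less_induct)
  case less
  show ?case
  proof (cases "irreducible f")
    case False
    have "f \<noteq> 0" using less.prems by auto
    then have "\<not> is_unit f" using less.prems is_unit_iff_degree[of f] by simp
    then obtain a b where ab: "f = a * b" "\<not> is_unit a" "\<not> is_unit b" using False \<open>f \<noteq> 0\<close> unfolding irreducible_def by blast
    have nz: "a \<noteq> 0" "b \<noteq> 0" using ab(1) \<open>f \<noteq> 0\<close> by auto
    then have d: "0 < degree a" "0 < degree b" using ab is_unit_iff_degree by blast+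
    then have "degree a < degree f" unfolding ab(1) degree_mult_eq[OF nz] by simp
    from less.hyps[OF this d(1)] show ?thesis unfolding ab(1) by (blast intro: dvd_mult2)
  qed auto
qed

text \<open>Primality takes the factors p out of b one at a time, since none of them can come from
  a.\<close>

lemma prime_power_dvd_mult_cancel:
  fixes p :: "bit poly"
  assumes p: "prime_elem p" "\<not> p dvd a"
  shows "p ^ k dvd a * b \<Longrightarrow> p ^ k dvd b"
proof (induction k arbitrary: b)
  case (Suc k)
  have "p dvd a * b" using dvd_trans[OF _ Suc.prems, of p] by simp
  then have "p dvd b" using p by (simp add: prime_elem_dvd_mult_iff)
  then obtain c where c: "b = p * c" by blast
  have "p * p ^ k dvd p * (a * c)" using Suc.prems unfolding c by (simp add: mult_ac)
  then have ac: "p ^ k dvd a * c" using p(1) by (simp add: prime_elem_def)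
  show ?case unfolding c power_Suc by (rule mult_dvd_mono[OF dvd_refl Suc.IH[OF ac]])
qed simp

text \<open>A multiplicity counted as a number of dividing powers, so that sums over polynomials and
  over exponents can be exchanged. For irreducible P the cutoff m is harmless as long as f is
  nonzero of degree at most m.\<close>

definition power_divisors :: "nat \<Rightarrow> bit poly \<Rightarrow> bit poly \<Rightarrow> nat set"
  where "power_divisors m P f = {k \<in> {1..m}. P ^ k dvd f}"

definition irreducibles :: "nat \<Rightarrow> bit poly set"
  where "irreducibles m = {P. irreducible P \<and> degree P \<le> m}"

lemma irreducibles_subset: "irreducibles m \<subseteq> (\<Union>d\<in>{1..m}. polys_of_degree d)"
proof
  fix P assume "P \<in> irreducibles m"
  then have "irreducible P" "degree P \<le> m" unfolding irreducibles_def by blast+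
  then have "P \<in> polys_of_degree (degree P)" "degree P \<in> {1..m}"
    using irreducible_degree_pos[of P] unfolding polys_of_degree_def by auto
  then show "P \<in> (\<Union>d\<in>{1..m}. polys_of_degree d)" by blast
qed

lemma finite_irreducibles: "finite (irreducibles m)"
  by (rule finite_subset[OF irreducibles_subset]) (use card_polys_of_degree in auto)

text \<open>Unique factorization in terms of degrees. Splitting off one irreducible Q raises the
  multiplicity of Q by one and leaves the others alone, so strong induction on the degree
  suffices.\<close>

lemma degree_eq_sum_irreducibles:
  "f \<noteq> 0 \<Longrightarrow> degree f \<le> m \<Longrightarrow> degree f = (\<Sum>P\<in>irreducibles m. degree P * card (power_divisors m P f))"
proof (induction "degree f" arbitrary: f rule: less_induct)
  case less
  \<comment> \<open>Irreducible polynomials have positive degree, so the degree bounds the exponents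
    of dividing powers and the cutoff m never cuts anything off.\<close>
  have le: "k \<le> degree g" if "P \<in> irreducibles m" "P ^ k dvd g" "g \<noteq> 0" for P k and g :: "bit poly"
  proof -
    have "0 < degree P" "P \<noteq> 0" using that(1) irreducible_degree_pos unfolding irreducibles_def by (auto simp: irreducible_def)
    then have "k \<le> degree (P ^ k)" by (simp add: degree_power_eq)
    then show ?thesis using dvd_imp_degree_le[OF that(2,3)] by simp
  qed
  show ?case
  proof (cases "degree f = 0")
    case True
    have "power_divisors m P f = {}" if "P \<in> irreducibles m" for P
      using le[OF that _ less.prems(1)] True unfolding power_divisors_def by force
    then show ?thesis using True by simp
  next
    case False
    then obtain Q where Q: "irreducible Q" "Q dvd f" using exists_irreducible_divisor[of f] by auto
    then obtain g where g: "f = Q * g" by blast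
    have nz: "Q \<noteq> 0" "g \<noteq> 0" using less.prems(1) g by auto
    have dg: "degree f = degree Q + degree g" unfolding g by (rule degree_mult_eq[OF nz])
    have Q1: "0 < degree Q" by (rule irreducible_degree_pos[OF Q(1)])
    have Qm: "Q \<in> irreducibles m" using Q(1) dg less.prems(2) unfolding irreducibles_def by simp
    have ih: "degree g = (\<Sum>P\<in>irreducibles m. degree P * card (power_divisors m P g))"
      using less.hyps[of g] dg Q1 nz(2) less.prems(2) by simp
    have PQ: "card (power_divisors m P f) = card (power_divisors m P g) + (if P = Q then 1 else 0)"
      if P: "P \<in> irreducibles m" for P
    proof (cases "P = Q")
      case True
      have "power_divisors m Q f = insert 1 (Suc ` power_divisors m Q g)"
      proof (intro equalityI subsetI)
        fix k assume k: "k \<in> power_divisors m Q f"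
        then obtain j where j: "k = Suc j" unfolding power_divisors_def by (cases k) auto
        have "Q * Q ^ j dvd Q * g" using k unfolding j power_divisors_def g by simp
        then have "Q ^ j dvd g" using nz(1) by simp
        then show "k \<in> insert 1 (Suc ` power_divisors m Q g)"
          using k unfolding j power_divisors_def by (cases j) auto
      next
        fix k assume "k \<in> insert 1 (Suc ` power_divisors m Q g)"
        then consider "k = 1" | j where "k = Suc j" "j \<in> power_divisors m Q g" by blast
        then show "k \<in> power_divisors m Q f"
        proof cases
          case 1
          then show ?thesis using Q(2) dg Q1 less.prems(2) unfolding power_divisors_def by auto
        next
          case 2
          then have "Q ^ j dvd g" unfolding power_divisors_def by simp
          then have "j \<le> degree g" by (rule le[OF Qm _ nz(2)])
          then have "k \<le> m" using 2(1) dg Q1 less.prems(2) by simp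
          then show ?thesis using \<open>Q ^ j dvd g\<close> unfolding 2(1) power_divisors_def g by (simp add: mult_dvd_mono)
        qed
      qed
      moreover have "1 \<notin> Suc ` power_divisors m Q g" unfolding power_divisors_def by auto
      moreover have "finite (power_divisors m Q g)" unfolding power_divisors_def by simp
      ultimately show ?thesis using True by (simp add: card_image)
    next
      case False
      have pP: "prime_elem P" using P field_poly_irreducible_imp_prime unfolding irreducibles_def by blast
      \<comment> \<open>Distinct irreducibles are never associated here, because 1 is the only
        unit.\<close>
      have "\<not> P dvd Q"
      proof
        assume "P dvd Q"
        then obtain u where u: "Q = P * u" by blast
        have "\<not> is_unit P" using pP by (simp add: prime_elem_def)
        then have "is_unit u" using Q(1) u unfolding irreducible_def by blast
        then show False using u False bit_poly_unit by simp
      qed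
      then have "P ^ k dvd f \<longleftrightarrow> P ^ k dvd g" for k
        unfolding g using prime_power_dvd_mult_cancel[OF pP] by (blast intro: dvd_mult)
      then show ?thesis using False unfolding power_divisors_def by simp
    qed
    have "(\<Sum>P\<in>irreducibles m. degree P * card (power_divisors m P f))
      = (\<Sum>P\<in>irreducibles m. degree P * card (power_divisors m P g) + (if P = Q then degree Q else 0))"
      by (intro sum.cong) (auto simp: PQ distrib_left)
    also have "\<dots> = degree g + degree Q"
      unfolding sum.distrib ih[symmetric] using Qm finite_irreducibles by (simp add: sum.delta)
    finally show ?thesis using dg by simp
  qed
qed

text \<open>Both sides count the total degree of all polynomials of degree \<open>n\<close>.\<close>

lemma total_degree:
  assumes "n \<le> m"
  shows "(\<Sum>P\<in>irreducibles m. \<Sum>k\<in>{1..m}. if k * degree P \<le> n then degree P * 2 ^ (n - k * degree P) else 0) = n * 2 ^ n"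
proof -
  have fin: "finite (polys_of_degree n)" using card_polys_of_degree by blast
  have "n * 2 ^ n = (\<Sum>f\<in>polys_of_degree n. degree f)"
    using card_polys_of_degree[of n] by (simp add: polys_of_degree_def mult.commute)
  also have "\<dots> = (\<Sum>f\<in>polys_of_degree n. \<Sum>P\<in>irreducibles m. degree P * card (power_divisors m P f))"
    using assms by (intro sum.cong refl degree_eq_sum_irreducibles) (auto simp: polys_of_degree_def)
  also have "\<dots> = (\<Sum>f\<in>polys_of_degree n. \<Sum>P\<in>irreducibles m. \<Sum>k\<in>{1..m}. if P ^ k dvd f then degree P else 0)"
    by (intro sum.cong refl) (simp add: power_divisors_def mult.commute flip: sum.inter_filter)
  also have "\<dots> = (\<Sum>P\<in>irreducibles m. \<Sum>f\<in>polys_of_degree n. \<Sum>k\<in>{1..m}. if P ^ k dvd f then degree P else 0)"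
    by (rule sum.swap)
  also have "\<dots> = (\<Sum>P\<in>irreducibles m. \<Sum>k\<in>{1..m}. \<Sum>f\<in>polys_of_degree n. if P ^ k dvd f then degree P else 0)"
    by (intro sum.cong refl sum.swap)
  also have "\<dots> = (\<Sum>P\<in>irreducibles m. \<Sum>k\<in>{1..m}. if k * degree P \<le> n then degree P * 2 ^ (n - k * degree P) else 0)"
  proof (intro sum.cong refl)
    fix P k assume P: "P \<in> irreducibles m"
    have nz: "P \<noteq> 0" using P unfolding irreducibles_def by (auto simp: irreducible_def)
    have "(\<Sum>f\<in>polys_of_degree n. if P ^ k dvd f then degree P else 0) = degree P * card {f \<in> polys_of_degree n. P ^ k dvd f}"
      using fin by (simp add: mult.commute flip: sum.inter_filter)
    also have "\<dots> = (if k * degree P \<le> n then degree P * 2 ^ (n - k * degree P) else 0)"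
      using card_multiples_of_degree[of "P ^ k" n] nz by (simp add: degree_power_eq mult.commute)
    finally show "(\<Sum>f\<in>polys_of_degree n. if P ^ k dvd f then degree P else 0)
      = (if k * degree P \<le> n then degree P * 2 ^ (n - k * degree P) else 0)" .
  qed
  finally show ?thesis by simp
qed

text \<open>Subtracting twice the identity \<open>total_degree\<close> for m - 1 from the one for m
  leaves only the terms with k * degree P = m. This is Gauss's formula: the degrees of all
  irreducible P whose degree divides m add up to 2^m. If none had degree m, these degrees would be
  at most m div 2, and even all polynomials of such degrees together have a total degree that is too
  small.\<close>

lemma exists_irreducible_bit_poly:
  assumes m: "1 \<le> m"
  shows "\<exists>P :: bit poly. irreducible P \<and> degree P = m"
proof (rule ccontr)
  assume no: "\<nexists>P :: bit poly. irreducible P \<and> degree P = m"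
  define S where "S = (\<Sum>P\<in>irreducibles m. \<Sum>k\<in>{1..m}. if k * degree P = m then degree P else 0)"
  \<comment> \<open>The identities are compared term by term: a count for m is twice the count for m
    - 1, except where k * degree P = m, which the count for m - 1 misses.\<close>
  have "m * 2 ^ m = (\<Sum>P\<in>irreducibles m. \<Sum>k\<in>{1..m}. 2 * (if k * degree P \<le> m - 1 then degree P * 2 ^ (m - 1 - k * degree P) else 0)
      + (if k * degree P = m then degree P else 0))"
    unfolding total_degree[OF order_refl, symmetric]
  proof (intro sum.cong refl)
    fix P :: "bit poly" and k
    consider "k * degree P = m" | "k * degree P \<le> m - 1" "k * degree P \<noteq> m" | "m < k * degree P" using m by linarith
    then show "(if k * degree P \<le> m then degree P * 2 ^ (m - k * degree P) else 0)
      = 2 * (if k * degree P \<le> m - 1 then degree P * 2 ^ (m - 1 - k * degree P) else 0) + (if k * degree P = m then degree P else 0)"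
    proof cases
      case 2
      then have "m - k * degree P = Suc (m - 1 - k * degree P)" using m by simp
      then show ?thesis using 2 m by simp
    qed (use m in auto)
  qed
  also have "\<dots> = 2 * ((m - 1) * 2 ^ (m - 1)) + S"
    unfolding total_degree[of "m - 1" m, OF diff_le_self, symmetric] S_def sum.distrib sum_distrib_left ..
  finally have "m * 2 ^ m = (m - 1) * 2 ^ m + S" using m by (cases m) simp_all
  then have S: "S = 2 ^ m" using m by (cases m) simp_all
  let ?h = "m div 2"
  \<comment> \<open>At most one k contributes for each P, and as this k is neither 0 nor 1, degree P
    is at most half of m.\<close>
  have "S \<le> (\<Sum>P\<in>irreducibles m. if degree P \<le> ?h then degree P else 0)"
    unfolding S_def
  proof (rule sum_mono)
    fix P assume P: "P \<in> irreducibles m"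
    have d: "0 < degree P" "degree P \<noteq> m" using P no irreducible_degree_pos unfolding irreducibles_def by auto
    show "(\<Sum>k\<in>{1..m}. if k * degree P = m then degree P else 0) \<le> (if degree P \<le> ?h then degree P else 0)"
    proof (cases "\<exists>k. k * degree P = m")
      case True
      then obtain k where k: "k * degree P = m" by blast
      have "k \<noteq> 0" "k \<noteq> 1" using k d m by auto
      then have "2 * degree P \<le> k * degree P" by (intro mult_right_mono) auto
      then have "degree P \<le> ?h" using k by simp
      moreover have "(\<Sum>k\<in>{1..m}. if k * degree P = m then degree P else 0) \<le> (\<Sum>i\<in>{1..m}. if i = k then degree P else 0)"
        using k d by (intro sum_mono) auto
      moreover have "\<dots> \<le> degree P" by (simp add: sum.delta)
      ultimately show ?thesis by simp
    qed simp
  qed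
  also have "\<dots> \<le> (\<Sum>P\<in>(\<Union>d\<in>{1..?h}. polys_of_degree d). degree P)"
  proof -
    have "(\<Sum>P\<in>irreducibles m. if degree P \<le> ?h then degree P else 0) = (\<Sum>P\<in>{P \<in> irreducibles m. degree P \<le> ?h}. degree P)"
      using finite_irreducibles by (rule sum.inter_filter[symmetric])
    also have "\<dots> \<le> (\<Sum>P\<in>(\<Union>d\<in>{1..?h}. polys_of_degree d). degree P)"
    proof (rule sum_mono2)
      show "{P \<in> irreducibles m. degree P \<le> ?h} \<subseteq> (\<Union>d\<in>{1..?h}. polys_of_degree d)"
        using irreducibles_subset[of m] unfolding polys_of_degree_def by force
    qed (use card_polys_of_degree in auto)
    finally show ?thesis .
  qed
  also have "\<dots> = (\<Sum>d\<in>{1..?h}. \<Sum>P\<in>polys_of_degree d. degree P)"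
    using card_polys_of_degree by (intro sum.UNION_disjoint) (auto simp: polys_of_degree_def)
  also have "\<dots> = (\<Sum>d\<in>{1..?h}. d * 2 ^ d)"
    using card_polys_of_degree by (intro sum.cong refl) (simp add: polys_of_degree_def mult.commute)
  also have "\<dots> < 4 ^ ?h"
  proof -
    have "(\<Sum>d\<in>{1..h}. d * 2 ^ d) < (4::nat) ^ h" for h
    proof (induction h)
      case (Suc h)
      have "2 * (h + 1) \<le> 3 * (2::nat) ^ h" by (induction h) auto
      then have "2 * (h + 1) * 2 ^ h \<le> 3 * 2 ^ h * (2::nat) ^ h" by (rule mult_right_mono) simp
      also have "\<dots> = 3 * 4 ^ h" by (simp add: power_mult_distrib[symmetric])
      finally show ?case using Suc by simp
    qed simp
    then show ?thesis .
  qed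
  also have "\<dots> = 2 ^ (2 * ?h)" by (simp add: power_mult)
  also have "\<dots> \<le> 2 ^ m" by (intro power_increasing) auto
  finally show False using S by simp
qed

section \<open>Binary digits of natural numbers\<close>

lemma bit_imp_less: "bit (k::nat) i \<Longrightarrow> i < k"
proof -
  assume "bit k i"
  then have "k div 2 ^ i \<noteq> 0" by (auto simp: bit_iff_odd intro: ccontr)
  then have "2 ^ i \<le> k" by (simp add: div_eq_0_iff)
  then show "i < k" using less_exp[of i] by linarith
qed

lemma finite_bits [simp]: "finite {i. bit (k::nat) i}"
  by (rule finite_subset[of _ "{..<k}"]) (auto dest: bit_imp_less)

lemma bits_add_power:
  assumes "n < (2::nat) ^ m"
  shows "{i. bit (n + 2 ^ m) i} = insert m {i. bit n i}" "\<not> bit n m"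
proof -
  have b: "\<not> bit n i" if "m \<le> i" for i
  proof -
    have "n < 2 ^ i" using assms power_increasing[OF that, of "2::nat"] by linarith
    then show ?thesis by (simp add: bit_iff_odd)
  qed
  have "n + 2 ^ m = n + push_bit m 1" by (simp add: push_bit_eq_mult)
  also have "\<dots> = semiring_bit_operations_class.or n (push_bit m 1)"
    by (rule disjunctive_add) (use b in \<open>auto simp: bit_exp_iff\<close>)
  finally show "{i. bit (n + 2 ^ m) i} = insert m {i. bit n i}"
    by (auto simp: bit_or_iff bit_exp_iff)
  show "\<not> bit n m" using b by simp
qed

text \<open>Expanding the product on the right selects a set of positions below m, that is, the
  digits of one n < 2^m. With signs as factors this evaluates both the Walsh kernel and the
  character sum over the lattice.\<close>

lemma sum_prod_bits:
  fixes a :: "nat \<Rightarrow> 'a::comm_ring_1"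
  shows "(\<Sum>n<(2::nat) ^ m. \<Prod>r | bit n r. a r) = (\<Prod>r<m. 1 + a r)"
proof (induction m)
  case (Suc m)
  have "{..<2 ^ Suc m} = {..<2 ^ m} \<union> (\<lambda>n. n + 2 ^ m) ` {..<(2::nat) ^ m}"
  proof -
    have "x \<in> (\<lambda>n. n + 2 ^ m) ` {..<(2::nat) ^ m}" if "x < 2 ^ Suc m" "\<not> x < 2 ^ m" for x
      using that by (intro image_eqI[where x="x - 2 ^ m"]) auto
    then show ?thesis by auto
  qed
  then have "(\<Sum>n<(2::nat) ^ Suc m. \<Prod>r | bit n r. a r) =
    (\<Sum>n<(2::nat) ^ m. \<Prod>r | bit n r. a r) + (\<Sum>n\<in>(\<lambda>n. n + 2 ^ m) ` {..<(2::nat) ^ m}. \<Prod>r | bit n r. a r)"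
    by (simp only:) (rule sum.union_disjoint, auto)
  also have "(\<Sum>n\<in>(\<lambda>n. n + 2 ^ m) ` {..<(2::nat) ^ m}. \<Prod>r | bit n r. a r)
     = (\<Sum>n<(2::nat) ^ m. \<Prod>r | bit (n + 2 ^ m) r. a r)"
    by (subst sum.reindex) (auto simp: inj_on_def)
  also have "\<dots> = (\<Sum>n<(2::nat) ^ m. a m * (\<Prod>r | bit n r. a r))"
    using bits_add_power by (intro sum.cong) auto
  finally show ?case using Suc by (simp add: sum_distrib_left[symmetric] algebra_simps)
qed (simp add: lessThan_Suc)

subsection \<open>Binary digits\<close>

text \<open>Position i carries 2^-(i + 1), so that it lines up with \<open>bdigit (Suc i)\<close>
  and with the binary digit i of a Walsh index.\<close>

definition dig :: "(nat \<Rightarrow> nat) \<Rightarrow> real"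
  where "dig e = (\<Sum>i. real (e i) / 2 ^ Suc i)"

lemma bdigit_le_1: "bdigit i x \<le> 1" "bdigit i x < 2"
  unfolding bdigit_def by auto

lemma summable_dig:
  assumes "\<And>i. e i \<le> (1::nat)" shows "summable (\<lambda>i. real (e i) / 2 ^ Suc i)"
proof (rule summable_comparison_test)
  show "summable (\<lambda>i. (1/2::real) ^ Suc i)" using power_half_series sums_summable by blast
  show "\<exists>N. \<forall>n\<ge>N. norm (real (e n) / 2 ^ Suc n) \<le> (1/2::real) ^ Suc n"
    using assms by (intro exI[of _ 0]) (auto simp: power_one_over divide_simps)
qed

text \<open>Comparison with the series of all ones, whose sum is 1; the zero digit at j makes the
  inequality strict.\<close>

lemma dig_bounds:
  assumes "\<And>i. e i \<le> 1" "e j = 0" shows "0 \<le> dig e" "dig e < 1"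
proof -
  note s = summable_dig[of e, OF assms(1)]
  show "0 \<le> dig e" unfolding dig_def by (rule suminf_nonneg[OF s]) auto
  have one: "(\<lambda>i. (1/2::real) ^ Suc i) sums 1" by (rule power_half_series)
  have "0 < (\<Sum>i. (1/2) ^ Suc i - real (e i) / 2 ^ Suc i)"
  proof (rule suminf_pos2[where i=j])
    show "summable (\<lambda>i. (1/2) ^ Suc i - real (e i) / 2 ^ Suc i)"
      using one s by (intro summable_diff) (auto simp: sums_iff)
    show "0 \<le> (1/2) ^ Suc n - real (e n) / 2 ^ Suc n" for n
      using assms(1)[of n] by (auto simp: power_one_over divide_simps)
    show "0 < (1/2) ^ Suc j - real (e j) / 2 ^ Suc j" using assms(2) by simp
  qed
  also have "(\<Sum>i. (1/2) ^ Suc i - real (e i) / 2 ^ Suc i) = 1 - dig e"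
    unfolding dig_def using one s by (subst suminf_diff[symmetric]) (auto simp: sums_iff)
  finally show "dig e < 1" by simp
qed

lemma dig_shift:
  assumes "\<And>i. e i \<le> 1"
  shows "dig e = (\<Sum>i<n. real (e i) / 2 ^ Suc i) + dig (\<lambda>i. e (i + n)) / 2 ^ n"
proof -
  note s = summable_dig[of e, OF assms]
  have s': "summable (\<lambda>i. real (e (i + n)) / 2 ^ Suc i)" using assms by (intro summable_dig) auto
  have "dig e = (\<Sum>i. real (e (i + n)) / 2 ^ Suc (i + n)) + (\<Sum>i<n. real (e i) / 2 ^ Suc i)"
    unfolding dig_def using suminf_split_initial_segment[OF s, of n] by simp
  also have "(\<Sum>i. real (e (i + n)) / 2 ^ Suc (i + n)) = dig (\<lambda>i. e (i + n)) / 2 ^ n"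
    unfolding dig_def suminf_divide[OF s', symmetric] by (simp add: power_add field_simps)
  finally show ?thesis by simp
qed

text \<open>Zeros at arbitrarily late positions keep every tail below 1, so the floor is the integer
  formed by the first n digits.\<close>

lemma floor_dig:
  assumes "\<And>i. e i \<le> 1" "\<And>i. \<exists>j>i. e j = 0"
  shows "\<lfloor>2 ^ n * dig e\<rfloor> = (\<Sum>i<n. int (e i) * 2 ^ (n - Suc i))"
proof -
  obtain j where j: "j > n" "e j = 0" using assms(2)[of n] by auto
  have t: "0 \<le> dig (\<lambda>i. e (i + n))" "dig (\<lambda>i. e (i + n)) < 1"
    using dig_bounds[of "\<lambda>i. e (i + n)" "j - n"] assms(1) j by auto
  have "2 ^ n * (\<Sum>i<n. real (e i) / 2 ^ Suc i) = (\<Sum>i<n. real (e i) * 2 ^ (n - Suc i))"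
    unfolding sum_distrib_left by (rule sum.cong) (auto simp: power_diff simp del: power_Suc)
  then have "2 ^ n * dig e = real_of_int (\<Sum>i<n. int (e i) * 2 ^ (n - Suc i)) + dig (\<lambda>i. e (i + n))"
    using dig_shift[of e n, OF assms(1)] by (simp add: algebra_simps)
  then show ?thesis using t by linarith
qed

lemma bdigit_dig:
  assumes "\<And>i. e i \<le> 1" "\<And>i. \<exists>j>i. e j = 0"
  shows "bdigit (Suc i) (dig e) = e i"
proof -
  have "(\<Sum>j<Suc i. int (e j) * 2 ^ (Suc i - Suc j)) = (\<Sum>j<i. int (e j) * (2 * 2 ^ (i - Suc j))) + int (e i)"
    by (auto intro!: sum.cong simp: Suc_diff_Suc simp flip: power_Suc)
  also have "\<dots> = 2 * (\<Sum>j<i. int (e j) * 2 ^ (i - Suc j)) + int (e i)"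
    by (simp add: sum_distrib_left mult_ac)
  also have "\<dots> = int (2 * (\<Sum>j<i. e j * 2 ^ (i - Suc j)) + e i)" by simp
  finally have "nat \<lfloor>2 ^ Suc i * dig e\<rfloor> = 2 * (\<Sum>j<i. e j * 2 ^ (i - Suc j)) + e i"
    unfolding floor_dig[OF assms] by (simp only: nat_int)
  then show ?thesis using assms(1)[of i] unfolding bdigit_def by simp
qed

lemma dig_finite:
  assumes "\<And>i. M \<le> i \<Longrightarrow> e i = 0"
  shows "dig e = (\<Sum>i<M. real (e i) / 2 ^ Suc i)"
  unfolding dig_def using assms by (intro suminf_finite) auto

lemma floor_double: "\<lfloor>2 * y\<rfloor> = 2 * \<lfloor>y\<rfloor> + \<lfloor>2 * y\<rfloor> mod 2" for y :: real
proof -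
  have "\<lfloor>2 * y\<rfloor> = 2 * \<lfloor>y\<rfloor> \<or> \<lfloor>2 * y\<rfloor> = 2 * \<lfloor>y\<rfloor> + 1" by linarith
  then have "\<lfloor>2 * y\<rfloor> div 2 = \<lfloor>y\<rfloor>" by auto
  then show ?thesis using mult_div_mod_eq[of 2 "\<lfloor>2 * y\<rfloor>"] by simp
qed

lemma floor_power_Suc:
  assumes "0 \<le> x" shows "\<lfloor>2 ^ Suc n * x\<rfloor> = 2 * \<lfloor>2 ^ n * x\<rfloor> + int (bdigit (Suc n) x)"
proof -
  have "int (bdigit (Suc n) x) = \<lfloor>2 ^ Suc n * x\<rfloor> mod 2"
    using assms unfolding bdigit_def by (simp add: zmod_int)
  then show ?thesis using floor_double[of "2 ^ n * x"] by (simp add: mult.assoc)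
qed

text \<open>If all digits after position i were 1, the distance from 1 of the fractional part of 2^n
  * x would double with each n and eventually exceed 1.\<close>

lemma bdigit_zero_cofinal:
  assumes "0 \<le> x" shows "\<exists>j>i. bdigit (Suc j) x = 0"
proof (rule ccontr)
  assume "\<not> ?thesis"
  then have one: "bdigit (Suc j) x = 1" if "j > i" for j
    using that bdigit_le_1[of "Suc j" x] by (metis One_nat_def le_antisym less_one not_less)
  define t where "t n = 2 ^ n * x - real_of_int \<lfloor>2 ^ n * x\<rfloor>" for n
  have t: "0 \<le> t n" "t n < 1" for n unfolding t_def by linarith+
  have step: "1 - t (Suc n) = 2 * (1 - t n)" if "n > i" for n
    using floor_power_Suc[OF assms, of n] one[OF that] unfolding t_def by simp
  have "1 - t (Suc i + k) = 2 ^ k * (1 - t (Suc i))" for k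
  proof (induction k)
    case (Suc k)
    then show ?case using step[of "Suc i + k"] by simp
  qed simp
  then have b: "2 ^ k * (1 - t (Suc i)) \<le> 1" for k using t(1)[of "Suc i + k"] by (metis diff_ge_0_iff_ge diff_le_eq le_add_same_cancel1)
  obtain k where "1 / (1 - t (Suc i)) < 2 ^ k" using real_arch_pow[of 2] by auto
  then have "1 < 2 ^ k * (1 - t (Suc i))" using t(2)[of "Suc i"] by (simp add: divide_simps)
  then show False using b[of k] by simp
qed

lemma floor_eq_iff_digits:
  assumes "0 \<le> x" "x < 1" "0 \<le> z" "z < 1"
  shows "\<lfloor>2 ^ n * x\<rfloor> = \<lfloor>2 ^ n * z\<rfloor> \<longleftrightarrow> (\<forall>i<n. bdigit (Suc i) x = bdigit (Suc i) z)"
proof (induction n)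
  case 0
  have "\<lfloor>x\<rfloor> = 0" "\<lfloor>z\<rfloor> = 0" using assms by linarith+
  then show ?case by simp
next
  case (Suc n)
  have "\<lfloor>2 ^ Suc n * x\<rfloor> = \<lfloor>2 ^ Suc n * z\<rfloor> \<longleftrightarrow>
    \<lfloor>2 ^ n * x\<rfloor> = \<lfloor>2 ^ n * z\<rfloor> \<and> bdigit (Suc n) x = bdigit (Suc n) z"
    using bdigit_le_1[of "Suc n" x] bdigit_le_1[of "Suc n" z]
    unfolding floor_power_Suc[OF assms(1)] floor_power_Suc[OF assms(3)] by presburger
  then show ?case using Suc by (auto simp: less_Suc_eq)
qed

definition rad :: "nat \<Rightarrow> real \<Rightarrow> real"
  where "rad i x = (-1) ^ bdigit (Suc i) x"

lemma wal_eq_prod: "wal k x = (\<Prod>i | bit k i. rad i x)"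
  unfolding wal_def rad_def by (simp add: power_sum)

lemma abs_rad [simp]: "\<bar>rad i x\<bar> = 1" unfolding rad_def by (simp add: power_abs)

lemma abs_wal [simp]: "\<bar>wal k x\<bar> = 1" unfolding wal_eq_prod by (simp add: abs_prod)

text \<open>The Dirichlet kernel of the Walsh system. It factors into terms 1 plus a product of two
  Rademacher signs, and one disagreement among the first L digits makes a factor vanish.\<close>

lemma sum_wal_mult:
  assumes "0 \<le> x" "x < 1" "0 \<le> z" "z < 1"
  shows "(\<Sum>k<2 ^ L. wal k x * wal k z) = (if \<lfloor>2 ^ L * x\<rfloor> = \<lfloor>2 ^ L * z\<rfloor> then 2 ^ L else 0)"
proof -
  have "(\<Sum>k<2 ^ L. wal k x * wal k z) = (\<Prod>r<L. 1 + rad r x * rad r z)"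
    unfolding wal_eq_prod prod.distrib[symmetric] by (rule sum_prod_bits)
  also have "\<dots> = (\<Prod>r<L. if bdigit (Suc r) x = bdigit (Suc r) z then 2 else 0)"
  proof (rule prod.cong[OF refl])
    fix r
    have "bdigit (Suc r) x = 0 \<or> bdigit (Suc r) x = 1" "bdigit (Suc r) z = 0 \<or> bdigit (Suc r) z = 1"
      using bdigit_le_1[of "Suc r" x] bdigit_le_1[of "Suc r" z] by linarith+
    then show "1 + rad r x * rad r z = (if bdigit (Suc r) x = bdigit (Suc r) z then 2 else 0)"
      unfolding rad_def by auto
  qed
  also have "\<dots> = (if \<forall>r<L. bdigit (Suc r) x = bdigit (Suc r) z then 2 ^ L else 0)"
    by (auto intro: prod_zero)
  finally show ?thesis using floor_eq_iff_digits[OF assms] by simp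
qed

text \<open>From position M on the digits of the sum are those of y, which contain infinitely many
  zeros. The digitwise sum is therefore already the canonical expansion, and its digits can be read
  off.\<close>

lemma digit_add_dig:
  assumes e: "\<And>i. e i \<le> 1" "\<And>i. M \<le> i \<Longrightarrow> e i = 0" and y: "0 \<le> y"
  shows "digit_add (dig e) y = dig (\<lambda>i. (e i + bdigit (Suc i) y) mod 2)"
    and "bdigit (Suc i) (digit_add (dig e) y) = (e i + bdigit (Suc i) y) mod 2"
    and "0 \<le> digit_add (dig e) y" "digit_add (dig e) y < 1"
proof -
  have "\<exists>j>i. e j = 0" for i using e(2) by (intro exI[of _ "i + M + 1"]) auto
  then have d: "bdigit (Suc i) (dig e) = e i" for i by (intro bdigit_dig) (use e in auto)
  show *: "digit_add (dig e) y = dig (\<lambda>i. (e i + bdigit (Suc i) y) mod 2)"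
    unfolding digit_add_def d unfolding dig_def ..
  have z: "\<exists>j>i. (e j + bdigit (Suc j) y) mod 2 = 0" for i
  proof -
    obtain j where "j > i + M" "bdigit (Suc j) y = 0" using bdigit_zero_cofinal[OF y] by blast
    then show ?thesis using e(2)[of j] by (intro exI[of _ j]) auto
  qed
  show "bdigit (Suc i) (digit_add (dig e) y) = (e i + bdigit (Suc i) y) mod 2"
    unfolding * by (rule bdigit_dig) (use z in auto)
  obtain j where "j > 0" and "(e j + bdigit (Suc j) y) mod 2 = 0" using z[of 0] by (elim exE conjE)
  from dig_bounds[of "\<lambda>i. (e i + bdigit (Suc i) y) mod 2", OF _ this(2)]
  show "0 \<le> digit_add (dig e) y" "digit_add (dig e) y < 1" unfolding * by auto
qed

text \<open>Finite expansions turn the interlacing series into a finite sum, whose terms are paired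
  off by induction on M.\<close>

lemma interlace2_dig:
  assumes e: "\<And>i. e i \<le> 1" "\<And>i. M \<le> i \<Longrightarrow> e i = 0"
    and f: "\<And>i. f i \<le> 1" "\<And>i. M \<le> i \<Longrightarrow> f i = 0"
  shows "interlace2 (dig e) (dig f) = dig (\<lambda>i. if even i then e (i div 2) else f (i div 2))"
proof -
  have "\<exists>j>i. e j = 0" "\<exists>j>i. f j = 0" for i
    using e(2) f(2) by (intro exI[of _ "i + M + 1"]; auto)+
  then have d: "bdigit (Suc i) (dig e) = e i" "bdigit (Suc i) (dig f) = f i" for i
    by (intro bdigit_dig; use e f in auto)+
  have "interlace2 (dig e) (dig f) = (\<Sum>i<M. real (e i) / 2 ^ (2 * Suc i - 1) + real (f i) / 2 ^ (2 * Suc i))"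
    unfolding interlace2_def d using e(2) f(2) by (intro suminf_finite) auto
  also have "\<dots> = (\<Sum>i<2 * M. real (if even i then e (i div 2) else f (i div 2)) / 2 ^ Suc i)"
    by (induction M) auto
  also have "\<dots> = dig (\<lambda>i. if even i then e (i div 2) else f (i div 2))"
    using e(2) f(2) by (intro dig_finite[symmetric]) auto
  finally show ?thesis .
qed

subsection \<open>Laurent series of polynomials\<close>

lemma poly_laurent_pCons: "poly_laurent (pCons a p) = fls_const a + fls_X_inv * poly_laurent p"
  unfolding poly_laurent_def by (simp add: Polynomial.map_poly_pCons)

lemma poly_laurent_0 [simp]: "poly_laurent 0 = 0" unfolding poly_laurent_def by simp

lemma poly_laurent_1 [simp]: "poly_laurent 1 = 1" unfolding poly_laurent_def by simp

lemma poly_laurent_add: "poly_laurent (p + q) = poly_laurent p + poly_laurent q"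
proof (induction p q rule: poly_induct2)
  case (pCons a p b q)
  have "poly_laurent (pCons a p + pCons b q) = (fls_const a + fls_const b) + fls_X_inv * (poly_laurent p + poly_laurent q)"
    unfolding add_pCons poly_laurent_pCons pCons.IH fls_plus_const ..
  then show ?case unfolding poly_laurent_pCons distrib_left by (simp only: ac_simps)
qed simp

lemma poly_laurent_smult: "poly_laurent (Polynomial.smult a q) = fls_const a * poly_laurent q"
  by (induction q) (simp_all add: poly_laurent_pCons algebra_simps fls_const_mult_const[symmetric])

lemma poly_laurent_mult: "poly_laurent (p * q) = poly_laurent p * poly_laurent q"
  by (induction p) (simp_all add: poly_laurent_pCons poly_laurent_add poly_laurent_smult algebra_simps)

lemma poly_laurent_monom: "poly_laurent (monom 1 i) = fls_X_inv ^ i"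
  by (induction i) (simp_all add: Polynomial.monom_Suc poly_laurent_pCons)

lemma fls_nth_poly_laurent: "fls_nth (poly_laurent p) k = (if k \<le> 0 then coeff p (nat (- k)) else 0)"
proof (induction p arbitrary: k)
  case (pCons a p)
  have "nat (- k) = Suc (nat (- (k + 1)))" if "k < 0" using that by auto
  then show ?case unfolding poly_laurent_pCons
    by (auto simp: pCons.IH fls_X_inv_times_conv_shift coeff_pCons split: nat.splits)
qed simp

lemma fls_subdegree_poly_laurent:
  assumes "p \<noteq> 0" shows "fls_subdegree (poly_laurent p) = - int (degree p)"
proof (rule fls_subdegree_eqI)
  show "fls_nth (poly_laurent p) (- int (degree p)) \<noteq> 0" using assms by (simp add: fls_nth_poly_laurent)
  show "fls_nth (poly_laurent p) k = 0" if "k < - int (degree p)" for k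
    using that by (simp add: fls_nth_poly_laurent coeff_eq_0)
qed

lemma poly_laurent_eq_0_iff [simp]: "poly_laurent p = 0 \<longleftrightarrow> p = 0"
proof
  assume "poly_laurent p = 0"
  then have "coeff p n = 0" for n using fls_nth_poly_laurent[of p "- int n"] by simp
  then show "p = 0" by (intro poly_eqI) simp
qed simp

text \<open>The coefficient of x^-1 in R / P, a residue. It is additive in R, and multiplying R by
  x^i yields the later digits of a lattice point, so that digit computations become linear
  algebra.\<close>

definition res :: "bit poly \<Rightarrow> bit poly \<Rightarrow> bit"
  where "res P R = fls_nth (poly_laurent R / poly_laurent P) 1"

lemma res_add: "res P (R + R') = res P R + res P R'"
  unfolding res_def by (simp add: poly_laurent_add add_divide_distrib)

lemma res_0 [simp]: "res P 0 = 0" unfolding res_def by simp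

lemma res_sum: "res P (sum f A) = (\<Sum>x\<in>A. res P (f x))"
  by (induction A rule: infinite_finite_induct) (auto simp: res_add)

lemma res_monom_mult: "res P (monom 1 i * R) = fls_nth (poly_laurent R / poly_laurent P) (1 + int i)"
  unfolding res_def poly_laurent_mult poly_laurent_monom times_divide_eq_right[symmetric]
  unfolding fls_X_inv_power_times_conv_shift by simp

text \<open>Only the remainder r of R modulo P contributes to the negative powers of x in R / P. If
  r is nonzero, its leading term sits at x^-(degree P - degree r), which is detected with i = degree
  P - degree r - 1.\<close>

lemma res_nondegenerate:
  assumes P: "P \<noteq> 0" and z: "\<And>i. i < degree P \<Longrightarrow> res P (monom 1 i * R) = 0"
  shows "P dvd R"
proof (rule ccontr)
  assume nd: "\<not> P dvd R"
  define r where "r = R mod P"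
  have r0: "r \<noteq> 0" using nd unfolding r_def by (simp add: dvd_eq_mod_eq_0)
  have deg: "degree r < degree P" using degree_mod_less[OF P, of R] r0 unfolding r_def by auto
  define i where "i = degree P - degree r - 1"
  have R: "R = P * (R div P) + r" unfolding r_def by simp
  have "poly_laurent R / poly_laurent P = poly_laurent (R div P) + poly_laurent r / poly_laurent P"
    using P by (subst R) (simp add: poly_laurent_add poly_laurent_mult add_divide_distrib)
  then have "fls_nth (poly_laurent R / poly_laurent P) (1 + int i) = fls_nth (poly_laurent r / poly_laurent P) (1 + int i)"
    by (simp add: fls_nth_poly_laurent)
  moreover have "1 + int i = fls_subdegree (poly_laurent r / poly_laurent P)"
    using P r0 deg by (subst fls_divide_subdegree) (auto simp: fls_subdegree_poly_laurent i_def)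
  ultimately have "res P (monom 1 i * R) \<noteq> 0"
    unfolding res_monom_mult using P r0 by (simp add: nth_fls_subdegree_nonzero)
  moreover have "i < degree P" using deg unfolding i_def by linarith
  ultimately show False using z by blast
qed

lemma coeff_nat_poly: "coeff (nat_poly n) r = of_bool (bit n r)"
  unfolding nat_poly_def by (simp add: coeff_sum of_bool_def)

lemma nat_poly_inj: "nat_poly n = nat_poly n' \<longleftrightarrow> n = n'"
proof
  assume "nat_poly n = nat_poly n'"
  then have "bit n r = bit n' r" for r using coeff_nat_poly[of n r] coeff_nat_poly[of n' r] by (auto simp: of_bool_def split: if_splits)
  then show "n = n'" by (intro bit_eqI) simp
qed simp

lemma degree_nat_poly_less:
  assumes "1 \<le> m" "n < 2 ^ m" shows "degree (nat_poly n) < m"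
proof -
  have "\<not> bit n i" if "m \<le> i" for i
  proof -
    have "n < 2 ^ i" using assms power_increasing[OF that, of "2::nat"] by linarith
    then show ?thesis by (simp add: bit_iff_odd)
  qed
  then have "degree (nat_poly n) \<le> m - 1" using assms(1) by (intro degree_le) (auto simp: coeff_nat_poly)
  then show ?thesis using assms(1) by linarith
qed

subsection \<open>Polynomial lattices\<close>

text \<open>The nontrivial character of the field with two elements; composed with
  \<open>res P\<close> it yields additive characters modulo P.\<close>

definition bit_sign :: "bit \<Rightarrow> real" where "bit_sign b = (if b = 0 then 1 else -1)"

lemma bit_sign_0 [simp]: "bit_sign 0 = 1" unfolding bit_sign_def by simp

lemma bit_sign_add: "bit_sign (a + b) = bit_sign a * bit_sign b"
  by (cases a; cases b) (simp_all add: bit_sign_def)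

lemma bit_sign_sum: "bit_sign (sum f A) = (\<Prod>x\<in>A. bit_sign (f x))"
proof (induction A rule: infinite_finite_induct)
  case (insert x F)
  then show ?case unfolding sum.insert[OF insert(1,2)] prod.insert[OF insert(1,2)] bit_sign_add by (simp only:)
qed simp_all

lemma power_of_bit: "(-1) ^ (of_bit b :: nat) = bit_sign b"
  by (cases b) (auto simp: bit_sign_def)

definition lattice_digit :: "nat \<Rightarrow> bit poly \<Rightarrow> bit poly \<Rightarrow> nat \<Rightarrow> nat"
  where "lattice_digit m P R i = (if i < m then of_bit (res P (monom 1 i * R)) else 0)"

lemma lattice_digit_le: "lattice_digit m P R i \<le> 1" "m \<le> i \<Longrightarrow> lattice_digit m P R i = 0"
  unfolding lattice_digit_def by auto

lemma lattice_point_dig: "lattice_point m P q n j = dig (lattice_digit m P (nat_poly n * q j))"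
proof -
  have "lattice_point m P q n j = (\<Sum>i<m. real (lattice_digit m P (nat_poly n * q j) i) / 2 ^ Suc i)"
    unfolding lattice_point_def v_map_def lattice_digit_def res_monom_mult
    by (rule sum.reindex_bij_witness[of _ Suc "\<lambda>l. l - 1"]) (auto simp: of_bool_def)
  then show ?thesis by (simp add: dig_finite[of m] lattice_digit_le)
qed

text \<open>Since digits are counted from 0, it is the even positions that belong to the component
  of odd number.\<close>

definition interlace_digit :: "nat \<Rightarrow> bit poly \<Rightarrow> (nat \<Rightarrow> bit poly) \<Rightarrow> nat \<Rightarrow> nat \<Rightarrow> nat \<Rightarrow> nat"
  where "interlace_digit m P q n j i =
    lattice_digit m P (nat_poly n * q (if even i then 2 * j - 1 else 2 * j)) (i div 2)"

lemma interlace_digit_le: "interlace_digit m P q n j i \<le> 1" "2 * m \<le> i \<Longrightarrow> interlace_digit m P q n j i = 0"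
  unfolding interlace_digit_def by (simp_all only: lattice_digit_le)

lemma interlace_dig:
  assumes "j \<in> {1..s}"
  shows "interlace s (lattice_point m P q n) j = dig (interlace_digit m P q n j)"
proof -
  have "interlace s (lattice_point m P q n) j = interlace2 (dig (lattice_digit m P (nat_poly n * q (2 * j - 1)))) (dig (lattice_digit m P (nat_poly n * q (2 * j))))"
    using assms unfolding interlace_def by (simp add: lattice_point_dig)
  also have "\<dots> = dig (\<lambda>i. if even i then lattice_digit m P (nat_poly n * q (2 * j - 1)) (i div 2) else lattice_digit m P (nat_poly n * q (2 * j)) (i div 2))"
    by (rule interlace2_dig[of _ m]) (simp_all only: lattice_digit_le)
  also have "(\<lambda>i. if even i then lattice_digit m P (nat_poly n * q (2 * j - 1)) (i div 2) else lattice_digit m P (nat_poly n * q (2 * j)) (i div 2))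
    = interlace_digit m P q n j" unfolding interlace_digit_def by (rule ext) simp
  finally show ?thesis .
qed

definition shifted_point :: "nat \<Rightarrow> nat \<Rightarrow> bit poly \<Rightarrow> (nat \<Rightarrow> bit poly) \<Rightarrow> (nat \<Rightarrow> real) \<Rightarrow> nat \<Rightarrow> nat \<Rightarrow> real"
  where "shifted_point s m P q \<Delta> n =
    (\<lambda>j\<in>{1..s}. digit_add (interlace s (lattice_point m P q n) j) (\<Delta> j))"

lemma bdigit_shifted_point:
  assumes "\<Delta> \<in> {1..s} \<rightarrow>\<^sub>E {0..<1}" "j \<in> {1..s}"
  shows "bdigit (Suc i) (shifted_point s m P q \<Delta> n j) = (interlace_digit m P q n j i + bdigit (Suc i) (\<Delta> j)) mod 2"
  using assms unfolding shifted_point_def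
  by (auto simp: interlace_dig PiE_iff intro!: digit_add_dig(2)[of _ "2 * m"] interlace_digit_le)

text \<open>Digit M of \<open>dig e\<close> is free, so adding 2^-(M + 1) causes no carry and
  coincides with digitwise addition. With M = 2 * m the translation by half a grid step becomes a
  digital shift.\<close>

lemma digit_add_half_step:
  assumes e: "\<And>i. e i \<le> 1" "\<And>i. M \<le> i \<Longrightarrow> e i = 0"
  shows "digit_add (dig e) (1 / 2 ^ Suc M) = dig e + 1 / 2 ^ Suc M"
    and "0 < dig e + 1 / 2 ^ Suc M" "dig e + 1 / 2 ^ Suc M < 1"
proof -
  have "\<exists>j>i. (if j = M then 1 else 0) = (0::nat)" for i by (intro exI[of _ "i + M + 1"]) auto
  then have d: "bdigit (Suc i) (dig (\<lambda>i. if i = M then 1 else 0)) = (if i = M then 1 else 0)" for i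
    by (intro bdigit_dig) auto
  have y: "dig (\<lambda>i. if i = M then 1 else 0) = 1 / 2 ^ Suc M"
    by (subst dig_finite[of "Suc M"]) (auto simp: )
  have md: "e i mod 2 = e i" for i using e(1)[of i] by (intro mod_less) linarith
  have *: "digit_add (dig e) (1 / 2 ^ Suc M) = dig (\<lambda>i. (e i + (if i = M then 1 else 0)) mod 2)"
    using digit_add_dig(1)[of e M, OF e, of "1 / 2 ^ Suc M"] d unfolding y by simp
  also have "\<dots> = (\<Sum>i<Suc M. real ((e i + (if i = M then 1 else 0)) mod 2) / 2 ^ Suc i)"
    using e(2) by (intro dig_finite) auto
  also have "\<dots> = (\<Sum>i<M. real (e i) / 2 ^ Suc i) + 1 / 2 ^ Suc M"
    using e(2)[of M] md by (auto intro!: sum.cong)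
  also have "\<dots> = dig e + 1 / 2 ^ Suc M" using dig_finite[of M e] e(2) by simp
  finally show eq: "digit_add (dig e) (1 / 2 ^ Suc M) = dig e + 1 / 2 ^ Suc M" .
  show "0 < dig e + 1 / 2 ^ Suc M"
    using dig_bounds(1)[of e M] e by (simp add: add_nonneg_pos)
  show "dig e + 1 / 2 ^ Suc M < 1"
    unfolding eq[symmetric] by (rule digit_add_dig(4)[of e M]) (use e in auto)
qed

text \<open>Both kinds of shift are brought to the form of a digitwise shift by one vector \<Delta>,
  so that the Walsh analysis has a single case to treat.\<close>

lemma shift_of_interlaced_lattice:
  assumes "is_shift_of s m (interlaced_lattice s m P q) X"
  obtains \<Delta> where "\<Delta> \<in> {1..s} \<rightarrow>\<^sub>E {0..<1}" "X = shifted_point s m P q \<Delta> ` {..<2 ^ m}"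
    "X \<subseteq> {1..s} \<rightarrow>\<^sub>E {0<..<1}"
  using assms unfolding is_shift_of_def
proof (elim disjE bexE conjE)
  assume X: "X = (\<lambda>x. \<lambda>j\<in>{1..s}. x j + 1 / 2 ^ (2 * m + 1)) ` interlaced_lattice s m P q"
  define \<Delta> :: "nat \<Rightarrow> real" where "\<Delta> = (\<lambda>j\<in>{1..s}. 1 / 2 ^ Suc (2 * m))"
  have "(1::real) < 2 ^ Suc (2 * m)" by (rule one_less_power) auto
  then have \<Delta>: "\<Delta> \<in> {1..s} \<rightarrow>\<^sub>E {0..<1}" unfolding \<Delta>_def
    by (auto simp del: power_Suc)
  note e = interlace_digit_le[where m=m and P=P and q=q]
  have "(\<lambda>j\<in>{1..s}. interlace s (lattice_point m P q n) j + 1 / 2 ^ (2 * m + 1)) = shifted_point s m P q \<Delta> n" for n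
    unfolding shifted_point_def
  proof (rule restrict_ext)
    fix j assume "j \<in> {1..s}"
    then show "interlace s (lattice_point m P q n) j + 1 / 2 ^ (2 * m + 1) = digit_add (interlace s (lattice_point m P q n) j) (\<Delta> j)"
      using digit_add_half_step(1)[of "interlace_digit m P q n j" "2 * m", OF e]
      by (simp add: \<Delta>_def interlace_dig del: power_Suc)
  qed
  then have X': "X = shifted_point s m P q \<Delta> ` {..<2 ^ m}"
    unfolding X interlaced_lattice_def image_image by simp
  have "shifted_point s m P q \<Delta> n \<in> {1..s} \<rightarrow>\<^sub>E {0<..<1}" for n
    unfolding shifted_point_def
  proof (rule restrict_PiE_iff[THEN iffD2], rule ballI)
    fix j assume "j \<in> {1..s}"
    then show "digit_add (interlace s (lattice_point m P q n) j) (\<Delta> j) \<in> {0<..<1}"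
      using digit_add_half_step[of "interlace_digit m P q n j" "2 * m", OF e]
      by (simp add: \<Delta>_def interlace_dig del: power_Suc)
  qed
  then show thesis using that \<Delta> X' by blast
next
  fix \<Delta> assume \<Delta>: "\<Delta> \<in> {1..s} \<rightarrow>\<^sub>E {0..<1}" "X \<subseteq> {1..s} \<rightarrow>\<^sub>E {0<..<1}"
    "X = (\<lambda>x. \<lambda>j\<in>{1..s}. digit_add (x j) (\<Delta> j)) ` interlaced_lattice s m P q"
  then show thesis using that unfolding interlaced_lattice_def image_image shifted_point_def by blast
qed

text \<open>Because q 1 = 1, the even digits of the first coordinate are, up to the shift, residues
  of x^i times n(x); by nondegeneracy they determine n(x) modulo P and hence n. This turns sums over
  the point set into sums over n.\<close>

lemma inj_shifted_point:
  assumes "\<Delta> \<in> {1..s} \<rightarrow>\<^sub>E {0..<1}" "1 \<le> s" "1 \<le> m" "degree P = m" "q 1 = 1"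
  shows "inj_on (shifted_point s m P q \<Delta>) {..<2 ^ m}"
proof (rule inj_onI)
  fix n n' :: nat assume n: "n \<in> {..<2 ^ m}" "n' \<in> {..<2 ^ m}"
    and eq: "shifted_point s m P q \<Delta> n = shifted_point s m P q \<Delta> n'"
  have P0: "P \<noteq> 0" using assms by auto
  have "res P (monom 1 i * (nat_poly n + nat_poly n')) = 0" if "i < m" for i
  proof -
    have "(interlace_digit m P q n 1 (2 * i) + bdigit (Suc (2 * i)) (\<Delta> 1)) mod 2
        = (interlace_digit m P q n' 1 (2 * i) + bdigit (Suc (2 * i)) (\<Delta> 1)) mod 2"
      using bdigit_shifted_point[OF assms(1), of 1 "2 * i" m P q] eq assms(2) by (metis atLeastAtMost_iff order_refl)
    then have "interlace_digit m P q n 1 (2 * i) = interlace_digit m P q n' 1 (2 * i)"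
      using interlace_digit_le(1)[of m P q n 1 "2 * i"] interlace_digit_le(1)[of m P q n' 1 "2 * i"] by presburger
    then have "res P (monom 1 i * nat_poly n) = res P (monom 1 i * nat_poly n')"
      using that assms(5) unfolding interlace_digit_def lattice_digit_def
      by (cases "res P (monom 1 i * nat_poly n)"; cases "res P (monom 1 i * nat_poly n')") (simp_all split: if_splits)
    then show ?thesis unfolding distrib_left res_add by simp
  qed
  then have "P dvd nat_poly n + nat_poly n'" using res_nondegenerate[OF P0] assms by auto
  moreover have "degree (nat_poly n + nat_poly n') < degree P"
    using degree_nat_poly_less[OF assms(3)] n assms(4) by (intro degree_add_less) auto
  ultimately have "nat_poly n + nat_poly n' = 0" by (meson dvd_imp_degree_le not_le)
  then have "coeff (nat_poly n) r + coeff (nat_poly n') r = 0" for r by (metis coeff_0 coeff_add)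
  moreover have "a = b" if "a + b = 0" for a b :: bit using that by (cases a; cases b) auto
  ultimately have "nat_poly n = nat_poly n'" by (intro poly_eqI) blast
  then show "n = n'" by (simp add: nat_poly_inj)
qed

section \<open>Splitting a Walsh index along the interlacing\<close>

definition even_bits :: "nat \<Rightarrow> nat"
  where "even_bits k = horner_sum of_bool 2 (map (\<lambda>r. bit k (2 * r)) [0..<k])"
definition odd_bits :: "nat \<Rightarrow> nat"
  where "odd_bits k = horner_sum of_bool 2 (map (\<lambda>r. bit k (2 * r + 1)) [0..<k])"

lemma bit_even_bits: "bit (even_bits k) r \<longleftrightarrow> bit k (2 * r)"
  using bit_imp_less[of k "2 * r"] unfolding even_bits_def by (auto simp: bit_horner_sum_bit_iff)

lemma bit_odd_bits: "bit (odd_bits k) r \<longleftrightarrow> bit k (2 * r + 1)"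
  using bit_imp_less[of k "2 * r + 1"] unfolding odd_bits_def by (auto simp: bit_horner_sum_bit_iff)

text \<open>Interlacing transported to frequencies: a product of s Walsh functions at an interlaced
  point is a product of 2 * s Walsh functions at the lattice point, with these indices.\<close>

definition deinterlace :: "(nat \<Rightarrow> nat) \<Rightarrow> nat \<Rightarrow> nat"
  where "deinterlace k j = (if odd j then even_bits (k ((j + 1) div 2)) else odd_bits (k (j div 2)))"

lemma prod_even_odd:
  fixes f :: "nat \<Rightarrow> real"
  shows "(\<Prod>i | bit k i. f i) = (\<Prod>r | bit (even_bits k) r. f (2 * r)) * (\<Prod>r | bit (odd_bits k) r. f (2 * r + 1))"
proof -
  have "{i. bit k i} = (\<lambda>r. 2 * r) ` {r. bit (even_bits k) r} \<union> (\<lambda>r. 2 * r + 1) ` {r. bit (odd_bits k) r}"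
  proof -
    have "i \<in> (\<lambda>r. 2 * r) ` {r. bit (even_bits k) r} \<union> (\<lambda>r. 2 * r + 1) ` {r. bit (odd_bits k) r}" if "bit k i" for i
      using that by (cases "even i") (auto simp: bit_even_bits bit_odd_bits elim!: evenE oddE)
    then show ?thesis by (auto simp: bit_even_bits bit_odd_bits)
  qed
  moreover have "(\<lambda>r::nat. 2 * r) ` A \<inter> (\<lambda>r. 2 * r + 1) ` B = {}" for A B
  proof -
    have "2 * a \<noteq> 2 * b + 1" for a b :: nat by presburger
    then show ?thesis by blast
  qed
  ultimately show ?thesis
    by (simp add: prod.union_disjoint prod.reindex inj_on_def)
qed

text \<open>The value of the Walsh function of index l at \<open>v_map m\<close> of R / P. The
  digits of l from m on meet zero digits of the point and are dropped by
  \<open>take_bit\<close>.\<close>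

definition lattice_wal :: "nat \<Rightarrow> bit poly \<Rightarrow> nat \<Rightarrow> bit poly \<Rightarrow> real"
  where "lattice_wal m P l R = bit_sign (res P (nat_poly (take_bit m l) * R))"

lemma prod_lattice_digit: "(\<Prod>r | bit l r. (-1) ^ lattice_digit m P R r) = lattice_wal m P l R"
proof -
  have "(\<Prod>r | bit l r. (-1) ^ lattice_digit m P R r) = (\<Prod>r | bit (take_bit m l) r. bit_sign (res P (monom 1 r * R)))"
    by (rule prod.mono_neutral_cong_right) (auto simp: lattice_digit_def bit_take_bit_iff power_of_bit bit_sign_def)
  then show ?thesis unfolding lattice_wal_def nat_poly_def sum_distrib_right res_sum bit_sign_sum .
qed

text \<open>Walsh functions are characters of digitwise addition, so the shift contributes nothing
  but the sign \<open>wal k (\<Delta> j)\<close>.\<close>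

lemma wal_shifted_point:
  assumes "\<Delta> \<in> {1..s} \<rightarrow>\<^sub>E {0..<1}" "j \<in> {1..s}"
  shows "wal k (shifted_point s m P q \<Delta> n j) =
    lattice_wal m P (even_bits k) (nat_poly n * q (2 * j - 1)) * lattice_wal m P (odd_bits k) (nat_poly n * q (2 * j)) * wal k (\<Delta> j)"
proof -
  have "rad i (shifted_point s m P q \<Delta> n j) = (-1) ^ interlace_digit m P q n j i * rad i (\<Delta> j)" for i
  proof -
    have "(-1::real) ^ (a mod 2) = (-1) ^ a" for a :: nat by (simp add: minus_one_power_iff)
    then show ?thesis unfolding rad_def bdigit_shifted_point[OF assms] by (simp add: power_add)
  qed
  then have "wal k (shifted_point s m P q \<Delta> n j) = (\<Prod>i | bit k i. (-1) ^ interlace_digit m P q n j i) * wal k (\<Delta> j)"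
    unfolding wal_eq_prod by (simp add: prod.distrib)
  also have "(\<Prod>i | bit k i. (-1) ^ interlace_digit m P q n j i :: real)
     = lattice_wal m P (even_bits k) (nat_poly n * q (2 * j - 1)) * lattice_wal m P (odd_bits k) (nat_poly n * q (2 * j))"
  proof -
    have "interlace_digit m P q n j (2 * r) = lattice_digit m P (nat_poly n * q (2 * j - 1)) r"
      "interlace_digit m P q n j (2 * r + 1) = lattice_digit m P (nat_poly n * q (2 * j)) r" for r
      unfolding interlace_digit_def by simp_all
    then show ?thesis by (subst prod_even_odd) (simp only: prod_lattice_digit)
  qed
  finally show ?thesis .
qed

lemma prod_pairs:
  fixes f :: "nat \<Rightarrow> 'a::comm_monoid_mult"
  shows "(\<Prod>j\<in>{1..2 * s}. f j) = (\<Prod>j\<in>{1..s}. f (2 * j - 1) * f (2 * j))"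
  by (induction s) (simp_all add: mult_ac)

text \<open>The polynomial tested in \<open>dual_net\<close>, summed over all 2 * s components. A
  zero index contributes nothing, so one polynomial serves every index set.\<close>

definition lattice_sum :: "nat \<Rightarrow> nat \<Rightarrow> (nat \<Rightarrow> bit poly) \<Rightarrow> (nat \<Rightarrow> nat) \<Rightarrow> bit poly"
  where "lattice_sum s m q l = (\<Sum>j\<in>{1..2 * s}. nat_poly (take_bit m (l j)) * q j)"

lemma prod_wal_shifted_point:
  assumes "\<Delta> \<in> {1..s} \<rightarrow>\<^sub>E {0..<1}"
  shows "(\<Prod>j\<in>{1..s}. wal (k j) (shifted_point s m P q \<Delta> n j))
    = bit_sign (res P (nat_poly n * lattice_sum s m q (deinterlace k))) * (\<Prod>j\<in>{1..s}. wal (k j) (\<Delta> j))"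
proof -
  have "bit_sign (res P (nat_poly n * lattice_sum s m q (deinterlace k)))
    = (\<Prod>j\<in>{1..2 * s}. lattice_wal m P (deinterlace k j) (nat_poly n * q j))"
    unfolding lattice_sum_def lattice_wal_def bit_sign_sum[symmetric] res_sum[symmetric] sum_distrib_left by (simp add: mult_ac)
  also have "\<dots> = (\<Prod>j\<in>{1..s}. lattice_wal m P (even_bits (k j)) (nat_poly n * q (2 * j - 1)) * lattice_wal m P (odd_bits (k j)) (nat_poly n * q (2 * j)))"
    unfolding prod_pairs by (intro prod.cong) (auto simp: deinterlace_def)
  finally show ?thesis
    unfolding prod.distrib[symmetric] by (simp add: wal_shifted_point[OF assms] mult_ac prod.distrib[symmetric])
qed

text \<open>Off the dual net the sum over n factors into 1 plus a sign for each binary digit of n,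
  and nondegeneracy of the residue supplies a digit with sign -1. The shift leaves a common sign,
  which the absolute value removes.\<close>

lemma sum_wal_shifted_point:
  assumes "\<Delta> \<in> {1..s} \<rightarrow>\<^sub>E {0..<1}" "1 \<le> m" "degree P = m"
  shows "\<bar>\<Sum>n<2 ^ m. \<Prod>j\<in>{1..s}. wal (k j) (shifted_point s m P q \<Delta> n j)\<bar>
    \<le> (if P dvd lattice_sum s m q (deinterlace k) then 2 ^ m else 0)"
proof (cases "P dvd lattice_sum s m q (deinterlace k)")
  case True
  have "\<bar>\<Sum>n<2 ^ m. \<Prod>j\<in>{1..s}. wal (k j) (shifted_point s m P q \<Delta> n j)\<bar>
    \<le> (\<Sum>n<(2::nat) ^ m. \<bar>\<Prod>j\<in>{1..s}. wal (k j) (shifted_point s m P q \<Delta> n j)\<bar>)" by (rule sum_abs)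
  then show ?thesis using True by (simp add: abs_prod)
next
  case False
  let ?R = "lattice_sum s m q (deinterlace k)"
  have P0: "P \<noteq> 0" using assms by auto
  obtain i where i: "i < m" "res P (monom 1 i * ?R) \<noteq> 0"
    using res_nondegenerate[OF P0] False assms(3) by blast
  have "bit_sign (res P (nat_poly n * ?R)) = (\<Prod>r | bit n r. bit_sign (res P (monom 1 r * ?R)))" for n
    unfolding nat_poly_def sum_distrib_right res_sum bit_sign_sum ..
  then have "(\<Sum>n<(2::nat) ^ m. bit_sign (res P (nat_poly n * ?R))) = (\<Prod>r<m. 1 + bit_sign (res P (monom 1 r * ?R)))"
    by (simp add: sum_prod_bits)
  also have "\<dots> = 0" using i by (intro prod_zero) (auto simp: bit_sign_def)
  finally show ?thesis using False
    unfolding prod_wal_shifted_point[OF assms(1)] sum_distrib_right[symmetric] by simp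
qed

section \<open>Subadditivity of powers with exponent at most 1\<close>

lemma powr_add_le:
  fixes x y l :: real
  assumes "0 \<le> x" "0 \<le> y" "0 < l" "l \<le> 1"
  shows "(x + y) powr l \<le> x powr l + y powr l"
proof (cases "x + y = 0")
  case True
  then show ?thesis using assms by (simp add: add_nonneg_eq_0_iff)
next
  case False
  then have pos: "0 < x + y" using assms by simp
  have le: "t \<le> t powr l" if "0 \<le> t" "t \<le> 1" for t :: real
    using powr_mono'[of l 1 t] that assms by auto
  \<comment> \<open>After division by x + y it suffices that t is at most t^l on the unit
    interval.\<close>
  have "1 = x / (x + y) + y / (x + y)" using False by (simp add: add_divide_distrib[symmetric])
  also have "\<dots> \<le> (x / (x + y)) powr l + (y / (x + y)) powr l"
    using pos assms by (intro add_mono le) auto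
  also have "\<dots> = (x powr l + y powr l) / (x + y) powr l"
    using pos assms by (simp add: powr_divide add_divide_distrib)
  finally show ?thesis using pos by (simp add: field_simps)
qed

lemma powr_sum_le:
  fixes f :: "'a \<Rightarrow> real"
  assumes "finite A" "\<And>x. x \<in> A \<Longrightarrow> 0 \<le> f x" "0 < l" "l \<le> 1"
  shows "(sum f A) powr l \<le> (\<Sum>x\<in>A. f x powr l)"
  using assms(1,2)
proof (induction A)
  case (insert x F)
  have "(f x + sum f F) powr l \<le> f x powr l + (sum f F) powr l"
    using insert assms by (intro powr_add_le sum_nonneg) auto
  then show ?case using insert by simp
qed (use assms in simp)

lemma powr_infsum_le:
  fixes f :: "'a \<Rightarrow> real"
  assumes nn: "\<And>x. x \<in> A \<Longrightarrow> 0 \<le> f x" and l: "0 < l" "l \<le> 1"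
    and s: "f summable_on A" "(\<lambda>x. f x powr l) summable_on A"
  shows "(infsum f A) powr l \<le> infsum (\<lambda>x. f x powr l) A"
proof -
  let ?U = "infsum (\<lambda>x. f x powr l) A"
  have U0: "0 \<le> ?U" by (rule infsum_nonneg) auto
  have "sum f F \<le> ?U powr (1 / l)" if F: "finite F" "F \<subseteq> A" for F
  proof -
    have "(sum f F) powr l \<le> (\<Sum>x\<in>F. f x powr l)" using powr_sum_le[OF F(1) _ l] nn F by blast
    also have "\<dots> \<le> ?U" by (rule finite_sum_le_infsum) (use s F in auto)
    finally have "((sum f F) powr l) powr (1 / l) \<le> ?U powr (1 / l)"
      using l by (intro powr_mono2) auto
    moreover have "0 \<le> sum f F" using nn F by (intro sum_nonneg) auto
    ultimately show ?thesis using l by (simp add: powr_powr)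
  qed
  then have "infsum f A \<le> ?U powr (1 / l)" by (intro infsum_le_finite_sums[OF s(1)]) auto
  moreover have "0 \<le> infsum f A" using nn by (rule infsum_nonneg)
  ultimately have "(infsum f A) powr l \<le> (?U powr (1 / l)) powr l" using l by (intro powr_mono2) auto
  then show ?thesis using l U0 by (simp add: powr_powr)
qed

lemma summable_on_sum_and_infsum_sum:
  fixes f :: "'i \<Rightarrow> 'a \<Rightarrow> real"
  assumes "finite I" "\<And>i. i \<in> I \<Longrightarrow> f i summable_on A"
  shows "(\<lambda>x. \<Sum>i\<in>I. f i x) summable_on A \<and> infsum (\<lambda>x. \<Sum>i\<in>I. f i x) A = (\<Sum>i\<in>I. infsum (f i) A)"
  using assms by (induction I) (auto simp: infsum_add summable_on_add)

subsection \<open>Generating polynomials\<close>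

lemma finite_gen_polys: "finite (gen_polys m)"
proof -
  have "inj_on (\<lambda>p::bit poly. {i. coeff p i \<noteq> 0}) (gen_polys m)"
  proof (rule inj_onI)
    fix p p' :: "bit poly" assume eq: "{i. coeff p i \<noteq> 0} = {i. coeff p' i \<noteq> 0}"
    have "coeff p i = coeff p' i" for i
    proof -
      have "coeff p i \<noteq> 0 \<longleftrightarrow> coeff p' i \<noteq> 0" using eq by blast
      then show ?thesis by (cases "coeff p i"; cases "coeff p' i") auto
    qed
    then show "p = p'" by (intro poly_eqI) simp
  qed
  moreover have "{i. coeff p i \<noteq> 0} \<subseteq> {..<m}" if "p \<in> gen_polys m" for p
  proof
    fix i assume "i \<in> {i. coeff p i \<noteq> 0}"
    then show "i \<in> {..<m}" using le_degree[of p i] that unfolding gen_polys_def by (simp del: bit_not_zero_iff)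
  qed
  then have "(\<lambda>p::bit poly. {i. coeff p i \<noteq> 0}) ` gen_polys m \<subseteq> Pow {..<m}" by blast
  ultimately show ?thesis by (rule inj_on_finite) simp
qed

lemma nat_poly_eq_0_iff: "nat_poly n = 0 \<longleftrightarrow> n = 0"
proof -
  have "nat_poly 0 = 0" unfolding nat_poly_def by (simp add: bot_fun_def)
  then show ?thesis using nat_poly_inj by metis
qed

text \<open>The nonzero n < 2^m give 2^m - 1 members; the missing zero polynomial costs at most the
  factor 2.\<close>

lemma card_gen_polys:
  assumes "1 \<le> m" shows "2 ^ m \<le> 2 * card (gen_polys m)"
proof -
  have "nat_poly ` {1..<2 ^ m} \<subseteq> gen_polys m"
    using degree_nat_poly_less[OF assms] unfolding gen_polys_def by (auto simp: nat_poly_eq_0_iff)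
  then have "card (nat_poly ` {1..<2 ^ m}) \<le> card (gen_polys m)"
    by (rule card_mono[OF finite_gen_polys])
  moreover have "card (nat_poly ` {1..<2 ^ m}) = 2 ^ m - 1"
    by (subst card_image) (auto simp: inj_on_def nat_poly_inj)
  moreover have "(2::nat) \<le> 2 ^ m" using assms by (metis power_increasing power_one_right one_le_numeral)
  ultimately show ?thesis by linarith
qed

lemma one_in_gen_polys: "1 \<le> m \<Longrightarrow> 1 \<in> gen_polys m"
  unfolding gen_polys_def by auto

lemma nat_poly_take_bit_dvd:
  assumes "1 \<le> m" "degree P = m" "P dvd nat_poly (take_bit m k)"
  shows "2 ^ m dvd k"
proof -
  have "degree (nat_poly (take_bit m k)) < degree P"
    using degree_nat_poly_less[OF assms(1), of "take_bit m k"] assms(2) by (simp add: take_bit_nat_less_exp)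
  then have "nat_poly (take_bit m k) = 0" using assms(3) by (meson dvd_imp_degree_le not_le)
  then show ?thesis by (simp add: nat_poly_eq_0_iff take_bit_eq_0_iff)
qed

text \<open>The truncated index polynomial is not divisible by the prime P, so P divides the
  difference of two solutions. This difference has degree below m and must vanish.\<close>

lemma card_solutions_le_1:
  assumes "1 \<le> m" "degree P = m" "irreducible P" "\<not> 2 ^ m dvd k"
  shows "card {p \<in> gen_polys m. P dvd R + nat_poly (take_bit m k) * p} \<le> 1"
proof -
  let ?t = "nat_poly (take_bit m k)"
  have "p = p'" if p: "p \<in> gen_polys m" "P dvd R + ?t * p" "p' \<in> gen_polys m" "P dvd R + ?t * p'" for p p'
  proof -
    have "(R + ?t * p) - (R + ?t * p') = ?t * (p - p')" by (simp add: algebra_simps)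
    then have "P dvd ?t * (p - p')" using p by (metis dvd_diff)
    moreover have "\<not> P dvd ?t" using nat_poly_take_bit_dvd assms by blast
    ultimately have "P dvd p - p'"
      using field_poly_irreducible_imp_prime[OF assms(3)] by (simp add: prime_elem_dvd_mult_iff)
    moreover have "degree (p - p') < degree P"
      using p assms unfolding gen_polys_def by (intro degree_diff_less) auto
    ultimately have "p - p' = 0" by (meson dvd_imp_degree_le not_le)
    then show ?thesis by simp
  qed
  then show ?thesis using finite_gen_polys by (subst card_le_Suc0_iff_eq[unfolded One_nat_def[symmetric]]) auto
qed

subsection \<open>The component-by-component construction\<close>

lemma dual_net_cong:
  assumes "\<And>j. j \<in> v \<Longrightarrow> q j = q' j" shows "dual_net m P v q = dual_net m P v q'"
  unfolding dual_net_def using assms by (metis (no_types, lifting) sum.cong)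

lemma criterion_cong:
  assumes "\<And>j. j \<in> {1..d} \<Longrightarrow> q j = q' j" shows "criterion \<gamma> C1 \<beta> m P d q = criterion \<gamma> C1 \<beta> m P d q'"
proof -
  have "dual_net m P v q = dual_net m P v q'" if "v \<subseteq> {1..d}" for v
    using that assms by (intro dual_net_cong) auto
  then show ?thesis unfolding criterion_def by (intro sum.cong) auto
qed

lemma exists_cbc_vector:
  assumes "1 \<le> m" shows "\<exists>q. cbc_vector \<gamma> C1 \<beta> s m P q"
proof -
  have "\<exists>q. q 1 = 1 \<and> (\<forall>d\<in>{2..D}. q d \<in> gen_polys m \<and>
       (\<forall>p\<in>gen_polys m. criterion \<gamma> C1 \<beta> m P d q \<le> criterion \<gamma> C1 \<beta> m P d (q(d := p))))" if "1 \<le> D" for D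
    using that
  proof (induction D rule: dec_induct)
    case base
    then show ?case by (intro exI[of _ "\<lambda>_. 1"]) auto
  next
    case (step D)
    then obtain q where q: "q 1 = 1" "\<forall>d\<in>{2..D}. q d \<in> gen_polys m \<and>
       (\<forall>p\<in>gen_polys m. criterion \<gamma> C1 \<beta> m P d q \<le> criterion \<gamma> C1 \<beta> m P d (q(d := p)))" by blast
    let ?f = "\<lambda>p. criterion \<gamma> C1 \<beta> m P (Suc D) (q(Suc D := p))"
    obtain p0 where p0: "p0 \<in> gen_polys m" "\<And>p. p \<in> gen_polys m \<Longrightarrow> ?f p0 \<le> ?f p"
      using arg_min_if_finite[OF finite_gen_polys, of m ?f] one_in_gen_polys[OF assms] by (metis empty_iff not_le)
    \<comment> \<open>The criterion at level d reads only the first d components, so extending the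
      vector preserves the earlier minimality.\<close>
    have eq: "criterion \<gamma> C1 \<beta> m P d (q(Suc D := p0)) = criterion \<gamma> C1 \<beta> m P d q"
      "criterion \<gamma> C1 \<beta> m P d ((q(Suc D := p0))(d := p)) = criterion \<gamma> C1 \<beta> m P d (q(d := p))" if "d \<le> D" for d p
      using that by (auto intro!: criterion_cong)
    show ?case
    proof (intro exI[of _ "q(Suc D := p0)"] conjI ballI)
      show "(q(Suc D := p0)) 1 = 1" using q step by auto
      fix d assume d: "d \<in> {2..Suc D}"
      show "(q(Suc D := p0)) d \<in> gen_polys m" using d q p0 by auto
      fix p assume p: "p \<in> gen_polys m"
      show "criterion \<gamma> C1 \<beta> m P d (q(Suc D := p0)) \<le> criterion \<gamma> C1 \<beta> m P d ((q(Suc D := p0))(d := p))"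
      proof (cases "d = Suc D")
        case True
        then show ?thesis using p0(2)[OF p] by simp
      next
        case False
        then have "d \<le> D" "d \<in> {2..D}" using d by auto
        then show ?thesis using q(2) p eq by auto
      qed
    qed
  qed
  \<comment> \<open>The length 2 * s + 1 is at least 1 also for s = 0.\<close>
  from this[of "2 * s + 1"] obtain q where "q 1 = 1" "\<forall>d\<in>{2..2 * s + 1}. q d \<in> gen_polys m \<and>
       (\<forall>p\<in>gen_polys m. criterion \<gamma> C1 \<beta> m P d q \<le> criterion \<gamma> C1 \<beta> m P d (q(d := p)))" by auto
  then show ?thesis unfolding cbc_vector_def by (intro exI[of _ q]) auto
qed

subsection \<open>The bound for the criterion\<close>

definition walsh_weight :: "real \<Rightarrow> nat \<Rightarrow> real"
  where "walsh_weight a k = 2 powr (- a * real_of_int \<lfloor>log 2 (real k)\<rfloor>)"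

lemma walsh_weight_pos: "0 < walsh_weight a k" unfolding walsh_weight_def by simp

lemma walsh_weight_powr: "walsh_weight a k powr l = walsh_weight (a * l) k"
  unfolding walsh_weight_def by (simp add: powr_powr mult_ac)

lemma prod_walsh_weight:
  "2 powr (- a * real_of_int (\<Sum>j\<in>v. \<lfloor>log 2 (real (k j))\<rfloor>)) = (\<Prod>j\<in>v. walsh_weight a (k j))"
  unfolding walsh_weight_def by (simp add: powr_sum[symmetric] sum_distrib_left)

lemma walsh_weight_shift:
  assumes "1 \<le> k" shows "walsh_weight a (2 ^ m * k) = 2 powr (- a * m) * walsh_weight a k"
proof -
  have "log 2 (real (2 ^ m * k)) = log 2 (real k) + real_of_int (int m)"
    using assms by (simp add: log_mult log_nat_power)
  then have "\<lfloor>log 2 (real (2 ^ m * k))\<rfloor> = \<lfloor>log 2 (real k)\<rfloor> + int m"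
    by (simp only: floor_add_int)
  then show ?thesis unfolding walsh_weight_def by (simp add: powr_add[symmetric] algebra_simps)
qed

text \<open>Rounding the logarithm down costs at most the factor 2^a, after which the series is that
  of k^-a.\<close>

lemma walsh_weight_summable:
  assumes "1 < a" shows "walsh_weight a summable_on {1..}"
proof -
  have "walsh_weight a k \<le> 2 powr a * real k powr (- a)" if "1 \<le> k" for k
  proof -
    have "- a * real_of_int \<lfloor>log 2 (real k)\<rfloor> \<le> - a * (log 2 (real k) - 1)"
      using assms by (intro mult_left_mono_neg) linarith+
    then have "walsh_weight a k \<le> 2 powr (a + - a * log 2 (real k))"
      unfolding walsh_weight_def by (intro powr_mono) (auto simp: algebra_simps)
    also have "\<dots> = 2 powr a * (2 powr (log 2 (real k))) powr (- a)" unfolding powr_add powr_powr by (simp add: mult.commute)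
    finally show ?thesis using that by simp
  qed
  then have le: "norm (norm (if 1 \<le> k then walsh_weight a k else 0)) \<le> 2 powr a * real k powr (- a)" for k
    using less_imp_le[OF walsh_weight_pos[of a k]] by (cases "1 \<le> k") simp_all
  have sm: "summable (\<lambda>k. 2 powr a * real k powr (- a))"
    using assms by (intro summable_mult) (simp add: summable_real_powr_iff)
  have "summable (\<lambda>k. norm (if 1 \<le> k then walsh_weight a k else 0))"
    by (rule summable_comparison_test[OF _ sm]) (rule exI[of _ 0], use le in blast)
  then have "(\<lambda>k. if 1 \<le> k then walsh_weight a k else 0) summable_on UNIV"
    by (rule norm_summable_imp_summable_on)
  then have "(\<lambda>k. if 1 \<le> k then walsh_weight a k else 0) summable_on {1..}"
    by (rule summable_on_subset_banach) simp
  then show ?thesis by (rule summable_on_cong[THEN iffD1, rotated]) auto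
qed

definition walsh_weight_sum :: "real \<Rightarrow> real"
  where "walsh_weight_sum a = infsum (walsh_weight a) {1..}"

lemma walsh_weight_sum_nonneg: "0 \<le> walsh_weight_sum a"
  unfolding walsh_weight_sum_def by (rule infsum_nonneg) (simp add: less_imp_le[OF walsh_weight_pos])

lemma walsh_weight_multiples_summable:
  assumes "1 < a"
  shows "(\<lambda>k. if 2 ^ m dvd k then walsh_weight a k else 0) summable_on {1..}"
  by (rule summable_on_comparison_test[OF walsh_weight_summable[OF assms]])
    (simp_all add: less_imp_le[OF walsh_weight_pos])

text \<open>These are the indices whose truncation vanishes, so that the choice of the generating
  polynomial has no influence on them. The factor 2^-m has to come from their small weights
  instead.\<close>

lemma infsum_walsh_weight_multiples:
  assumes "1 < a"
  shows "infsum (\<lambda>k. if 2 ^ m dvd k then walsh_weight a k else 0) {1..} \<le> walsh_weight_sum a / 2 ^ m"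
proof -
  have bij: "inj_on (\<lambda>k. 2 ^ m * k) {1::nat..}" by (auto simp: inj_on_def)
  have "infsum (\<lambda>k. if 2 ^ m dvd k then walsh_weight a k else 0) {1..} = infsum (walsh_weight a) ((\<lambda>k. 2 ^ m * k) ` {1..})"
  proof (rule infsum_cong_neutral)
    fix x assume "x \<in> {1..} - (\<lambda>k. 2 ^ m * k) ` {1::nat..}"
    then show "(if 2 ^ m dvd x then walsh_weight a x else 0) = 0" by (auto elim!: dvdE simp: image_iff)
  qed (auto simp: image_iff)
  also have "\<dots> = infsum (\<lambda>k. 2 powr (- a * m) * walsh_weight a k) {1..}"
    unfolding infsum_reindex[OF bij] o_def by (intro infsum_cong walsh_weight_shift) simp
  also have "\<dots> = 2 powr (- a * m) * walsh_weight_sum a"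
    unfolding walsh_weight_sum_def by (rule infsum_cmult_right')
  also have "\<dots> \<le> 2 powr (- real m) * walsh_weight_sum a"
    using assms walsh_weight_sum_nonneg by (intro mult_right_mono powr_mono) (auto simp: mult_le_cancel_right1)
  finally show ?thesis by (simp add: powr_minus powr_realpow divide_simps mult_ac)
qed

lemma prod_summable_PiE:
  fixes f :: "'i \<Rightarrow> nat \<Rightarrow> real"
  assumes "finite v" "\<And>j k. j \<in> v \<Longrightarrow> 1 \<le> k \<Longrightarrow> 0 \<le> f j k" "\<And>j. j \<in> v \<Longrightarrow> f j summable_on {1..}"
  shows "(\<lambda>k. \<Prod>j\<in>v. f j (k j)) summable_on (v \<rightarrow>\<^sub>E {1..})"
    and "infsum (\<lambda>k. \<Prod>j\<in>v. f j (k j)) (v \<rightarrow>\<^sub>E {1..}) = (\<Prod>j\<in>v. infsum (f j) {1..})"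
proof -
  have abs: "Infinite_Sum.abs_summable_on (f j) {1..}" if "j \<in> v" for j
    using assms(3)[OF that] by (rule summable_on_cong[THEN iffD1, rotated]) (use assms(2)[OF that] in auto)
  have "Infinite_Sum.abs_summable_on (\<lambda>k. \<Prod>j\<in>v. f j (k j)) (v \<rightarrow>\<^sub>E {1..})"
    unfolding abs_summable_equivalent
    by (intro abs_summable_on_prod_PiE assms abs[unfolded abs_summable_equivalent]) auto
  then show "(\<lambda>k. \<Prod>j\<in>v. f j (k j)) summable_on (v \<rightarrow>\<^sub>E {1..})" by (rule abs_summable_summable)
  show "infsum (\<lambda>k. \<Prod>j\<in>v. f j (k j)) (v \<rightarrow>\<^sub>E {1..}) = (\<Prod>j\<in>v. infsum (f j) {1..})"
    by (rule infsum_prod_PiE_abs) (use assms abs in auto)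
qed

lemma walsh_weight_prod_summable:
  assumes "1 < a" "finite v" "A \<subseteq> v \<rightarrow>\<^sub>E {1..}"
  shows "(\<lambda>k. \<Prod>j\<in>v. walsh_weight a (k j)) summable_on A"
  by (rule summable_on_subset_banach[OF prod_summable_PiE(1) assms(3)])
    (use assms walsh_weight_summable less_imp_le[OF walsh_weight_pos] in auto)

definition dual_sum :: "real \<Rightarrow> nat \<Rightarrow> bit poly \<Rightarrow> nat set \<Rightarrow> (nat \<Rightarrow> bit poly) \<Rightarrow> real"
  where "dual_sum a m P v q = infsum (\<lambda>k. \<Prod>j\<in>v. walsh_weight a (k j)) (dual_net m P v q)"

lemma dual_net_subset: "dual_net m P v q \<subseteq> v \<rightarrow>\<^sub>E {1..}" unfolding dual_net_def by auto

lemma dual_sum_nonneg: "0 \<le> dual_sum a m P v q"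
  unfolding dual_sum_def by (intro infsum_nonneg prod_nonneg) (simp add: less_imp_le[OF walsh_weight_pos])

lemma criterion_eq:
  "criterion \<gamma> C1 \<beta> m P d q =
    (\<Sum>v | v \<noteq> {} \<and> v \<subseteq> {1..d}. \<gamma> (u_of v) * (C1 * 2 powr (2 + \<beta>)) ^ card (u_of v) * dual_sum (1 + \<beta>) m P v q)"
  unfolding criterion_def dual_sum_def prod_walsh_weight ..

lemma dual_sum_powr_le:
  assumes "1 < a" "1 < a * l" "0 < l" "l \<le> 1" "finite v"
  shows "dual_sum a m P v q powr l \<le> dual_sum (a * l) m P v q"
proof -
  have eq: "(\<Prod>j\<in>v. walsh_weight a (k j)) powr l = (\<Prod>j\<in>v. walsh_weight (a * l) (k j))" for k
    unfolding walsh_weight_powr[symmetric] by (rule prod_powr_distrib)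
  show ?thesis unfolding dual_sum_def
    by (rule order_trans[OF powr_infsum_le])
      (auto simp: eq assms intro!: walsh_weight_prod_summable[OF _ _ dual_net_subset] prod_nonneg less_imp_le[OF walsh_weight_pos])
qed

text \<open>The averaging argument. For a fixed k, either k d is not a multiple of 2^m and at most
  one p puts k into the dual net, or all p may do so, but such k carry at most the fraction 2^-m of
  the total weight. The factor 3 consists of 2 from \<open>card_gen_polys\<close> for the first case
  and 1 for the second.\<close>

lemma sum_dual_sum_le:
  assumes a: "1 < a" and m: "1 \<le> m" and P: "degree P = m" "irreducible P" and v: "finite v" "d \<in> v"
  shows "(\<Sum>p\<in>gen_polys m. dual_sum a m P v (q(d := p))) \<le> walsh_weight_sum a ^ card v * (3 * card (gen_polys m) / 2 ^ m)"
proof -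
  let ?h = "\<lambda>k. \<Prod>j\<in>v. walsh_weight a (k j)"
  let ?G = "card (gen_polys m)"
  \<comment> \<open>A majorant of product form: coordinate d alone carries the number of admissible
    p, so the sum over k still factors.\<close>
  define g where "g j k = (if j = d then walsh_weight a k + real ?G * (if 2 ^ m dvd k then walsh_weight a k else 0) else walsh_weight a k)" for j :: nat and k :: nat
  have pos: "0 \<le> walsh_weight a k" for k by (rule less_imp_le[OF walsh_weight_pos])
  have hnn: "0 \<le> ?h k" for k using pos by (intro prod_nonneg) auto
  have sm: "(\<lambda>k. if 2 ^ m dvd k then walsh_weight a k else 0) summable_on {1..}"
    by (rule walsh_weight_multiples_summable[OF a])
  have gs: "g j summable_on {1..}" for j unfolding g_def
    using walsh_weight_summable[OF a] sm by (cases "j = d") (auto intro!: summable_on_add summable_on_cmult_right)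
  have gnn: "0 \<le> g j k" for j k unfolding g_def using pos by auto
  have card_le: "(\<Sum>p\<in>gen_polys m. if k \<in> dual_net m P v (q(d := p)) then ?h k else 0) \<le> (\<Prod>j\<in>v. g j (k j))"
    if k: "k \<in> v \<rightarrow>\<^sub>E {1..}" for k
  proof -
    define R where "R = (\<Sum>j\<in>v - {d}. nat_poly (take_bit m (k j)) * q j)"
    have iff: "k \<in> dual_net m P v (q(d := p)) \<longleftrightarrow> P dvd R + nat_poly (take_bit m (k d)) * p" for p
    proof -
      have "(\<Sum>j\<in>v. nat_poly (take_bit m (k j)) * (q(d := p)) j) = R + nat_poly (take_bit m (k d)) * p"
        unfolding R_def using v by (subst sum.remove[of _ d]) (auto intro!: sum.cong simp: add.commute)
      then show ?thesis using k unfolding dual_net_def by simp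
    qed
    have "(\<Sum>p\<in>gen_polys m. if k \<in> dual_net m P v (q(d := p)) then ?h k else 0)
      = card {p \<in> gen_polys m. P dvd R + nat_poly (take_bit m (k d)) * p} * ?h k"
      unfolding iff by (subst sum.inter_filter[symmetric]) (simp_all add: finite_gen_polys)
    also have "\<dots> \<le> (1 + real ?G * (if 2 ^ m dvd k d then 1 else 0)) * ?h k"
    proof (rule mult_right_mono[OF _ hnn])
      show "real (card {p \<in> gen_polys m. P dvd R + nat_poly (take_bit m (k d)) * p}) \<le> 1 + real ?G * (if 2 ^ m dvd k d then 1 else 0)"
      proof (cases "2 ^ m dvd k d")
        case True
        have "card {p \<in> gen_polys m. P dvd R + nat_poly (take_bit m (k d)) * p} \<le> ?G"
          by (intro card_mono finite_gen_polys) auto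
        then show ?thesis using True by simp
      next
        case False
        then show ?thesis using card_solutions_le_1[OF m P False, of R] by simp
      qed
    qed
    also have "\<dots> = g d (k d) * (\<Prod>j\<in>v - {d}. walsh_weight a (k j))"
      using v by (subst prod.remove[of _ d]) (auto simp: g_def algebra_simps)
    also have "(\<Prod>j\<in>v - {d}. walsh_weight a (k j)) = (\<Prod>j\<in>v - {d}. g j (k j))"
      by (rule prod.cong) (auto simp: g_def)
    also have "g d (k d) * (\<Prod>j\<in>v - {d}. g j (k j)) = (\<Prod>j\<in>v. g j (k j))"
      using v by (subst prod.remove[of v d]) auto
    finally show ?thesis .
  qed
  have ext: "(\<lambda>k. if k \<in> dual_net m P v (q(d := p)) then ?h k else 0) summable_on (v \<rightarrow>\<^sub>E {1..})" for p
    by (rule summable_on_comparison_test[OF walsh_weight_prod_summable[OF a v(1) order_refl]]) (auto simp: hnn)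
  have "dual_sum a m P v (q(d := p)) = infsum (\<lambda>k. if k \<in> dual_net m P v (q(d := p)) then ?h k else 0) (v \<rightarrow>\<^sub>E {1..})" for p
    unfolding dual_sum_def
    by (rule infsum_cong_neutral) (use dual_net_subset[of m P v "q(d := p)"] in auto)
  then have "(\<Sum>p\<in>gen_polys m. dual_sum a m P v (q(d := p)))
    = infsum (\<lambda>k. \<Sum>p\<in>gen_polys m. if k \<in> dual_net m P v (q(d := p)) then ?h k else 0) (v \<rightarrow>\<^sub>E {1..})"
    using summable_on_sum_and_infsum_sum[OF finite_gen_polys ext] by simp
  also have "\<dots> \<le> infsum (\<lambda>k. \<Prod>j\<in>v. g j (k j)) (v \<rightarrow>\<^sub>E {1..})"
    by (intro infsum_mono card_le prod_summable_PiE(1) v gnn gs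
        summable_on_sum_and_infsum_sum[OF finite_gen_polys ext, THEN conjunct1])
  also have "\<dots> = (\<Prod>j\<in>v. infsum (g j) {1..})" by (intro prod_summable_PiE(2) v gnn gs)
  also have "\<dots> = infsum (g d) {1..} * (\<Prod>j\<in>v - {d}. infsum (g j) {1..})" using v by (simp add: prod.remove)
  also have "(\<Prod>j\<in>v - {d}. infsum (g j) {1..}) = walsh_weight_sum a ^ (card v - 1)"
  proof -
    have "g j = walsh_weight a" if "j \<in> v - {d}" for j using that by (auto simp: g_def fun_eq_iff)
    then have "(\<Prod>j\<in>v - {d}. infsum (g j) {1..}) = (\<Prod>j\<in>v - {d}. walsh_weight_sum a)"
      by (intro prod.cong) (simp_all add: walsh_weight_sum_def)
    then show ?thesis using v by simp
  qed
  also have "infsum (g d) {1..} \<le> walsh_weight_sum a * (3 * ?G / 2 ^ m)"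
  proof -
    have "infsum (g d) {1..} = walsh_weight_sum a + real ?G * infsum (\<lambda>k. if 2 ^ m dvd k then walsh_weight a k else 0) {1..}"
      unfolding g_def walsh_weight_sum_def using walsh_weight_summable[OF a] sm
      by (simp add: infsum_add infsum_cmult_right' summable_on_cmult_right)
    also have "\<dots> \<le> walsh_weight_sum a + real ?G * (walsh_weight_sum a / 2 ^ m)"
      using infsum_walsh_weight_multiples[OF a, of m] by (intro add_left_mono mult_left_mono) auto
    also have "\<dots> \<le> walsh_weight_sum a * (2 * ?G / 2 ^ m) + real ?G * (walsh_weight_sum a / 2 ^ m)"
    proof -
      have "real (2 ^ m) \<le> real (2 * ?G)" using card_gen_polys[OF m] by (rule of_nat_mono)
      then have "1 \<le> 2 * real ?G / 2 ^ m" by simp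
      then have "walsh_weight_sum a * 1 \<le> walsh_weight_sum a * (2 * real ?G / 2 ^ m)"
        using walsh_weight_sum_nonneg by (intro mult_left_mono) auto
      then show ?thesis by (simp only: mult_1_right add_le_cancel_right)
    qed
    also have "\<dots> = walsh_weight_sum a * (3 * ?G / 2 ^ m)" by (simp add: field_simps)
    finally show ?thesis .
  qed
  then have "infsum (g d) {1..} * walsh_weight_sum a ^ (card v - 1) \<le> walsh_weight_sum a * (3 * ?G / 2 ^ m) * walsh_weight_sum a ^ (card v - 1)"
    using walsh_weight_sum_nonneg by (intro mult_right_mono) auto
  also have "\<dots> = walsh_weight_sum a ^ card v * (3 * ?G / 2 ^ m)"
    using v by (cases "card v") (auto simp: mult_ac)
  finally show ?thesis .
qed

definition criterion_weight :: "(nat set \<Rightarrow> real) \<Rightarrow> real \<Rightarrow> real \<Rightarrow> nat set \<Rightarrow> real"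
  where "criterion_weight \<gamma> C1 \<beta> v = \<gamma> (u_of v) * (C1 * 2 powr (2 + \<beta>)) ^ card (u_of v)"

lemma u_of_subset: "v \<subseteq> {1..2 * s} \<Longrightarrow> u_of v \<subseteq> {1..s}"
  unfolding u_of_def by (auto simp: ceiling_le_iff le_nat_iff nat_le_iff le_ceiling_iff)

text \<open>The chosen component is at least as good as every p, so the l-th power of the criterion
  is bounded by the average over p of what p would give. Subadditivity splits off the sets v that
  contain the new index, and \<open>sum_dual_sum_le\<close> applies to them with the exponent (1 +
  \<beta>) * l > 1, which brings in the factor 3.\<close>

lemma cbc_criterion_bound:
  assumes \<gamma>: "\<And>u. u \<subseteq> {1..s} \<Longrightarrow> 0 < \<gamma> u" and C1: "0 < C1"
    and l: "1 < (1 + \<beta>) * l" "0 < l" "l \<le> 1"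
    and m: "1 \<le> m" and P: "degree P = m" "irreducible P"
    and q: "cbc_vector \<gamma> C1 \<beta> s m P q" and d: "1 \<le> d" "d \<le> 2 * s"
  shows "criterion \<gamma> C1 \<beta> m P d q powr l \<le>
    (\<Sum>v\<in>Pow {1..d}. 3 * criterion_weight \<gamma> C1 \<beta> v powr l * walsh_weight_sum ((1 + \<beta>) * l) ^ card v) / 2 ^ m"
  using d
proof (induction d rule: dec_induct)
  define a where "a = 1 + \<beta>"
  \<comment> \<open>Since l \<le> 1, the condition a * l > 1 entails a > 1, so the series in the
    criterion itself converge as well.\<close>
  have a: "1 < a * l" "1 < a" using l unfolding a_def
    by (auto, smt (verit) mult_left_le mult_minus_left mult_nonneg_nonneg)
  let ?c = "criterion_weight \<gamma> C1 \<beta>" and ?S = "walsh_weight_sum (a * l)"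
  have c: "0 < ?c v" if "v \<subseteq> {1..2 * s}" for v
    unfolding criterion_weight_def using \<gamma>[OF u_of_subset[OF that]] C1 by simp
  have crit: "criterion \<gamma> C1 \<beta> m P d q = (\<Sum>v | v \<noteq> {} \<and> v \<subseteq> {1..d}. ?c v * dual_sum a m P v q)" for d q
    unfolding criterion_eq criterion_weight_def a_def ..
  have tm: "(?c v * dual_sum a m P v q) powr l \<le> ?c v powr l * dual_sum (a * l) m P v q" if "v \<subseteq> {1..2 * s}" for v q
  proof -
    have "finite v" using that by (rule finite_subset) simp
    from dual_sum_powr_le[OF a(2,1) l(2,3) this, of m P q] show ?thesis
      using c[OF that] dual_sum_nonneg[of a m P v q] by (simp add: powr_mult mult_left_mono)
  qed
  {
    case base
    have "{v. v \<noteq> {} \<and> v \<subseteq> {1..1}} = {{1::nat}}" by auto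
    then have "criterion \<gamma> C1 \<beta> m P 1 q powr l = (?c {1} * dual_sum a m P {1} q) powr l" unfolding crit by simp
    also have "\<dots> \<le> ?c {1} powr l * dual_sum (a * l) m P {1} q" using base by (intro tm) auto
    also have "dual_sum (a * l) m P {1} q \<le> infsum (\<lambda>k. \<Prod>j\<in>{1::nat}. (if 2 ^ m dvd k j then walsh_weight (a * l) (k j) else 0)) ({1} \<rightarrow>\<^sub>E {1..})"
      unfolding dual_sum_def
    proof (rule infsum_mono_neutral)
      show "(\<lambda>k. \<Prod>j\<in>{1}. walsh_weight (a * l) (k j)) summable_on dual_net m P {1} q"
        by (rule walsh_weight_prod_summable[OF a(1) _ dual_net_subset]) simp
      show "(\<lambda>k. \<Prod>j\<in>{1::nat}. if 2 ^ m dvd k j then walsh_weight (a * l) (k j) else 0) summable_on {1} \<rightarrow>\<^sub>E {1..}"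
        by (rule prod_summable_PiE(1)[where f="\<lambda>j k. if 2 ^ m dvd k then walsh_weight (a * l) k else 0"])
          (simp_all add: walsh_weight_multiples_summable[OF a(1)] less_imp_le[OF walsh_weight_pos] del: One_nat_def)
      fix k assume "k \<in> dual_net m P {1} q \<inter> ({1} \<rightarrow>\<^sub>E {1..})"
      \<comment> \<open>With q 1 = 1 the dual condition concerns the truncated index alone and
        forces k 1 to be a multiple of 2^m.\<close>
      then have "P dvd nat_poly (take_bit m (k 1))"
        using q unfolding dual_net_def cbc_vector_def by simp
      then show "(\<Prod>j\<in>{1}. walsh_weight (a * l) (k j)) \<le> (\<Prod>j\<in>{1}. if 2 ^ m dvd k j then walsh_weight (a * l) (k j) else 0)"
        using nat_poly_take_bit_dvd[OF m P(1)] by simp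
    qed (use dual_net_subset[of m P "{1}" q] in \<open>auto simp: less_imp_le[OF walsh_weight_pos]\<close>)
    also have "\<dots> = (\<Prod>j\<in>{1::nat}. infsum (\<lambda>k. if 2 ^ m dvd k then walsh_weight (a * l) k else 0) {1..})"
      by (rule prod_summable_PiE(2)[where f="\<lambda>j k. if 2 ^ m dvd k then walsh_weight (a * l) k else 0"])
        (simp_all add: walsh_weight_multiples_summable[OF a(1)] less_imp_le[OF walsh_weight_pos] del: One_nat_def)
    also have "\<dots> \<le> ?S / 2 ^ m" using infsum_walsh_weight_multiples[OF a(1), of m] by simp
    finally have "criterion \<gamma> C1 \<beta> m P 1 q powr l \<le> ?c {1} powr l * (?S / 2 ^ m)" by (simp add: mult_left_mono)
    also have "\<dots> \<le> (3 * ?c {1} powr l * ?S) / 2 ^ m" using walsh_weight_sum_nonneg[of "a * l"] by (simp add: divide_right_mono mult_right_mono)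
    also have "\<dots> \<le> (\<Sum>v\<in>Pow {1..1}. 3 * ?c v powr l * ?S ^ card v) / 2 ^ m"
    proof (rule divide_right_mono)
      have "3 * ?c {1} powr l * ?S ^ card {1::nat} \<le> (\<Sum>v\<in>Pow {1..1}. 3 * ?c v powr l * ?S ^ card v)"
        using walsh_weight_sum_nonneg[of "a * l"] by (intro member_le_sum) auto
      then show "3 * ?c {1} powr l * ?S \<le> (\<Sum>v\<in>Pow {1..1}. 3 * ?c v powr l * ?S ^ card v)" by simp
    qed simp
    finally show ?case unfolding a_def .
  next
    case (step d)
    \<comment> \<open>The sets that contain the new component; the other terms of the criterion do
      not depend on it.\<close>
    let ?V = "{v. d + 1 \<in> v \<and> v \<subseteq> {1..Suc d}}"
    let ?G = "real (card (gen_polys m))"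
    have V: "{v. v \<noteq> {} \<and> v \<subseteq> {1..Suc d}} = {v. v \<noteq> {} \<and> v \<subseteq> {1..d}} \<union> ?V"
      "{v. v \<noteq> {} \<and> v \<subseteq> {1..d}} \<inter> ?V = {}"
      by (auto simp: subset_iff le_Suc_eq)
    have finV: "finite ?V" "finite {v. v \<noteq> {} \<and> v \<subseteq> {1..d}}"
      by (rule finite_subset[of _ "Pow {1..Suc d}"]; auto)+
    have Vs: "v \<subseteq> {1..2 * s}" "finite v" if "v \<in> ?V" for v
      using that step(4) by (auto intro: finite_subset[OF _ finite_atLeastAtMost])
    have GG: "0 < ?G" using one_in_gen_polys[OF m] finite_gen_polys[of m] by (auto simp: card_gt_0_iff)
    have bnd: "criterion \<gamma> C1 \<beta> m P (Suc d) q powr l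
      \<le> criterion \<gamma> C1 \<beta> m P d q powr l + (\<Sum>v\<in>?V. ?c v powr l * dual_sum (a * l) m P v (q(d + 1 := p)))" if p: "p \<in> gen_polys m" for p
    proof -
      let ?q = "q(d + 1 := p)"
      have nn: "0 \<le> criterion \<gamma> C1 \<beta> m P d' q'" if "d' \<le> Suc d" for d' q' unfolding crit
        using step(4) that by (intro sum_nonneg mult_nonneg_nonneg dual_sum_nonneg less_imp_le[OF c]) auto
      have "criterion \<gamma> C1 \<beta> m P (Suc d) q \<le> criterion \<gamma> C1 \<beta> m P (Suc d) ?q"
        using q p step unfolding cbc_vector_def by auto
      also have "\<dots> = criterion \<gamma> C1 \<beta> m P d ?q + (\<Sum>v\<in>?V. ?c v * dual_sum a m P v ?q)"
        unfolding crit V(1) by (rule sum.union_disjoint[OF finV(2,1) V(2)])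
      also have "criterion \<gamma> C1 \<beta> m P d ?q = criterion \<gamma> C1 \<beta> m P d q" by (rule criterion_cong) auto
      finally have cle: "criterion \<gamma> C1 \<beta> m P (Suc d) q \<le> criterion \<gamma> C1 \<beta> m P d q + (\<Sum>v\<in>?V. ?c v * dual_sum a m P v ?q)" .
      have "criterion \<gamma> C1 \<beta> m P (Suc d) q powr l
        \<le> (criterion \<gamma> C1 \<beta> m P d q + (\<Sum>v\<in>?V. ?c v * dual_sum a m P v ?q)) powr l"
        by (rule powr_mono2[OF _ _ cle]) (use nn l in auto)
      also have "\<dots> \<le> criterion \<gamma> C1 \<beta> m P d q powr l + (\<Sum>v\<in>?V. ?c v * dual_sum a m P v ?q) powr l"
        using nn l Vs by (intro powr_add_le sum_nonneg mult_nonneg_nonneg dual_sum_nonneg less_imp_le[OF c]) auto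
      also have "(\<Sum>v\<in>?V. ?c v * dual_sum a m P v ?q) powr l \<le> (\<Sum>v\<in>?V. (?c v * dual_sum a m P v ?q) powr l)"
        using l Vs finV by (intro powr_sum_le mult_nonneg_nonneg dual_sum_nonneg less_imp_le[OF c]) auto
      also have "\<dots> \<le> (\<Sum>v\<in>?V. ?c v powr l * dual_sum (a * l) m P v ?q)"
        using Vs by (intro sum_mono tm) auto
      finally show ?thesis by simp
    qed
    have avg: "(\<Sum>p\<in>gen_polys m. dual_sum (a * l) m P v (q(d + 1 := p))) \<le> ?S ^ card v * (3 * ?G / 2 ^ m)" if "v \<in> ?V" for v
      using sum_dual_sum_le[OF a(1) m P Vs(2)[OF that], of "d + 1" q] that
      by (simp only: of_nat_mult of_nat_numeral mem_Collect_eq)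
    have "?G * criterion \<gamma> C1 \<beta> m P (Suc d) q powr l = (\<Sum>p\<in>gen_polys m. criterion \<gamma> C1 \<beta> m P (Suc d) q powr l)" by simp
    also have "\<dots> \<le> (\<Sum>p\<in>gen_polys m. criterion \<gamma> C1 \<beta> m P d q powr l + (\<Sum>v\<in>?V. ?c v powr l * dual_sum (a * l) m P v (q(d + 1 := p))))"
      by (intro sum_mono bnd)
    also have "\<dots> = ?G * criterion \<gamma> C1 \<beta> m P d q powr l
      + (\<Sum>v\<in>?V. ?c v powr l * (\<Sum>p\<in>gen_polys m. dual_sum (a * l) m P v (q(d + 1 := p))))"
      by (simp only: sum.distrib sum_constant sum_distrib_left) (subst sum.swap, rule refl)
    also have "\<dots> \<le> ?G * criterion \<gamma> C1 \<beta> m P d q powr l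
      + (\<Sum>v\<in>?V. ?c v powr l * (?S ^ card v * (3 * ?G / 2 ^ m)))"
      by (intro add_left_mono sum_mono mult_left_mono avg) auto
    also have "\<dots> = ?G * (criterion \<gamma> C1 \<beta> m P d q powr l + (\<Sum>v\<in>?V. 3 * ?c v powr l * ?S ^ card v) / 2 ^ m)"
      by (simp add: sum_distrib_left sum_divide_distrib algebra_simps)
    finally have "criterion \<gamma> C1 \<beta> m P (Suc d) q powr l \<le> criterion \<gamma> C1 \<beta> m P d q powr l + (\<Sum>v\<in>?V. 3 * ?c v powr l * ?S ^ card v) / 2 ^ m"
      using GG by simp
    also have "\<dots> \<le> (\<Sum>v\<in>Pow {1..d}. 3 * ?c v powr l * ?S ^ card v) / 2 ^ m + (\<Sum>v\<in>?V. 3 * ?c v powr l * ?S ^ card v) / 2 ^ m"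
      using step unfolding a_def by (intro add_right_mono) auto
    also have "\<dots> = (\<Sum>v\<in>Pow {1..d} \<union> ?V. 3 * ?c v powr l * ?S ^ card v) / 2 ^ m"
      using finV by (subst sum.union_disjoint) (auto simp: add_divide_distrib)
    also have "Pow {1..d} \<union> ?V = Pow {1..Suc d}" by (auto simp: subset_iff le_Suc_eq)
    finally show ?case unfolding a_def .
  }
qed

subsection \<open>Sign changes and primitives of Walsh functions\<close>

text \<open>All step functions below change their sign when the digit of index \<open>a + 1\<close> flips; this
  makes their primitives vanish at the dyadic points of level \<open>a\<close>.\<close>

definition antisym_at :: "nat \<Rightarrow> (real \<Rightarrow> real) \<Rightarrow> bool"
  where "antisym_at a w \<longleftrightarrow> (\<forall>i::nat. \<forall>x. real i / 2 ^ a \<le> x \<and> x < (real i + 1 / 2) / 2 ^ a \<and> x < 1 \<longrightarrow>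
    w (x + 1 / 2 ^ Suc a) = - w x)"

text \<open>The point x lies in the left half of a dyadic cell of level a and moves to the right
  half. Coarser digits see the same cell, digit a goes from 0 to 1, and for j > a the number 2^(j +
  1) * x grows by the even integer 2^(j - a).\<close>

lemma bdigit_add_half:
  assumes "real i / 2 ^ a \<le> x" "x < (real i + 1 / 2) / 2 ^ a"
  shows "bdigit (Suc j) (x + 1 / 2 ^ Suc a) = (if j = a then 1 - bdigit (Suc j) x else bdigit (Suc j) x)"
proof -
  have x0: "0 \<le> x" using assms(1) by (meson divide_nonneg_nonneg of_nat_0_le_iff order_trans zero_le_numeral zero_le_power)
  have b: "real i \<le> 2 ^ a * x" "2 ^ a * x < real i + 1 / 2"
    using assms by (simp_all add: field_simps)
  show ?thesis
  proof (cases "j < a")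
    case True
    have ex: "2 ^ a = (2::real) ^ (a - Suc j) * 2 ^ Suc j"
      using True by (simp flip: power_add del: power_Suc)
    define N where "N = (2::nat) ^ (a - Suc j)"
    have N: "real N * (2 ^ Suc j * x) = 2 ^ a * x" unfolding N_def ex by simp
    have Nadd: "real N * (2 ^ Suc j * (x + 1 / 2 ^ Suc a)) = 2 ^ a * x + 1 / 2"
      using ex unfolding N_def by (simp add: field_simps)
    have N0: "0 < N" unfolding N_def by simp
    have fl: "\<lfloor>y\<rfloor> = int (i div N)" if "real i \<le> real N * y" "real N * y < real i + 1" for y
    proof -
      have "real (N * (i div N)) \<le> real i" by (rule of_nat_mono) simp
      then have "real N * real (i div N) \<le> real N * y" using that by simp
      then have 1: "real (i div N) \<le> y" using N0 by simp
      have "i < N * (i div N + 1)" using N0 by (metis add.commute dividend_less_times_div mult.commute mult_Suc_right plus_1_eq_Suc)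
      then have "real (i + 1) \<le> real (N * (i div N + 1))" by (intro of_nat_mono) simp
      then have "real N * y < real N * (real (i div N) + 1)" using that by (simp add: algebra_simps)
      then have "y < real (i div N) + 1" using N0 by simp
      then show ?thesis using 1 by (intro floor_unique) auto
    qed
    have "\<lfloor>2 ^ Suc j * x\<rfloor> = \<lfloor>2 ^ Suc j * (x + 1 / 2 ^ Suc a)\<rfloor>"
      using fl[of "2 ^ Suc j * x"] fl[of "2 ^ Suc j * (x + 1 / 2 ^ Suc a)"] b unfolding N Nadd by simp
    then show ?thesis using True unfolding bdigit_def by simp
  next
    case False
    then have "a \<le> j" by simp
    have ex: "(2::real) ^ Suc j = 2 ^ (j - a) * 2 ^ Suc a" using False by (simp flip: power_add)
    have sh: "2 ^ Suc j * (x + 1 / 2 ^ Suc a) = 2 ^ Suc j * x + of_int (2 ^ (j - a))"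
      unfolding distrib_left using ex by simp
    have fl: "nat \<lfloor>2 ^ Suc j * (x + 1 / 2 ^ Suc a)\<rfloor> = nat \<lfloor>2 ^ Suc j * x\<rfloor> + 2 ^ (j - a)"
      unfolding sh floor_add_int[symmetric] using x0 by (simp add: nat_add_distrib nat_power_eq)
    show ?thesis
    proof (cases "j = a")
      case True
      have "\<lfloor>2 ^ Suc a * x\<rfloor> = 2 * int i" using b by (intro floor_unique) auto
      moreover have "nat (2 * int i) = 2 * i" by simp
      ultimately show ?thesis unfolding bdigit_def fl using True by simp
    next
      case False
      then have "even ((2::nat) ^ (j - a))" using \<open>a \<le> j\<close> by simp
      then show ?thesis using False unfolding bdigit_def fl by (metis dvd_eq_mod_eq_0 mod_add_right_eq add.right_neutral)
    qed
  qed
qed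

lemma antisym_at_wal: "bit k a \<Longrightarrow> antisym_at a (wal k)"
  unfolding antisym_at_def
proof (intro allI impI)
  fix i :: nat and x :: real
  assume k: "bit k a" and x: "real i / 2 ^ a \<le> x \<and> x < (real i + 1 / 2) / 2 ^ a \<and> x < 1"
  have r: "rad j (x + 1 / 2 ^ Suc a) = (if j = a then - rad j x else rad j x)" for j
  proof -
    have "bdigit (Suc a) x = 0 \<or> bdigit (Suc a) x = 1" using bdigit_le_1[of "Suc a" x] by linarith
    then show ?thesis unfolding rad_def using bdigit_add_half[of i a x j] x by auto
  qed
  have split: "(\<Prod>j | bit k j. f j) = f a * (\<Prod>j\<in>{j. bit k j} - {a}. f j)" for f :: "nat \<Rightarrow> real"
    using k by (intro prod.remove) auto
  have "(\<Prod>j\<in>{j. bit k j} - {a}. rad j (x + 1 / 2 ^ Suc a)) = (\<Prod>j\<in>{j. bit k j} - {a}. rad j x)"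
    using r by (intro prod.cong) auto
  then show "wal k (x + 1 / 2 ^ Suc a) = - wal k x"
    unfolding wal_eq_prod split using r[of a] by simp
qed

text \<open>The functions \<^const>\<open>walsh_w\<close> are Walsh functions cut off to a dyadic interval of level \<open>a2\<close>,
  which does not affect the sign changes.\<close>

lemma indicator_dyadic_add_half:
  fixes i m' :: nat
  assumes a: "b \<le> a" and x: "real i / 2 ^ a \<le> x" "x < (real i + 1 / 2) / 2 ^ a"
  shows "indicator {real m' / 2 ^ b ..< (real m' + 1) / 2 ^ b} (x + 1 / 2 ^ Suc a)
    = (indicator {real m' / 2 ^ b ..< (real m' + 1) / 2 ^ b} x :: real)"
proof -
  define N where "N = (2::nat) ^ (a - b)"
  have ex: "(2::real) ^ a = real N * 2 ^ b" unfolding N_def using a by (simp flip: power_add)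
  have N0: "0 < N" unfolding N_def by simp
  have mem: "y \<in> {real m' / 2 ^ b ..< (real m' + 1) / 2 ^ b} \<longleftrightarrow> N * m' \<le> i \<and> i < N * (m' + 1)"
    if "real i \<le> 2 ^ a * y" "2 ^ a * y < real i + 1" for y
  proof -
    have "real m' / 2 ^ b \<le> y \<longleftrightarrow> real (N * m') \<le> 2 ^ a * y"
      using N0 unfolding ex by (simp add: field_simps)
    also have "\<dots> \<longleftrightarrow> N * m' \<le> i"
    proof
      assume "real (N * m') \<le> 2 ^ a * y"
      then have "real (N * m') < real (i + 1)" using that by simp
      then show "N * m' \<le> i" by (simp only: of_nat_less_iff)
    next
      assume "N * m' \<le> i"
      then have "real (N * m') \<le> real i" by (rule of_nat_mono)
      then show "real (N * m') \<le> 2 ^ a * y" using that by simp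
    qed
    finally have 1: "real m' / 2 ^ b \<le> y \<longleftrightarrow> N * m' \<le> i" .
    have "y < (real m' + 1) / 2 ^ b \<longleftrightarrow> 2 ^ a * y < real (N * (m' + 1))"
    proof -
      have "y < (real m' + 1) / 2 ^ b \<longleftrightarrow> real N * (y * 2 ^ b) < real N * (real m' + 1)"
        using N0 by (simp add: pos_less_divide_eq)
      moreover have "real N * (y * 2 ^ b) = 2 ^ a * y" "real N * (real m' + 1) = real (N * (m' + 1))"
        unfolding ex by (simp_all add: distrib_left)
      ultimately show ?thesis by (simp only:)
    qed
    also have "\<dots> \<longleftrightarrow> i < N * (m' + 1)"
    proof
      assume "2 ^ a * y < real (N * (m' + 1))"
      then have "real i < real (N * (m' + 1))" using that by linarith
      then show "i < N * (m' + 1)" by (simp only: of_nat_less_iff)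
    next
      assume "i < N * (m' + 1)"
      then have "real (i + 1) \<le> real (N * (m' + 1))" by (intro of_nat_mono) simp
      then show "2 ^ a * y < real (N * (m' + 1))" using that by simp
    qed
    finally show ?thesis using 1 by simp
  qed
  have b: "real i \<le> 2 ^ a * x" "2 ^ a * x < real i + 1 / 2" using x by (simp_all add: field_simps)
  moreover have "2 ^ a * (x + 1 / 2 ^ Suc a) = 2 ^ a * x + 1 / 2" by (simp add: field_simps)
  ultimately show ?thesis using mem[of x] mem[of "x + 1 / 2 ^ Suc a"] by (auto simp: indicator_def)
qed

lemma antisym_at_walsh_w:
  assumes "a = a1 \<or> a = a2" "a2 < a1"
  shows "antisym_at a (walsh_w a1 a2 m')"
proof -
  have "bit (2 ^ a1 + 2 ^ a2 :: nat) j \<longleftrightarrow> j = a1 \<or> j = a2" for j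
  proof -
    have "(2::nat) ^ a2 < 2 ^ a1" using assms(2) by simp
    then have "{i. bit (2 ^ a2 + 2 ^ a1 :: nat) i} = insert a1 {i. bit (2 ^ a2 :: nat) i}" by (rule bits_add_power)
    then show ?thesis by (auto simp: bit_exp_iff add.commute set_eq_iff)
  qed
  then have k: "bit (2 ^ a1 + 2 ^ a2 :: nat) a" using assms(1) by blast
  have "a2 \<le> a" using assms by auto
  then show ?thesis
    using antisym_at_wal[OF k] indicator_dyadic_add_half[of a2 a]
    unfolding antisym_at_def walsh_w_def by auto
qed

definition prim :: "(real \<Rightarrow> real) \<Rightarrow> real \<Rightarrow> real" where "prim w x = integral {0..x} w"

lemma integral_shift_interval:
  fixes f :: "real \<Rightarrow> real"
  assumes "f integrable_on {a + h..b + h}"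
  shows "integral {a + h..b + h} f = integral {a..b} (\<lambda>x. f (x + h))"
proof -
  have "(f has_integral integral {a + h..b + h} f) (cbox (a + h) (b + h))"
    using assms by (simp add: integrable_integral)
  then have "((f \<circ> (+) h) has_integral integral {a + h..b + h} f) (cbox a b)"
    by (simp only: has_integral_shift_cbox_iff)
  then show ?thesis by (simp add: o_def add.commute integral_unique)
qed

lemma integral_shift_neg:
  fixes f :: "real \<Rightarrow> real"
  assumes f: "f integrable_on {a..a + 2 * h}" and h: "0 < h"
    and anti: "\<And>x. a \<le> x \<Longrightarrow> x < a + h \<Longrightarrow> f (x + h) = - f x"
  shows "integral {a..a + 2 * h} f = 0"
proof -
  have s: "integral {a..a + 2 * h} f = integral {a..a + h} f + integral {a + h..a + 2 * h} f"
    using h f by (intro Henstock_Kurzweil_Integration.integral_combine[symmetric]) auto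
  have "f integrable_on {a + h..a + h + h}"
    using h by (intro integrable_on_subinterval[OF f]) auto
  then have "integral {a + h..a + 2 * h} f = integral {a..a + h} (\<lambda>x. f (x + h))"
  proof -
    have "a + 2 * h = a + h + h" by simp
    then show ?thesis using integral_shift_interval[of f a h "a + h"] \<open>f integrable_on {a + h..a + h + h}\<close> by (simp only:)
  qed
  also have "\<dots> = integral {a..a + h} (\<lambda>x. - f x)"
    by (rule integral_spike[of "{a + h}"]) (use anti in \<open>auto simp: le_less\<close>)
  finally show ?thesis using s by simp
qed

lemma prim_dyadic_zero:
  assumes w: "w integrable_on {0..1}" and anti: "antisym_at a w" and i: "i \<le> 2 ^ a"
  shows "prim w (real i / 2 ^ a) = 0"
  using i
proof (induction i)
  case (Suc i)
  define h :: real where "h = 1 / 2 ^ Suc a"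
  have h: "0 < h" "2 * h = 1 / 2 ^ a" unfolding h_def by simp_all
  have e: "real (Suc i) / 2 ^ a = real i / 2 ^ a + 2 * h" unfolding h(2) by (simp add: add_divide_distrib)
  have "real (Suc i) \<le> real (2 ^ a)" using Suc by (intro of_nat_mono) simp
  then have le1: "real (Suc i) / 2 ^ a \<le> 1" by (simp add: divide_le_eq_1 del: of_nat_Suc)
  have sub: "{x..y} \<subseteq> {0..1}" if "0 \<le> x" "y \<le> 1" for x y :: real using that by auto
  have "prim w (real (Suc i) / 2 ^ a) = prim w (real i / 2 ^ a) + integral {real i / 2 ^ a..real (Suc i) / 2 ^ a} w"
    unfolding prim_def using h e
    by (intro Henstock_Kurzweil_Integration.integral_combine[symmetric] integrable_on_subinterval[OF w] sub le1) auto
  also have "integral {real i / 2 ^ a..real (Suc i) / 2 ^ a} w = 0"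
    unfolding e
  proof (rule integral_shift_neg)
    show "w integrable_on {real i / 2 ^ a..real i / 2 ^ a + 2 * h}"
      using le1 unfolding e by (intro integrable_on_subinterval[OF w] sub) auto
    fix x assume x: "real i / 2 ^ a \<le> x" "x < real i / 2 ^ a + h"
    then have "x < (real i + 1 / 2) / 2 ^ a" unfolding h_def by (simp add: field_simps)
    moreover have "x < 1" using x h e le1 by linarith
    ultimately show "w (x + h) = - w x" using anti x unfolding antisym_at_def h_def by blast
  qed (rule h)
  finally show ?case using Suc by simp
qed (simp add: prim_def)

lemma dyadic_floor:
  assumes "0 \<le> x" "x < (1::real)"
  obtains i :: nat where "i < 2 ^ a" "real i / 2 ^ a \<le> x" "x < (real i + 1) / 2 ^ a"
proof -
  define i where "i = nat \<lfloor>2 ^ a * x\<rfloor>"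
  have i: "real i = of_int \<lfloor>2 ^ a * x\<rfloor>" unfolding i_def using assms by simp
  have "real i \<le> 2 ^ a * x" "2 ^ a * x < real i + 1" unfolding i by linarith+
  moreover have "2 ^ a * x < 2 ^ a" using assms by simp
  ultimately have "real i < 2 ^ a" by linarith
  then have "i < 2 ^ a" by (metis of_nat_less_iff of_nat_numeral of_nat_power)
  then show ?thesis using that[of i] \<open>real i \<le> 2 ^ a * x\<close> \<open>2 ^ a * x < real i + 1\<close> by (simp add: field_simps)
qed

text \<open>The primitive vanishes at 0, at 1 and at the dyadic points of level a, and it has the
  Lipschitz constant B; each kind of zero gives one term of the minimum. The terms x and 1 - x are
  kept because under \<Phi> they turn into Gaussian tails.\<close>

lemma prim_bound:
  assumes w: "w integrable_on {0..1}" and B: "\<And>x. 0 \<le> x \<Longrightarrow> x \<le> 1 \<Longrightarrow> \<bar>w x\<bar> \<le> B"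
    and anti: "antisym_at a w" and x: "0 \<le> x" "x \<le> 1"
  shows "\<bar>prim w x\<bar> \<le> B * min x (min (1 - x) (1 / 2 ^ a))"
proof -
  have diff: "\<bar>prim w y - prim w z\<bar> \<le> B * (y - z)" if "0 \<le> z" "z \<le> y" "y \<le> 1" for y z
  proof -
    have "prim w y = prim w z + integral {z..y} w"
      unfolding prim_def using that
      by (intro Henstock_Kurzweil_Integration.integral_combine[symmetric] integrable_on_subinterval[OF w]) auto
    moreover have "norm (integral {z..y} w) \<le> B * (y - z)"
    proof -
      have "w integrable_on {z..y}" using that by (intro integrable_on_subinterval[OF w]) auto
      then have "(w has_integral integral {z..y} w) {z..y}" by (rule integrable_integral)
      moreover have "0 \<le> B" using B[of 0] by force
      ultimately have "norm (integral {z..y} w) \<le> B * measure lborel {z..y}"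
        by (intro has_integral_bound_real[where f=w]) (use that B in auto)
      then show ?thesis using that by simp
    qed
    ultimately show ?thesis by simp
  qed
  have B0: "0 \<le> B" using B[of 0] by force
  have z: "prim w 0 = 0" "prim w 1 = 0"
    using prim_dyadic_zero[OF w anti, of 0] prim_dyadic_zero[OF w anti, of "2 ^ a"] by simp_all
  have 1: "\<bar>prim w x\<bar> \<le> B * x" using diff[of 0 x] x z by simp
  have 2: "\<bar>prim w x\<bar> \<le> B * (1 - x)" using diff[of x 1] x z by simp
  have 3: "\<bar>prim w x\<bar> \<le> B * (1 / 2 ^ a)"
  proof (cases "x = 1")
    case False
    then obtain i where i: "i < 2 ^ a" "real i / 2 ^ a \<le> x" "x < (real i + 1) / 2 ^ a"
      using dyadic_floor[of x a] x by (metis less_eq_real_def)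
    have "\<bar>prim w x - prim w (real i / 2 ^ a)\<bar> \<le> B * (x - real i / 2 ^ a)"
      using i x by (intro diff) auto
    also have "\<dots> \<le> B * (1 / 2 ^ a)"
      using i B0 by (intro mult_left_mono) (auto simp: add_divide_distrib)
    finally show ?thesis using prim_dyadic_zero[OF w anti, of i] i by simp
  qed (use z B0 in simp)
  show ?thesis using 1 2 3 unfolding min_def by simp
qed

lemma prim_continuous: "w integrable_on {0..1} \<Longrightarrow> continuous_on {0..1} (prim w)"
  unfolding prim_def by (rule indefinite_integral_continuous_1)

lemma prim_integrable: "w integrable_on {0..1} \<Longrightarrow> prim w integrable_on {0..1}"
  by (rule integrable_continuous_real[OF prim_continuous])

text \<open>As b < a, the midpoint of a cell of level b is a dyadic point of level a, so the
  primitive vanishes there as well as at the left end. On the two halves it is then the integral of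
  opposite functions. This is why the sign change at the higher digit is used first.\<close>

lemma antisym_at_prim:
  assumes w: "w integrable_on {0..1}" and anti: "antisym_at a w" "antisym_at b w" and ab: "b < a"
  shows "antisym_at b (prim w)"
  unfolding antisym_at_def
proof (intro allI impI, elim conjE)
  fix i :: nat and x :: real
  assume x: "real i / 2 ^ b \<le> x" "x < (real i + 1 / 2) / 2 ^ b" "x < 1"
  define h :: real where "h = 1 / 2 ^ Suc b"
  define y where "y = real i / 2 ^ b"
  have h: "0 < h" "2 * h = 1 / 2 ^ b" unfolding h_def by simp_all
  have xy: "y \<le> x" "x < y + h" using x unfolding y_def h_def by (simp_all add: field_simps)
  have y0: "0 \<le> y" unfolding y_def by simp
  have "real i < 2 ^ b" using x(1,3) by (smt (verit) divide_less_eq_1_pos zero_less_power)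
  then have "i < 2 ^ b" by (metis of_nat_less_iff of_nat_numeral of_nat_power)
  then have i1: "i + 1 \<le> 2 ^ b" by simp
  then have "real (i + 1) \<le> real (2 ^ b)" by (rule of_nat_mono)
  then have y1: "y + 2 * h \<le> 1" unfolding y_def h(2) by (simp add: field_simps)
  have ex: "(2::real) ^ a = 2 ^ (a - Suc b) * 2 ^ Suc b" using ab by (simp flip: power_add del: power_Suc)
  define j where "j = (2 * i + 1) * 2 ^ (a - Suc b)"
  have yh: "y + h = real j / 2 ^ a" unfolding y_def h_def j_def ex by (simp add: field_simps)
  have "real j / 2 ^ a \<le> 1" using y1 h unfolding yh[symmetric] by linarith
  then have "j \<le> 2 ^ a" by (metis divide_le_eq_1_pos of_nat_le_iff of_nat_numeral of_nat_power zero_less_numeral zero_less_power)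
  then have zh: "prim w (y + h) = 0" unfolding yh by (rule prim_dyadic_zero[OF w anti(1)])
  have zy: "prim w y = 0" unfolding y_def using i1 by (intro prim_dyadic_zero[OF w anti(2)]) simp
  have comb: "prim w v = prim w u + integral {u..v} w" if "0 \<le> u" "u \<le> v" "v \<le> 1" for u v
    unfolding prim_def using that
    by (intro Henstock_Kurzweil_Integration.integral_combine[symmetric] integrable_on_subinterval[OF w]) auto
  have "prim w (x + h) = integral {y + h..x + h} w" using comb[of "y + h" "x + h"] zh xy y0 y1 h by simp
  also have "\<dots> = integral {y..x} (\<lambda>t. w (t + h))"
    using y0 y1 xy h by (intro integral_shift_interval integrable_on_subinterval[OF w]) auto
  also have "\<dots> = integral {y..x} (\<lambda>t. - w t)"
  proof (rule integral_cong)
    fix t assume t: "t \<in> {y..x}"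
    then have "real i / 2 ^ b \<le> t \<and> t < (real i + 1 / 2) / 2 ^ b \<and> t < 1" using x unfolding y_def by auto
    then show "w (t + h) = - w t" using anti(2) unfolding antisym_at_def h_def by blast
  qed
  also have "\<dots> = - prim w x" using comb[of y x] zy xy y0 x(3) by simp
  finally show "prim w (x + 1 / 2 ^ Suc b) = - prim w x" unfolding h_def .
qed

lemma prim_prim_bound:
  assumes w: "w integrable_on {0..1}" and B: "\<And>x. 0 \<le> x \<Longrightarrow> x \<le> 1 \<Longrightarrow> \<bar>w x\<bar> \<le> B"
    and anti: "antisym_at a w" "antisym_at b w" and ab: "b < a" and x: "0 \<le> x" "x \<le> 1"
  shows "\<bar>prim (prim w) x\<bar> \<le> B / 2 ^ a * min x (min (1 - x) (1 / 2 ^ b))"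
proof (rule prim_bound[OF prim_integrable[OF w] _ antisym_at_prim[OF w anti ab] x])
  fix x :: real assume x: "0 \<le> x" "x \<le> 1"
  have "B * min x (min (1 - x) (1 / 2 ^ a)) \<le> B * (1 / 2 ^ a)"
    using B[of 0] by (intro mult_left_mono) auto
  then show "\<bar>prim w x\<bar> \<le> B / 2 ^ a" using prim_bound[OF w B anti(1) x] by simp
qed

lemma borel_measurable_bdigit [measurable]: "(\<lambda>x. bdigit i x) \<in> borel \<rightarrow>\<^sub>M count_space UNIV"
  unfolding bdigit_def by measurable

lemma borel_measurable_wal [measurable]: "wal k \<in> borel_measurable borel"
  unfolding wal_eq_prod rad_def by measurable

lemma integrable_on_bounded_measurable:
  fixes w :: "real \<Rightarrow> real"
  assumes [measurable]: "w \<in> borel_measurable borel" and B: "\<And>x. x \<in> {a..b} \<Longrightarrow> \<bar>w x\<bar> \<le> B"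
  shows "w integrable_on {a..b}"
proof -
  have "set_integrable lborel {a..b} w"
    unfolding set_integrable_def
  proof (rule Bochner_Integration.integrable_bound[where f="\<lambda>x. indicator {a..b} x *\<^sub>R B"])
    show "integrable lborel (\<lambda>x. indicator {a..b} x *\<^sub>R B)"
      by (auto intro!: integrable_real_indicator simp: emeasure_lborel_Icc_eq)
    show "AE x in lborel. norm (indicator {a..b} x *\<^sub>R w x) \<le> norm (indicator {a..b} x *\<^sub>R B)"
      using B by (intro AE_I2) (force simp: indicator_def)
  qed simp
  then show ?thesis by (rule set_borel_integral_eq_integral(1))
qed

lemma wal_integrable: "wal k integrable_on {0..1}"
  by (rule integrable_on_bounded_measurable[where B=1]) auto

lemma walsh_w_bound: "\<bar>walsh_w a1 a2 m' x\<bar> \<le> 2 powr (real a2 / 2)"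
  unfolding walsh_w_def by (auto simp: abs_mult indicator_def)

lemma walsh_w_integrable: "walsh_w a1 a2 m' integrable_on {0..1}"
  by (rule integrable_on_bounded_measurable[where B="2 powr (real a2 / 2)"])
    (simp_all add: walsh_w_bound, simp add: walsh_w_def[abs_def])

lemma walsh_W2_eq_prim: "walsh_W2 a1 a2 m' = prim (prim (walsh_w a1 a2 m'))"
  unfolding walsh_W2_def prim_def walsh_W_def[abs_def] by (simp add: fun_eq_iff)

text \<open>Off the dyadic points of level L all digits that enter are locally constant.\<close>

lemma isCont_wal:
  assumes "k < 2 ^ L" "0 < x" and nd: "\<And>i::nat. x \<noteq> real i / 2 ^ L"
  shows "isCont (wal k) x"
proof -
  have "\<forall>\<^sub>F y in at x. rad j y = rad j x" if j: "j < L" for j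
  proof -
    have ni: "2 ^ Suc j * x \<notin> \<int>"
    proof
      assume "2 ^ Suc j * x \<in> \<int>"
      then obtain n where n: "2 ^ Suc j * x = of_int n" by (auto elim: Ints_cases)
      then have "0 \<le> n" using assms(2) by (metis less_imp_le mult_nonneg_nonneg of_int_0_le_iff zero_le_numeral zero_le_power)
      have "2 ^ L = (2::real) ^ (L - Suc j) * 2 ^ Suc j" using j by (simp flip: power_add del: power_Suc)
      then have "2 ^ L * x = 2 ^ (L - Suc j) * (2 ^ Suc j * x)" by (simp only: mult.assoc)
      also have "\<dots> = real (2 ^ (L - Suc j) * nat n)" unfolding n using \<open>0 \<le> n\<close> by simp
      finally have "x = real (2 ^ (L - Suc j) * nat n) / 2 ^ L" by (simp add: field_simps)
      then show False using nd by blast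
    qed
    have "isCont (\<lambda>y. 2 ^ Suc j * y) x" by (intro continuous_intros)
    then have lim: "((\<lambda>y. 2 ^ Suc j * y) \<longlongrightarrow> 2 ^ Suc j * x) (at x)" by (simp add: isCont_def)
    have "\<forall>\<^sub>F y in at x. \<lfloor>2 ^ Suc j * y\<rfloor> = \<lfloor>2 ^ Suc j * x\<rfloor>"
      by (rule eventually_floor_eq[OF lim ni])
    then show ?thesis unfolding rad_def bdigit_def by eventually_elim simp
  qed
  then have "\<forall>\<^sub>F y in at x. \<forall>j\<in>{..<L}. rad j y = rad j x" by (intro eventually_ball_finite) auto
  then have "\<forall>\<^sub>F y in at x. wal k y = wal k x"
  proof eventually_elim
    case (elim y)
    have "j < L" if "bit k j" for j
      using that assms(1) by (metis bit_take_bit_iff take_bit_nat_eq_self)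
    then show ?case unfolding wal_eq_prod using elim by (intro prod.cong) auto
  qed
  then show ?thesis unfolding isCont_def by (rule tendsto_eventually)
qed

lemma prim_has_derivative:
  assumes w: "w integrable_on {0..1}" and x: "0 < x" "x < 1" and c: "isCont w x"
  shows "(prim w has_real_derivative w x) (at x)"
proof -
  have "((\<lambda>u. integral {0..u} w) has_vector_derivative w x) (at x within {0..1} - {})"
    using x by (intro integral_has_vector_derivative_continuous_at[OF w] continuous_at_imp_continuous_at_within[OF c]) auto
  then have "((\<lambda>u. integral {0..u} w) has_vector_derivative w x) (at x)"
    using x by (simp add: at_within_Icc_at)
  then show ?thesis unfolding prim_def[abs_def] has_real_derivative_iff_has_vector_derivative .
qed

lemma prim_prim_has_derivative:
  assumes w: "w integrable_on {0..1}" and x: "0 < x" "x < 1"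
  shows "(prim (prim w) has_real_derivative prim w x) (at x)"
proof (rule prim_has_derivative[OF prim_integrable[OF w] x])
  show "isCont (prim w) x"
    using prim_continuous[OF w] x by (intro continuous_on_interior[of "{0..1}"]) auto
qed

subsection \<open>The normal distribution function\<close>

locale normal_cdf =
  fixes \<sigma> :: real assumes \<sigma>_pos: "0 < \<sigma>"
begin

abbreviation "\<Phi> \<equiv> dens_cdf (gauss \<sigma>)"

sublocale N: real_distribution "density lborel (\<lambda>x. ennreal (gauss \<sigma> x))"
  unfolding real_distribution_def real_distribution_axioms_def
  using prob_space_normal_density[OF \<sigma>_pos] by simp

lemma gauss_pos: "0 < gauss \<sigma> x" by (rule normal_density_pos[OF \<sigma>_pos])

lemma measure_density:
  assumes [measurable]: "A \<in> sets borel"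
  shows "measure (density lborel (\<lambda>x. ennreal (gauss \<sigma> x))) A = (\<integral>x. indicator A x * gauss \<sigma> x \<partial>lborel)"
proof -
  have "emeasure (density lborel (\<lambda>x. ennreal (gauss \<sigma> x))) A = (\<integral>\<^sup>+x. ennreal (indicator A x * gauss \<sigma> x) \<partial>lborel)"
    by (subst emeasure_density) (auto intro!: nn_integral_cong simp: indicator_def)
  moreover have "(\<integral>x. indicator A x * gauss \<sigma> x \<partial>lborel) = enn2real (\<integral>\<^sup>+x. ennreal (indicator A x * gauss \<sigma> x) \<partial>lborel)"
    using gauss_pos by (intro integral_eq_nn_integral) (auto simp: less_imp_le)
  ultimately show ?thesis by (simp add: measure_def)
qed

lemma Phi_diff: "x \<le> y \<Longrightarrow> \<Phi> y - \<Phi> x = integral {x..y} (gauss \<sigma>)"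
proof (cases "x = y")
  case False
  assume "x \<le> y"
  then have "\<Phi> y - \<Phi> x = measure (density lborel (\<lambda>x. ennreal (gauss \<sigma> x))) {x<..y}"
    unfolding dens_cdf_def using False by (intro N.cdf_diff_eq) auto
  also have "\<dots> = (\<integral>t. indicator {x<..y} t * gauss \<sigma> t \<partial>lborel)" by (intro measure_density) auto
  also have "\<dots> = (\<integral>t. indicator {x..y} t *\<^sub>R gauss \<sigma> t \<partial>lborel)"
  proof (rule integral_cong_AE)
    show "AE t in lborel. indicator {x<..y} t * gauss \<sigma> t = indicator {x..y} t *\<^sub>R gauss \<sigma> t"
      using AE_lborel_singleton[of x] by eventually_elim (auto simp: indicator_def)
  qed simp_all
  also have "\<dots> = integral {x..y} (gauss \<sigma>)"
    unfolding set_lebesgue_integral_def[symmetric]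
    by (intro set_borel_integral_eq_integral) (use integrable_mult_indicator[of "{x..y}" lborel "gauss \<sigma>"] integrable_normal_density[OF \<sigma>_pos] in \<open>auto simp: set_integrable_def\<close>)
  finally show ?thesis .
qed simp

lemma isCont_gauss: "0 < \<tau> \<Longrightarrow> isCont (gauss \<tau>) x"
  unfolding normal_density_def by (intro continuous_intros) (auto simp: )

lemma Phi_has_derivative: "(\<Phi> has_real_derivative gauss \<sigma> x) (at x)"
proof -
  have "((\<lambda>u. integral {x - 1..u} (gauss \<sigma>)) has_real_derivative gauss \<sigma> x) (at x within {x - 1..x + 1})"
    by (intro integral_has_real_derivative continuous_at_imp_continuous_on) (auto simp: isCont_gauss \<sigma>_pos)
  then have "((\<lambda>u. \<Phi> (x - 1) + integral {x - 1..u} (gauss \<sigma>)) has_real_derivative gauss \<sigma> x) (at x)"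
    by (auto simp: at_within_Icc_at intro!: derivative_eq_intros)
  moreover have "\<forall>\<^sub>F u in nhds x. \<Phi> (x - 1) + integral {x - 1..u} (gauss \<sigma>) = \<Phi> u"
  proof -
    have "\<forall>\<^sub>F u in nhds x. x - 1 < u"
      using eventually_nhds_in_open[of "{x - 1<..}" x] by simp
    then show ?thesis by eventually_elim (simp add: Phi_diff[symmetric])
  qed
  ultimately show ?thesis by (subst (asm) DERIV_cong_ev[OF refl _ refl]) auto
qed

lemma Phi_strict_mono: "strict_mono \<Phi>"
  by (rule strict_monoI) (rule DERIV_pos_imp_increasing, auto intro!: exI Phi_has_derivative gauss_pos)

lemma isCont_Phi: "isCont \<Phi> x" by (rule DERIV_isCont[OF Phi_has_derivative])

lemma Phi_range: "0 < \<Phi> x" "\<Phi> x < 1"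
proof -
  have "0 \<le> \<Phi> (x - 1)" unfolding dens_cdf_def by (rule N.cdf_nonneg)
  also have "\<Phi> (x - 1) < \<Phi> x" by (rule strict_monoD[OF Phi_strict_mono]) simp
  finally show "0 < \<Phi> x" .
  have "\<Phi> x < \<Phi> (x + 1)" by (rule strict_monoD[OF Phi_strict_mono]) simp
  also have "\<Phi> (x + 1) \<le> 1" unfolding dens_cdf_def by (rule N.cdf_bounded_prob)
  finally show "\<Phi> x < 1" .
qed

lemma inj_Phi: "inj \<Phi>" by (rule strict_mono_imp_inj_on[OF Phi_strict_mono])

lemma Phi_surj:
  assumes "0 < p" "p < 1" shows "\<exists>x. \<Phi> x = p"
proof -
  have "\<forall>\<^sub>F x in at_bot. \<Phi> x < p" unfolding dens_cdf_def by (rule order_tendstoD(2)[OF N.cdf_lim_at_bot assms(1)])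
  then obtain a where a: "\<Phi> a < p" by (auto simp: eventually_at_bot_linorder)
  have "\<forall>\<^sub>F x in at_top. p < \<Phi> x" unfolding dens_cdf_def by (rule order_tendstoD(1)[OF N.cdf_lim_at_top_prob assms(2)])
  then obtain b where b: "p < \<Phi> b" by (auto simp: eventually_at_top_linorder)
  have "a \<le> b" using a b strict_mono_less[OF Phi_strict_mono, of b a] by linarith
  then show ?thesis using IVT'[of \<Phi> a p b] a b isCont_Phi by (auto intro: continuous_at_imp_continuous_on)
qed

lemma Phi_inv: "0 < p \<Longrightarrow> p < 1 \<Longrightarrow> \<Phi> (inv_into UNIV \<Phi> p) = p"
  using Phi_surj[of p] by (auto intro: f_inv_into_f)

text \<open>On the tail beyond x one has x * (t - x) \<ge> 0 and hence t^2 \<ge> x^2 + (t - x)^2.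
  There the density is at most exp (- x^2 / (2 \<sigma>^2)) times the normal density centred at x,
  whose mass is 1. The sign condition covers both tails.\<close>

lemma Phi_tail: "min (\<Phi> x) (1 - \<Phi> x) \<le> exp (- x\<^sup>2 / (2 * \<sigma>\<^sup>2))"
proof -
  have key: "measure (density lborel (\<lambda>x. ennreal (gauss \<sigma> x))) A \<le> exp (- x\<^sup>2 / (2 * \<sigma>\<^sup>2))"
    if [measurable]: "A \<in> sets borel" and A: "\<And>t. t \<in> A \<Longrightarrow> 0 \<le> x * (t - x)" for A
  proof -
    have "measure (density lborel (\<lambda>x. ennreal (gauss \<sigma> x))) A = (\<integral>t. indicator A t * gauss \<sigma> t \<partial>lborel)"
      by (rule measure_density) simp
    also have "\<dots> \<le> (\<integral>t. exp (- x\<^sup>2 / (2 * \<sigma>\<^sup>2)) * normal_density x \<sigma> t \<partial>lborel)"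
    proof (rule integral_mono)
      show "integrable lborel (\<lambda>t. indicator A t * gauss \<sigma> t)"
        using integrable_mult_indicator[of A lborel "gauss \<sigma>"] integrable_normal_density[OF \<sigma>_pos] by simp
      show "integrable lborel (\<lambda>t. exp (- x\<^sup>2 / (2 * \<sigma>\<^sup>2)) * normal_density x \<sigma> t)"
        using integrable_normal_density[OF \<sigma>_pos] by simp
      fix t
      show "indicator A t * gauss \<sigma> t \<le> exp (- x\<^sup>2 / (2 * \<sigma>\<^sup>2)) * normal_density x \<sigma> t"
      proof (cases "t \<in> A")
        case True
        have "t\<^sup>2 = x\<^sup>2 + (t - x)\<^sup>2 + 2 * (x * (t - x))" by (simp add: power2_eq_square algebra_simps)
        then have "x\<^sup>2 + (t - x)\<^sup>2 \<le> t\<^sup>2" using A[OF True] by simp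
        then have "- t\<^sup>2 / (2 * \<sigma>\<^sup>2) \<le> - x\<^sup>2 / (2 * \<sigma>\<^sup>2) + - (t - x)\<^sup>2 / (2 * \<sigma>\<^sup>2)"
          unfolding add_divide_distrib[symmetric] by (intro divide_right_mono) auto
        then have "exp (- t\<^sup>2 / (2 * \<sigma>\<^sup>2)) \<le> exp (- x\<^sup>2 / (2 * \<sigma>\<^sup>2)) * exp (- (t - x)\<^sup>2 / (2 * \<sigma>\<^sup>2))"
          unfolding exp_add[symmetric] by simp
        then show ?thesis using True \<sigma>_pos unfolding normal_density_def by (simp add: divide_right_mono)
      qed (simp add: normal_density_nonneg)
    qed
    also have "\<dots> = exp (- x\<^sup>2 / (2 * \<sigma>\<^sup>2))" using integral_normal_density[OF \<sigma>_pos] by simp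
    finally show ?thesis .
  qed
  show ?thesis
  proof (cases "0 \<le> x")
    case True
    have "1 - \<Phi> x = measure (density lborel (\<lambda>x. ennreal (gauss \<sigma> x))) {x<..}"
    proof -
      have "{x<..} = space (density lborel (\<lambda>x. ennreal (gauss \<sigma> x))) - {..x}" by auto
      then show ?thesis unfolding dens_cdf_def cdf_def by (simp only:) (subst N.prob_compl, auto)
    qed
    also have "\<dots> \<le> exp (- x\<^sup>2 / (2 * \<sigma>\<^sup>2))" using True by (intro key) auto
    finally show ?thesis by simp
  next
    case False
    have "\<Phi> x = measure (density lborel (\<lambda>x. ennreal (gauss \<sigma> x))) {..x}" unfolding dens_cdf_def cdf_def ..
    also have "\<dots> \<le> exp (- x\<^sup>2 / (2 * \<sigma>\<^sup>2))" using False by (intro key) (auto intro: mult_nonpos_nonpos)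
    finally show ?thesis by simp
  qed
qed

lemma gauss_has_derivative: "(gauss \<sigma> has_real_derivative (- x / \<sigma>\<^sup>2 * gauss \<sigma> x)) (at x)"
  unfolding normal_density_def using \<sigma>_pos
  by (auto intro!: derivative_eq_intros simp: field_simps power2_eq_square)

lemma deriv_gauss: "deriv (gauss \<sigma>) x = - x / \<sigma>\<^sup>2 * gauss \<sigma> x"
  by (rule DERIV_imp_deriv[OF gauss_has_derivative])

text \<open>The root turns exp (- x^2 / (2 \<rho>^2)) into the density \<open>gauss \<rho>\<close>.
  With c = \<delta> / (2 \<sigma>^2), the other factor bounds exp (- c x^2) * (1 + |x| / \<sigma>^2)
  and so serves a function and its product with the logarithmic derivative of the density at
  once.\<close>

definition transform_const :: "real \<Rightarrow> real \<Rightarrow> real"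
  where "transform_const \<rho> \<delta> = sqrt (2 * pi * \<rho>\<^sup>2) * (1 + (1 + 2 * \<sigma>\<^sup>2 / \<delta>) / \<sigma>\<^sup>2)"

text \<open>If z is the smaller tail at x, then min z 2^-b is at most z^(1 - \<beta>) * 2^(- \<beta>
  b). Since 1 - \<beta> = \<sigma>^2 / \<rho>^2 + \<delta>, the tail bound makes z^(1 - \<beta>) a
  multiple of \<open>gauss \<rho>\<close> times an extra exp (- c x^2), and this extra factor pays
  for |x| in the second estimate.\<close>

lemma transform_bound:
  assumes \<rho>: "0 < \<rho>" and \<delta>: "0 < \<delta>" "0 \<le> \<beta>" "\<beta> = 1 - \<sigma>\<^sup>2 / \<rho>\<^sup>2 - \<delta>" and B: "0 \<le> B"
    and V: "\<And>t. 0 \<le> t \<Longrightarrow> t \<le> 1 \<Longrightarrow> \<bar>V t\<bar> \<le> B / 2 ^ a * min t (min (1 - t) (1 / 2 ^ b))"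
  shows "\<bar>V (\<Phi> x)\<bar> \<le> transform_const \<rho> \<delta> * B * 2 powr (- real a - \<beta> * real b) * gauss \<rho> x"
    and "\<bar>V (\<Phi> x)\<bar> * (\<bar>x\<bar> / \<sigma>\<^sup>2) \<le> transform_const \<rho> \<delta> * B * 2 powr (- real a - \<beta> * real b) * gauss \<rho> x"
proof -
  define z where "z = min (\<Phi> x) (1 - \<Phi> x)"
  define c where "c = \<delta> / (2 * \<sigma>\<^sup>2)"
  have c0: "0 < c" unfolding c_def using \<delta> \<sigma>_pos by simp
  have z: "0 < z" "z \<le> exp (- x\<^sup>2 / (2 * \<sigma>\<^sup>2))" unfolding z_def using Phi_tail Phi_range by auto
  have \<beta>1: "0 \<le> 1 - \<beta>" using \<delta> \<rho> \<sigma>_pos by simp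
  have "min z (1 / 2 ^ b) \<le> z powr (1 - \<beta>) * (1 / 2 ^ b) powr \<beta>"
  proof -
    let ?m = "min z (1 / 2 ^ b)"
    have m0: "0 < ?m" using z by simp
    have "?m = ?m powr (1 - \<beta>) * ?m powr \<beta>" using m0 by (simp add: powr_add[symmetric])
    also have "\<dots> \<le> z powr (1 - \<beta>) * (1 / 2 ^ b) powr \<beta>"
      using m0 \<beta>1 \<delta> by (intro mult_mono powr_mono2) auto
    finally show ?thesis .
  qed
  also have "\<dots> \<le> exp (- x\<^sup>2 / (2 * \<sigma>\<^sup>2)) powr (1 - \<beta>) * (1 / 2 ^ b) powr \<beta>"
    using z \<beta>1 by (intro mult_right_mono powr_mono2) auto
  also have "(1 / 2 ^ b) powr \<beta> = 2 powr (- \<beta> * real b)"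
    by (simp add: powr_minus[symmetric] powr_realpow[symmetric] powr_powr inverse_eq_divide[symmetric] mult.commute)
  also have "exp (- x\<^sup>2 / (2 * \<sigma>\<^sup>2)) powr (1 - \<beta>) = exp (- x\<^sup>2 / (2 * \<rho>\<^sup>2)) * exp (- c * x\<^sup>2)"
  proof -
    have e: "1 - \<beta> = \<sigma>\<^sup>2 / \<rho>\<^sup>2 + \<delta>" using \<delta>(3) by simp
    have "(1 - \<beta>) * (- x\<^sup>2 / (2 * \<sigma>\<^sup>2)) = - x\<^sup>2 / (2 * \<rho>\<^sup>2) + - c * x\<^sup>2"
      unfolding e c_def using \<open>0 < \<rho>\<close> \<sigma>_pos by (simp add: field_simps)
    then show ?thesis by (simp add: powr_def exp_add[symmetric])
  qed
  also have "exp (- x\<^sup>2 / (2 * \<rho>\<^sup>2)) = sqrt (2 * pi * \<rho>\<^sup>2) * gauss \<rho> x"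
    unfolding normal_density_def using \<rho> by simp
  finally have m: "min z (1 / 2 ^ b) \<le> sqrt (2 * pi * \<rho>\<^sup>2) * gauss \<rho> x * exp (- c * x\<^sup>2) * 2 powr (- \<beta> * real b)" .
  have "\<bar>V (\<Phi> x)\<bar> \<le> B / 2 ^ a * min z (1 / 2 ^ b)"
    using V[of "\<Phi> x"] Phi_range[of x] unfolding z_def by (simp add: min.assoc)
  also have "\<dots> \<le> B / 2 ^ a * (sqrt (2 * pi * \<rho>\<^sup>2) * gauss \<rho> x * exp (- c * x\<^sup>2) * 2 powr (- \<beta> * real b))"
    using m B by (intro mult_left_mono) auto
  also have "\<dots> = sqrt (2 * pi * \<rho>\<^sup>2) * B * 2 powr (- real a - \<beta> * real b) * gauss \<rho> x * exp (- c * x\<^sup>2)"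
    by (simp add: powr_diff powr_minus powr_realpow field_simps)
  finally have VB: "\<bar>V (\<Phi> x)\<bar> \<le> sqrt (2 * pi * \<rho>\<^sup>2) * B * 2 powr (- real a - \<beta> * real b) * gauss \<rho> x * exp (- c * x\<^sup>2)" .
  let ?R = "B * 2 powr (- real a - \<beta> * real b) * gauss \<rho> x"
  have R0: "0 \<le> ?R" using B by (simp add: normal_density_nonneg)
  have tc: "transform_const \<rho> \<delta> = sqrt (2 * pi * \<rho>\<^sup>2) * (1 + (1 + 1 / c) / \<sigma>\<^sup>2)"
    unfolding transform_const_def c_def by simp
  have 1: "exp (- c * x\<^sup>2) * (1 + \<bar>x\<bar> / \<sigma>\<^sup>2) \<le> 1 + (1 + 1 / c) / \<sigma>\<^sup>2"
  proof -
    have "\<bar>x\<bar> \<le> 1 + x\<^sup>2"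
    proof -
      have "0 \<le> (\<bar>x\<bar> - 1)\<^sup>2" by simp
      then have "2 * \<bar>x\<bar> \<le> 1 + x\<^sup>2" by (simp add: power2_diff)
      then show ?thesis by linarith
    qed
    also have "1 + x\<^sup>2 \<le> (1 + 1 / c) * (1 + c * x\<^sup>2)" using c0 by (simp add: field_simps)
    also have "\<dots> \<le> (1 + 1 / c) * exp (c * x\<^sup>2)" using c0 exp_ge_add_one_self[of "c * x\<^sup>2"] by (intro mult_left_mono) auto
    finally have "exp (- c * x\<^sup>2) * \<bar>x\<bar> \<le> exp (- c * x\<^sup>2) * ((1 + 1 / c) * exp (c * x\<^sup>2))" by (intro mult_left_mono) auto
    also have "\<dots> = 1 + 1 / c" by (simp add: exp_minus field_simps)
    finally have "exp (- c * x\<^sup>2) * \<bar>x\<bar> / \<sigma>\<^sup>2 \<le> (1 + 1 / c) / \<sigma>\<^sup>2" by (rule divide_right_mono) simp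
    moreover have "exp (- c * x\<^sup>2) \<le> 1" using c0 by simp
    ultimately have "exp (- c * x\<^sup>2) + exp (- c * x\<^sup>2) * \<bar>x\<bar> / \<sigma>\<^sup>2 \<le> 1 + (1 + 1 / c) / \<sigma>\<^sup>2"
      by (intro add_mono)
    then show ?thesis by (simp only: distrib_left mult_1_right times_divide_eq_right)
  qed
  have 2: "\<bar>V (\<Phi> x)\<bar> * (1 + \<bar>x\<bar> / \<sigma>\<^sup>2) \<le> transform_const \<rho> \<delta> * ?R"
  proof -
    have "\<bar>V (\<Phi> x)\<bar> * (1 + \<bar>x\<bar> / \<sigma>\<^sup>2) \<le> sqrt (2 * pi * \<rho>\<^sup>2) * ?R * exp (- c * x\<^sup>2) * (1 + \<bar>x\<bar> / \<sigma>\<^sup>2)"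
      using VB by (intro mult_right_mono) (auto simp: mult_ac)
    also have "\<dots> = sqrt (2 * pi * \<rho>\<^sup>2) * ?R * (exp (- c * x\<^sup>2) * (1 + \<bar>x\<bar> / \<sigma>\<^sup>2))" by simp
    also have "\<dots> \<le> sqrt (2 * pi * \<rho>\<^sup>2) * ?R * (1 + (1 + 1 / c) / \<sigma>\<^sup>2)"
      using 1 R0 by (intro mult_left_mono) auto
    finally show ?thesis unfolding tc by (simp add: mult_ac)
  qed
  have "\<bar>V (\<Phi> x)\<bar> \<le> \<bar>V (\<Phi> x)\<bar> * (1 + \<bar>x\<bar> / \<sigma>\<^sup>2)" by (simp add: distrib_left)
  then show "\<bar>V (\<Phi> x)\<bar> \<le> transform_const \<rho> \<delta> * B * 2 powr (- real a - \<beta> * real b) * gauss \<rho> x"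
    using 2 by (simp add: mult.assoc)
  have "\<bar>V (\<Phi> x)\<bar> * (\<bar>x\<bar> / \<sigma>\<^sup>2) \<le> \<bar>V (\<Phi> x)\<bar> * (1 + \<bar>x\<bar> / \<sigma>\<^sup>2)" by (simp add: distrib_left)
  then show "\<bar>V (\<Phi> x)\<bar> * (\<bar>x\<bar> / \<sigma>\<^sup>2) \<le> transform_const \<rho> \<delta> * B * 2 powr (- real a - \<beta> * real b) * gauss \<rho> x"
    using 2 by (simp add: mult.assoc)
qed

lemma transform_const_pos: "0 < \<rho> \<Longrightarrow> 0 < \<delta> \<Longrightarrow> 0 < transform_const \<rho> \<delta>"
  unfolding transform_const_def using \<sigma>_pos by (intro mult_pos_pos add_pos_nonneg) auto

lemma exists_walsh_constant:
  assumes \<rho>: "0 < \<rho>" and \<delta>: "0 < \<delta>" "0 \<le> \<beta>" "\<beta> = 1 - \<sigma>\<^sup>2 / \<rho>\<^sup>2 - \<delta>"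
    and \<psi>: "\<psi> = (\<lambda>x. gauss \<rho> x / gauss \<sigma> x)"
  shows "walsh_constant (gauss \<sigma>) \<psi> \<psi> \<beta> (transform_const \<rho> \<delta>)"
  unfolding walsh_constant_def
proof (intro conjI allI impI, rule transform_const_pos[OF \<rho> \<delta>(1)]; elim conjE)
  fix a1 a2 m' :: nat and x :: real assume a: "a2 < a1" "m' < 2 ^ a2"
  let ?B = "2 powr (real a2 / 2)" let ?T = "transform_const \<rho> \<delta>"
  have V: "\<bar>walsh_W2 a1 a2 m' t\<bar> \<le> ?B / 2 ^ a1 * min t (min (1 - t) (1 / 2 ^ a2))" if "0 \<le> t" "t \<le> 1" for t
    unfolding walsh_W2_eq_prim
    by (rule prim_prim_bound[OF walsh_w_integrable walsh_w_bound antisym_at_walsh_w antisym_at_walsh_w]) (use a that in auto)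
  have B0: "0 \<le> ?B" by simp
  note b = transform_bound[OF \<rho> \<delta> B0 V, of x]
  have g: "0 < gauss \<rho> x" "0 < gauss \<sigma> x" using normal_density_pos \<rho> \<sigma>_pos by auto
  then have e: "gauss \<sigma> x * \<psi> x = gauss \<rho> x" unfolding \<psi> by simp
  show "\<bar>walsh_W2_dens (gauss \<sigma>) a1 a2 m' x\<bar> / (gauss \<sigma> x * \<psi> x) \<le> ?T * ?B * 2 powr (- real a1 - \<beta> * real a2)"
    unfolding e walsh_W2_dens_def using b(1) g by (simp add: pos_divide_le_eq)
  \<comment> \<open>The logarithmic derivative of the density is - x / \<sigma>^2, and the product
    of the density with \<psi> is \<open>gauss \<rho>\<close>; so this is the second estimate of
    \<open>transform_bound\<close> in the form of a quotient.\<close>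
  have "\<bar>walsh_W2_dens (gauss \<sigma>) a1 a2 m' x * deriv (gauss \<sigma>) x\<bar> / ((gauss \<sigma> x)\<^sup>2 * \<psi> x)
    = \<bar>walsh_W2 a1 a2 m' (\<Phi> x)\<bar> * (\<bar>x\<bar> / \<sigma>\<^sup>2) / gauss \<rho> x"
    unfolding deriv_gauss walsh_W2_dens_def \<psi> using g by (simp add: abs_mult power2_eq_square field_simps)
  also have "\<dots> \<le> ?T * ?B * 2 powr (- real a1 - \<beta> * real a2)"
    by (subst pos_divide_le_eq[OF g(1)]) (rule b(2))
  finally show "\<bar>walsh_W2_dens (gauss \<sigma>) a1 a2 m' x * deriv (gauss \<sigma>) x\<bar> / ((gauss \<sigma> x)\<^sup>2 * \<psi> x)
    \<le> ?T * ?B * 2 powr (- real a1 - \<beta> * real a2)" .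
qed

end

subsection \<open>Bump functions\<close>

text \<open>The one-variable analogue of \<open>Ck\<close>. The derivative is a witness, so that
  explicit formulas can be supplied in inductions.\<close>

primrec Ck1 :: "nat \<Rightarrow> (real \<Rightarrow> real) \<Rightarrow> bool"
  where
    "Ck1 0 f \<longleftrightarrow> continuous_on UNIV f"
  | "Ck1 (Suc k) f \<longleftrightarrow> continuous_on UNIV f \<and> (\<exists>f'. (\<forall>x. (f has_real_derivative f' x) (at x)) \<and> Ck1 k f')"

lemma Ck1_SucI: "(\<And>x. (f has_real_derivative f' x) (at x)) \<Longrightarrow> Ck1 k f' \<Longrightarrow> Ck1 (Suc k) f"
  unfolding Ck1.simps using DERIV_isCont[of f] by (auto simp: continuous_on_eq_continuous_at)

lemma Ck1_Suc_imp: "Ck1 (Suc k) f \<Longrightarrow> Ck1 k f"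
proof (induction k arbitrary: f)
  case (Suc k)
  then obtain f' where "\<And>x. (f has_real_derivative f' x) (at x)" "Ck1 (Suc k) f'" by auto
  then show ?case using Suc.IH by (intro Ck1_SucI) blast+
qed simp

lemma Ck1_mult: "Ck1 k f \<Longrightarrow> Ck1 k g \<Longrightarrow> Ck1 k (\<lambda>x. f x * g x)"
proof (induction k arbitrary: f g)
  case 0
  then show ?case by (auto intro: continuous_intros)
next
  case (Suc k)
  then obtain f' g' where d: "\<And>x. (f has_real_derivative f' x) (at x)" "Ck1 k f'"
    "\<And>x. (g has_real_derivative g' x) (at x)" "Ck1 k g'" by auto
  have add: "Ck1 k (\<lambda>x. a x + b x)" if "Ck1 k a" "Ck1 k b" for a b
    using that
  proof (induction k arbitrary: a b)
    case 0
    then show ?case by (auto intro: continuous_intros)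
  next
    case (Suc k)
    then obtain a' b' where "\<And>x. (a has_real_derivative a' x) (at x)" "Ck1 k a'"
      "\<And>x. (b has_real_derivative b' x) (at x)" "Ck1 k b'" by auto
    then show ?case using Suc.IH by (intro Ck1_SucI[where f'="\<lambda>x. a' x + b' x"]) (auto intro!: derivative_intros)
  qed
  have "Ck1 k (\<lambda>x. f' x * g x + f x * g' x)"
    using Suc.IH[OF d(2) Ck1_Suc_imp[OF Suc.prems(2)]] Suc.IH[OF Ck1_Suc_imp[OF Suc.prems(1)] d(4)] by (rule add)
  moreover have "((\<lambda>x. f x * g x) has_real_derivative f' x * g x + f x * g' x) (at x)" for x
    using DERIV_mult[OF d(1)[of x] d(3)[of x]] by (simp add: mult.commute add.commute)
  ultimately show ?case by (rule Ck1_SucI[rotated])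
qed

lemma Ck1_affine: "Ck1 k f \<Longrightarrow> Ck1 k (\<lambda>x. b * f (c * x + d))"
proof (induction k arbitrary: f b)
  case 0
  then show ?case by (auto intro!: continuous_intros continuous_on_compose2[of UNIV f])
next
  case (Suc k)
  then obtain f' where d: "\<And>x. (f has_real_derivative f' x) (at x)" "Ck1 k f'" by auto
  have "((\<lambda>x. b * f (c * x + d)) has_real_derivative (b * c) * f' (c * x + d)) (at x)" for x
    by (auto intro!: derivative_eq_intros DERIV_chain2[OF d(1)])
  then show ?case using Suc.IH[OF d(2)] by (rule Ck1_SucI)
qed

text \<open>The classical flat function exp (- e / s), with a polynomial in 1 / s in front so that
  the family is closed under differentiation.\<close>

definition flat_exp :: "real \<Rightarrow> real poly \<Rightarrow> real \<Rightarrow> real"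
  where "flat_exp e p s = (if 0 < s then poly p (1 / s) * exp (- e / s) else 0)"

lemma flat_exp_tendsto:
  assumes e: "0 < e" shows "(flat_exp e p \<longlongrightarrow> 0) (at_right 0)"
proof -
  have mono: "((\<lambda>x. x ^ i * exp (- e * x)) \<longlongrightarrow> 0) at_top" for i
  proof -
    have "filterlim (\<lambda>x. e * x) at_top at_top"
      using e by (intro filterlim_tendsto_pos_mult_at_top[OF tendsto_const _ filterlim_ident])
    from filterlim_compose[OF tendsto_power_div_exp_0[of i] this]
    have "((\<lambda>x. (1 / e ^ i) * ((e * x) ^ i / exp (e * x))) \<longlongrightarrow> (1 / e ^ i) * 0) at_top" by (intro tendsto_mult tendsto_const)
    moreover have "(1 / e ^ i) * ((e * x) ^ i / exp (e * x)) = x ^ i * exp (- e * x)" for x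
      using e by (simp add: power_mult_distrib exp_minus field_simps)
    ultimately show ?thesis by (simp only: mult_zero_right)
  qed
  have "((\<lambda>x. \<Sum>i\<le>degree p. coeff p i * (x ^ i * exp (- e * x))) \<longlongrightarrow> (\<Sum>i\<le>degree p. coeff p i * 0)) at_top"
    by (intro tendsto_sum tendsto_mult tendsto_const mono)
  then have "((\<lambda>x. poly p x * exp (- e * x)) \<longlongrightarrow> 0) at_top"
    by (simp add: poly_altdef sum_distrib_right mult.assoc)
  from filterlim_compose[OF this filterlim_inverse_at_top_right]
  have "((\<lambda>s. poly p (inverse s) * exp (- e * inverse s)) \<longlongrightarrow> 0) (at_right 0)" .
  moreover have "\<forall>\<^sub>F s in at_right 0. poly p (inverse s) * exp (- e * inverse s) = flat_exp e p s"
    using eventually_at_right_less[of "0::real"] by eventually_elim (simp add: flat_exp_def divide_inverse)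
  ultimately show ?thesis by (rule Lim_transform_eventually)
qed

lemma flat_exp_tendsto_0:
  assumes e: "0 < e" shows "(flat_exp e p \<longlongrightarrow> 0) (at 0)"
proof (rule filterlim_split_at[OF _ flat_exp_tendsto[OF e]])
  have "\<forall>\<^sub>F s in at_left 0. flat_exp e p s = 0"
    using eventually_at_left_real[of "-1" 0] by (auto elim!: eventually_mono simp: flat_exp_def)
  then show "(flat_exp e p \<longlongrightarrow> 0) (at_left 0)" by (rule tendsto_eventually)
qed

text \<open>With t = 1 / s, the derivative of p(t) * exp (- e t) with respect to s is (e t^2 p(t) -
  t^2 p'(t)) * exp (- e t).\<close>

definition flat_exp_deriv :: "real \<Rightarrow> real poly \<Rightarrow> real poly"
  where "flat_exp_deriv e p = [:0, 0, e:] * p - [:0, 0, 1:] * pderiv p"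

lemma flat_exp_has_derivative:
  assumes e: "0 < e" shows "(flat_exp e p has_real_derivative flat_exp e (flat_exp_deriv e p) s) (at s)"
proof -
  consider "0 < s" | "s < 0" | "s = 0" by linarith
  then show ?thesis
  proof cases
    case 1
    have "((\<lambda>s. poly p (1 / s) * exp (- e / s)) has_real_derivative
      (poly (pderiv p) (1 / s) * (- 1 / s\<^sup>2)) * exp (- e / s) + poly p (1 / s) * (exp (- e / s) * (e / s\<^sup>2))) (at s)"
      using 1 by (auto intro!: derivative_eq_intros poly_DERIV[THEN DERIV_chain2] simp: power2_eq_square)
    also have "(poly (pderiv p) (1 / s) * (- 1 / s\<^sup>2)) * exp (- e / s) + poly p (1 / s) * (exp (- e / s) * (e / s\<^sup>2))
      = flat_exp e (flat_exp_deriv e p) s"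
      using 1 by (simp add: flat_exp_def flat_exp_deriv_def power2_eq_square field_simps)
    finally show ?thesis
    proof (rule has_field_derivative_transform_within_open[where S="{0<..}"])
      show "poly p (1 / x) * exp (- e / x) = flat_exp e p x" if "x \<in> {0<..}" for x using that by (simp add: flat_exp_def)
    qed (use 1 in auto)
  next
    case 2
    have "((\<lambda>s. 0) has_real_derivative 0) (at s)" by simp
    then have "(flat_exp e p has_real_derivative 0) (at s)"
      by (rule has_field_derivative_transform_within_open[where S="{..<0}"]) (use 2 in \<open>auto simp: flat_exp_def\<close>)
    then show ?thesis using 2 by (simp add: flat_exp_def)
  next
    case 3
    \<comment> \<open>At 0 the difference quotient is itself a flat function, with the polynomial t
      * p(t), and so tends to 0.\<close>
    have "((\<lambda>h. (flat_exp e p (0 + h) - flat_exp e p 0) / h) \<longlongrightarrow> 0) (at 0)"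
    proof (rule Lim_transform_eventually[OF flat_exp_tendsto_0[OF e, of "[:0, 1:] * p"]])
      show "\<forall>\<^sub>F h in at 0. flat_exp e ([:0, 1:] * p) h = (flat_exp e p (0 + h) - flat_exp e p 0) / h"
        by (intro always_eventually allI) (simp add: flat_exp_def)
    qed
    then have "(flat_exp e p has_real_derivative 0) (at 0)" by (simp add: DERIV_def)
    then show ?thesis using 3 by (simp add: flat_exp_def)
  qed
qed

lemma Ck1_flat_exp: "0 < e \<Longrightarrow> Ck1 k (flat_exp e p)"
proof (induction k arbitrary: p)
  case 0
  then show ?case using flat_exp_has_derivative DERIV_isCont by (force simp: continuous_on_eq_continuous_at)
next
  case (Suc k)
  then show ?case by (intro Ck1_SucI[OF flat_exp_has_derivative]) auto
qed

text \<open>The parameter e acts twice: it keeps the support at distance e from the ends of the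
  interval, and it makes the exponentials tend to 1 inside as e goes to 0. Thus smooth functions of
  compact support converge to the indicator.\<close>

definition bump1 :: "real \<Rightarrow> real \<Rightarrow> real \<Rightarrow> real \<Rightarrow> real"
  where "bump1 e a b s = flat_exp e 1 (s - a - e) * flat_exp e 1 (b - e - s)"

lemma Ck1_bump1: "0 < e \<Longrightarrow> Ck1 k (bump1 e a b)"
proof -
  assume e: "0 < e"
  have "Ck1 k (\<lambda>s. 1 * flat_exp e 1 (1 * s + (- a - e)))" "Ck1 k (\<lambda>s. 1 * flat_exp e 1 ((-1) * s + (b - e)))"
    by (rule Ck1_affine[OF Ck1_flat_exp[OF e]])+
  from Ck1_mult[OF this] have "Ck1 k (\<lambda>s. (1 * flat_exp e 1 (1 * s + (- a - e))) * (1 * flat_exp e 1 ((-1) * s + (b - e))))" .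
  moreover have "(\<lambda>s. (1 * flat_exp e 1 (1 * s + (- a - e))) * (1 * flat_exp e 1 ((-1) * s + (b - e)))) = bump1 e a b"
    unfolding bump1_def by (intro ext arg_cong2[of _ _ _ _ "(*)"]) (simp_all add: algebra_simps)
  ultimately show ?thesis by simp
qed

lemma flat_exp_1_bounds: "0 < e \<Longrightarrow> 0 \<le> flat_exp e 1 s" "0 < e \<Longrightarrow> flat_exp e 1 s \<le> 1"
  unfolding flat_exp_def by auto

lemma bump1_bounds: "0 < e \<Longrightarrow> 0 \<le> bump1 e a b s" "0 < e \<Longrightarrow> bump1 e a b s \<le> 1"
  unfolding bump1_def by (auto intro!: mult_nonneg_nonneg mult_le_one flat_exp_1_bounds)

lemma bump1_support: "bump1 e a b s \<noteq> 0 \<Longrightarrow> a + e < s \<and> s < b - e"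
  unfolding bump1_def flat_exp_def by (auto split: if_splits)

lemma bump1_tendsto:
  "(\<lambda>n. bump1 (1 / real (Suc n)) a b s) \<longlonglongrightarrow> (if a < s \<and> s < b then 1 else 0)"
proof -
  have e0: "(\<lambda>n. 1 / real (Suc n)) \<longlonglongrightarrow> 0" using LIMSEQ_inverse_real_of_nat by (simp add: inverse_eq_divide)
  have 1: "(\<lambda>n. flat_exp (1 / real (Suc n)) 1 (c - 1 / real (Suc n))) \<longlonglongrightarrow> 1" if "0 < c" for c
  proof -
    have "(\<lambda>n. exp (- (1 / real (Suc n)) / (c - 1 / real (Suc n)))) \<longlonglongrightarrow> exp (- 0 / (c - 0))"
      using that by (intro tendsto_intros e0) auto
    then have l: "(\<lambda>n. exp (- (1 / real (Suc n)) / (c - 1 / real (Suc n)))) \<longlonglongrightarrow> 1" by simp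
    have "\<forall>\<^sub>F n in sequentially. 1 / real (Suc n) < c" by (rule order_tendstoD(2)[OF e0 that])
    then have "\<forall>\<^sub>F n in sequentially. exp (- (1 / real (Suc n)) / (c - 1 / real (Suc n))) = flat_exp (1 / real (Suc n)) 1 (c - 1 / real (Suc n))"
      by eventually_elim (simp add: flat_exp_def)
    then show ?thesis by (rule Lim_transform_eventually[OF l])
  qed
  show ?thesis
  proof (cases "a < s \<and> s < b")
    case True
    have "(\<lambda>n. flat_exp (1 / real (Suc n)) 1 ((s - a) - 1 / real (Suc n)) * flat_exp (1 / real (Suc n)) 1 ((b - s) - 1 / real (Suc n))) \<longlonglongrightarrow> 1 * 1"
      using True by (intro tendsto_mult 1) auto
    moreover have "(s - a) - x = s - a - x" "(b - s) - x = b - x - s" for x by simp_all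
    ultimately show ?thesis using True unfolding bump1_def by (simp only: if_True mult_1 simp_thms)
  next
    case False
    have z: "bump1 (1 / real (Suc n)) a b s = 0" for n
    proof (rule ccontr)
      assume "bump1 (1 / real (Suc n)) a b s \<noteq> 0"
      from bump1_support[OF this] have "a + 1 / real (Suc n) < s \<and> s < b - 1 / real (Suc n)" .
      moreover have "0 < 1 / real (Suc n)" by simp
      ultimately show False using False by linarith
    qed
    show ?thesis by (simp only: if_not_P[OF False] z tendsto_const)
  qed
qed

text \<open>A partial derivative replaces one factor by its derivative, so the induction stays
  within products of one-variable functions.\<close>

lemma Ck_prod_Ck1:
  fixes \<eta> :: "'d::euclidean_space \<Rightarrow> real \<Rightarrow> real"
  assumes "\<And>i. i \<in> Basis \<Longrightarrow> Ck1 k (\<eta> i)"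
  shows "Ck k (\<lambda>x. \<Prod>i\<in>Basis. \<eta> i (x \<bullet> i))"
  using assms
proof (induction k arbitrary: \<eta>)
  case 0
  have "continuous_on UNIV (\<lambda>x. \<eta> i (x \<bullet> i))" if "i \<in> Basis" for i :: 'd
  proof (rule continuous_on_compose2[of UNIV "\<eta> i" UNIV])
    show "continuous_on UNIV (\<eta> i)" using 0 that by simp
    show "continuous_on UNIV (\<lambda>x. x \<bullet> i)" by (intro continuous_intros)
  qed simp
  then show ?case unfolding Ck.simps by (rule continuous_on_prod)
next
  case (Suc k)
  then have "\<forall>i\<in>Basis. \<exists>f'. (\<forall>x. (\<eta> i has_real_derivative f' x) (at x)) \<and> Ck1 k f'" by auto
  then obtain \<eta>' where d: "\<And>i x. i \<in> Basis \<Longrightarrow> (\<eta> i has_real_derivative \<eta>' i x) (at x)" "\<And>i. i \<in> Basis \<Longrightarrow> Ck1 k (\<eta>' i)" by metis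
  have hd: "((\<lambda>x. \<Prod>i\<in>Basis. \<eta> i (x \<bullet> i)) has_derivative
     (\<lambda>y. \<Sum>i\<in>Basis. (\<eta>' i (x \<bullet> i) * (y \<bullet> i)) * (\<Prod>j\<in>Basis - {i}. \<eta> j (x \<bullet> j)))) (at x)" for x :: 'd
  proof (rule has_derivative_prod)
    fix i :: 'd assume i: "i \<in> Basis"
    have "((\<lambda>x. x \<bullet> i) has_derivative (\<lambda>y. y \<bullet> i)) (at x)" by (auto intro!: derivative_eq_intros)
    from has_derivative_compose[OF this d(1)[OF i, unfolded has_field_derivative_def]]
    show "((\<lambda>x. \<eta> i (x \<bullet> i)) has_derivative (\<lambda>y. \<eta>' i (x \<bullet> i) * (y \<bullet> i))) (at x)" .
  qed
  have fd: "frechet_derivative (\<lambda>x. \<Prod>i\<in>Basis. \<eta> i (x \<bullet> i)) (at x) b = (\<Prod>i\<in>Basis. (\<eta>(b := \<eta>' b)) i (x \<bullet> i))" if b: "b \<in> Basis" for b x :: 'd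
  proof -
    have "frechet_derivative (\<lambda>x. \<Prod>i\<in>Basis. \<eta> i (x \<bullet> i)) (at x) b
      = (\<Sum>i\<in>Basis. (\<eta>' i (x \<bullet> i) * (b \<bullet> i)) * (\<Prod>j\<in>Basis - {i}. \<eta> j (x \<bullet> j)))"
      unfolding frechet_derivative_at[OF hd[of x], symmetric] ..
    also have "\<dots> = (\<Sum>i\<in>Basis. if i = b then \<eta>' b (x \<bullet> b) * (\<Prod>j\<in>Basis - {b}. \<eta> j (x \<bullet> j)) else 0)"
      using b by (intro sum.cong) (auto simp: inner_Basis)
    also have "\<dots> = \<eta>' b (x \<bullet> b) * (\<Prod>j\<in>Basis - {b}. \<eta> j (x \<bullet> j))" using b by simp
    also have "\<dots> = (\<Prod>i\<in>Basis. (\<eta>(b := \<eta>' b)) i (x \<bullet> i))"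
      using b by (subst prod.remove[of _ b]) (auto intro!: prod.cong)
    finally show ?thesis .
  qed
  show ?case unfolding Ck.simps
  proof (intro conjI allI ballI)
    show "(\<lambda>x. \<Prod>i\<in>Basis. \<eta> i (x \<bullet> i)) differentiable (at x)" for x using hd unfolding differentiable_def by blast
    fix b :: 'd assume b: "b \<in> Basis"
    have "Ck k (\<lambda>x. \<Prod>i\<in>Basis. (\<eta>(b := \<eta>' b)) i (x \<bullet> i))"
      using Suc.prems d(2) Ck1_Suc_imp by (intro Suc.IH) auto
    then show "Ck k (\<lambda>x. frechet_derivative (\<lambda>x. \<Prod>i\<in>Basis. \<eta> i (x \<bullet> i)) (at x) b)" unfolding fd[OF b] .
  qed
qed

definition bump :: "real \<Rightarrow> 'd::euclidean_space \<Rightarrow> 'd \<Rightarrow> 'd \<Rightarrow> real"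
  where "bump e a b x = (\<Prod>i\<in>Basis. bump1 e (a \<bullet> i) (b \<bullet> i) (x \<bullet> i))"

lemma bump_bounds: "0 < e \<Longrightarrow> \<bar>bump e a b x\<bar> \<le> 1"
proof -
  assume e: "0 < e"
  have "0 \<le> bump e a b x" "bump e a b x \<le> 1"
    unfolding bump_def using bump1_bounds[OF e] by (auto intro!: prod_nonneg prod_le_1)
  then show ?thesis by simp
qed

lemma bump_tendsto: "(\<lambda>n. bump (1 / real (Suc n)) a b x) \<longlonglongrightarrow> indicator (box a b) x"
proof -
  have "(\<lambda>n. bump (1 / real (Suc n)) a b x) \<longlonglongrightarrow> (\<Prod>i\<in>Basis. if a \<bullet> i < x \<bullet> i \<and> x \<bullet> i < b \<bullet> i then 1 else 0)"
    unfolding bump_def by (intro tendsto_prod bump1_tendsto)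
  moreover have "(\<Prod>i\<in>Basis. if a \<bullet> i < x \<bullet> i \<and> x \<bullet> i < b \<bullet> i then 1 else 0) = (indicator (box a b) x :: real)"
    by (auto simp: indicator_def mem_box intro!: prod.neutral prod_zero)
  ultimately show ?thesis by simp
qed

lemma test_function_continuous: "test_function D t \<Longrightarrow> continuous_on UNIV t"
proof -
  assume "test_function D t"
  then have "Ck 0 t" unfolding test_function_def by blast
  then show ?thesis by simp
qed

lemma test_function_bump:
  assumes e: "0 < e" and D: "box a b \<subseteq> D"
  shows "test_function D (bump e a b)"
proof -
  let ?c = "cbox (a + e *\<^sub>R One) (b - e *\<^sub>R One)"
  have One: "One \<bullet> i = 1" if "i \<in> Basis" for i :: 'a
    using that by (simp add: inner_sum_left inner_Basis)
  have "{x. bump e a b x \<noteq> 0} \<subseteq> ?c"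
  proof
    fix x assume "x \<in> {x. bump e a b x \<noteq> 0}"
    then have "bump1 e (a \<bullet> i) (b \<bullet> i) (x \<bullet> i) \<noteq> 0" if "i \<in> Basis" for i
      using that unfolding bump_def by (auto simp: prod_zero_iff)
    then have "a \<bullet> i + e < x \<bullet> i \<and> x \<bullet> i < b \<bullet> i - e" if "i \<in> Basis" for i using bump1_support that by blast
    then show "x \<in> ?c" by (auto simp: mem_box inner_add_left inner_diff_left One less_imp_le)
  qed
  then have sub: "closure {x. bump e a b x \<noteq> 0} \<subseteq> ?c" by (intro closure_minimal) auto
  have "?c \<subseteq> box a b" using e by (force simp: mem_box inner_add_left inner_diff_left One)
  moreover have "compact (closure {x. bump e a b x \<noteq> 0})"
    using compact_Int_closed[OF compact_cbox closed_closure, of "a + e *\<^sub>R One" "b - e *\<^sub>R One" "{x. bump e a b x \<noteq> 0}"] sub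
    by (simp add: Int_absorb1)
  moreover have "Ck k (bump e a b)" for k
    unfolding bump_def[abs_def] by (rule Ck_prod_Ck1) (rule Ck1_bump1[OF e])
  ultimately show ?thesis using sub D unfolding test_function_def by blast
qed

subsection \<open>The fundamental lemma of the calculus of variations\<close>

text \<open>Boxes form an intersection-stable generator of the Borel sets, so the vanishing of
  integrals extends to all Borel sets; the total integral enters when passing to
  complements.\<close>

lemma integral_boxes_zero:
  fixes f :: "'d::euclidean_space \<Rightarrow> real"
  assumes f: "integrable lborel f" and z: "\<And>a b. (\<integral>x. indicator (box a b) x * f x \<partial>lborel) = 0" and t: "(\<integral>x. f x \<partial>lborel) = 0"
  shows "AE x in lborel. f x = 0"
proof -
  have sb: "sets borel = sigma_sets UNIV (range (\<lambda>(a, b). box a b :: 'd set))"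
    by (subst borel_eq_box) (rule sets_measure_of, simp)
  have P: "(\<integral>x. indicator A x * f x \<partial>lborel) = 0" if "A \<in> sets borel" for A
  proof -
    have "Int_stable (range (\<lambda>(a, b). box a b :: 'd set))"
      unfolding Int_stable_def by (auto simp: box_Int_box)
    moreover have "range (\<lambda>(a, b). box a b :: 'd set) \<subseteq> Pow UNIV" by simp
    moreover have "A \<in> sigma_sets UNIV (range (\<lambda>(a, b). box a b :: 'd set))" using that unfolding sb .
    ultimately show ?thesis
    proof (induction A rule: sigma_sets_induct_disjoint)
      case (basic A)
      then show ?case using z by auto
    next
      case (compl A)
      have "A \<in> sets borel" using compl(1) unfolding sb .
      then have "integrable lborel (\<lambda>x. indicator A x * f x)" using integrable_mult_indicator[OF _ f, of A] by simp
      then have "(\<integral>x. f x - indicator A x * f x \<partial>lborel) = 0" using f t compl(2) by simp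
      moreover have "indicator (UNIV - A) x * f x = f x - indicator A x * f x" for x by (simp add: indicator_def)
      ultimately show ?case by (simp only:)
    next
      case (union A)
      have Am: "A i \<in> sets borel" for i using union(2) unfolding sb by auto
      have "(\<integral>x\<in>(\<Union>i. A i). f x \<partial>lborel) = (\<Sum>i. (\<integral>x\<in>A i. f x \<partial>lborel))"
      proof (rule lebesgue_integral_countable_add)
        show "A i \<inter> A j = {}" if "i \<noteq> j" for i j using union(1) that by (auto simp: disjoint_family_on_def)
        show "set_integrable lborel (\<Union>i. A i) f"
          unfolding set_integrable_def using Am by (intro integrable_mult_indicator f) auto
      qed (use Am in auto)
      then show ?case using union(3) by (simp add: set_lebesgue_integral_def)
    qed simp_all
  qed
  show ?thesis
  proof (rule density_unique_real)
    show "integrable lborel f" by (rule f)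
    show "integrable lborel (\<lambda>_. 0 :: real)" by simp
    show "(\<integral>x\<in>A. f x \<partial>lborel) = (\<integral>x\<in>A. 0 \<partial>lborel)" if "A \<in> sets lborel" for A
      using P[of A] that unfolding set_lebesgue_integral_def by simp
  qed
qed

text \<open>Bumps converge boundedly to the indicator of a box. Hence g has integral 0 over each box
  inside D and vanishes almost everywhere in it, and countably many rational boxes cover D.\<close>

lemma test_functions_separate:
  fixes g :: "'d::euclidean_space \<Rightarrow> real"
  assumes D: "open D" and g: "integrable (lebesgue_on D) g"
    and z: "\<And>t. test_function D t \<Longrightarrow> (\<integral>x. g x * t x \<partial>lebesgue_on D) = 0"
  shows "AE x in lebesgue_on D. g x = 0"
proof -
  have Ds: "D \<inter> space lebesgue \<in> sets lebesgue" using D by simp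
  define G where "G x = indicator D x * g x" for x
  have Gi: "integrable lebesgue G" using g integrable_restrict_space[OF Ds, of g] unfolding G_def by simp
  \<comment> \<open>Boxes generate only the Borel sets, so the extension of g by 0 is replaced by a
    Borel function that agrees with it almost everywhere.\<close>
  obtain g' where g': "g' \<in> borel_measurable lborel" "AE x in lborel. G x = g' x"
    using completion_ex_borel_measurable_real[of G lborel] Gi by auto
  have AEc: "AE x in lebesgue. G x = g' x" using g'(2) by (rule AE_completion)
  have g'l: "integrable lebesgue g'"
    using Gi g'(1) AEc by (subst integrable_cong_AE[symmetric, of G]) (auto intro: measurable_completion)
  then have g'i: "integrable lborel g'" using integrable_completion[OF g'(1)] by simp
  have tI: "(\<integral>x. g' x * t x \<partial>lborel) = 0" if t: "test_function D t" for t
  proof -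
    have tm: "t \<in> borel_measurable borel"
      by (rule borel_measurable_continuous_onI[OF test_function_continuous[OF t]])
    have "(\<integral>x. g x * t x \<partial>lebesgue_on D) = (\<integral>x. G x * t x \<partial>lebesgue)"
      unfolding integral_restrict_space[OF Ds] G_def by (simp add: mult.assoc)
    also have "\<dots> = (\<integral>x. g' x * t x \<partial>lebesgue)"
    proof (rule integral_cong_AE)
      show "AE x in lebesgue. G x * t x = g' x * t x" using AEc by eventually_elim simp
      have "t \<in> borel_measurable lebesgue" using tm by (intro measurable_completion) simp
      then show "(\<lambda>x. G x * t x) \<in> borel_measurable lebesgue" "(\<lambda>x. g' x * t x) \<in> borel_measurable lebesgue"
        using Gi g'l by auto
    qed
    also have "\<dots> = (\<integral>x. g' x * t x \<partial>lborel)" using g'(1) tm by (intro integral_completion) auto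
    finally show ?thesis using z[OF t] by simp
  qed
  have box0: "(\<integral>x. indicator (box a b) x * g' x \<partial>lborel) = 0" if ab: "box a b \<subseteq> D" for a b
  proof -
    let ?t = "\<lambda>n. bump (1 / real (Suc n)) a b"
    have tt: "test_function D (?t n)" for n by (rule test_function_bump[OF _ ab]) simp
    have tm: "?t n \<in> borel_measurable borel" for n
      by (rule borel_measurable_continuous_onI[OF test_function_continuous[OF tt]])
    have "(\<lambda>n. \<integral>x. g' x * ?t n x \<partial>lborel) \<longlonglongrightarrow> (\<integral>x. indicator (box a b) x * g' x \<partial>lborel)"
    proof (rule integral_dominated_convergence[where w="\<lambda>x. \<bar>g' x\<bar>"])
      show "AE x in lborel. (\<lambda>n. g' x * ?t n x) \<longlonglongrightarrow> indicator (box a b) x * g' x"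
        by (intro AE_I2) (subst mult.commute, intro tendsto_mult tendsto_const bump_tendsto)
      show "AE x in lborel. norm (g' x * ?t n x) \<le> \<bar>g' x\<bar>" for n
        using bump_bounds[of "1 / real (Suc n)" a b] by (intro AE_I2) (simp add: abs_mult mult_left_le)
    qed (use g' tm g'i in auto)
    then show ?thesis using tI[OF tt] by (simp add: LIMSEQ_const_iff)
  qed
  have AEbox: "AE x in lborel. x \<in> box a b \<longrightarrow> g' x = 0" if ab: "box a b \<subseteq> D" for a b
  proof -
    have "AE x in lborel. indicator (box a b) x * g' x = 0"
    proof (rule integral_boxes_zero)
      show "integrable lborel (\<lambda>x. indicator (box a b) x * g' x)"
        using integrable_mult_indicator[OF _ g'i, of "box a b"] by simp
      show "(\<integral>x. indicator (box a b) x * g' x \<partial>lborel) = 0" by (rule box0[OF ab])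
      fix c d :: 'd
      obtain p q where pq: "box c d \<inter> box a b = box p q" by (auto simp: box_Int_box)
      have "box p q \<subseteq> D" using pq ab by blast
      moreover have "indicator (box c d) x * (indicator (box a b) x * g' x) = indicator (box p q) x * g' x" for x
        unfolding pq[symmetric] by (simp add: indicator_def)
      ultimately show "(\<integral>x. indicator (box c d) x * (indicator (box a b) x * g' x) \<partial>lborel) = 0"
        using box0[of p q] by (simp only:)
    qed
    then show ?thesis by eventually_elim (auto simp: indicator_def)
  qed
  define a' :: "('d \<Rightarrow> real \<times> real) \<Rightarrow> 'd" where "a' f = (\<Sum>i\<in>Basis. fst (f i) *\<^sub>R i)" for f
  define b' :: "('d \<Rightarrow> real \<times> real) \<Rightarrow> 'd" where "b' f = (\<Sum>i\<in>Basis. snd (f i) *\<^sub>R i)" for f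
  define I where "I = {f \<in> (Basis :: 'd set) \<rightarrow>\<^sub>E \<rat> \<times> \<rat>. box (a' f) (b' f) \<subseteq> D}"
  have DU: "D = (\<Union>f\<in>I. box (a' f) (b' f))"
    unfolding I_def a'_def b'_def by (rule open_UNION_box[OF D])
  have "countable I" unfolding I_def
    by (rule countable_subset[OF _ countable_PiE[of Basis "\<lambda>_. \<rat> \<times> \<rat>"]]) (auto simp: countable_rat)
  then have "AE x in lborel. \<forall>f\<in>I. x \<in> box (a' f) (b' f) \<longrightarrow> g' x = 0"
    by (subst AE_ball_countable) (auto simp: I_def intro!: AEbox)
  then have "AE x in lborel. x \<in> D \<longrightarrow> g' x = 0" by eventually_elim (subst DU, blast)
  then have "AE x in lebesgue. x \<in> D \<longrightarrow> g' x = 0" by (rule AE_completion)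
  then have "AE x in lebesgue. x \<in> D \<longrightarrow> g x = 0"
    using AEc by eventually_elim (auto simp: G_def)
  then show ?thesis by (subst AE_restrict_space_iff[OF Ds]) auto
qed

subsection \<open>The space of functions with weak gradients\<close>

lemma Ck_lincomb:
  fixes g h :: "'d::euclidean_space \<Rightarrow> real"
  shows "Ck k g \<Longrightarrow> Ck k h \<Longrightarrow> Ck k (\<lambda>x. a * g x + b * h x)"
proof (induction k arbitrary: g h)
  case 0
  then have "continuous_on UNIV g" "continuous_on UNIV h" by simp_all
  then show ?case unfolding Ck.simps
    by (intro continuous_on_add continuous_on_mult continuous_on_const)
next
  case (Suc k)
  have fd: "frechet_derivative (\<lambda>x. a * g x + b * h x) (at x) v = a * frechet_derivative g (at x) v + b * frechet_derivative h (at x) v"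
    "(\<lambda>x. a * g x + b * h x) differentiable (at x)" for x v
  proof -
    have "(g has_derivative frechet_derivative g (at x)) (at x)" "(h has_derivative frechet_derivative h (at x)) (at x)"
      using Suc.prems by (auto simp: frechet_derivative_works)
    then have d: "((\<lambda>x. a * g x + b * h x) has_derivative (\<lambda>v. a * frechet_derivative g (at x) v + b * frechet_derivative h (at x) v)) (at x)"
      by (auto intro!: derivative_eq_intros)
    then show "(\<lambda>x. a * g x + b * h x) differentiable (at x)" unfolding differentiable_def by blast
    show "frechet_derivative (\<lambda>x. a * g x + b * h x) (at x) v = a * frechet_derivative g (at x) v + b * frechet_derivative h (at x) v"
      unfolding frechet_derivative_at[OF d, symmetric] ..
  qed
  show ?case unfolding Ck.simps fd(1) using Suc by (auto intro: fd(2))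
qed

lemma grad_lincomb:
  assumes "test_function D g" "test_function D h"
  shows "grad (\<lambda>x. a * g x + b * h x) x = a *\<^sub>R grad g x + b *\<^sub>R grad h x"
proof -
  have "Ck (Suc 0) g" "Ck (Suc 0) h" using assms unfolding test_function_def by blast+
  then have "(g has_derivative frechet_derivative g (at x)) (at x)" "(h has_derivative frechet_derivative h (at x)) (at x)"
    by (auto simp: frechet_derivative_works)
  then have d: "((\<lambda>x. a * g x + b * h x) has_derivative (\<lambda>v. a * frechet_derivative g (at x) v + b * frechet_derivative h (at x) v)) (at x)"
    by (auto intro!: derivative_eq_intros)
  have "frechet_derivative (\<lambda>x. a * g x + b * h x) (at x) v = a * frechet_derivative g (at x) v + b * frechet_derivative h (at x) v" for v
    unfolding frechet_derivative_at[OF d, symmetric] ..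
  then show ?thesis unfolding grad_def
    by (simp add: scaleR_add_left sum.distrib scaleR_sum_right)
qed

lemma test_function_lincomb:
  assumes "test_function D g" "test_function D h"
  shows "test_function D (\<lambda>x. a * g x + b * h x)"
proof -
  let ?G = "closure {x. g x \<noteq> 0}" and ?H = "closure {x. h x \<noteq> 0}" and ?S = "closure {x. a * g x + b * h x \<noteq> 0}"
  have c: "compact ?G" "compact ?H" "?G \<subseteq> D" "?H \<subseteq> D" "\<And>k. Ck k g" "\<And>k. Ck k h"
    using assms unfolding test_function_def by auto
  have cl: "y \<in> closure A" if "y \<in> A" for y :: 'a and A using subsetD[OF closure_subset that] .
  have sub: "{x. a * g x + b * h x \<noteq> 0} \<subseteq> ?G \<union> ?H"
  proof
    fix x assume "x \<in> {x. a * g x + b * h x \<noteq> 0}"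
    then have "g x \<noteq> 0 \<or> h x \<noteq> 0" by auto
    then show "x \<in> ?G \<union> ?H"
    proof
      assume "g x \<noteq> 0"
      then show ?thesis by (intro UnI1 cl CollectI)
    next
      assume "h x \<noteq> 0"
      then show ?thesis by (intro UnI2 cl CollectI)
    qed
  qed
  have S: "?S \<subseteq> ?G \<union> ?H" by (rule closure_minimal[OF sub closed_Un[OF closed_closure closed_closure]])
  have "compact ((?G \<union> ?H) \<inter> ?S)" by (rule compact_Int_closed[OF compact_Un[OF c(1,2)] closed_closure])
  then have "compact ?S" by (simp only: Int_absorb1[OF S])
  moreover have "?S \<subseteq> D" using S c(3,4) by (meson Un_least order_trans)
  moreover have "Ck k (\<lambda>x. a * g x + b * h x)" for k by (rule Ck_lincomb[OF c(5,6)])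
  ultimately show ?thesis unfolding test_function_def by (intro conjI allI)
qed

lemma finite_measure_lebesgue_on:
  assumes "open D" "bounded D" shows "finite_measure (lebesgue_on (D :: 'd::euclidean_space set))"
proof (rule finite_measureI)
  have "D \<in> sets lebesgue" using assms(1) by simp
  then have "emeasure (lebesgue_on D) (space (lebesgue_on D)) = emeasure lebesgue D"
    by (simp add: emeasure_restrict_space space_restrict_space)
  also have "\<dots> < \<infinity>" using bounded_set_imp_lmeasurable[OF assms(2) \<open>D \<in> sets lebesgue\<close>] by (auto simp: fmeasurable_def)
  finally show "emeasure (lebesgue_on D) (space (lebesgue_on D)) \<noteq> \<infinity>" by simp
qed

text \<open>The crude inequality (x + y)^2 \<le> 2 x^2 + 2 y^2 is enough, as the estimate only
  serves to show convergence to 0.\<close>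

lemma in_L2_lincomb:
  assumes "in_L2 D g" "in_L2 D h" shows "in_L2 D (\<lambda>x. a *\<^sub>R g x + b *\<^sub>R h x)"
    and "(norm_L2 D (\<lambda>x. a *\<^sub>R g x + b *\<^sub>R h x))\<^sup>2 \<le> 2 * a\<^sup>2 * (norm_L2 D g)\<^sup>2 + 2 * b\<^sup>2 * (norm_L2 D h)\<^sup>2"
proof -
  let ?k = "\<lambda>x. a *\<^sub>R g x + b *\<^sub>R h x" and ?M = "lebesgue_on D"
  have m: "g \<in> borel_measurable ?M" "h \<in> borel_measurable ?M"
    and i: "integrable ?M (\<lambda>x. (norm (g x))\<^sup>2)" "integrable ?M (\<lambda>x. (norm (h x))\<^sup>2)"
    using assms unfolding in_L2_def by auto
  have km: "?k \<in> borel_measurable ?M" using m by simp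
  have pt: "(norm (?k x))\<^sup>2 \<le> 2 * a\<^sup>2 * (norm (g x))\<^sup>2 + 2 * b\<^sup>2 * (norm (h x))\<^sup>2" for x
  proof -
    have "(norm (?k x))\<^sup>2 \<le> (\<bar>a\<bar> * norm (g x) + \<bar>b\<bar> * norm (h x))\<^sup>2"
      using norm_triangle_ineq[of "a *\<^sub>R g x" "b *\<^sub>R h x"] by (intro power_mono) auto
    also have "\<dots> \<le> 2 * (\<bar>a\<bar> * norm (g x))\<^sup>2 + 2 * (\<bar>b\<bar> * norm (h x))\<^sup>2"
      using sum_squares_bound[of "\<bar>a\<bar> * norm (g x)" "\<bar>b\<bar> * norm (h x)"] by (simp add: power2_sum)
    finally show ?thesis by (simp add: power_mult_distrib)
  qed
  have ri: "integrable ?M (\<lambda>x. 2 * a\<^sup>2 * (norm (g x))\<^sup>2 + 2 * b\<^sup>2 * (norm (h x))\<^sup>2)" using i by simp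
  have ki: "integrable ?M (\<lambda>x. (norm (?k x))\<^sup>2)"
    by (rule Bochner_Integration.integrable_bound[OF ri]) (use km pt in auto)
  show "in_L2 D ?k" using km ki unfolding in_L2_def by blast
  have "(\<integral>x. (norm (?k x))\<^sup>2 \<partial>?M) \<le> (\<integral>x. 2 * a\<^sup>2 * (norm (g x))\<^sup>2 + 2 * b\<^sup>2 * (norm (h x))\<^sup>2 \<partial>?M)"
    by (rule integral_mono[OF ki ri pt])
  also have "\<dots> = 2 * a\<^sup>2 * (\<integral>x. (norm (g x))\<^sup>2 \<partial>?M) + 2 * b\<^sup>2 * (\<integral>x. (norm (h x))\<^sup>2 \<partial>?M)" using i by simp
  finally show "(norm_L2 D ?k)\<^sup>2 \<le> 2 * a\<^sup>2 * (norm_L2 D g)\<^sup>2 + 2 * b\<^sup>2 * (norm_L2 D h)\<^sup>2"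
    unfolding norm_L2_def by simp
qed

lemmas in_L2_lincomb_real = in_L2_lincomb[where 'b=real, unfolded real_scaleR_def]

lemma in_L2_inner_integrable:
  assumes "in_L2 D g" "in_L2 D h" shows "integrable (lebesgue_on D) (\<lambda>x. g x \<bullet> h x)"
proof -
  have m: "g \<in> borel_measurable (lebesgue_on D)" "h \<in> borel_measurable (lebesgue_on D)"
    and i: "integrable (lebesgue_on D) (\<lambda>x. (norm (g x))\<^sup>2)" "integrable (lebesgue_on D) (\<lambda>x. (norm (h x))\<^sup>2)"
    using assms unfolding in_L2_def by auto
  have "\<bar>g x \<bullet> h x\<bar> \<le> (norm (g x))\<^sup>2 + (norm (h x))\<^sup>2" for x
  proof -
    have "\<bar>g x \<bullet> h x\<bar> \<le> norm (g x) * norm (h x)" by (rule Cauchy_Schwarz_ineq2)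
    also have "\<dots> \<le> (norm (g x))\<^sup>2 + (norm (h x))\<^sup>2"
      using sum_squares_bound[of "norm (g x)" "norm (h x)"] mult_nonneg_nonneg[OF norm_ge_zero norm_ge_zero, of "g x" "h x"] by linarith
    finally show ?thesis .
  qed
  then show ?thesis
    by (intro Bochner_Integration.integrable_bound[OF Bochner_Integration.integrable_add[OF i]]) (use m in auto)
qed

lemma in_L2_cong_AE:
  assumes "AE x in lebesgue_on D. g x = h x" "g \<in> borel_measurable (lebesgue_on D)" "h \<in> borel_measurable (lebesgue_on D)"
  shows "norm_L2 D g = norm_L2 D h"
  unfolding norm_L2_def using assms by (intro arg_cong[of _ _ sqrt] integral_cong_AE) auto

lemma in_L2_bounded:
  fixes g :: "'d::euclidean_space \<Rightarrow> 'b::euclidean_space"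
  assumes "open D" "bounded D" "continuous_on UNIV g" "\<And>x. norm (g x) \<le> B" shows "in_L2 D g"
proof -
  interpret finite_measure "lebesgue_on D" by (rule finite_measure_lebesgue_on[OF assms(1,2)])
  have "g \<in> borel_measurable lebesgue"
    using borel_measurable_continuous_onI[OF assms(3)] by (intro measurable_completion) simp
  then have m: "g \<in> borel_measurable (lebesgue_on D)" by (rule measurable_restrict_space1)
  have "(norm (g x))\<^sup>2 \<le> B\<^sup>2" for x using assms(4)[of x] by (intro power_mono) auto
  then have "integrable (lebesgue_on D) (\<lambda>x. (norm (g x))\<^sup>2)"
    using m by (intro integrable_const_bound[of _ "B\<^sup>2"]) auto
  then show ?thesis using m unfolding in_L2_def by blast
qed

lemma compact_support_bounded:
  fixes g :: "'d::euclidean_space \<Rightarrow> 'b::euclidean_space"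
  assumes "compact K" "continuous_on UNIV g" "\<And>x. x \<notin> K \<Longrightarrow> g x = 0"
  obtains B where "\<And>x. norm (g x) \<le> B"
proof -
  have "bounded (g ` K)"
    by (intro compact_imp_bounded compact_continuous_image assms(1) continuous_on_subset[OF assms(2)]) auto
  then obtain B where B: "\<And>x. x \<in> K \<Longrightarrow> norm (g x) \<le> B" unfolding bounded_iff by blast
  have "norm (g x) \<le> \<bar>B\<bar>" for x by (cases "x \<in> K") (use B[of x] assms(3)[of x] in auto)
  then show ?thesis by (rule that)
qed

lemma test_function_in_L2:
  fixes D :: "'d::euclidean_space set"
  assumes D: "open D" "bounded D" and t: "test_function D t"
  shows "in_L2 D t" "in_L2 D (grad t)"
proof -
  let ?K = "closure {x. t x \<noteq> 0}"
  have K: "compact ?K" and C: "Ck 0 t" "Ck (Suc 0) t" using t unfolding test_function_def by blast+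
  have z: "t x = 0" if "x \<notin> ?K" for x using that subsetD[OF closure_subset, of x "{x. t x \<noteq> 0}"] by auto
  obtain B where "\<And>x. norm (t x) \<le> B" by (rule compact_support_bounded[OF K _ z]) (use C in auto)
  then show "in_L2 D t" using C by (intro in_L2_bounded[OF D]) auto
  have c: "continuous_on UNIV (grad t)"
    unfolding grad_def using C by (auto intro!: continuous_intros)
  \<comment> \<open>Off the closed support the function vanishes in a neighbourhood, and so does its
    derivative.\<close>
  have "grad t x = 0" if "x \<notin> ?K" for x
  proof -
    have "((\<lambda>_. 0) has_derivative (\<lambda>_. 0)) (at x)" by simp
    then have "(t has_derivative (\<lambda>_. 0)) (at x)"
    proof (rule has_derivative_transform_within_open[where s="- ?K"])
      show "open (- ?K)" by (rule open_Compl[OF closed_closure])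
      show "x \<in> - ?K" using that by (simp only: Compl_iff not_False_eq_True)
      show "0 = t y" if "y \<in> - ?K" for y using z[of y] that by (simp only: Compl_iff simp_thms)
    qed
    from frechet_derivative_at[OF this, symmetric] show ?thesis by (simp add: grad_def)
  qed
  then obtain B' where "\<And>x. norm (grad t x) \<le> B'" by (rule compact_support_bounded[OF K c]) auto
  then show "in_L2 D (grad t)" using c by (intro in_L2_bounded[OF D]) auto
qed

lemma in_L2_imp_integrable:
  assumes "open D" "bounded D" "in_L2 D g" shows "integrable (lebesgue_on D) (\<lambda>x. g x \<bullet> b)"
proof -
  have "in_L2 D (\<lambda>_. b)" using assms by (intro in_L2_bounded[of _ _ "norm b"]) auto
  then show ?thesis by (rule in_L2_inner_integrable[OF assms(3)])
qed

text \<open>\<open>wgrad\<close> picks an arbitrary weak gradient, so the linearity of gradients can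
  only hold almost everywhere; it rests on this uniqueness.\<close>

lemma is_weak_grad_unique:
  fixes D :: "'d::euclidean_space set"
  assumes D: "open D" "bounded D" and g: "is_weak_grad D v g" "is_weak_grad D v h"
  shows "AE x in lebesgue_on D. g x = h x"
proof -
  have L: "in_L2 D g" "in_L2 D h" using g unfolding is_weak_grad_def by auto
  have "AE x in lebesgue_on D. (g x - h x) \<bullet> b = 0" if b: "b \<in> Basis" for b
  proof (rule test_functions_separate[OF D(1)])
    have i: "integrable (lebesgue_on D) (\<lambda>x. g x \<bullet> b)" "integrable (lebesgue_on D) (\<lambda>x. h x \<bullet> b)"
      by (intro in_L2_imp_integrable D L)+
    then show "integrable (lebesgue_on D) (\<lambda>x. (g x - h x) \<bullet> b)" by (simp add: inner_diff_left)
    fix t assume t: "test_function D t"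
    have tb: "in_L2 D (\<lambda>x. t x *\<^sub>R b)"
    proof -
      have "in_L2 D t" by (rule test_function_in_L2[OF D t])
      then show ?thesis using b unfolding in_L2_def by (auto intro!: borel_measurable_scaleR)
    qed
    have "integrable (lebesgue_on D) (\<lambda>x. (g x \<bullet> b) * t x)" "integrable (lebesgue_on D) (\<lambda>x. (h x \<bullet> b) * t x)"
      using in_L2_inner_integrable[OF L(1) tb] in_L2_inner_integrable[OF L(2) tb] by (simp_all add: mult.commute)
    moreover have "(\<integral>x. (g x \<bullet> b) * t x \<partial>lebesgue_on D) = (\<integral>x. (h x \<bullet> b) * t x \<partial>lebesgue_on D)"
    proof -
      have "(\<integral>x. v x * (grad t x \<bullet> b) \<partial>lebesgue_on D) = - (\<integral>x. (g x \<bullet> b) * t x \<partial>lebesgue_on D)"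
        "(\<integral>x. v x * (grad t x \<bullet> b) \<partial>lebesgue_on D) = - (\<integral>x. (h x \<bullet> b) * t x \<partial>lebesgue_on D)"
        using g t b unfolding is_weak_grad_def by blast+
      then show ?thesis by linarith
    qed
    ultimately show "(\<integral>x. ((g x - h x) \<bullet> b) * t x \<partial>lebesgue_on D) = 0"
      by (simp add: inner_diff_left left_diff_distrib)
  qed
  then have "AE x in lebesgue_on D. \<forall>b\<in>Basis. (g x - h x) \<bullet> b = 0"
    by (intro AE_ball_countable[THEN iffD2] ballI) (auto simp: countable_finite)
  then show ?thesis by eventually_elim (simp add: euclidean_eq_iff[of "g _"] inner_diff_left)
qed

lemma is_weak_grad_lincomb:
  fixes D :: "'d::euclidean_space set"
  assumes D: "open D" "bounded D" and L: "in_L2 D u" "in_L2 D v" and g: "is_weak_grad D u g" "is_weak_grad D v h"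
  shows "is_weak_grad D (\<lambda>x. a * u x + b * v x) (\<lambda>x. a *\<^sub>R g x + b *\<^sub>R h x)"
  unfolding is_weak_grad_def
proof (intro conjI allI impI ballI)
  have gL: "in_L2 D g" "in_L2 D h" using g unfolding is_weak_grad_def by auto
  then show "in_L2 D (\<lambda>x. a *\<^sub>R g x + b *\<^sub>R h x)" by (rule in_L2_lincomb)
  fix t :: "'d \<Rightarrow> real" and c :: 'd assume t: "test_function D t" and c: "c \<in> Basis"
  have tL: "in_L2 D t" "in_L2 D (grad t)" by (rule test_function_in_L2[OF D t])+
  have tb: "in_L2 D (\<lambda>x. t x *\<^sub>R c)" using tL(1) c unfolding in_L2_def by (auto intro!: borel_measurable_scaleR)
  have gb: "in_L2 D (\<lambda>x. grad t x \<bullet> c)"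
  proof -
    have m: "(\<lambda>x. grad t x \<bullet> c) \<in> borel_measurable (lebesgue_on D)" using tL(2) unfolding in_L2_def
      by (intro borel_measurable_inner borel_measurable_const) blast
    have le: "norm ((norm (grad t x \<bullet> c))\<^sup>2) \<le> norm ((norm (grad t x))\<^sup>2)" for x
    proof -
      have "(norm (grad t x \<bullet> c))\<^sup>2 \<le> (norm (grad t x))\<^sup>2"
        using Basis_le_norm[OF c, of "grad t x"] by (intro power_mono) auto
      then show ?thesis by simp
    qed
    have i: "integrable (lebesgue_on D) (\<lambda>x. (norm (grad t x))\<^sup>2)" using tL(2) unfolding in_L2_def by blast
    have m2: "(\<lambda>x. (norm (grad t x \<bullet> c))\<^sup>2) \<in> borel_measurable (lebesgue_on D)"
      using m by (simp only: real_norm_def power2_abs) (rule borel_measurable_power)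
    have "integrable (lebesgue_on D) (\<lambda>x. (norm (grad t x \<bullet> c))\<^sup>2)"
      by (rule Bochner_Integration.integrable_bound[OF i m2 AE_I2[OF le]])
    then show ?thesis using m unfolding in_L2_def by blast
  qed
  have i: "integrable (lebesgue_on D) (\<lambda>x. u x * (grad t x \<bullet> c))" "integrable (lebesgue_on D) (\<lambda>x. v x * (grad t x \<bullet> c))"
    "integrable (lebesgue_on D) (\<lambda>x. (g x \<bullet> c) * t x)" "integrable (lebesgue_on D) (\<lambda>x. (h x \<bullet> c) * t x)"
    using in_L2_inner_integrable[OF L(1) gb] in_L2_inner_integrable[OF L(2) gb]
      in_L2_inner_integrable[OF gL(1) tb] in_L2_inner_integrable[OF gL(2) tb] by (simp_all add: mult.commute)
  have "(\<integral>x. (a * u x + b * v x) * (grad t x \<bullet> c) \<partial>lebesgue_on D)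
    = (\<integral>x. a * (u x * (grad t x \<bullet> c)) + b * (v x * (grad t x \<bullet> c)) \<partial>lebesgue_on D)"
    by (simp add: algebra_simps)
  also have "\<dots> = a * (\<integral>x. u x * (grad t x \<bullet> c) \<partial>lebesgue_on D) + b * (\<integral>x. v x * (grad t x \<bullet> c) \<partial>lebesgue_on D)"
    using i by simp
  also have "\<dots> = - (a * (\<integral>x. (g x \<bullet> c) * t x \<partial>lebesgue_on D) + b * (\<integral>x. (h x \<bullet> c) * t x \<partial>lebesgue_on D))"
    using g t c unfolding is_weak_grad_def by simp
  also have "\<dots> = - (\<integral>x. a * ((g x \<bullet> c) * t x) + b * ((h x \<bullet> c) * t x) \<partial>lebesgue_on D)"
    using i by simp
  also have "\<dots> = - (\<integral>x. ((a *\<^sub>R g x + b *\<^sub>R h x) \<bullet> c) * t x \<partial>lebesgue_on D)"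
    by (simp add: inner_add_left distrib_right mult.assoc)
  finally show "(\<integral>x. (a * u x + b * v x) * (grad t x \<bullet> c) \<partial>lebesgue_on D)
    = - (\<integral>x. ((a *\<^sub>R g x + b *\<^sub>R h x) \<bullet> c) * t x \<partial>lebesgue_on D)" .
qed

lemma is_weak_grad_wgrad: "v \<in> H1 D \<Longrightarrow> is_weak_grad D v (wgrad D v)"
  proof -
  assume "v \<in> H1 D"
  then have "\<exists>g. is_weak_grad D v g" unfolding H1_def by blast
  then show ?thesis unfolding wgrad_def by (rule someI_ex)
qed

lemma wgrad_in_L2: "v \<in> H1 D \<Longrightarrow> in_L2 D (wgrad D v)"
  by (drule is_weak_grad_wgrad) (simp only: is_weak_grad_def)

lemma H1_lincomb:
  fixes D :: "'d::euclidean_space set"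
  assumes D: "open D" "bounded D" and u: "u \<in> H1 D" "v \<in> H1 D"
  shows "(\<lambda>x. a * u x + b * v x) \<in> H1 D"
    and "AE x in lebesgue_on D. wgrad D (\<lambda>x. a * u x + b * v x) x = a *\<^sub>R wgrad D u x + b *\<^sub>R wgrad D v x"
proof -
  have L: "in_L2 D u" "in_L2 D v" using u unfolding H1_def by auto
  have w: "is_weak_grad D (\<lambda>x. a * u x + b * v x) (\<lambda>x. a *\<^sub>R wgrad D u x + b *\<^sub>R wgrad D v x)"
    by (intro is_weak_grad_lincomb D L is_weak_grad_wgrad u)
  then show m: "(\<lambda>x. a * u x + b * v x) \<in> H1 D"
    using in_L2_lincomb_real(1)[OF L] unfolding H1_def by blast
  show "AE x in lebesgue_on D. wgrad D (\<lambda>x. a * u x + b * v x) x = a *\<^sub>R wgrad D u x + b *\<^sub>R wgrad D v x"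
    by (rule is_weak_grad_unique[OF D is_weak_grad_wgrad[OF m] w])
qed

lemma norm_L2_tendsto_lincomb:
  assumes "\<And>n. in_L2 D (f n)" "\<And>n. in_L2 D (g n)" "(\<lambda>n. norm_L2 D (f n)) \<longlonglongrightarrow> 0" "(\<lambda>n. norm_L2 D (g n)) \<longlonglongrightarrow> 0"
  shows "(\<lambda>n. norm_L2 D (\<lambda>x. a *\<^sub>R f n x + b *\<^sub>R g n x)) \<longlonglongrightarrow> 0"
proof -
  have "(\<lambda>n. (norm_L2 D (\<lambda>x. a *\<^sub>R f n x + b *\<^sub>R g n x))\<^sup>2) \<longlonglongrightarrow> 0"
  proof (rule tendsto_sandwich[OF _ _ tendsto_const])
    have "(\<lambda>n. 2 * a\<^sup>2 * (norm_L2 D (f n))\<^sup>2 + 2 * b\<^sup>2 * (norm_L2 D (g n))\<^sup>2) \<longlonglongrightarrow> 2 * a\<^sup>2 * 0\<^sup>2 + 2 * b\<^sup>2 * 0\<^sup>2"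
      by (intro tendsto_intros assms)
    then show "(\<lambda>n. 2 * a\<^sup>2 * (norm_L2 D (f n))\<^sup>2 + 2 * b\<^sup>2 * (norm_L2 D (g n))\<^sup>2) \<longlonglongrightarrow> 0" by simp
    show "\<forall>\<^sub>F n in sequentially. (norm_L2 D (\<lambda>x. a *\<^sub>R f n x + b *\<^sub>R g n x))\<^sup>2 \<le> 2 * a\<^sup>2 * (norm_L2 D (f n))\<^sup>2 + 2 * b\<^sup>2 * (norm_L2 D (g n))\<^sup>2"
      by (intro always_eventually allI in_L2_lincomb(2) assms)
  qed simp
  then have "(\<lambda>n. sqrt ((norm_L2 D (\<lambda>x. a *\<^sub>R f n x + b *\<^sub>R g n x))\<^sup>2)) \<longlonglongrightarrow> sqrt 0" by (rule tendsto_real_sqrt)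
  moreover have "0 \<le> norm_L2 D h" for h :: "'a \<Rightarrow> 'b" unfolding norm_L2_def by simp
  ultimately show ?thesis by simp
qed

lemma in_L2_diff: "in_L2 D g \<Longrightarrow> in_L2 D h \<Longrightarrow> in_L2 D (\<lambda>x. g x - h x)"
proof -
  assume "in_L2 D g" "in_L2 D h"
  then have "in_L2 D (\<lambda>x. 1 *\<^sub>R g x + (-1) *\<^sub>R h x)" by (rule in_L2_lincomb)
  then show ?thesis by simp
qed

lemma H10_lincomb:
  fixes D :: "'d::euclidean_space set"
  assumes D: "open D" "bounded D" and u: "u \<in> H10 D" "v \<in> H10 D"
  shows "(\<lambda>x. a * u x + b * v x) \<in> H10 D"
proof -
  have H: "u \<in> H1 D" "v \<in> H1 D" using u unfolding H10_def by auto
  have L: "in_L2 D u" "in_L2 D v" using H unfolding H1_def by auto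
  have gL: "in_L2 D (wgrad D u)" "in_L2 D (wgrad D v)" using wgrad_in_L2 H by auto
  obtain t where t: "\<And>n. test_function D (t n)" "(\<lambda>n. norm_L2 D (\<lambda>x. u x - t n x)) \<longlonglongrightarrow> 0"
    "(\<lambda>n. norm_L2 D (\<lambda>x. wgrad D u x - grad (t n) x)) \<longlonglongrightarrow> 0" using u(1) unfolding H10_def by blast
  obtain r where r: "\<And>n. test_function D (r n)" "(\<lambda>n. norm_L2 D (\<lambda>x. v x - r n x)) \<longlonglongrightarrow> 0"
    "(\<lambda>n. norm_L2 D (\<lambda>x. wgrad D v x - grad (r n) x)) \<longlonglongrightarrow> 0" using u(2) unfolding H10_def by blast
  note tL = test_function_in_L2[OF D t(1)] and rL = test_function_in_L2[OF D r(1)]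
  let ?w = "\<lambda>x. a * u x + b * v x" and ?q = "\<lambda>n x. a * t n x + b * r n x"
  have q: "test_function D (?q n)" for n by (intro test_function_lincomb t r)
  have 1: "(\<lambda>n. norm_L2 D (\<lambda>x. ?w x - ?q n x)) \<longlonglongrightarrow> 0"
  proof -
    have "(\<lambda>n. norm_L2 D (\<lambda>x. a *\<^sub>R (u x - t n x) + b *\<^sub>R (v x - r n x))) \<longlonglongrightarrow> 0"
      by (intro norm_L2_tendsto_lincomb in_L2_diff L tL rL t r)
    then show ?thesis by (simp add: algebra_simps)
  qed
  have wL: "in_L2 D (wgrad D ?w)" by (rule wgrad_in_L2[OF H1_lincomb(1)[OF D H]])
  \<comment> \<open>The gradient chosen for the combination agrees with the combination of the
    chosen gradients only up to a null set, which the norm does not see.\<close>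
  have eq: "norm_L2 D (\<lambda>x. wgrad D ?w x - grad (?q n) x)
    = norm_L2 D (\<lambda>x. a *\<^sub>R (wgrad D u x - grad (t n) x) + b *\<^sub>R (wgrad D v x - grad (r n) x))" for n
  proof (rule in_L2_cong_AE)
    show "AE x in lebesgue_on D. wgrad D ?w x - grad (?q n) x
      = a *\<^sub>R (wgrad D u x - grad (t n) x) + b *\<^sub>R (wgrad D v x - grad (r n) x)"
      using H1_lincomb(2)[OF D H, of a b]
      by eventually_elim (simp add: grad_lincomb[OF t(1) r(1)] algebra_simps)
    show "(\<lambda>x. wgrad D ?w x - grad (?q n) x) \<in> borel_measurable (lebesgue_on D)"
      using in_L2_diff[OF wL test_function_in_L2(2)[OF D q]] unfolding in_L2_def by blast
    show "(\<lambda>x. a *\<^sub>R (wgrad D u x - grad (t n) x) + b *\<^sub>R (wgrad D v x - grad (r n) x)) \<in> borel_measurable (lebesgue_on D)"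
      using in_L2_lincomb(1)[OF in_L2_diff[OF gL(1) tL(2)] in_L2_diff[OF gL(2) rL(2)]] unfolding in_L2_def by blast
  qed
  have 2: "(\<lambda>n. norm_L2 D (\<lambda>x. wgrad D ?w x - grad (?q n) x)) \<longlonglongrightarrow> 0"
    unfolding eq by (intro norm_L2_tendsto_lincomb in_L2_diff gL tL rL t r)
  show ?thesis unfolding H10_def
    by (intro CollectI conjI exI[of _ ?q] allI H1_lincomb(1)[OF D H] q 1 2)
qed

lemma zero_in_H10:
  fixes D :: "'d::euclidean_space set"
  assumes D: "open D" "bounded D"
  shows "(\<lambda>_. 0) \<in> H10 D" "AE x in lebesgue_on D. wgrad D (\<lambda>_. 0) x = 0"
proof -
  have fd: "frechet_derivative (\<lambda>_. 0 :: real) (at x) = (\<lambda>_. 0)" for x :: 'd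
    by (rule frechet_derivative_at[symmetric]) simp
  have "Ck k (\<lambda>_ :: 'd. 0)" for k by (induction k) (simp_all add: fd)
  then have t: "test_function D (\<lambda>_. 0)" unfolding test_function_def by simp
  have g0: "grad (\<lambda>_ :: 'd. 0) = (\<lambda>_. 0)" unfolding grad_def fd by simp
  have L: "in_L2 D (\<lambda>_. 0 :: 'b::euclidean_space)" unfolding in_L2_def by simp
  have w: "is_weak_grad D (\<lambda>_. 0) (\<lambda>_. 0)" unfolding is_weak_grad_def using L by simp
  then have H: "(\<lambda>_. 0) \<in> H1 D" unfolding H1_def using L by blast
  show ae: "AE x in lebesgue_on D. wgrad D (\<lambda>_. 0) x = 0"
    by (rule is_weak_grad_unique[OF D is_weak_grad_wgrad[OF H] w])
  have "norm_L2 D (\<lambda>x. wgrad D (\<lambda>_. 0) x - 0) = norm_L2 D (\<lambda>_. 0 :: 'd)"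
    by (rule in_L2_cong_AE) (use ae wgrad_in_L2[OF H] in \<open>auto simp: in_L2_def\<close>)
  then show "(\<lambda>_. 0) \<in> H10 D" unfolding H10_def using H t g0
    by (auto intro!: exI[of _ "\<lambda>_ _. 0"] simp: norm_L2_def)
qed

lemma dual_V_lincomb:
  assumes "f \<in> dual_V D" "u \<in> H10 D" "v \<in> H10 D"
  shows "f (\<lambda>x. a * u x + b * v x) = a * f u + b * f v"
proof -
  have "\<forall>u\<in>H10 D. \<forall>v\<in>H10 D. \<forall>a b. f (\<lambda>x. a * u x + b * v x) = a * f u + b * f v"
    using assms(1) unfolding dual_V_def by blast
  from this[THEN bspec, OF assms(2), THEN bspec, OF assms(3), THEN spec, THEN spec, of a b] show ?thesis .
qed

lemma H10_sum:
  fixes D :: "'d::euclidean_space set"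
  assumes D: "open D" "bounded D" and I: "finite I" "\<And>i. i \<in> I \<Longrightarrow> e i \<in> H10 D"
  shows "(\<lambda>x. \<Sum>i\<in>I. c i * e i x) \<in> H10 D"
    and "AE x in lebesgue_on D. wgrad D (\<lambda>x. \<Sum>i\<in>I. c i * e i x) x = (\<Sum>i\<in>I. c i *\<^sub>R wgrad D (e i) x)"
    and "f \<in> dual_V D \<Longrightarrow> f (\<lambda>x. \<Sum>i\<in>I. c i * e i x) = (\<Sum>i\<in>I. c i * f (e i))"
proof -
  have "(\<lambda>x. \<Sum>i\<in>I. c i * e i x) \<in> H10 D
    \<and> (AE x in lebesgue_on D. wgrad D (\<lambda>x. \<Sum>i\<in>I. c i * e i x) x = (\<Sum>i\<in>I. c i *\<^sub>R wgrad D (e i) x))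
    \<and> (f \<in> dual_V D \<longrightarrow> f (\<lambda>x. \<Sum>i\<in>I. c i * e i x) = (\<Sum>i\<in>I. c i * f (e i)))"
    using I
  proof (induction I rule: finite_induct)
    case empty
    have "f (\<lambda>_. 0) = 0" if "f \<in> dual_V D"
    proof -
      have "f (\<lambda>x. 0 * (\<lambda>_. 0) x + 0 * (\<lambda>_. 0) x) = 0 * f (\<lambda>_. 0) + 0 * f (\<lambda>_. 0)"
        using that zero_in_H10(1)[OF D] by (intro dual_V_lincomb)
      then show ?thesis by simp
    qed
    then show ?case using zero_in_H10[OF D] by simp
  next
    case (insert j I)
    let ?v = "\<lambda>x. \<Sum>i\<in>I. c i * e i x"
    have ih: "?v \<in> H10 D" "AE x in lebesgue_on D. wgrad D ?v x = (\<Sum>i\<in>I. c i *\<^sub>R wgrad D (e i) x)"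
      "f \<in> dual_V D \<longrightarrow> f ?v = (\<Sum>i\<in>I. c i * f (e i))" using insert.IH insert.prems by auto
    have j: "e j \<in> H10 D" using insert.prems by simp
    have H1: "e j \<in> H1 D" "?v \<in> H1 D" using ih(1) j unfolding H10_def by auto
    have eq: "(\<lambda>x. \<Sum>i\<in>insert j I. c i * e i x) = (\<lambda>x. c j * e j x + 1 * ?v x)"
      using insert.hyps by simp
    have "AE x in lebesgue_on D. wgrad D (\<lambda>x. c j * e j x + 1 * ?v x) x = (\<Sum>i\<in>insert j I. c i *\<^sub>R wgrad D (e i) x)"
      using H1_lincomb(2)[OF D H1, of "c j" 1] ih(2) by eventually_elim (use insert.hyps in simp)
    moreover have "f (\<lambda>x. c j * e j x + 1 * ?v x) = (\<Sum>i\<in>insert j I. c i * f (e i))" if "f \<in> dual_V D"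
    proof -
      have "f (\<lambda>x. c j * e j x + 1 * ?v x) = c j * f (e j) + 1 * f ?v"
        using that j ih(1) by (intro dual_V_lincomb)
      then show ?thesis using ih(3) that insert.hyps by simp
    qed
    ultimately show ?case unfolding eq using H10_lincomb[OF D j ih(1)] by blast
  qed
  then show "(\<lambda>x. \<Sum>i\<in>I. c i * e i x) \<in> H10 D"
    "AE x in lebesgue_on D. wgrad D (\<lambda>x. \<Sum>i\<in>I. c i * e i x) x = (\<Sum>i\<in>I. c i *\<^sub>R wgrad D (e i) x)"
    "f \<in> dual_V D \<Longrightarrow> f (\<lambda>x. \<Sum>i\<in>I. c i * e i x) = (\<Sum>i\<in>I. c i * f (e i))" by blast+
qed

declare One_nat_def [simp del]

subsection \<open>Smooth functions of exponential growth\<close>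

abbreviation euclid :: "nat \<Rightarrow> (nat \<Rightarrow> real) measure"
  where "euclid s \<equiv> (\<Pi>\<^sub>M j\<in>{1..s}. lborel)"

abbreviation points :: "nat \<Rightarrow> (nat \<Rightarrow> real) set"
  where "points s \<equiv> {1..s} \<rightarrow>\<^sub>E UNIV"

text \<open>The growth caused by a log-normal coefficient. It is stable under sums and products and
  is beaten by every Gaussian factor.\<close>

definition exp_bounded :: "nat \<Rightarrow> ((nat \<Rightarrow> real) \<Rightarrow> real) \<Rightarrow> bool"
  where "exp_bounded s P \<longleftrightarrow> P \<in> borel_measurable (euclid s) \<and>
    (\<exists>C c. 0 \<le> C \<and> 0 \<le> c \<and> (\<forall>y\<in>points s. \<bar>P y\<bar> \<le> C * exp (c * (\<Sum>j\<in>{1..s}. \<bar>y j\<bar>))))"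

definition has_partial :: "nat \<Rightarrow> nat \<Rightarrow> ((nat \<Rightarrow> real) \<Rightarrow> real) \<Rightarrow> ((nat \<Rightarrow> real) \<Rightarrow> real) \<Rightarrow> bool"
  where "has_partial s j P Q \<longleftrightarrow> (\<forall>y\<in>points s. ((\<lambda>t. P (y(j := t))) has_real_derivative Q y) (at (y j)))"

text \<open>The derivatives are witnesses constrained on \<open>points s\<close> only, because
  values off the product space carry no meaning. No order of differentiation is prescribed.\<close>

primrec tame :: "nat \<Rightarrow> nat \<Rightarrow> ((nat \<Rightarrow> real) \<Rightarrow> real) \<Rightarrow> bool"
  where
    "tame s 0 P \<longleftrightarrow> exp_bounded s P"
  | "tame s (Suc n) P \<longleftrightarrow> exp_bounded s P \<and> (\<forall>j\<in>{1..s}. \<exists>Q. tame s n Q \<and> has_partial s j P Q)"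

lemma tame_SucE:
  assumes "tame s (Suc n) P" "j \<in> {1..s}" obtains D where "tame s n D" "has_partial s j P D"
  using assms unfolding tame.simps by blast

lemma tame_SucI:
  assumes "exp_bounded s P" "\<And>j. j \<in> {1..s} \<Longrightarrow> \<exists>D. tame s n D \<and> has_partial s j P D" shows "tame s (Suc n) P"
  using assms unfolding tame.simps by blast

lemma space_euclid [simp]: "space (euclid s) = points s" by (simp add: space_PiM)

lemma points_upd: "y \<in> points s \<Longrightarrow> j \<in> {1..s} \<Longrightarrow> y(j := t) \<in> points s"
  by (auto simp: PiE_iff extensional_def)

lemma exp_bounded_cong:
  assumes "\<And>y. y \<in> points s \<Longrightarrow> P y = Q y" shows "exp_bounded s P \<longleftrightarrow> exp_bounded s Q"
proof -
  have "P \<in> borel_measurable (euclid s) \<longleftrightarrow> Q \<in> borel_measurable (euclid s)"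
    by (rule measurable_cong) (simp add: assms)
  then show ?thesis unfolding exp_bounded_def using assms by simp
qed

lemma has_partial_cong:
  assumes "\<And>y. y \<in> points s \<Longrightarrow> P y = Q y" "j \<in> {1..s}" "has_partial s j P D" shows "has_partial s j Q D"
  using assms points_upd[OF _ assms(2)] unfolding has_partial_def by simp

lemma tame_cong:
  assumes "\<And>y. y \<in> points s \<Longrightarrow> P y = Q y" "tame s n P" shows "tame s n Q"
proof (cases n)
  case 0
  then show ?thesis using assms exp_bounded_cong[OF assms(1)] by simp
next
  case (Suc m)
  then show ?thesis using assms exp_bounded_cong[OF assms(1)] has_partial_cong[OF assms(1)] by (auto dest!: bspec)
qed

lemma tame_Suc_imp: "tame s (Suc n) P \<Longrightarrow> tame s n P"
proof (induction n arbitrary: P)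
  case (Suc n)
  show ?case
  proof (rule tame_SucI)
    show "exp_bounded s P" using Suc.prems unfolding tame.simps by blast
    fix j assume "j \<in> {1..s}"
    then show "\<exists>D. tame s n D \<and> has_partial s j P D" using Suc.prems Suc.IH by (meson tame_SucE)
  qed
qed simp

lemma tame_imp_exp_bounded: "tame s n P \<Longrightarrow> exp_bounded s P"
  by (cases n) auto

lemma exp_bounded_const: "exp_bounded s (\<lambda>_. c)"
  unfolding exp_bounded_def by (intro conjI exI[of _ "\<bar>c\<bar>"] exI[of _ 0]) auto

lemma exp_boundedE:
  assumes "exp_bounded s P"
  obtains C c where "0 \<le> C" "0 \<le> c" "\<And>y. y \<in> points s \<Longrightarrow> \<bar>P y\<bar> \<le> C * exp (c * (\<Sum>j\<in>{1..s}. \<bar>y j\<bar>))"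
  using assms unfolding exp_bounded_def by blast

lemma exp_boundedI:
  assumes "P \<in> borel_measurable (euclid s)" "0 \<le> C" "0 \<le> c"
    "\<And>y. y \<in> points s \<Longrightarrow> \<bar>P y\<bar> \<le> C * exp (c * (\<Sum>j\<in>{1..s}. \<bar>y j\<bar>))"
  shows "exp_bounded s P"
  using assms unfolding exp_bounded_def by blast

lemma exp_bounded_add:
  assumes "exp_bounded s P" "exp_bounded s Q" shows "exp_bounded s (\<lambda>y. P y + Q y)"
proof -
  obtain C c where 1: "0 \<le> C" "0 \<le> c" "\<And>y. y \<in> points s \<Longrightarrow> \<bar>P y\<bar> \<le> C * exp (c * (\<Sum>j\<in>{1..s}. \<bar>y j\<bar>))"
    using exp_boundedE[OF assms(1)] by blast
  obtain C' c' where 2: "0 \<le> C'" "0 \<le> c'" "\<And>y. y \<in> points s \<Longrightarrow> \<bar>Q y\<bar> \<le> C' * exp (c' * (\<Sum>j\<in>{1..s}. \<bar>y j\<bar>))"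
    using exp_boundedE[OF assms(2)] by blast
  have "\<bar>P y + Q y\<bar> \<le> (C + C') * exp ((c + c') * (\<Sum>j\<in>{1..s}. \<bar>y j\<bar>))" if y: "y \<in> points s" for y
  proof -
    let ?r = "\<Sum>j\<in>{1..s}. \<bar>y j\<bar>"
    have r: "0 \<le> ?r" by (intro sum_nonneg) auto
    have "C * exp (c * ?r) \<le> C * exp ((c + c') * ?r)" "C' * exp (c' * ?r) \<le> C' * exp ((c + c') * ?r)"
      using 1 2 r by (auto intro!: mult_left_mono mult_right_mono)
    then show ?thesis using 1(3)[OF y] 2(3)[OF y] by (simp add: distrib_right)
  qed
  then show ?thesis using assms 1 2 unfolding exp_bounded_def
    by (intro conjI borel_measurable_add exI[of _ "C + C'"] exI[of _ "c + c'"]) auto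
qed

lemma exp_bounded_mult:
  assumes "exp_bounded s P" "exp_bounded s Q" shows "exp_bounded s (\<lambda>y. P y * Q y)"
proof -
  obtain C c where 1: "0 \<le> C" "0 \<le> c" "\<And>y. y \<in> points s \<Longrightarrow> \<bar>P y\<bar> \<le> C * exp (c * (\<Sum>j\<in>{1..s}. \<bar>y j\<bar>))"
    using exp_boundedE[OF assms(1)] by blast
  obtain C' c' where 2: "0 \<le> C'" "0 \<le> c'" "\<And>y. y \<in> points s \<Longrightarrow> \<bar>Q y\<bar> \<le> C' * exp (c' * (\<Sum>j\<in>{1..s}. \<bar>y j\<bar>))"
    using exp_boundedE[OF assms(2)] by blast
  have "\<bar>P y * Q y\<bar> \<le> (C * C') * exp ((c + c') * (\<Sum>j\<in>{1..s}. \<bar>y j\<bar>))" if y: "y \<in> points s" for y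
  proof -
    have "\<bar>P y * Q y\<bar> \<le> (C * exp (c * (\<Sum>j\<in>{1..s}. \<bar>y j\<bar>))) * (C' * exp (c' * (\<Sum>j\<in>{1..s}. \<bar>y j\<bar>)))"
      unfolding abs_mult using 1 2 y by (intro mult_mono) auto
    then show ?thesis by (simp add: distrib_right exp_add mult_ac)
  qed
  then show ?thesis using assms 1 2 unfolding exp_bounded_def
    by (intro conjI borel_measurable_times exI[of _ "C * C'"] exI[of _ "c + c'"]) auto
qed

lemma exp_bounded_coord:
  assumes "j \<in> {1..s}" shows "exp_bounded s (\<lambda>y. y j)"
proof -
  have "\<bar>y j\<bar> \<le> 1 * exp (1 * (\<Sum>j\<in>{1..s}. \<bar>y j\<bar>))" for y :: "nat \<Rightarrow> real"
  proof -
    have "\<bar>y j\<bar> \<le> (\<Sum>j\<in>{1..s}. \<bar>y j\<bar>)" using assms by (intro member_le_sum) auto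
    also have "\<dots> \<le> exp (\<Sum>j\<in>{1..s}. \<bar>y j\<bar>)" using exp_ge_add_one_self[of "\<Sum>j\<in>{1..s}. \<bar>y j\<bar>"] by linarith
    finally show ?thesis by simp
  qed
  moreover have "(\<lambda>y. y j) \<in> borel_measurable (euclid s)"
    using measurable_component_singleton[OF assms, of "\<lambda>_. lborel"] by simp
  ultimately show ?thesis unfolding exp_bounded_def
    by (intro conjI exI[of _ 1]) auto
qed

lemma tame_const: "tame s n (\<lambda>_. c)"
proof (induction n arbitrary: c)
  case (Suc n)
  have "has_partial s j (\<lambda>_. c) (\<lambda>_. 0)" for j unfolding has_partial_def by simp
  then show ?case using Suc by (blast intro: tame_SucI exp_bounded_const)
qed (simp add: exp_bounded_const)

lemma tame_coord:
  assumes "j \<in> {1..s}" shows "tame s n (\<lambda>y. y j)"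
proof (cases n)
  case (Suc m)
  have "has_partial s i (\<lambda>y. y j) (\<lambda>_. if i = j then 1 else 0)" for i
    unfolding has_partial_def by (auto intro!: derivative_eq_intros)
  then show ?thesis unfolding Suc by (blast intro: tame_SucI exp_bounded_coord[OF assms] tame_const)
qed (simp add: exp_bounded_coord[OF assms])

lemma tame_add: "tame s n P \<Longrightarrow> tame s n Q \<Longrightarrow> tame s n (\<lambda>y. P y + Q y)"
proof (induction n arbitrary: P Q)
  case (Suc n)
  have "\<exists>D. tame s n D \<and> has_partial s j (\<lambda>y. P y + Q y) D" if "j \<in> {1..s}" for j
  proof -
    obtain D D' where "tame s n D" "has_partial s j P D" "tame s n D'" "has_partial s j Q D'"
      using Suc.prems \<open>j \<in> {1..s}\<close> by (meson tame_SucE)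
    then show ?thesis using Suc.IH[of D D'] unfolding has_partial_def
      by (intro exI[of _ "\<lambda>y. D y + D' y"]) (auto intro!: derivative_intros)
  qed
  then show ?case
    by (intro tame_SucI exp_bounded_add tame_imp_exp_bounded[OF Suc.prems(1)] tame_imp_exp_bounded[OF Suc.prems(2)]) blast+
qed (simp add: exp_bounded_add)

lemma has_partial_mult:
  assumes "has_partial s j P D" "has_partial s j Q D'"
  shows "has_partial s j (\<lambda>y. P y * Q y) (\<lambda>y. D y * Q y + P y * D' y)"
  using assms unfolding has_partial_def by (auto intro!: derivative_eq_intros)

lemma tame_mult: "tame s n P \<Longrightarrow> tame s n Q \<Longrightarrow> tame s n (\<lambda>y. P y * Q y)"
proof (induction n arbitrary: P Q)
  case (Suc n)
  have "\<exists>D. tame s n D \<and> has_partial s j (\<lambda>y. P y * Q y) D" if "j \<in> {1..s}" for j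
  proof -
    obtain D D' where "tame s n D" "has_partial s j P D" "tame s n D'" "has_partial s j Q D'"
      using Suc.prems \<open>j \<in> {1..s}\<close> by (meson tame_SucE)
    moreover have "tame s n P" "tame s n Q" using Suc.prems by (blast intro: tame_Suc_imp)+
    ultimately show ?thesis using Suc.IH has_partial_mult tame_add by metis
  qed
  then show ?case
    by (intro tame_SucI exp_bounded_mult tame_imp_exp_bounded[OF Suc.prems(1)] tame_imp_exp_bounded[OF Suc.prems(2)]) blast+
qed (simp add: exp_bounded_mult)

lemma tame_cmult: "tame s n P \<Longrightarrow> tame s n (\<lambda>y. c * P y)"
  using tame_mult[OF tame_const] .

lemma tame_diff: "tame s n P \<Longrightarrow> tame s n Q \<Longrightarrow> tame s n (\<lambda>y. P y - Q y)"
  using tame_add[of s n P "\<lambda>y. -1 * Q y"] tame_cmult[of s n Q "-1"] by simp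

text \<open>The derivative of 1 / P is - D / P^2, a product of functions already known to be tame. A
  bound on 1 / P cannot be inferred from P and has to be supplied.\<close>

lemma tame_inverse:
  assumes "tame s n P" "exp_bounded s (\<lambda>y. inverse (P y))" "\<And>y. y \<in> points s \<Longrightarrow> P y \<noteq> 0"
  shows "tame s n (\<lambda>y. inverse (P y))"
  using assms
proof (induction n)
  case (Suc n)
  have "\<exists>D. tame s n D \<and> has_partial s j (\<lambda>y. inverse (P y)) D" if "j \<in> {1..s}" for j
  proof -
    obtain D where D: "tame s n D" "has_partial s j P D" using tame_SucE[OF Suc.prems(1) \<open>j \<in> {1..s}\<close>] by blast
    have inv: "tame s n (\<lambda>y. inverse (P y))" using Suc.IH[OF tame_Suc_imp] Suc.prems by blast
    have "has_partial s j (\<lambda>y. inverse (P y)) (\<lambda>y. -1 * (D y * (inverse (P y) * inverse (P y))))"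
      using D(2) Suc.prems(3) unfolding has_partial_def by (auto intro!: derivative_eq_intros)
    moreover have "tame s n (\<lambda>y. -1 * (D y * (inverse (P y) * inverse (P y))))"
      by (intro tame_cmult tame_mult D inv)
    ultimately show ?thesis by blast
  qed
  then show ?case using Suc.prems by (intro tame_SucI) blast+
qed simp

subsection \<open>Smooth functions of Gaussian decay\<close>

definition damping :: "nat \<Rightarrow> real \<Rightarrow> (nat \<Rightarrow> real) \<Rightarrow> real"
  where "damping s \<kappa> y = (\<Prod>j\<in>{1..s}. exp (- \<kappa> * (y j)\<^sup>2))"

text \<open>The linear factors that arise from differentiating the Gaussian are absorbed into the
  tame factor, so \<kappa> is the same for all derivatives.\<close>

definition gsmooth :: "nat \<Rightarrow> real \<Rightarrow> nat \<Rightarrow> ((nat \<Rightarrow> real) \<Rightarrow> real) \<Rightarrow> bool"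
  where "gsmooth s \<kappa> n H \<longleftrightarrow> (\<exists>P. tame s n P \<and> (\<forall>y\<in>points s. H y = P y * damping s \<kappa> y))"

lemma has_partial_damping:
  assumes j: "j \<in> {1..s}"
  shows "has_partial s j (damping s \<kappa>) (\<lambda>y. -2 * \<kappa> * y j * damping s \<kappa> y)"
  unfolding has_partial_def
proof
  fix y assume y: "y \<in> points s"
  define R where "R = (\<Prod>i\<in>{1..s} - {j}. exp (- \<kappa> * (y i)\<^sup>2))"
  have d: "damping s \<kappa> (y(j := t)) = exp (- \<kappa> * t\<^sup>2) * R" for t
    unfolding damping_def R_def using j by (subst prod.remove[of _ j]) (auto intro!: prod.cong)
  have "((\<lambda>t. exp (- \<kappa> * t\<^sup>2) * R) has_real_derivative -2 * \<kappa> * y j * (exp (- \<kappa> * (y j)\<^sup>2) * R)) (at (y j))"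
    by (auto intro!: derivative_eq_intros)
  then show "((\<lambda>t. damping s \<kappa> (y(j := t))) has_real_derivative -2 * \<kappa> * y j * damping s \<kappa> y) (at (y j))"
    using d[of "y j"] by (simp add: d)
qed

lemma gsmooth_partial:
  assumes H: "gsmooth s \<kappa> (Suc n) H" and j: "j \<in> {1..s}"
  shows "gsmooth s \<kappa> n (partial_deriv j H)" "has_partial s j H (partial_deriv j H)"
proof -
  obtain P where P: "tame s (Suc n) P" "\<And>y. y \<in> points s \<Longrightarrow> H y = P y * damping s \<kappa> y"
    using H unfolding gsmooth_def by blast
  obtain D where D: "tame s n D" "has_partial s j P D" using P(1) j by (meson tame_SucE)
  have "has_partial s j (\<lambda>y. P y * damping s \<kappa> y) (\<lambda>y. D y * damping s \<kappa> y + P y * (-2 * \<kappa> * y j * damping s \<kappa> y))"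
    by (rule has_partial_mult[OF D(2) has_partial_damping[OF j]])
  then have h: "has_partial s j H (\<lambda>y. D y * damping s \<kappa> y + P y * (-2 * \<kappa> * y j * damping s \<kappa> y))"
    by (rule has_partial_cong[rotated 2]) (use P j in auto)
  then have eq: "partial_deriv j H y = D y * damping s \<kappa> y + P y * (-2 * \<kappa> * y j * damping s \<kappa> y)" if "y \<in> points s" for y
    using that unfolding has_partial_def partial_deriv_def by (auto intro: DERIV_imp_deriv)
  show "has_partial s j H (partial_deriv j H)" using h eq unfolding has_partial_def by simp
  have "tame s n (\<lambda>y. D y + P y * (-2 * \<kappa> * y j))"
    by (intro tame_add tame_mult tame_coord tame_const D(1) tame_Suc_imp[OF P(1)] j)
  moreover have "partial_deriv j H y = (D y + P y * (-2 * \<kappa> * y j)) * damping s \<kappa> y" if "y \<in> points s" for y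
    unfolding eq[OF that] by (simp add: algebra_simps)
  ultimately show "gsmooth s \<kappa> n (partial_deriv j H)" unfolding gsmooth_def by blast
qed

definition smooth_decay :: "nat \<Rightarrow> real \<Rightarrow> ((nat \<Rightarrow> real) \<Rightarrow> real) \<Rightarrow> bool"
  where "smooth_decay s \<kappa> H \<longleftrightarrow> (\<forall>n. gsmooth s \<kappa> n H)"

lemma smooth_decay_partial:
  assumes "smooth_decay s \<kappa> H" "j \<in> {1..s}"
  shows "smooth_decay s \<kappa> (partial_deriv j H)" "has_partial s j H (partial_deriv j H)"
  using assms gsmooth_partial unfolding smooth_decay_def by blast+

text \<open>\<open>mixed_deriv\<close> applies the derivative of the smallest index last. Inductions
  over index sets therefore insert a new minimum, which respects this order.\<close>

lemma mixed_deriv_insert_min: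
  assumes "finite u" "\<And>i. i \<in> u \<Longrightarrow> j < i"
  shows "mixed_deriv (insert j u) H = partial_deriv j (mixed_deriv u H)"
proof -
  have "j \<notin> u" using assms by auto
  have "sorted_list_of_set (insert j u) = insort j (sorted_list_of_set u)"
    using sorted_list_of_set_insert[OF assms(1) \<open>j \<notin> u\<close>] by simp
  also have "\<dots> = j # sorted_list_of_set u"
    using assms by (intro insort_is_Cons) (auto simp: less_imp_le)
  finally show ?thesis unfolding mixed_deriv_def by simp
qed

lemma smooth_decay_mixed:
  assumes "smooth_decay s \<kappa> H" "u \<subseteq> {1..s}" shows "smooth_decay s \<kappa> (mixed_deriv u H)"
proof -
  have "finite u" using assms(2) by (rule finite_subset) simp
  then show ?thesis using assms(2)
  proof (induction u rule: finite_linorder_min_induct)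
    case empty
    then show ?case using assms(1) by (simp add: mixed_deriv_def)
  next
    case (insert j u)
    then show ?case using mixed_deriv_insert_min[of u j H] smooth_decay_partial(1) by auto
  qed
qed

text \<open>Half of the Gaussian absorbs the exponential, by completing the square; the other half
  remains.\<close>

lemma exp_abs_square_le:
  fixes c t :: real
  assumes "0 < \<kappa>"
  shows "exp (c * \<bar>t\<bar> - \<kappa> * t\<^sup>2) \<le> exp (c\<^sup>2 / (2 * \<kappa>)) * exp (- (\<kappa> / 2) * t\<^sup>2)"
proof -
  have "0 \<le> (\<kappa> * \<bar>t\<bar> - c)\<^sup>2 / (2 * \<kappa>)" using assms by simp
  also have "(\<kappa> * \<bar>t\<bar> - c)\<^sup>2 / (2 * \<kappa>) = \<kappa> / 2 * t\<^sup>2 - c * \<bar>t\<bar> + c\<^sup>2 / (2 * \<kappa>)"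
    using assms by (simp add: power2_diff power_mult_distrib field_simps) (simp add: power2_eq_square)
  finally have "c * \<bar>t\<bar> - \<kappa> * t\<^sup>2 \<le> c\<^sup>2 / (2 * \<kappa>) + - (\<kappa> / 2) * t\<^sup>2" by simp
  then show ?thesis unfolding exp_add[symmetric] by simp
qed

lemma integrable_exp_abs_square:
  assumes "0 < \<kappa>" shows "integrable lborel (\<lambda>t. exp (c * \<bar>t\<bar> - \<kappa> * t\<^sup>2) :: real)"
proof (rule Bochner_Integration.integrable_bound)
  define \<tau> where "\<tau> = 1 / sqrt \<kappa>"
  have \<tau>: "0 < \<tau>" "\<tau>\<^sup>2 = 1 / \<kappa>" unfolding \<tau>_def using assms by (simp_all add: power_divide)
  have e: "exp (- (\<kappa> / 2) * t\<^sup>2) = sqrt (2 * pi * \<tau>\<^sup>2) * gauss \<tau> t" for t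
    unfolding normal_density_def \<tau>(2) using assms by simp
  show "integrable lborel (\<lambda>t. exp (c\<^sup>2 / (2 * \<kappa>)) * exp (- (\<kappa> / 2) * t\<^sup>2))"
    unfolding e using integrable_normal_density[OF \<tau>(1)] by simp
  show "AE t in lborel. norm (exp (c * \<bar>t\<bar> - \<kappa> * t\<^sup>2)) \<le> norm (exp (c\<^sup>2 / (2 * \<kappa>)) * exp (- (\<kappa> / 2) * t\<^sup>2))"
    using exp_abs_square_le[OF assms, of c] by simp
qed simp

definition exp_bounded1 :: "(real \<Rightarrow> real) \<Rightarrow> bool"
  where "exp_bounded1 p \<longleftrightarrow> p \<in> borel_measurable borel \<and> (\<exists>C c. 0 \<le> C \<and> 0 \<le> c \<and> (\<forall>t. \<bar>p t\<bar> \<le> C * exp (c * \<bar>t\<bar>)))"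

lemma exp_bounded1_imp:
  assumes "exp_bounded1 p" "j \<in> {1..s}" shows "exp_bounded s (\<lambda>y. p (y j))"
proof -
  obtain C c where c: "0 \<le> C" "0 \<le> c" "\<And>t. \<bar>p t\<bar> \<le> C * exp (c * \<bar>t\<bar>)" using assms unfolding exp_bounded1_def by blast
  have [measurable]: "p \<in> borel_measurable borel" "(\<lambda>y. y j) \<in> borel_measurable (euclid s)"
    using assms exp_bounded_coord[OF assms(2)] unfolding exp_bounded1_def exp_bounded_def by auto
  have "\<bar>p (y j)\<bar> \<le> C * exp (c * (\<Sum>j\<in>{1..s}. \<bar>y j\<bar>))" for y
  proof -
    have "\<bar>y j\<bar> \<le> (\<Sum>j\<in>{1..s}. \<bar>y j\<bar>)" using assms by (intro member_le_sum) auto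
    then have "C * exp (c * \<bar>y j\<bar>) \<le> C * exp (c * (\<Sum>j\<in>{1..s}. \<bar>y j\<bar>))" using c by (intro mult_left_mono) (auto intro: mult_left_mono)
    then show ?thesis using c(3)[of "y j"] by linarith
  qed
  moreover have "(\<lambda>y. p (y j)) \<in> borel_measurable (euclid s)" by measurable
  ultimately show ?thesis using c(1,2) unfolding exp_bounded_def by blast
qed

lemma exp_bounded_prod:
  "(\<And>i. i \<in> I \<Longrightarrow> exp_bounded s (P i)) \<Longrightarrow> exp_bounded s (\<lambda>y. \<Prod>i\<in>I. P i y)"
  by (induction I rule: infinite_finite_induct) (auto simp: exp_bounded_const exp_bounded_mult)

lemma damping_measurable: "damping s \<kappa> \<in> borel_measurable (euclid s)"
  unfolding damping_def
proof (rule borel_measurable_prod)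
  fix i assume "i \<in> {1..s}"
  then have [measurable]: "(\<lambda>y. y i) \<in> borel_measurable (euclid s)"
    using exp_bounded_coord unfolding exp_bounded_def by blast
  show "(\<lambda>y. exp (- \<kappa> * (y i)\<^sup>2)) \<in> borel_measurable (euclid s)" by measurable
qed

interpretation lborel_product: product_sigma_finite "\<lambda>_::nat. lborel :: real measure"
  by standard

lemma integrable_exp_bounded_damping:
  assumes P: "exp_bounded s P" and \<kappa>: "0 < \<kappa>"
  shows "integrable (euclid s) (\<lambda>y. P y * damping s \<kappa> y)"
proof -
  obtain C c where c: "0 \<le> C" "0 \<le> c" "\<And>y. y \<in> points s \<Longrightarrow> \<bar>P y\<bar> \<le> C * exp (c * (\<Sum>j\<in>{1..s}. \<bar>y j\<bar>))"
    using exp_boundedE[OF P] by blast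
  show ?thesis
  proof (rule Bochner_Integration.integrable_bound)
    show "integrable (euclid s) (\<lambda>y. C * (\<Prod>j\<in>{1..s}. exp (c * \<bar>y j\<bar> - \<kappa> * (y j)\<^sup>2)))"
      by (intro integrable_mult_right lborel_product.product_integrable_prod integrable_exp_abs_square \<kappa>) simp
    show "(\<lambda>y. P y * damping s \<kappa> y) \<in> borel_measurable (euclid s)"
      using P damping_measurable unfolding exp_bounded_def by auto
    show "AE y in euclid s. norm (P y * damping s \<kappa> y) \<le> norm (C * (\<Prod>j\<in>{1..s}. exp (c * \<bar>y j\<bar> - \<kappa> * (y j)\<^sup>2)))"
    proof (rule AE_I2)
      fix y assume "y \<in> space (euclid s)"
      then have y: "y \<in> points s" by simp
      have d: "0 \<le> damping s \<kappa> y" unfolding damping_def by (intro prod_nonneg) auto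
      have "\<bar>P y * damping s \<kappa> y\<bar> \<le> C * exp (c * (\<Sum>j\<in>{1..s}. \<bar>y j\<bar>)) * damping s \<kappa> y"
        using c(3)[OF y] d by (simp add: abs_mult mult_right_mono)
      also have "\<dots> = C * (\<Prod>j\<in>{1..s}. exp (c * \<bar>y j\<bar> - \<kappa> * (y j)\<^sup>2))"
        unfolding damping_def sum_distrib_left exp_sum[OF finite_atLeastAtMost] mult.assoc prod.distrib[symmetric] exp_add[symmetric] by simp
      finally show "norm (P y * damping s \<kappa> y) \<le> norm (C * (\<Prod>j\<in>{1..s}. exp (c * \<bar>y j\<bar> - \<kappa> * (y j)\<^sup>2)))"
        using c(1) by (simp add: prod_nonneg)
    qed
  qed
qed

lemma gsmooth_integrable:
  assumes H: "gsmooth s \<kappa> n H" and R: "exp_bounded s R" and \<kappa>: "0 < \<kappa>"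
  shows "integrable (euclid s) (\<lambda>y. H y * R y)"
proof -
  obtain P where P: "tame s n P" "\<And>y. y \<in> points s \<Longrightarrow> H y = P y * damping s \<kappa> y"
    using H unfolding gsmooth_def by blast
  have "integrable (euclid s) (\<lambda>y. (P y * R y) * damping s \<kappa> y)"
    by (intro integrable_exp_bounded_damping exp_bounded_mult R \<kappa> tame_imp_exp_bounded[OF P(1)])
  then show ?thesis by (rule Bochner_Integration.integrable_cong[THEN iffD1, rotated 2]) (auto simp: P(2))
qed

subsection \<open>Integration by parts\<close>

text \<open>The fundamental theorem of calculus on [-n, n], with boundary terms that decay. The
  finite set F admits the jumps of Walsh functions; continuity of f across F keeps the theorem
  valid.\<close>

lemma integral_derivative_zero:
  fixes f f' :: "real \<Rightarrow> real"
  assumes F: "finite F" and d: "\<And>t. t \<notin> F \<Longrightarrow> (f has_real_derivative f' t) (at t)"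
    and cont: "continuous_on UNIV f" and m: "f' \<in> borel_measurable borel"
    and \<kappa>: "0 < \<kappa>" and b: "\<And>t. \<bar>f t\<bar> \<le> C * exp (c * \<bar>t\<bar> - \<kappa> * t\<^sup>2)" "\<And>t. \<bar>f' t\<bar> \<le> C * exp (c * \<bar>t\<bar> - \<kappa> * t\<^sup>2)"
  shows "integrable lborel f'" "(\<integral>t. f' t \<partial>lborel) = 0"
proof -
  have C0: "0 \<le> C" using b(1)[of 0] by (smt (verit) exp_gt_zero mult_le_0_iff abs_ge_zero zero_le_mult_iff)
  show int: "integrable lborel f'"
  proof (rule Bochner_Integration.integrable_bound)
    show "integrable lborel (\<lambda>t. C * exp (c * \<bar>t\<bar> - \<kappa> * t\<^sup>2))"
      by (intro integrable_mult_right integrable_exp_abs_square \<kappa>)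
    show "AE t in lborel. norm (f' t) \<le> norm (C * exp (c * \<bar>t\<bar> - \<kappa> * t\<^sup>2))"
      using b(2) C0 by (simp add: abs_mult)
  qed (use m in simp)
  have lim: "(\<lambda>n::nat. \<integral>t. indicator {- real n..real n} t *\<^sub>R f' t \<partial>lborel) \<longlonglongrightarrow> (\<integral>t. f' t \<partial>lborel)"
  proof (rule integral_dominated_convergence[where w="\<lambda>t. \<bar>f' t\<bar>"])
    show "AE t in lborel. (\<lambda>n::nat. indicator {- real n..real n} t *\<^sub>R f' t) \<longlonglongrightarrow> f' t"
    proof (rule AE_I2)
      fix t
      have "\<forall>\<^sub>F n::nat in sequentially. indicator {- real n..real n} t *\<^sub>R f' t = f' t"
        using eventually_ge_at_top[of "nat \<lceil>\<bar>t\<bar>\<rceil>"]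
        by eventually_elim (auto simp: indicator_def abs_le_iff nat_le_iff ceiling_le_iff)
      then show "(\<lambda>n::nat. indicator {- real n..real n} t *\<^sub>R f' t) \<longlonglongrightarrow> f' t" by (rule tendsto_eventually)
    qed
    show "AE t in lborel. norm (indicator {- real n..real n} t *\<^sub>R f' t) \<le> \<bar>f' t\<bar>" for n :: nat
      by (auto simp: indicator_def)
  qed (use m int in auto)
  have val: "(\<integral>t. indicator {- real n..real n} t *\<^sub>R f' t \<partial>lborel) = f (real n) - f (- real n)" for n :: nat
  proof -
    have "set_integrable lborel {- real n..real n} f'"
      using integrable_mult_indicator[OF _ int, of "{- real n..real n}"] unfolding set_integrable_def by simp
    then have "(\<integral>t. indicator {- real n..real n} t *\<^sub>R f' t \<partial>lborel) = integral {- real n..real n} f'"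
      unfolding set_lebesgue_integral_def[symmetric] by (rule set_borel_integral_eq_integral)
    moreover have "(f' has_integral (f (real n) - f (- real n))) {- real n..real n}"
      by (rule fundamental_theorem_of_calculus_interior_strong[OF F])
        (use d cont in \<open>auto simp: has_real_derivative_iff_has_vector_derivative[symmetric] intro: continuous_on_subset\<close>)
    ultimately show ?thesis by (simp add: integral_unique)
  qed
  have z: "((\<lambda>t. C * exp (c * \<bar>t\<bar> - \<kappa> * t\<^sup>2)) \<longlongrightarrow> 0) at_top"
  proof -
    have "((\<lambda>t. C * (exp (c\<^sup>2 / (2 * \<kappa>)) * exp (- (\<kappa> / 2) * t\<^sup>2))) \<longlongrightarrow> C * (exp (c\<^sup>2 / (2 * \<kappa>)) * 0)) at_top"
    proof (intro tendsto_mult tendsto_const filterlim_compose[OF exp_at_bot])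
      have "filterlim (\<lambda>t::real. t\<^sup>2) at_top at_top" by (rule filterlim_pow_at_top[OF _ filterlim_ident]) simp
      then have "filterlim (\<lambda>t::real. (- (\<kappa> / 2)) * t\<^sup>2) at_bot at_top"
        using \<kappa> by (intro filterlim_tendsto_neg_mult_at_bot[OF tendsto_const]) auto
      then show "LIM t at_top. - (\<kappa> / 2) * t\<^sup>2 :> at_bot" .
    qed
    then have l: "((\<lambda>t. C * (exp (c\<^sup>2 / (2 * \<kappa>)) * exp (- (\<kappa> / 2) * t\<^sup>2))) \<longlongrightarrow> 0) at_top" by simp
    show ?thesis
      by (rule tendsto_sandwich[OF _ _ tendsto_const l])
        (use C0 exp_abs_square_le[OF \<kappa>, of c] in \<open>auto intro!: always_eventually mult_left_mono\<close>)
  qed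
  have zn: "(\<lambda>n. C * exp (c * \<bar>real n\<bar> - \<kappa> * (real n)\<^sup>2)) \<longlonglongrightarrow> 0"
    by (rule filterlim_compose[OF z filterlim_real_sequentially])
  have "(\<lambda>n. f (real n)) \<longlonglongrightarrow> 0"
    by (rule Lim_null_comparison[OF _ zn], rule always_eventually, rule allI, simp only: real_norm_def, rule b(1))
  moreover have "\<bar>f (- real n)\<bar> \<le> C * exp (c * \<bar>real n\<bar> - \<kappa> * (real n)\<^sup>2)" for n
    using b(1)[of "- real n"] by simp
  then have "(\<lambda>n. f (- real n)) \<longlonglongrightarrow> 0"
    by (intro Lim_null_comparison[OF _ zn] always_eventually allI) (simp only: real_norm_def)
  ultimately have "(\<lambda>n. f (real n) - f (- real n)) \<longlonglongrightarrow> 0 - 0" by (rule tendsto_diff)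
  then show "(\<integral>t. f' t \<partial>lborel) = 0" using lim unfolding val by (metis LIMSEQ_unique diff_zero)
qed

text \<open>Keeping the factors as a family lets integration by parts exchange one of them by a
  function update.\<close>

definition coord_prod :: "nat \<Rightarrow> (nat \<Rightarrow> real \<Rightarrow> real) \<Rightarrow> (nat \<Rightarrow> real) \<Rightarrow> real"
  where "coord_prod s p y = (\<Prod>i\<in>{1..s}. p i (y i))"

lemma exp_bounded_coord_prod:
  "(\<And>i. i \<in> {1..s} \<Longrightarrow> exp_bounded1 (p i)) \<Longrightarrow> exp_bounded s (coord_prod s p)"
  unfolding coord_prod_def by (intro exp_bounded_prod exp_bounded1_imp)

lemma coord_prod_integrable:
  assumes "smooth_decay s \<kappa> K" "0 < \<kappa>" "\<And>i. i \<in> {1..s} \<Longrightarrow> exp_bounded1 (p i)"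
  shows "integrable (euclid s) (\<lambda>y. K y * coord_prod s p y)"
  using assms unfolding smooth_decay_def by (intro gsmooth_integrable[where n=0] exp_bounded_coord_prod) auto

lemma euclid_integral_split:
  fixes f :: "(nat \<Rightarrow> real) \<Rightarrow> real"
  assumes j: "j \<in> {1..s}" and f: "integrable (euclid s) f"
  shows "(\<integral>y. f y \<partial>euclid s) = (\<integral>x. (\<integral>t. f (x(j := t)) \<partial>lborel) \<partial>(\<Pi>\<^sub>M i\<in>{1..s} - {j}. lborel))"
proof -
  have "insert j ({1..s} - {j}) = {1..s}" using j by auto
  then show ?thesis
    using lborel_product.product_integral_insert[of "{1..s} - {j}" j f] f by simp
qed

text \<open>Along a line in direction j the other coordinates only enter the constant C, whereas
  \<kappa> is retained.\<close>

lemma slice_bound: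
  assumes K: "smooth_decay s \<kappa> K" and j: "j \<in> {1..s}" and y: "y \<in> points s"
  obtains C c where "\<And>t. \<bar>K (y(j := t))\<bar> \<le> C * exp (c * \<bar>t\<bar> - \<kappa> * t\<^sup>2)" "0 \<le> C" "0 \<le> c"
proof -
  obtain P where P: "tame s 0 P" "\<And>y. y \<in> points s \<Longrightarrow> K y = P y * damping s \<kappa> y"
    using K unfolding smooth_decay_def gsmooth_def by blast
  obtain C c where c: "0 \<le> C" "0 \<le> c" "\<And>y. y \<in> points s \<Longrightarrow> \<bar>P y\<bar> \<le> C * exp (c * (\<Sum>j\<in>{1..s}. \<bar>y j\<bar>))"
    using exp_boundedE[OF tame_imp_exp_bounded[OF P(1)]] by blast
  define r where "r = (\<Sum>i\<in>{1..s} - {j}. \<bar>y i\<bar>)"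
  define R where "R = (\<Prod>i\<in>{1..s} - {j}. exp (- \<kappa> * (y i)\<^sup>2))"
  have R0: "0 \<le> R" unfolding R_def by (intro prod_nonneg) auto
  have "\<bar>K (y(j := t))\<bar> \<le> (C * exp (c * r) * R) * exp (c * \<bar>t\<bar> - \<kappa> * t\<^sup>2)" for t
  proof -
    let ?y = "y(j := t)"
    have yp: "?y \<in> points s" by (rule points_upd[OF y j])
    have s: "(\<Sum>i\<in>{1..s}. \<bar>?y i\<bar>) = \<bar>t\<bar> + r"
      unfolding r_def using j by (subst sum.remove[of _ j]) (auto intro!: sum.cong)
    have d: "damping s \<kappa> ?y = exp (- \<kappa> * t\<^sup>2) * R"
      unfolding damping_def R_def using j by (subst prod.remove[of _ j]) (auto intro!: prod.cong)
    have "\<bar>K ?y\<bar> = \<bar>P ?y\<bar> * (exp (- \<kappa> * t\<^sup>2) * R)" unfolding P(2)[OF yp] d abs_mult using R0 by simp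
    also have "\<dots> \<le> (C * exp (c * (\<bar>t\<bar> + r))) * (exp (- \<kappa> * t\<^sup>2) * R)"
      using c(3)[OF yp] R0 unfolding s by (intro mult_right_mono) auto
    also have "\<dots> = (C * exp (c * r) * R) * exp (c * \<bar>t\<bar> - \<kappa> * t\<^sup>2)"
      by (simp add: exp_add exp_diff exp_minus distrib_left divide_inverse mult_ac)
    finally show ?thesis .
  qed
  then show thesis using that[of "C * exp (c * r) * R" c] c R0 by simp
qed

lemma exp_bounded1E:
  assumes "exp_bounded1 p" obtains C c where "0 \<le> C" "0 \<le> c" "\<And>t. \<bar>p t\<bar> \<le> C * exp (c * \<bar>t\<bar>)"
  using assms unfolding exp_bounded1_def by blast

text \<open>On each line in direction j the two integrands add up to the derivative of K times A, up
  to a constant factor, and so integrate to 0; Fubini transfers this to the whole space.\<close>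

lemma integral_by_parts_coord:
  assumes K: "smooth_decay s \<kappa> K" and \<kappa>: "0 < \<kappa>" and j: "j \<in> {1..s}"
    and p: "\<And>i. i \<in> {1..s} \<Longrightarrow> exp_bounded1 (p i)"
    and A: "exp_bounded1 A" "exp_bounded1 A'" "continuous_on UNIV A"
    and F: "finite F" and dA: "\<And>t. t \<notin> F \<Longrightarrow> (A has_real_derivative A' t) (at t)"
  shows "(\<integral>y. K y * coord_prod s (p(j := A')) y \<partial>euclid s)
    = - (\<integral>y. partial_deriv j K y * coord_prod s (p(j := A)) y \<partial>euclid s)"
proof -
  note K' = smooth_decay_partial[OF K j]
  let ?D = "partial_deriv j K"
  have i1: "integrable (euclid s) (\<lambda>y. K y * coord_prod s (p(j := A')) y)"
    by (rule coord_prod_integrable[OF K \<kappa>]) (use p A in auto)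
  have i2: "integrable (euclid s) (\<lambda>y. ?D y * coord_prod s (p(j := A)) y)"
    by (rule coord_prod_integrable[OF K'(1) \<kappa>]) (use p A in auto)
  have "(\<integral>y. K y * coord_prod s (p(j := A')) y + ?D y * coord_prod s (p(j := A)) y \<partial>euclid s) = 0"
  proof (subst euclid_integral_split[OF j Bochner_Integration.integrable_add[OF i1 i2]])
    have inner: "(\<integral>t. K (x(j := t)) * coord_prod s (p(j := A')) (x(j := t)) + ?D (x(j := t)) * coord_prod s (p(j := A)) (x(j := t)) \<partial>lborel) = 0"
      if x: "x \<in> space (\<Pi>\<^sub>M i\<in>{1..s} - {j}. lborel)" for x
    proof -
      define y where "y = x(j := 0)"
      have y: "y \<in> points s" using x j unfolding y_def by (auto simp: space_PiM PiE_iff extensional_def)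
      have xy: "x(j := t) = y(j := t)" for t unfolding y_def by simp
      define R where "R = (\<Prod>i\<in>{1..s} - {j}. p i (x i))"
      have cp: "coord_prod s (p(j := B)) (x(j := t)) = B t * R" for B t
        unfolding coord_prod_def R_def using j by (subst prod.remove[of _ j]) (auto intro!: prod.cong)
      define k where "k t = K (x(j := t))" for t
      define k' where "k' t = ?D (x(j := t))" for t
      have dk: "(k has_real_derivative k' t) (at t)" for t
        using K'(2) points_upd[OF y j, of t] unfolding has_partial_def k_def k'_def xy by fastforce
      obtain C1 c1 where 1: "\<And>t. \<bar>k t\<bar> \<le> C1 * exp (c1 * \<bar>t\<bar> - \<kappa> * t\<^sup>2)" "0 \<le> C1" "0 \<le> c1"
        using slice_bound[OF K j y] unfolding k_def xy by blast
      obtain C2 c2 where 2: "\<And>t. \<bar>k' t\<bar> \<le> C2 * exp (c2 * \<bar>t\<bar> - \<kappa> * t\<^sup>2)" "0 \<le> C2" "0 \<le> c2"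
        using slice_bound[OF K'(1) j y] unfolding k'_def xy by blast
      obtain C3 c3 where 3: "0 \<le> C3" "0 \<le> c3" "\<And>t. \<bar>A t\<bar> \<le> C3 * exp (c3 * \<bar>t\<bar>)" using exp_bounded1E[OF A(1)] by blast
      obtain C4 c4 where 4: "0 \<le> C4" "0 \<le> c4" "\<And>t. \<bar>A' t\<bar> \<le> C4 * exp (c4 * \<bar>t\<bar>)" using exp_bounded1E[OF A(2)] by blast
      define C where "C = C1 * C3 + C1 * C4 + C2 * C3"
      define c where "c = c1 + c2 + c3 + c4"
      have bd: "\<bar>u * v\<bar> \<le> (D * D') * exp (c * \<bar>t\<bar> - \<kappa> * t\<^sup>2)"
        if "\<bar>u\<bar> \<le> D * exp (d * \<bar>t\<bar> - \<kappa> * t\<^sup>2)" "\<bar>v\<bar> \<le> D' * exp (d' * \<bar>t\<bar>)" "d + d' \<le> c" "0 \<le> D" "0 \<le> D'" for u v D D' d d' t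
      proof -
        have "\<bar>u * v\<bar> \<le> (D * exp (d * \<bar>t\<bar> - \<kappa> * t\<^sup>2)) * (D' * exp (d' * \<bar>t\<bar>))"
          unfolding abs_mult using that by (intro mult_mono) auto
        also have "\<dots> = (D * D') * exp ((d + d') * \<bar>t\<bar> - \<kappa> * t\<^sup>2)" by (simp add: exp_add[symmetric] distrib_right algebra_simps)
        also have "\<dots> \<le> (D * D') * exp (c * \<bar>t\<bar> - \<kappa> * t\<^sup>2)"
          using that by (intro mult_left_mono) (auto intro!: mult_right_mono)
        finally show ?thesis .
      qed
      have le: "a * exp z \<le> C * exp z" if "a \<le> C" for a z :: real using that by (intro mult_right_mono) auto
      have C13: "C1 * C3 \<le> C" "C1 * C4 + C2 * C3 \<le> C" unfolding C_def using 1(2) 2(2) 3(1) 4(1) by auto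
      have "(\<integral>t. k t * A' t + k' t * A t \<partial>lborel) = 0"
      proof (rule integral_derivative_zero(2)[where f="\<lambda>t. k t * A t" and C=C and c=c and \<kappa>=\<kappa>, OF F _ _ _ \<kappa>])
        show "((\<lambda>t. k t * A t) has_real_derivative k t * A' t + k' t * A t) (at t)" if "t \<notin> F" for t
          using DERIV_mult[OF dk[of t] dA[OF that]] by (simp add: mult_ac add.commute)
        have ck: "continuous_on UNIV k" using dk DERIV_isCont by (auto simp: continuous_on_eq_continuous_at)
        then show "continuous_on UNIV (\<lambda>t. k t * A t)" using A(3) by (intro continuous_intros)
        have "?D \<in> borel_measurable (euclid s)"
          using K'(1) gsmooth_integrable[where n=0 and R="\<lambda>_. 1", OF _ exp_bounded_const \<kappa>] unfolding smooth_decay_def by fastforce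
        then have "?D \<in> borel_measurable (PiM (insert j ({1..s} - {j})) (\<lambda>_. lborel))" using j by (simp add: insert_absorb)
        moreover have "(\<lambda>t. x(j := t)) \<in> lborel \<rightarrow>\<^sub>M PiM (insert j ({1..s} - {j})) (\<lambda>_. lborel)"
          using measurable_component_update[OF x, of j] by simp
        ultimately have "k' \<in> borel_measurable lborel" unfolding k'_def by (rule measurable_compose[rotated])
        moreover have "k \<in> borel_measurable borel" by (rule borel_measurable_continuous_onI[OF ck])
        ultimately show "(\<lambda>t. k t * A' t + k' t * A t) \<in> borel_measurable borel"
          using A(1,2) unfolding exp_bounded1_def by (intro borel_measurable_add borel_measurable_times) auto
        fix t
        have "\<bar>k t * A t\<bar> \<le> (C1 * C3) * exp (c * \<bar>t\<bar> - \<kappa> * t\<^sup>2)"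
          using 1 2 3 4 by (intro bd[where d=c1 and d'=c3]) (auto simp: c_def)
        also have "\<dots> \<le> C * exp (c * \<bar>t\<bar> - \<kappa> * t\<^sup>2)" using C13(1) by (rule le)
        finally show "\<bar>k t * A t\<bar> \<le> C * exp (c * \<bar>t\<bar> - \<kappa> * t\<^sup>2)" .
        have "\<bar>k t * A' t\<bar> \<le> (C1 * C4) * exp (c * \<bar>t\<bar> - \<kappa> * t\<^sup>2)"
          using 1 2 3 4 by (intro bd[where d=c1 and d'=c4]) (auto simp: c_def)
        moreover have "\<bar>k' t * A t\<bar> \<le> (C2 * C3) * exp (c * \<bar>t\<bar> - \<kappa> * t\<^sup>2)"
          using 1 2 3 4 by (intro bd[where d=c2 and d'=c3]) (auto simp: c_def)
        ultimately have "\<bar>k t * A' t + k' t * A t\<bar> \<le> (C1 * C4 + C2 * C3) * exp (c * \<bar>t\<bar> - \<kappa> * t\<^sup>2)"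
          by (simp add: distrib_right)
        also have "\<dots> \<le> C * exp (c * \<bar>t\<bar> - \<kappa> * t\<^sup>2)" using C13(2) by (rule le)
        finally show "\<bar>k t * A' t + k' t * A t\<bar> \<le> C * exp (c * \<bar>t\<bar> - \<kappa> * t\<^sup>2)" .
      qed
      then have "(\<integral>t. R * (k t * A' t + k' t * A t) \<partial>lborel) = 0" by simp
      then show ?thesis unfolding cp k_def k'_def by (simp add: algebra_simps)
    qed
    have "(\<integral>x. (\<integral>t. K (x(j := t)) * coord_prod s (p(j := A')) (x(j := t)) + ?D (x(j := t)) * coord_prod s (p(j := A)) (x(j := t)) \<partial>lborel) \<partial>(\<Pi>\<^sub>M i\<in>{1..s} - {j}. lborel))
      = (\<integral>x. 0 \<partial>(\<Pi>\<^sub>M i\<in>{1..s} - {j}. (lborel :: real measure)))"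
      by (rule Bochner_Integration.integral_cong[OF refl]) (rule inner)
    then show "(\<integral>x. (\<integral>t. K (x(j := t)) * coord_prod s (p(j := A')) (x(j := t)) + ?D (x(j := t)) * coord_prod s (p(j := A)) (x(j := t)) \<partial>lborel) \<partial>(\<Pi>\<^sub>M i\<in>{1..s} - {j}. lborel)) = 0" by simp
  qed
  then show ?thesis using Bochner_Integration.integral_add[OF i1 i2] by linarith
qed

lemma coord_prod_upd:
  assumes "j \<in> {1..s}"
  shows "coord_prod s (p(j := h)) y = h (y j) * (\<Prod>i\<in>{1..s} - {j}. p i (y i))"
  unfolding coord_prod_def using assms by (subst prod.remove[of _ j]) (auto intro!: prod.cong)

text \<open>The first integration, once in every coordinate of u. In the application a i is a Walsh
  function times the density and b i its continuous primitive.\<close>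

lemma integral_by_parts_all:
  assumes K: "smooth_decay s \<kappa> K" and \<kappa>: "0 < \<kappa>" and u: "u \<subseteq> {1..s}"
    and p: "\<And>i. i \<in> {1..s} \<Longrightarrow> exp_bounded1 (p i)"
    and ab: "\<And>i. i \<in> u \<Longrightarrow> exp_bounded1 (a i)" "\<And>i. i \<in> u \<Longrightarrow> exp_bounded1 (b i)"
      "\<And>i. i \<in> u \<Longrightarrow> continuous_on UNIV (b i)"
      "\<And>i. i \<in> u \<Longrightarrow> \<exists>F. finite F \<and> (\<forall>t. t \<notin> F \<longrightarrow> (b i has_real_derivative a i t) (at t))"
  shows "(\<integral>y. K y * coord_prod s (\<lambda>i. if i \<in> u then a i else p i) y \<partial>euclid s)
    = (-1) ^ card u * (\<integral>y. mixed_deriv u K y * coord_prod s (\<lambda>i. if i \<in> u then b i else p i) y \<partial>euclid s)"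
proof -
  have "finite u" using u by (rule finite_subset) simp
  then show ?thesis using u p ab
  proof (induction u arbitrary: p rule: finite_linorder_min_induct)
    case empty
    then show ?case by (simp add: mixed_deriv_def)
  next
    case (insert j u)
    have j: "j \<in> {1..s}" "j \<notin> u" using insert by auto
    define q where "q = (\<lambda>i. if i \<in> u then b i else p i)"
    have e: "(\<lambda>i. if i \<in> insert j u then a i else p i) = (\<lambda>i. if i \<in> u then a i else (p(j := a j)) i)"
      "(\<lambda>i. if i \<in> u then b i else (p(j := a j)) i) = q(j := a j)"
      "(\<lambda>i. if i \<in> insert j u then b i else p i) = q(j := b j)"
      using j(2) unfolding q_def by (auto simp: fun_eq_iff)
    have 1: "(\<integral>y. K y * coord_prod s (\<lambda>i. if i \<in> u then a i else (p(j := a j)) i) y \<partial>euclid s)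
      = (-1) ^ card u * (\<integral>y. mixed_deriv u K y * coord_prod s (\<lambda>i. if i \<in> u then b i else (p(j := a j)) i) y \<partial>euclid s)"
      using insert.prems by (intro insert.IH) auto
    have q: "exp_bounded1 (q i)" if "i \<in> {1..s}" for i
      using insert.prems(2)[OF that] insert.prems(4)[of i] unfolding q_def by auto
    have u': "u \<subseteq> {1..s}" using insert.prems(1) by auto
    obtain F where F: "finite F" "\<And>t. t \<notin> F \<Longrightarrow> (b j has_real_derivative a j t) (at t)" using insert.prems(6)[of j] by auto
    have 2: "(\<integral>y. mixed_deriv u K y * coord_prod s (q(j := a j)) y \<partial>euclid s)
      = - (\<integral>y. partial_deriv j (mixed_deriv u K) y * coord_prod s (q(j := b j)) y \<partial>euclid s)"
      by (rule integral_by_parts_coord[OF smooth_decay_mixed[OF K u'] \<kappa> j(1) q _ _ _ F]) (use insert.prems in auto)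
    have 3: "mixed_deriv (insert j u) K = partial_deriv j (mixed_deriv u K)"
      using insert by (intro mixed_deriv_insert_min) auto
    show ?case unfolding e(1) 1 unfolding e(2,3) 2 3 using insert.hyps(1) j(2) by simp
  qed
qed

text \<open>The second integration. With b i = P i' + Q i, in each coordinate of v either P i' is
  integrated by parts, which adds the coordinate to w, or Q i is kept. This produces the sum over w
  in \<open>norm_uv\<close>. In the application Q i arises from differentiating the reciprocal of
  the density.\<close>

lemma integral_by_parts_split:
  assumes K: "smooth_decay s \<kappa> K" and \<kappa>: "0 < \<kappa>" and v: "v \<subseteq> {1..s}"
    and p: "\<And>i. i \<in> {1..s} \<Longrightarrow> exp_bounded1 (p i)"
    and b: "\<And>i. i \<in> v \<Longrightarrow> exp_bounded1 (b i)" "\<And>i. i \<in> v \<Longrightarrow> exp_bounded1 (P i)" "\<And>i. i \<in> v \<Longrightarrow> exp_bounded1 (Q i)"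
      "\<And>i t. i \<in> v \<Longrightarrow> (P i has_real_derivative b i t - Q i t) (at t)"
  shows "(\<integral>y. K y * coord_prod s (\<lambda>i. if i \<in> v then b i else p i) y \<partial>euclid s)
    = (\<Sum>w\<in>Pow v. (-1) ^ card w * (\<integral>y. mixed_deriv w K y * coord_prod s (\<lambda>i. if i \<in> w then P i else if i \<in> v then Q i else p i) y \<partial>euclid s))"
proof -
  have "finite v" using v by (rule finite_subset) simp
  then show ?thesis using v p b
  proof (induction v arbitrary: p rule: finite_linorder_min_induct)
    case empty
    then show ?case by (simp add: mixed_deriv_def)
  next
    case (insert j v)
    have j: "j \<in> {1..s}" "j \<notin> v" using insert by auto
    define q where "q w = (\<lambda>i. if i \<in> w then P i else if i \<in> v then Q i else p i)" for w
    let ?I = "\<lambda>L r. \<integral>y. L y * coord_prod s r y \<partial>euclid s"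
    have e1: "(\<lambda>i. if i \<in> insert j v then b i else p i) = (\<lambda>i. if i \<in> v then b i else (p(j := b j)) i)"
      using j(2) by (auto simp: fun_eq_iff)
    have "?I K (\<lambda>i. if i \<in> v then b i else (p(j := b j)) i)
      = (\<Sum>w\<in>Pow v. (-1) ^ card w * ?I (mixed_deriv w K) (\<lambda>i. if i \<in> w then P i else if i \<in> v then Q i else (p(j := b j)) i))"
      using insert.prems by (intro insert.IH) auto
    also have "\<dots> = (\<Sum>w\<in>Pow v. (-1) ^ card w * ?I (mixed_deriv w K) (\<lambda>i. if i \<in> w then P i else if i \<in> insert j v then Q i else p i)
       + (-1) ^ card (insert j w) * ?I (mixed_deriv (insert j w) K) (\<lambda>i. if i \<in> insert j w then P i else if i \<in> insert j v then Q i else p i))"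
    proof (rule sum.cong[OF refl])
      fix w assume w: "w \<in> Pow v"
      then have wj: "j \<notin> w" "w \<subseteq> {1..s}" "finite w" using j(2) insert.prems(1) insert.hyps(1) by (auto intro: finite_subset)
      have e: "(\<lambda>i. if i \<in> w then P i else if i \<in> v then Q i else (p(j := b j)) i) = (q w)(j := b j)"
        "(\<lambda>i. if i \<in> w then P i else if i \<in> insert j v then Q i else p i) = (q w)(j := Q j)"
        "(\<lambda>i. if i \<in> insert j w then P i else if i \<in> insert j v then Q i else p i) = (q w)(j := P j)"
        using j(2) wj w unfolding q_def by (auto simp: fun_eq_iff)
      have L: "smooth_decay s \<kappa> (mixed_deriv w K)" by (rule smooth_decay_mixed[OF K wj(2)])
      have q: "exp_bounded1 (q w i)" if "i \<in> {1..s}" for i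
        using insert.prems(2)[OF that] insert.prems(4,5)[of i] w unfolding q_def by auto
      have bj: "exp_bounded1 (b j)" "exp_bounded1 (Q j)" "exp_bounded1 (P j)" using insert.prems by auto
      have P': "exp_bounded1 (\<lambda>t. b j t - Q j t)"
      proof -
        obtain C c where 1: "0 \<le> C" "0 \<le> c" "\<And>t. \<bar>b j t\<bar> \<le> C * exp (c * \<bar>t\<bar>)" using exp_bounded1E[OF bj(1)] by blast
        obtain C' c' where 2: "0 \<le> C'" "0 \<le> c'" "\<And>t. \<bar>Q j t\<bar> \<le> C' * exp (c' * \<bar>t\<bar>)" using exp_bounded1E[OF bj(2)] by blast
        have "\<bar>b j t - Q j t\<bar> \<le> (C + C') * exp ((c + c') * \<bar>t\<bar>)" for t
        proof -
          have "C * exp (c * \<bar>t\<bar>) \<le> C * exp ((c + c') * \<bar>t\<bar>)" "C' * exp (c' * \<bar>t\<bar>) \<le> C' * exp ((c + c') * \<bar>t\<bar>)"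
            using 1 2 by (auto intro!: mult_left_mono mult_right_mono)
          moreover have "(C + C') * exp ((c + c') * \<bar>t\<bar>) = C * exp ((c + c') * \<bar>t\<bar>) + C' * exp ((c + c') * \<bar>t\<bar>)"
            by (rule distrib_right)
          ultimately show ?thesis using 1(3)[of t] 2(3)[of t] by linarith
        qed
        moreover have "(\<lambda>t. b j t - Q j t) \<in> borel_measurable borel" using bj unfolding exp_bounded1_def by auto
        ultimately show ?thesis using 1 2 unfolding exp_bounded1_def by (intro conjI exI[of _ "C + C'"] exI[of _ "c + c'"]) auto
      qed
      have dP: "(P j has_real_derivative b j t - Q j t) (at t)" for t using insert.prems(6) by simp
      have i1: "integrable (euclid s) (\<lambda>y. mixed_deriv w K y * coord_prod s ((q w)(j := \<lambda>t. b j t - Q j t)) y)"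
        by (rule coord_prod_integrable[OF L \<kappa>]) (use q P' in auto)
      have i2: "integrable (euclid s) (\<lambda>y. mixed_deriv w K y * coord_prod s ((q w)(j := Q j)) y)"
        by (rule coord_prod_integrable[OF L \<kappa>]) (use q bj in auto)
      have "?I (mixed_deriv w K) ((q w)(j := b j))
        = (\<integral>y. mixed_deriv w K y * coord_prod s ((q w)(j := \<lambda>t. b j t - Q j t)) y + mixed_deriv w K y * coord_prod s ((q w)(j := Q j)) y \<partial>euclid s)"
        unfolding coord_prod_upd[OF j(1)] by (intro Bochner_Integration.integral_cong refl) (simp add: algebra_simps)
      also have "\<dots> = ?I (mixed_deriv w K) ((q w)(j := \<lambda>t. b j t - Q j t)) + ?I (mixed_deriv w K) ((q w)(j := Q j))"
        by (rule Bochner_Integration.integral_add[OF i1 i2])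
      also have "?I (mixed_deriv w K) ((q w)(j := \<lambda>t. b j t - Q j t)) = - ?I (partial_deriv j (mixed_deriv w K)) ((q w)(j := P j))"
        by (rule integral_by_parts_coord[where F="{}", OF L \<kappa> j(1) q bj(3) P'])
          (use dP DERIV_isCont in \<open>auto simp: continuous_on_eq_continuous_at\<close>)
      also have "partial_deriv j (mixed_deriv w K) = mixed_deriv (insert j w) K"
        using insert.hyps w wj by (intro mixed_deriv_insert_min[symmetric]) auto
      finally have fin: "?I (mixed_deriv w K) ((q w)(j := b j)) = - ?I (mixed_deriv (insert j w) K) ((q w)(j := P j)) + ?I (mixed_deriv w K) ((q w)(j := Q j))" .
      have alg: "c * (- Z + Y) = c * Y + (-1 * c) * Z" for c Y Z :: real by (simp add: algebra_simps)
      show "(-1) ^ card w * ?I (mixed_deriv w K) (\<lambda>i. if i \<in> w then P i else if i \<in> v then Q i else (p(j := b j)) i)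
        = (-1) ^ card w * ?I (mixed_deriv w K) (\<lambda>i. if i \<in> w then P i else if i \<in> insert j v then Q i else p i)
       + (-1) ^ card (insert j w) * ?I (mixed_deriv (insert j w) K) (\<lambda>i. if i \<in> insert j w then P i else if i \<in> insert j v then Q i else p i)"
        unfolding e fin card_insert_disjoint[OF wj(3,1)] power_Suc by (rule alg)
    qed
    also have "\<dots> = (\<Sum>w\<in>Pow (insert j v). (-1) ^ card w * ?I (mixed_deriv w K) (\<lambda>i. if i \<in> w then P i else if i \<in> insert j v then Q i else p i))"
    proof -
      have inj: "inj_on (insert j) (Pow v)" using j(2) by (auto simp: inj_on_def)
      have disj: "Pow v \<inter> insert j ` Pow v = {}" using j(2) by auto
      show ?thesis unfolding Pow_insert
        by (subst sum.union_disjoint[OF _ _ disj]) (use insert.hyps(1) in \<open>auto simp: sum.reindex[OF inj] sum.distrib\<close>)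
    qed
    finally show ?case unfolding e1 .
  qed
qed

lemma smooth_decay_measurable: "smooth_decay s \<kappa> K \<Longrightarrow> K \<in> borel_measurable (euclid s)"
proof -
  assume "smooth_decay s \<kappa> K"
  then obtain P where P: "tame s 0 P" "\<And>y. y \<in> points s \<Longrightarrow> K y = P y * damping s \<kappa> y"
    unfolding smooth_decay_def gsmooth_def by blast
  have "P \<in> borel_measurable (euclid s)" using P(1) by (simp add: exp_bounded_def)
  then have "(\<lambda>y. P y * damping s \<kappa> y) \<in> borel_measurable (euclid s)" using damping_measurable by simp
  then show ?thesis by (rule measurable_cong[THEN iffD1, rotated]) (use P(2) in auto)
qed

text \<open>The coordinates outside u are integrated first, with weight \<phi>, and stay inside the
  absolute value; the other factors are bounded pointwise by multiples of \<psi> or by constants.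
  What results is one summand of \<open>norm_uv\<close>, possibly infinite.\<close>

lemma abs_integral_le_norm_term:
  fixes \<beta> :: "nat \<Rightarrow> real"
  assumes L: "smooth_decay s \<kappa> L" and \<kappa>: "0 < \<kappa>" and u: "u \<subseteq> {1..s}" and w: "w \<subseteq> v" "v \<subseteq> u"
    and r: "\<And>i. i \<in> u \<Longrightarrow> exp_bounded1 (r i)" and \<phi>: "exp_bounded1 \<phi>"
    and [measurable]: "\<psi> \<in> borel_measurable borel" and \<psi>: "\<And>t. 0 \<le> \<psi> t"
    and \<beta>: "\<And>i. i \<in> u \<Longrightarrow> 0 \<le> \<beta> i"
    and rb: "\<And>i t. i \<in> v \<Longrightarrow> \<bar>r i t\<bar> \<le> \<beta> i * \<psi> t" "\<And>i t. i \<in> u - v \<Longrightarrow> \<bar>r i t\<bar> \<le> \<beta> i"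
  shows "ennreal \<bar>\<integral>y. L y * coord_prod s (\<lambda>i. if i \<in> u then r i else \<phi>) y \<partial>euclid s\<bar>
    \<le> ennreal (\<Prod>i\<in>u. \<beta> i) * (\<integral>\<^sup>+ x.
        ennreal (\<bar>\<integral> z. L (merge u ({1..s} - u) (x, z)) * (\<Prod>j\<in>{1..s} - u. \<phi> (z j)) \<partial>(\<Pi>\<^sub>M j\<in>{1..s} - u. lborel)\<bar>
                 * (\<Prod>j\<in>w. \<psi> (x j)) * (\<Prod>j\<in>v - w. \<psi> (x j))) \<partial>(\<Pi>\<^sub>M j\<in>u. lborel))"
proof -
  let ?J = "{1..s} - u" and ?Mu = "\<Pi>\<^sub>M j\<in>u. lborel :: (nat \<Rightarrow> real) measure"
  let ?MJ = "\<Pi>\<^sub>M j\<in>{1..s} - u. lborel :: (nat \<Rightarrow> real) measure"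
  have fin: "finite u" using u by (rule finite_subset) simp
  have un: "u \<union> ?J = {1..s}" using u by auto
  let ?f = "\<lambda>y. L y * coord_prod s (\<lambda>i. if i \<in> u then r i else \<phi>) y"
  have int: "integrable (euclid s) ?f"
    by (rule coord_prod_integrable[OF L \<kappa>]) (use r \<phi> in auto)
  define I where "I x = (\<integral>z. L (merge u ?J (x, z)) * (\<Prod>j\<in>?J. \<phi> (z j)) \<partial>?MJ)" for x
  have cp: "coord_prod s (\<lambda>i. if i \<in> u then r i else \<phi>) (merge u ?J (x, z)) = (\<Prod>i\<in>u. r i (x i)) * (\<Prod>j\<in>?J. \<phi> (z j))" for x z
  proof -
    have "coord_prod s (\<lambda>i. if i \<in> u then r i else \<phi>) (merge u ?J (x, z)) = (\<Prod>i\<in>u \<union> ?J. (if i \<in> u then r i else \<phi>) (merge u ?J (x, z) i))"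
      unfolding coord_prod_def un ..
    also have "\<dots> = (\<Prod>i\<in>u. (if i \<in> u then r i else \<phi>) (merge u ?J (x, z) i)) * (\<Prod>i\<in>?J. (if i \<in> u then r i else \<phi>) (merge u ?J (x, z) i))"
      using fin by (intro prod.union_disjoint) auto
    also have "\<dots> = (\<Prod>i\<in>u. r i (x i)) * (\<Prod>j\<in>?J. \<phi> (z j))"
      by (intro arg_cong2[of _ _ _ _ "(*)"] prod.cong) (auto simp: merge_def)
    finally show ?thesis .
  qed
  have "(\<integral>y. ?f y \<partial>euclid s) = (\<integral>x. (\<integral>z. ?f (merge u ?J (x, z)) \<partial>?MJ) \<partial>?Mu)"
    using lborel_product.product_integral_fold[of u ?J ?f] fin int un by simp
  also have "\<dots> = (\<integral>x. (\<Prod>i\<in>u. r i (x i)) * I x \<partial>?Mu)"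
    unfolding cp I_def by (simp add: mult_ac flip: Bochner_Integration.integral_mult_right_zero)
  finally have eq: "(\<integral>y. ?f y \<partial>euclid s) = (\<integral>x. (\<Prod>i\<in>u. r i (x i)) * I x \<partial>?Mu)" .
  \<comment> \<open>If the integrand is not integrable, its integral is 0 by convention and the
    bound is trivial.\<close>
  have "ennreal \<bar>\<integral>x. (\<Prod>i\<in>u. r i (x i)) * I x \<partial>?Mu\<bar> \<le> (\<integral>\<^sup>+x. ennreal \<bar>(\<Prod>i\<in>u. r i (x i)) * I x\<bar> \<partial>?Mu)"
  proof (cases "integrable ?Mu (\<lambda>x. (\<Prod>i\<in>u. r i (x i)) * I x)")
    case True
    then show ?thesis using integral_norm_bound_ennreal[OF True] by simp
  qed (simp add: not_integrable_integral_eq)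
  also have "\<dots> \<le> (\<integral>\<^sup>+x. ennreal (\<Prod>i\<in>u. \<beta> i) * ennreal (\<bar>I x\<bar> * (\<Prod>j\<in>w. \<psi> (x j)) * (\<Prod>j\<in>v - w. \<psi> (x j))) \<partial>?Mu)"
  proof (intro nn_integral_mono)
    fix x
    have fv: "finite v" using fin w by (auto intro: finite_subset)
    have "\<bar>\<Prod>i\<in>u. r i (x i)\<bar> = (\<Prod>i\<in>u. \<bar>r i (x i)\<bar>)" by (rule abs_prod)
    also have "\<dots> \<le> (\<Prod>i\<in>u. \<beta> i * (if i \<in> v then \<psi> (x i) else 1))"
      using rb by (intro prod_mono) auto
    also have "\<dots> = (\<Prod>i\<in>u. \<beta> i) * (\<Prod>i\<in>v. \<psi> (x i))"
      using fin w by (simp add: prod.distrib prod.If_cases Int_absorb1)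
    also have "(\<Prod>i\<in>v. \<psi> (x i)) = (\<Prod>j\<in>w. \<psi> (x j)) * (\<Prod>j\<in>v - w. \<psi> (x j))"
      using prod.subset_diff[OF w(1) fv, of "\<lambda>i. \<psi> (x i)"] by (simp add: mult.commute)
    finally have "\<bar>\<Prod>i\<in>u. r i (x i)\<bar> * \<bar>I x\<bar> \<le> (\<Prod>i\<in>u. \<beta> i) * ((\<Prod>j\<in>w. \<psi> (x j)) * (\<Prod>j\<in>v - w. \<psi> (x j))) * \<bar>I x\<bar>"
      by (rule mult_right_mono) simp
    then have "\<bar>(\<Prod>i\<in>u. r i (x i)) * I x\<bar> \<le> (\<Prod>i\<in>u. \<beta> i) * (\<bar>I x\<bar> * (\<Prod>j\<in>w. \<psi> (x j)) * (\<Prod>j\<in>v - w. \<psi> (x j)))"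
      by (simp add: abs_mult mult_ac)
    then show "ennreal \<bar>(\<Prod>i\<in>u. r i (x i)) * I x\<bar> \<le> ennreal (\<Prod>i\<in>u. \<beta> i) * ennreal (\<bar>I x\<bar> * (\<Prod>j\<in>w. \<psi> (x j)) * (\<Prod>j\<in>v - w. \<psi> (x j)))"
      using \<beta> \<psi> by (subst ennreal_mult[symmetric]) (auto intro!: prod_nonneg ennreal_leI mult_nonneg_nonneg)
  qed
  also have "\<dots> = ennreal (\<Prod>i\<in>u. \<beta> i) * (\<integral>\<^sup>+x. ennreal (\<bar>I x\<bar> * (\<Prod>j\<in>w. \<psi> (x j)) * (\<Prod>j\<in>v - w. \<psi> (x j))) \<partial>?Mu)"
  proof (rule nn_integral_cmult)
    interpret MJ: sigma_finite_measure ?MJ by (rule lborel_product.sigma_finite) simp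
    have "L \<in> borel_measurable (\<Pi>\<^sub>M j\<in>u \<union> ?J. lborel)" using smooth_decay_measurable[OF L] unfolding un .
    then have [measurable]: "(\<lambda>xz. L (merge u ?J xz)) \<in> borel_measurable (?Mu \<Otimes>\<^sub>M ?MJ)"
      by (rule measurable_compose[OF measurable_merge])
    have [measurable]: "\<phi> \<in> borel_measurable borel" using \<phi> unfolding exp_bounded1_def by simp
    have "(\<lambda>(x, z). L (merge u ?J (x, z)) * (\<Prod>j\<in>?J. \<phi> (z j))) \<in> borel_measurable (?Mu \<Otimes>\<^sub>M ?MJ)"
      by measurable
    then have [measurable]: "I \<in> borel_measurable ?Mu" unfolding I_def[abs_def]
      by (rule MJ.borel_measurable_lebesgue_integral)
    have [measurable]: "(\<lambda>x. \<psi> (x j)) \<in> borel_measurable ?Mu" if "j \<in> u" for j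
      using that by measurable
    have "(\<lambda>x. \<Prod>j\<in>w. \<psi> (x j)) \<in> borel_measurable ?Mu" "(\<lambda>x. \<Prod>j\<in>v - w. \<psi> (x j)) \<in> borel_measurable ?Mu"
      using w by (intro borel_measurable_prod; auto)+
    then show "(\<lambda>x. ennreal (\<bar>I x\<bar> * (\<Prod>j\<in>w. \<psi> (x j)) * (\<Prod>j\<in>v - w. \<psi> (x j)))) \<in> borel_measurable ?Mu"
      by measurable
  qed
  finally show ?thesis unfolding eq I_def .
qed

section \<open>Decay from the leading digits of a Walsh index\<close>

lemma top_bit:
  assumes "1 \<le> (l::nat)" obtains \<mu> where "bit l \<mu>" "\<lfloor>log 2 (real l)\<rfloor> = int \<mu>"
proof -
  have l0: "0 \<le> \<lfloor>log 2 (real l)\<rfloor>" using assms by simp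
  define \<mu> where "\<mu> = nat \<lfloor>log 2 (real l)\<rfloor>"
  have \<mu>: "\<lfloor>log 2 (real l)\<rfloor> = int \<mu>" unfolding \<mu>_def using l0 by simp
  have "2 powr of_int (int \<mu>) \<le> real l \<and> real l < 2 powr of_int (int \<mu> + 1)"
    using \<mu> assms by (subst floor_log_eq_powr_iff[symmetric]) auto
  then have "real (2 ^ \<mu>) \<le> real l" "real l < real (2 ^ Suc \<mu>)" by (simp_all add: powr_realpow powr_add)
  then have "2 ^ \<mu> \<le> l" "l < 2 ^ Suc \<mu>" by (simp_all only: of_nat_le_iff of_nat_less_iff)
  then have "l div 2 ^ \<mu> = 1" by (intro div_nat_eqI) auto
  then have "bit l \<mu>" by (simp add: bit_iff_odd)
  then show ?thesis using that \<mu> by blast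
qed

text \<open>Index 0 stands for a component that is absent from the index set, hence the weight
  1.\<close>

definition digit_weight :: "real \<Rightarrow> nat \<Rightarrow> real"
  where "digit_weight a l = (if l = 0 then 1 else walsh_weight a l)"

lemma digit_weight_pos: "0 < digit_weight a l" unfolding digit_weight_def using walsh_weight_pos by simp

definition wal_weight :: "real \<Rightarrow> nat \<Rightarrow> real"
  where "wal_weight a k = digit_weight a (even_bits k) * digit_weight a (odd_bits k)"

lemma wal_weight_pos: "0 < wal_weight a k" unfolding wal_weight_def using digit_weight_pos by simp

lemma even_odd_bits_eq_0: "even_bits k = 0 \<and> odd_bits k = 0 \<longleftrightarrow> k = 0"
proof
  assume e: "even_bits k = 0 \<and> odd_bits k = 0"
  have "\<not> bit k i" for i
  proof -
    have "\<not> bit k (2 * (i div 2))" "\<not> bit k (2 * (i div 2) + 1)"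
      unfolding bit_even_bits[symmetric] bit_odd_bits[symmetric] using e by simp_all
    moreover have "i = 2 * (i div 2) \<or> i = 2 * (i div 2) + 1" by presburger
    ultimately show ?thesis by metis
  qed
  then show "k = 0" by (intro bit_eqI) simp
qed (simp add: even_bits_def odd_bits_def)

text \<open>Interlacing turns the top digits of the two parts of \<open>k\<close> into two different digits of
  \<open>k\<close>, at which the Walsh function changes sign. No decay is lost when the higher one is used
  for the first and the lower one for the second integration.\<close>

lemma two_digits:
  assumes "even_bits k \<noteq> 0" "odd_bits k \<noteq> 0" and \<beta>: "0 \<le> \<beta>" "\<beta> \<le> 1"
  obtains a b where "bit k a" "bit k b" "b < a" "2 powr (- real a - \<beta> * real b) \<le> wal_weight (1 + \<beta>) k"
proof -
  obtain \<mu> where \<mu>: "bit (even_bits k) \<mu>" "\<lfloor>log 2 (real (even_bits k))\<rfloor> = int \<mu>" using top_bit[of "even_bits k"] assms by auto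
  obtain \<nu> where \<nu>: "bit (odd_bits k) \<nu>" "\<lfloor>log 2 (real (odd_bits k))\<rfloor> = int \<nu>" using top_bit[of "odd_bits k"] assms by auto
  have w: "wal_weight (1 + \<beta>) k = 2 powr (- (1 + \<beta>) * (real \<mu> + real \<nu>))"
    unfolding wal_weight_def digit_weight_def walsh_weight_def \<mu>(2) \<nu>(2) using assms by (simp add: powr_add[symmetric] algebra_simps)
  have bits: "bit k (2 * \<mu>)" "bit k (2 * \<nu> + 1)" using \<mu>(1) \<nu>(1) by (simp_all add: bit_even_bits bit_odd_bits)
  \<comment> \<open>Here z is \<mu> + \<nu>, and x, y are the digit positions 2 * \<mu> and 2 *
    \<nu> + 1 in decreasing order. As the larger position has the larger coefficient, x + \<beta> y
    is at least (1 + \<beta>) (x + y) / 2.\<close>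
  have le: "- x - \<beta> * y \<le> - (1 + \<beta>) * z" if "2 * z \<le> x + y" "y \<le> x" for x y z :: real
  proof -
    have "(1 + \<beta>) * (2 * z) \<le> (1 + \<beta>) * (x + y)" using that \<beta> by (intro mult_left_mono) auto
    moreover have "0 \<le> (1 - \<beta>) * (x - y)" using that \<beta> by simp
    ultimately show ?thesis by (simp add: algebra_simps)
  qed
  show ?thesis
  proof (cases "2 * \<mu> < 2 * \<nu> + 1")
    case True
    show ?thesis
      by (rule that[OF bits(2,1) True]) (unfold w, intro powr_mono le, use True in auto)
  next
    case False
    then have "2 * \<nu> + 1 < 2 * \<mu>" by presburger
    then have "real (2 * \<nu> + 1) \<le> real (2 * \<mu>)" by (intro of_nat_mono) simp
    then have "- real (2 * \<mu>) - \<beta> * real (2 * \<nu> + 1) \<le> - (1 + \<beta>) * (real \<mu> + real \<nu>)" by (intro le) auto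
    then have "2 powr (- real (2 * \<mu>) - \<beta> * real (2 * \<nu> + 1)) \<le> wal_weight (1 + \<beta>) k"
      unfolding w by (intro powr_mono) auto
    then show ?thesis using that[OF bits] \<open>2 * \<nu> + 1 < 2 * \<mu>\<close> by blast
  qed
qed

text \<open>Interlacing doubles the position of the top digit, and 2 \<ge> 1 + \<beta>, so a single
  integration already gives the required decay.\<close>

lemma one_digit:
  assumes "k \<noteq> 0" "even_bits k = 0 \<or> odd_bits k = 0" and \<beta>: "0 \<le> \<beta>" "\<beta> \<le> 1"
  obtains a where "bit k a" "1 / 2 ^ a \<le> wal_weight (1 + \<beta>) k"
proof -
  have p: "1 / 2 ^ a = 2 powr (- real a)" for a by (simp add: powr_minus powr_realpow divide_simps)
  have le: "- x \<le> - (1 + \<beta>) * z" if "2 * z \<le> x" "0 \<le> z" for x z :: real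
  proof -
    have "(1 + \<beta>) * z \<le> 2 * z" using that \<beta> by (intro mult_right_mono) auto
    then show ?thesis using that by (simp add: algebra_simps)
  qed
  show ?thesis
  proof (cases "even_bits k = 0")
    case True
    then have o: "odd_bits k \<noteq> 0" using assms(1) even_odd_bits_eq_0[of k] by simp
    obtain \<nu> where \<nu>: "bit (odd_bits k) \<nu>" "\<lfloor>log 2 (real (odd_bits k))\<rfloor> = int \<nu>" using top_bit[of "odd_bits k"] o by auto
    have "wal_weight (1 + \<beta>) k = 2 powr (- (1 + \<beta>) * real \<nu>)"
      unfolding wal_weight_def digit_weight_def walsh_weight_def \<nu>(2) using True o by simp
    moreover have "1 / 2 ^ (2 * \<nu> + 1) \<le> 2 powr (- (1 + \<beta>) * real \<nu>)" unfolding p by (intro powr_mono le) auto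
    moreover have "bit k (2 * \<nu> + 1)" using \<nu>(1) by (simp only: bit_odd_bits)
    ultimately show ?thesis using that by simp
  next
    case False
    then have o: "odd_bits k = 0" using assms(2) by simp
    obtain \<mu> where \<mu>: "bit (even_bits k) \<mu>" "\<lfloor>log 2 (real (even_bits k))\<rfloor> = int \<mu>" using top_bit[of "even_bits k"] False by auto
    have "wal_weight (1 + \<beta>) k = 2 powr (- (1 + \<beta>) * real \<mu>)"
      unfolding wal_weight_def digit_weight_def walsh_weight_def \<mu>(2) using False o by simp
    moreover have "1 / 2 ^ (2 * \<mu>) \<le> 2 powr (- (1 + \<beta>) * real \<mu>)" unfolding p by (intro powr_mono le) auto
    moreover have "bit k (2 * \<mu>)" using \<mu>(1) by (simp only: bit_even_bits)
    ultimately show ?thesis using that by simp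
  qed
qed

subsection \<open>Walsh coefficients\<close>

context normal_cdf
begin

text \<open>The Walsh coefficient of H composed with the inverse of \<Phi>, written on the whole
  space by the substitution x = \<Phi> t.\<close>

definition wal_coeff :: "nat \<Rightarrow> ((nat \<Rightarrow> real) \<Rightarrow> real) \<Rightarrow> (nat \<Rightarrow> nat) \<Rightarrow> real"
  where "wal_coeff s H k = (\<integral>y. H y * coord_prod s (\<lambda>i t. wal (k i) (\<Phi> t) * gauss \<sigma> t) y \<partial>euclid s)"

lemma exp_bounded1_bounded:
  assumes "p \<in> borel_measurable borel" "\<And>t. \<bar>p t\<bar> \<le> B" shows "exp_bounded1 p"
proof -
  have "0 \<le> B" using assms(2)[of 0] by linarith
  then show ?thesis using assms unfolding exp_bounded1_def by (intro conjI exI[of _ B] exI[of _ 0]) auto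
qed

lemma gauss_le: "gauss \<sigma> t \<le> 1 / sqrt (2 * pi * \<sigma>\<^sup>2)"
proof -
  have "exp (- t\<^sup>2 / (2 * \<sigma>\<^sup>2)) \<le> 1" by simp
  then show ?thesis unfolding normal_density_def by (simp add: divide_right_mono)
qed

lemma Phi_measurable [measurable]: "\<Phi> \<in> borel_measurable borel"
  by (rule borel_measurable_continuous_onI) (auto simp: continuous_on_eq_continuous_at isCont_Phi)

lemma exp_bounded1_gauss: "exp_bounded1 (gauss \<sigma>)"
  by (rule exp_bounded1_bounded[OF _ order_trans[OF _ gauss_le]]) (auto simp: normal_density_nonneg)

lemma exp_bounded1_wal: "exp_bounded1 (\<lambda>t. wal k (\<Phi> t) * gauss \<sigma> t)"
  by (rule exp_bounded1_bounded[OF _ order_trans[OF _ gauss_le]]) (auto simp: abs_mult normal_density_nonneg)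

lemma continuous_prim_Phi:
  assumes "w integrable_on {0..1}" shows "continuous_on UNIV (\<lambda>t. prim w (\<Phi> t))"
proof (rule continuous_on_compose2[OF prim_continuous[OF assms]])
  show "continuous_on UNIV \<Phi>" by (auto simp: continuous_on_eq_continuous_at isCont_Phi)
  show "\<Phi> ` UNIV \<subseteq> {0..1}" by (auto intro: less_imp_le[OF Phi_range(1)] less_imp_le[OF Phi_range(2)])
qed

text \<open>All coordinates in u are integrated once, and those in the witness v, where both halves
  of the index are nonzero, a second time. The maximum with 1 in the constant serves the coordinates
  integrated only once, where no quotient by the density arises.\<close>

lemma wal_coeff_bound:
  assumes H: "smooth_decay s \<kappa> H" "0 < \<kappa>"
    and \<rho>: "0 < \<rho>" and \<delta>: "0 < \<delta>" "0 \<le> \<beta>" "\<beta> \<le> 1" "\<beta> = 1 - \<sigma>\<^sup>2 / \<rho>\<^sup>2 - \<delta>"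
    and \<psi>: "\<psi> = (\<lambda>x. gauss \<rho> x / gauss \<sigma> x)"
    and u: "u = {j \<in> {1..s}. k j \<noteq> 0}"
  shows "\<exists>v\<subseteq>u. ennreal \<bar>wal_coeff s H k\<bar>
    \<le> ennreal (\<Prod>j\<in>u. max 1 (transform_const \<rho> \<delta>) * wal_weight (1 + \<beta>) (k j)) * norm_uv s (gauss \<sigma>) \<psi> \<psi> u v H"
proof -
  define M where "M = max 1 (transform_const \<rho> \<delta>)"
  define v where "v = {j \<in> u. even_bits (k j) \<noteq> 0 \<and> odd_bits (k j) \<noteq> 0}"
  define B where "B j = M * wal_weight (1 + \<beta>) (k j)" for j
  have B0: "0 \<le> B j" for j unfolding B_def M_def using less_imp_le[OF wal_weight_pos] by auto
  have us: "u \<subseteq> {1..s}" "v \<subseteq> u" unfolding u v_def by auto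
  \<comment> \<open>The functions b and V after \<Phi> come from the first and second primitive of
    the Walsh function on [0, 1]. The derivative of V after \<Phi> is b times the density, so that
    division by the density gives P with P' = b - Q.\<close>
  define a where "a j = (\<lambda>t. wal (k j) (\<Phi> t) * gauss \<sigma> t)" for j
  define b where "b j = (\<lambda>t. prim (wal (k j)) (\<Phi> t))" for j
  define V where "V j = prim (prim (wal (k j)))" for j
  define P where "P j = (\<lambda>t. V j (\<Phi> t) / gauss \<sigma> t)" for j
  define Q where "Q j = (\<lambda>t. V j (\<Phi> t) * (- t / \<sigma>\<^sup>2) / gauss \<sigma> t)" for j
  have gp: "0 < gauss \<rho> t" "0 < gauss \<sigma> t" for t using normal_density_pos \<rho> \<sigma>_pos by auto
  have \<psi>0: "0 \<le> \<psi> t" for t unfolding \<psi> using gp by (simp add: less_imp_le)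
  have \<psi>m: "\<psi> \<in> borel_measurable borel" unfolding \<psi> by measurable
  have Phi01: "0 \<le> \<Phi> t" "\<Phi> t \<le> 1" for t using Phi_range[of t] by auto
  have Vc: "continuous_on UNIV (\<lambda>t. V j (\<Phi> t))" for j
    unfolding V_def by (rule continuous_prim_Phi[OF prim_integrable[OF wal_integrable]])
  have bc: "continuous_on UNIV (b j)" for j unfolding b_def by (rule continuous_prim_Phi[OF wal_integrable])
  have bb: "\<bar>b j t\<bar> \<le> 1 / 2 ^ c" if "bit (k j) c" for j c t
  proof -
    have "\<bar>b j t\<bar> \<le> 1 * min (\<Phi> t) (min (1 - \<Phi> t) (1 / 2 ^ c))"
      unfolding b_def by (rule prim_bound[OF wal_integrable _ antisym_at_wal[OF that] Phi01]) simp
    then show ?thesis by simp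
  qed
  have bit_ex: "\<exists>c. bit (k j) c" if "j \<in> u" for j
  proof (rule ccontr)
    assume "\<nexists>c. bit (k j) c"
    then have "k j = 0" by (intro bit_eqI) simp
    then show False using that unfolding u by simp
  qed
  have ebb: "exp_bounded1 (b j)" if ju: "j \<in> u" for j
  proof -
    obtain c where "bit (k j) c" using bit_ex[OF ju] by blast
    then show ?thesis using bb bc[of j] by (intro exp_bounded1_bounded[of _ "1 / 2 ^ c"] borel_measurable_continuous_onI) auto
  qed
  have eba: "exp_bounded1 (a j)" for j unfolding a_def by (rule exp_bounded1_wal)
  \<comment> \<open>A Walsh function of index below 2^L jumps only at dyadic points of level L, and
    \<Phi> is injective, so finitely many exceptional points remain.\<close>
  have db: "\<exists>F. finite F \<and> (\<forall>t. t \<notin> F \<longrightarrow> (b j has_real_derivative a j t) (at t))" for j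
  proof -
    obtain L where L: "k j < 2 ^ L" using less_exp by blast
    define F where "F = \<Phi> -` ((\<lambda>i::nat. real i / 2 ^ L) ` {..2 ^ L})"
    have "finite F" unfolding F_def by (intro finite_vimageI inj_Phi) simp
    moreover have "(b j has_real_derivative a j t) (at t)" if "t \<notin> F" for t
    proof -
      have nd: "\<Phi> t \<noteq> real i / 2 ^ L" for i :: nat
      proof
        assume e: "\<Phi> t = real i / 2 ^ L"
        then have "real i \<le> real (2 ^ L)" using Phi01(2)[of t] by (simp add: divide_le_eq)
        then have "i \<le> 2 ^ L" by (simp only: of_nat_le_iff)
        then show False using that e unfolding F_def by auto
      qed
      have "(prim (wal (k j)) has_real_derivative wal (k j) (\<Phi> t)) (at (\<Phi> t))"
        by (rule prim_has_derivative[OF wal_integrable Phi_range isCont_wal[OF L Phi_range(1) nd]])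
      from DERIV_chain2[OF this Phi_has_derivative] show ?thesis unfolding a_def b_def .
    qed
    ultimately show ?thesis by blast
  qed
  have vdig: "\<exists>c d. bit (k j) c \<and> bit (k j) d \<and> d < c \<and> 2 powr (- real c - \<beta> * real d) \<le> wal_weight (1 + \<beta>) (k j)" if "j \<in> v" for j
    using that two_digits[of "k j" \<beta>] \<delta> unfolding v_def by blast
  have Vb: "\<bar>V j (\<Phi> t)\<bar> \<le> min (\<Phi> t) (1 - \<Phi> t)"
    "\<bar>V j (\<Phi> t)\<bar> \<le> B j * gauss \<rho> t" "\<bar>V j (\<Phi> t)\<bar> * (\<bar>t\<bar> / \<sigma>\<^sup>2) \<le> B j * gauss \<rho> t" if jv: "j \<in> v" for j t
  proof -
    obtain c d where cd: "bit (k j) c" "bit (k j) d" "d < c" "2 powr (- real c - \<beta> * real d) \<le> wal_weight (1 + \<beta>) (k j)"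
      using vdig[OF jv] by blast
    have Vb: "\<bar>V j x\<bar> \<le> 1 / 2 ^ c * min x (min (1 - x) (1 / 2 ^ d))" if "0 \<le> x" "x \<le> 1" for x
      unfolding V_def by (rule prim_prim_bound[OF wal_integrable _ antisym_at_wal[OF cd(1)] antisym_at_wal[OF cd(2)] cd(3) that]) simp
    have le1: "1 / 2 ^ c * min (\<Phi> t) (min (1 - \<Phi> t) (1 / 2 ^ d)) \<le> 1 * min (\<Phi> t) (1 - \<Phi> t)"
      using Phi01[of t] by (intro mult_mono) auto
    show "\<bar>V j (\<Phi> t)\<bar> \<le> min (\<Phi> t) (1 - \<Phi> t)" by (rule order_trans[OF Vb[OF Phi01[of t]] le1[unfolded mult_1_left]])
    have le: "transform_const \<rho> \<delta> * 1 * 2 powr (- real c - \<beta> * real d) * gauss \<rho> t \<le> B j * gauss \<rho> t"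
      unfolding B_def M_def using cd(4) gp(1)[of t] transform_const_pos[OF \<rho> \<delta>(1)]
      by (intro mult_right_mono mult_mono) auto
    note tb = transform_bound[OF \<rho> \<delta>(1,2,4) zero_le_one Vb, of t]
    show "\<bar>V j (\<Phi> t)\<bar> \<le> B j * gauss \<rho> t" by (rule order_trans[OF tb(1) le])
    show "\<bar>V j (\<Phi> t)\<bar> * (\<bar>t\<bar> / \<sigma>\<^sup>2) \<le> B j * gauss \<rho> t" by (rule order_trans[OF tb(2) le])
  qed
  \<comment> \<open>A bound without decay in k; it secures the growth conditions under which the
    integrations by parts are allowed.\<close>
  have VS: "\<bar>V j (\<Phi> t)\<bar> / gauss \<sigma> t \<le> sqrt (2 * pi * \<sigma>\<^sup>2)" if "j \<in> v" for j t
  proof -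
    have "\<bar>V j (\<Phi> t)\<bar> \<le> exp (- t\<^sup>2 / (2 * \<sigma>\<^sup>2))" using Vb(1)[OF that, of t] Phi_tail[of t] by linarith
    also have "\<dots> = sqrt (2 * pi * \<sigma>\<^sup>2) * gauss \<sigma> t" unfolding normal_density_def using \<sigma>_pos by simp
    finally show ?thesis using gp(2)[of t] by (simp add: pos_divide_le_eq)
  qed
  have Vm [measurable]: "(\<lambda>t. V j (\<Phi> t)) \<in> borel_measurable borel" for j
    by (rule borel_measurable_continuous_onI[OF Vc])
  have ebP: "exp_bounded1 (P j)" if "j \<in> v" for j
    unfolding P_def using VS[OF that] gp(2) by (intro exp_bounded1_bounded[where B="sqrt (2 * pi * \<sigma>\<^sup>2)"]) (auto simp: less_imp_le)
  have ebQ: "exp_bounded1 (Q j)" if "j \<in> v" for j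
  proof -
    have "\<bar>Q j t\<bar> \<le> (sqrt (2 * pi * \<sigma>\<^sup>2) / \<sigma>\<^sup>2) * exp (1 * \<bar>t\<bar>)" for t
    proof -
      have "\<bar>Q j t\<bar> = \<bar>V j (\<Phi> t)\<bar> / gauss \<sigma> t * \<bar>t\<bar> / \<sigma>\<^sup>2" unfolding Q_def using gp(2)[of t] by (simp add: abs_mult)
      moreover have "\<bar>t\<bar> \<le> exp \<bar>t\<bar>" using exp_ge_add_one_self[of "\<bar>t\<bar>"] by linarith
      then have "\<bar>V j (\<Phi> t)\<bar> / gauss \<sigma> t * \<bar>t\<bar> / \<sigma>\<^sup>2 \<le> sqrt (2 * pi * \<sigma>\<^sup>2) * exp (\<bar>t\<bar>) / \<sigma>\<^sup>2"
        using VS[OF that, of t] gp(2)[of t] by (intro divide_right_mono mult_mono) auto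
      ultimately show ?thesis by simp
    qed
    moreover have "Q j \<in> borel_measurable borel" unfolding Q_def by measurable
    ultimately show ?thesis unfolding exp_bounded1_def
      by (intro conjI exI[of _ "sqrt (2 * pi * \<sigma>\<^sup>2) / \<sigma>\<^sup>2"] exI[of _ 1]) auto
  qed
  have dP: "(P j has_real_derivative b j t - Q j t) (at t)" for j t
  proof -
    have "(V j has_real_derivative prim (wal (k j)) (\<Phi> t)) (at (\<Phi> t))"
      unfolding V_def by (rule prim_prim_has_derivative[OF wal_integrable Phi_range])
    from DERIV_chain2[OF this Phi_has_derivative]
    have "((\<lambda>t. V j (\<Phi> t)) has_real_derivative b j t * gauss \<sigma> t) (at t)" unfolding b_def .
    note d = this
    have gne: "gauss \<sigma> t \<noteq> 0" using gp(2)[of t] by simp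
    show ?thesis unfolding P_def Q_def
      by (rule DERIV_cong[OF DERIV_divide[OF d gauss_has_derivative gne]]) (use gne in \<open>simp add: field_simps\<close>)
  qed
  have Pb: "\<bar>P j t\<bar> \<le> B j * \<psi> t" "\<bar>Q j t\<bar> \<le> B j * \<psi> t" if "j \<in> v" for j t
  proof -
    have e: "\<bar>P j t\<bar> = \<bar>V j (\<Phi> t)\<bar> / gauss \<sigma> t" "\<bar>Q j t\<bar> = \<bar>V j (\<Phi> t)\<bar> * (\<bar>t\<bar> / \<sigma>\<^sup>2) / gauss \<sigma> t"
      unfolding P_def Q_def using gp(2)[of t] by (simp_all add: abs_mult)
    show "\<bar>P j t\<bar> \<le> B j * \<psi> t" "\<bar>Q j t\<bar> \<le> B j * \<psi> t"
      unfolding e \<psi> times_divide_eq_right[of "B j"]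
      by (rule divide_right_mono[OF Vb(2)[OF that] less_imp_le[OF gp(2)]], rule divide_right_mono[OF Vb(3)[OF that] less_imp_le[OF gp(2)]])
  qed
  have b1: "\<bar>b j t\<bar> \<le> B j" if "j \<in> u - v" for j t
  proof -
    have "k j \<noteq> 0" "even_bits (k j) = 0 \<or> odd_bits (k j) = 0" using that unfolding u v_def by auto
    then obtain c where c: "bit (k j) c" "1 / 2 ^ c \<le> wal_weight (1 + \<beta>) (k j)" using one_digit \<delta> by metis
    have "\<bar>b j t\<bar> \<le> 1 / 2 ^ c" by (rule bb[OF c(1)])
    also have "\<dots> \<le> wal_weight (1 + \<beta>) (k j)" by (rule c(2))
    also have "\<dots> \<le> B j" unfolding B_def M_def using wal_weight_pos[of "1 + \<beta>" "k j"] by (simp add: mult_le_cancel_right1)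
    finally show ?thesis .
  qed
  have w0: "wal 0 x = 1" for x unfolding wal_eq_prod by (simp add: bot_fun_def)
  have "coord_prod s (\<lambda>i t. wal (k i) (\<Phi> t) * gauss \<sigma> t) = coord_prod s (\<lambda>i. if i \<in> u then a i else gauss \<sigma>)"
    unfolding coord_prod_def a_def u by (intro ext prod.cong) (auto simp: w0)
  then have "wal_coeff s H k = (-1) ^ card u * (\<integral>y. mixed_deriv u H y * coord_prod s (\<lambda>i. if i \<in> u then b i else gauss \<sigma>) y \<partial>euclid s)"
    unfolding wal_coeff_def
    using integral_by_parts_all[OF H us(1) exp_bounded1_gauss, of a b] eba ebb bc db by simp
  also have "(\<lambda>i. if i \<in> u then b i else gauss \<sigma>) = (\<lambda>i. if i \<in> v then b i else (if i \<in> u then b i else gauss \<sigma>))"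
    using us by (auto simp: fun_eq_iff)
  also have "(\<integral>y. mixed_deriv u H y * coord_prod s (\<lambda>i. if i \<in> v then b i else (if i \<in> u then b i else gauss \<sigma>)) y \<partial>euclid s)
    = (\<Sum>w\<in>Pow v. (-1) ^ card w * (\<integral>y. mixed_deriv w (mixed_deriv u H) y * coord_prod s (\<lambda>i. if i \<in> w then P i else if i \<in> v then Q i else (if i \<in> u then b i else gauss \<sigma>)) y \<partial>euclid s))"
    by (rule integral_by_parts_split[OF smooth_decay_mixed[OF H(1) us(1)] H(2)])
      (use us ebb ebP ebQ dP exp_bounded1_gauss in auto)
  finally have "\<bar>wal_coeff s H k\<bar> \<le> (\<Sum>w\<in>Pow v. \<bar>\<integral>y. mixed_deriv w (mixed_deriv u H) y * coord_prod s (\<lambda>i. if i \<in> w then P i else if i \<in> v then Q i else (if i \<in> u then b i else gauss \<sigma>)) y \<partial>euclid s\<bar>)"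
    by (simp add: abs_mult) (rule order_trans[OF sum_abs], simp add: abs_mult)
  then have "ennreal \<bar>wal_coeff s H k\<bar> \<le> ennreal (\<Sum>w\<in>Pow v. \<bar>\<integral>y. mixed_deriv w (mixed_deriv u H) y * coord_prod s (\<lambda>i. if i \<in> w then P i else if i \<in> v then Q i else (if i \<in> u then b i else gauss \<sigma>)) y \<partial>euclid s\<bar>)"
    by (rule ennreal_leI)
  also have "\<dots> = (\<Sum>w\<in>Pow v. ennreal \<bar>\<integral>y. mixed_deriv w (mixed_deriv u H) y * coord_prod s (\<lambda>i. if i \<in> w then P i else if i \<in> v then Q i else (if i \<in> u then b i else gauss \<sigma>)) y \<partial>euclid s\<bar>)"
    by (rule sum_ennreal[symmetric]) simp
  also have "\<dots> \<le> (\<Sum>w\<in>Pow v. ennreal (\<Prod>i\<in>u. B i) * (\<integral>\<^sup>+ x.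
        ennreal (\<bar>\<integral> z. mixed_deriv w (mixed_deriv u H) (merge u ({1..s} - u) (x, z)) * (\<Prod>j\<in>{1..s} - u. gauss \<sigma> (z j)) \<partial>(\<Pi>\<^sub>M j\<in>{1..s} - u. lborel)\<bar>
                 * (\<Prod>j\<in>w. \<psi> (x j)) * (\<Prod>j\<in>v - w. \<psi> (x j))) \<partial>(\<Pi>\<^sub>M j\<in>u. lborel)))"
  proof (rule sum_mono)
    fix w assume "w \<in> Pow v"
    then have w: "w \<subseteq> v" by simp
    define r where "r i = (if i \<in> w then P i else if i \<in> v then Q i else b i)" for i
    have e: "(\<lambda>i. if i \<in> w then P i else if i \<in> v then Q i else (if i \<in> u then b i else gauss \<sigma>)) = (\<lambda>i. if i \<in> u then r i else gauss \<sigma>)"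
      unfolding r_def using w us by (auto simp: fun_eq_iff)
    show "ennreal \<bar>\<integral>y. mixed_deriv w (mixed_deriv u H) y * coord_prod s (\<lambda>i. if i \<in> w then P i else if i \<in> v then Q i else (if i \<in> u then b i else gauss \<sigma>)) y \<partial>euclid s\<bar>
      \<le> ennreal (\<Prod>i\<in>u. B i) * (\<integral>\<^sup>+ x.
        ennreal (\<bar>\<integral> z. mixed_deriv w (mixed_deriv u H) (merge u ({1..s} - u) (x, z)) * (\<Prod>j\<in>{1..s} - u. gauss \<sigma> (z j)) \<partial>(\<Pi>\<^sub>M j\<in>{1..s} - u. lborel)\<bar>
                 * (\<Prod>j\<in>w. \<psi> (x j)) * (\<Prod>j\<in>v - w. \<psi> (x j))) \<partial>(\<Pi>\<^sub>M j\<in>u. lborel))"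
      unfolding e
    proof (rule abs_integral_le_norm_term[OF _ H(2) us(1) w us(2) _ exp_bounded1_gauss \<psi>m \<psi>0 B0])
      show "smooth_decay s \<kappa> (mixed_deriv w (mixed_deriv u H))"
        using w us by (intro smooth_decay_mixed H(1)) auto
      show "exp_bounded1 (r i)" if "i \<in> u" for i unfolding r_def using ebP ebQ ebb that w by auto
      show "\<bar>r i t\<bar> \<le> B i * \<psi> t" if "i \<in> v" for i t unfolding r_def using Pb that by auto
      show "\<bar>r i t\<bar> \<le> B i" if "i \<in> u - v" for i t unfolding r_def using b1 that w by auto
    qed
  qed
  also have "\<dots> = ennreal (\<Prod>i\<in>u. B i) * norm_uv s (gauss \<sigma>) \<psi> \<psi> u v H"
    unfolding norm_uv_def by (rule sum_distrib_left[symmetric])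
  finally show ?thesis using us(2) unfolding B_def M_def by blast
qed

end

section \<open>Point values as limits of Walsh partial sums\<close>

lemma smooth_decay_bounded:
  assumes K: "smooth_decay s \<kappa> K" and \<kappa>: "0 < \<kappa>"
  obtains B where "0 \<le> B" "\<And>y. y \<in> points s \<Longrightarrow> \<bar>K y\<bar> \<le> B"
proof -
  obtain P where P: "tame s 0 P" "\<And>y. y \<in> points s \<Longrightarrow> K y = P y * damping s \<kappa> y"
    using K unfolding smooth_decay_def gsmooth_def by blast
  obtain C c where c: "0 \<le> C" "0 \<le> c" "\<And>y. y \<in> points s \<Longrightarrow> \<bar>P y\<bar> \<le> C * exp (c * (\<Sum>j\<in>{1..s}. \<bar>y j\<bar>))"
    using exp_boundedE[OF tame_imp_exp_bounded[OF P(1)]] by blast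
  have "\<bar>K y\<bar> \<le> C * (\<Prod>j\<in>{1..s}. exp (c\<^sup>2 / (2 * \<kappa>)))" if y: "y \<in> points s" for y
  proof -
    have d: "0 \<le> damping s \<kappa> y" unfolding damping_def by (intro prod_nonneg) auto
    have "\<bar>K y\<bar> \<le> C * exp (c * (\<Sum>j\<in>{1..s}. \<bar>y j\<bar>)) * damping s \<kappa> y"
      unfolding P(2)[OF y] using c(3)[OF y] d by (simp add: abs_mult mult_right_mono)
    also have "\<dots> = C * (\<Prod>j\<in>{1..s}. exp (c * \<bar>y j\<bar> - \<kappa> * (y j)\<^sup>2))"
      unfolding damping_def sum_distrib_left exp_sum[OF finite_atLeastAtMost] mult.assoc prod.distrib[symmetric] exp_add[symmetric] by simp
    also have "\<dots> \<le> C * (\<Prod>j\<in>{1..s}. exp (c\<^sup>2 / (2 * \<kappa>)))"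
    proof (intro mult_left_mono prod_mono conjI c(1))
      fix j
      have "exp (c * \<bar>y j\<bar> - \<kappa> * (y j)\<^sup>2) \<le> exp (c\<^sup>2 / (2 * \<kappa>)) * exp (- (\<kappa> / 2) * (y j)\<^sup>2)"
        by (rule exp_abs_square_le[OF \<kappa>])
      also have "\<dots> \<le> exp (c\<^sup>2 / (2 * \<kappa>)) * 1" using \<kappa> by (intro mult_left_mono) auto
      finally show "exp (c * \<bar>y j\<bar> - \<kappa> * (y j)\<^sup>2) \<le> exp (c\<^sup>2 / (2 * \<kappa>))" by simp
    qed simp
    finally show ?thesis .
  qed
  then show thesis using that[of "C * (\<Prod>j\<in>{1..s}. exp (c\<^sup>2 / (2 * \<kappa>)))"] c(1) by (simp add: prod_nonneg)
qed

text \<open>The coordinates are changed from z to y one at a time, each change being controlled by a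
  bounded partial derivative.\<close>

lemma smooth_decay_lipschitz:
  assumes K: "smooth_decay s \<kappa> K" and \<kappa>: "0 < \<kappa>"
  obtains B where "0 \<le> B" "\<And>y z. y \<in> points s \<Longrightarrow> z \<in> points s \<Longrightarrow> \<bar>K y - K z\<bar> \<le> B * (\<Sum>j\<in>{1..s}. \<bar>y j - z j\<bar>)"
proof -
  have "\<exists>B. 0 \<le> B \<and> (\<forall>y\<in>points s. \<bar>partial_deriv j K y\<bar> \<le> B)" if "j \<in> {1..s}" for j
    using smooth_decay_bounded[OF smooth_decay_partial(1)[OF K that] \<kappa>] by metis
  then obtain Bj where Bj: "\<And>j. j \<in> {1..s} \<Longrightarrow> 0 \<le> Bj j" "\<And>j y. j \<in> {1..s} \<Longrightarrow> y \<in> points s \<Longrightarrow> \<bar>partial_deriv j K y\<bar> \<le> Bj j"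
    by metis
  define B where "B = (\<Sum>j\<in>{1..s}. Bj j)"
  have B: "\<bar>partial_deriv j K y\<bar> \<le> B" if "j \<in> {1..s}" "y \<in> points s" for j y
  proof -
    have "Bj j \<le> B" unfolding B_def using that Bj(1) by (intro member_le_sum) auto
    then show ?thesis using Bj(2)[OF that] by linarith
  qed
  have B0: "0 \<le> B" unfolding B_def using Bj(1) by (intro sum_nonneg) auto
  have "\<bar>K y - K z\<bar> \<le> B * (\<Sum>j\<in>{1..s}. \<bar>y j - z j\<bar>)" if y: "y \<in> points s" and z: "z \<in> points s" for y z
  proof -
    define ov where "ov A = (\<lambda>i. if i \<in> A then y i else z i)" for A
    have ovp: "ov A \<in> points s" for A using y z unfolding ov_def by (auto simp: PiE_iff extensional_def)
    have "\<bar>K (ov A) - K z\<bar> \<le> B * (\<Sum>j\<in>A. \<bar>y j - z j\<bar>)" if "finite A" "A \<subseteq> {1..s}" for A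
      using that
    proof (induction A)
      case empty
      then show ?case by (simp add: ov_def)
    next
      case (insert j A)
      then have j: "j \<in> {1..s}" by auto
      let ?f = "\<lambda>t. K ((ov A)(j := t))"
      have d: "(?f has_real_derivative partial_deriv j K ((ov A)(j := t))) (at t)" for t
        using smooth_decay_partial(2)[OF K j] points_upd[OF ovp[of A] j, of t] unfolding has_partial_def by fastforce
      have "norm (?f (y j) - ?f (z j)) \<le> B * norm (y j - z j)"
        by (rule field_differentiable_bound[where S=UNIV and f'="\<lambda>t. partial_deriv j K ((ov A)(j := t))"])
          (rule convex_UNIV, rule d, unfold real_norm_def, rule B[OF j points_upd[OF ovp j]], rule UNIV_I, rule UNIV_I)
      moreover have "(ov A)(j := y j) = ov (insert j A)" "(ov A)(j := z j) = ov A"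
        using insert.hyps unfolding ov_def by auto
      ultimately have "\<bar>K (ov (insert j A)) - K (ov A)\<bar> \<le> B * \<bar>y j - z j\<bar>" by simp
      moreover have "\<bar>K (ov A) - K z\<bar> \<le> B * (\<Sum>j\<in>A. \<bar>y j - z j\<bar>)" using insert by auto
      ultimately show ?case using insert.hyps by (simp add: distrib_left)
    qed
    from this[of "{1..s}"] have "\<bar>K (ov {1..s}) - K z\<bar> \<le> B * (\<Sum>j\<in>{1..s}. \<bar>y j - z j\<bar>)" by simp
    moreover have "ov {1..s} = y" using y z unfolding ov_def by (auto simp: PiE_iff extensional_def fun_eq_iff)
    ultimately show ?thesis by simp
  qed
  then show thesis using that B0 by blast
qed

context normal_cdf
begin

text \<open>The Walsh kernel of \<open>sum_wal_mult\<close> pulled back by \<Phi>, times the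
  density.\<close>

definition cell_kernel :: "nat \<Rightarrow> real \<Rightarrow> real \<Rightarrow> real"
  where "cell_kernel L x t = (if \<lfloor>2 ^ L * x\<rfloor> = \<lfloor>2 ^ L * \<Phi> t\<rfloor> then 2 ^ L else 0) * gauss \<sigma> t"

lemma cell_kernel_nonneg: "0 \<le> cell_kernel L x t"
  unfolding cell_kernel_def by (simp add: normal_density_nonneg)

lemma cell_kernel_measurable [measurable]: "cell_kernel L x \<in> borel_measurable borel"
  unfolding cell_kernel_def by measurable

lemma exp_bounded1_cell_kernel: "exp_bounded1 (cell_kernel L x)"
proof (rule exp_bounded1_bounded)
  fix t
  have "\<bar>cell_kernel L x t\<bar> \<le> 2 ^ L * gauss \<sigma> t" unfolding cell_kernel_def by (simp add: normal_density_nonneg)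
  also have "\<dots> \<le> 2 ^ L * (1 / sqrt (2 * pi * \<sigma>\<^sup>2))" by (intro mult_left_mono gauss_le) simp
  finally show "\<bar>cell_kernel L x t\<bar> \<le> 2 ^ L * (1 / sqrt (2 * pi * \<sigma>\<^sup>2))" .
qed simp

text \<open>\<open>\<Phi>\<close> maps the normal distribution to the uniform one, so every dyadic cell has the
  mass of its length.\<close>

lemma integral_cell_kernel:
  assumes x: "0 < x" "x < 1" and L: "1 / 2 ^ L < x" "1 / 2 ^ L < 1 - x"
  shows "integrable lborel (cell_kernel L x)" "(\<integral>t. cell_kernel L x t \<partial>lborel) = 1"
proof -
  define i where "i = \<lfloor>2 ^ L * x\<rfloor>"
  have i: "of_int i \<le> 2 ^ L * x" "2 ^ L * x < of_int i + 1" unfolding i_def by linarith+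
  \<comment> \<open>The cell of x must not touch 0 or 1, since both of its ends need preimages and
    \<Phi> attains only interior values.\<close>
  have L1: "1 < 2 ^ L * x" using L(1) by (simp add: field_simps)
  have L2: "2 ^ L * x < 2 ^ L - 1" using L(2) by (simp add: field_simps)
  have i1: "0 < of_int i / (2::real) ^ L" using i(2) L1 by simp
  have i2: "(of_int i + 1) / (2::real) ^ L < 1" using i(1) L2 by simp
  have lt: "of_int i / (2::real) ^ L < (of_int i + 1) / 2 ^ L" by (simp add: divide_strict_right_mono)
  obtain a where a: "\<Phi> a = of_int i / 2 ^ L" using Phi_surj[OF i1 less_trans[OF lt i2]] by blast
  obtain b where b: "\<Phi> b = (of_int i + 1) / 2 ^ L" using Phi_surj[OF less_trans[OF i1 lt] i2] by blast
  have ab: "a < b" using strict_mono_less[OF Phi_strict_mono, of a b] a b lt by simp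
  have eq: "cell_kernel L x t = 2 ^ L * (indicator {a..<b} t * gauss \<sigma> t)" for t
  proof -
    have "i = \<lfloor>2 ^ L * \<Phi> t\<rfloor> \<longleftrightarrow> of_int i / 2 ^ L \<le> \<Phi> t \<and> \<Phi> t < (of_int i + 1) / 2 ^ L"
      by (auto simp: field_simps floor_eq_iff eq_commute[of i])
    also have "\<dots> \<longleftrightarrow> t \<in> {a..<b}"
      unfolding a[symmetric] b[symmetric] strict_mono_less[OF Phi_strict_mono] strict_mono_less_eq[OF Phi_strict_mono] by simp
    finally show ?thesis unfolding cell_kernel_def i_def[symmetric] by (simp add: indicator_def)
  qed
  have int: "integrable lborel (\<lambda>t. indicator {a..<b} t * gauss \<sigma> t)"
    using integrable_mult_indicator[of "{a..<b}" lborel "gauss \<sigma>"] integrable_normal_density[OF \<sigma>_pos] by simp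
  then show "integrable lborel (cell_kernel L x)" unfolding eq[abs_def] by simp
  have "(\<integral>t. indicator {a..<b} t * gauss \<sigma> t \<partial>lborel) = (\<integral>t. indicator {a..b} t *\<^sub>R gauss \<sigma> t \<partial>lborel)"
  proof (rule integral_cong_AE)
    show "AE t in lborel. indicator {a..<b} t * gauss \<sigma> t = indicator {a..b} t *\<^sub>R gauss \<sigma> t"
      using AE_lborel_singleton[of b] by eventually_elim (auto simp: indicator_def)
  qed simp_all
  also have "\<dots> = integral {a..b} (gauss \<sigma>)"
    unfolding set_lebesgue_integral_def[symmetric]
    by (intro set_borel_integral_eq_integral)
      (use integrable_mult_indicator[of "{a..b}" lborel "gauss \<sigma>"] integrable_normal_density[OF \<sigma>_pos] in \<open>auto simp: set_integrable_def\<close>)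
  also have "\<dots> = \<Phi> b - \<Phi> a" using ab by (intro Phi_diff[symmetric]) simp
  also have "\<dots> = 1 / 2 ^ L" unfolding a b by (simp add: diff_divide_distrib[symmetric])
  finally show "(\<integral>t. cell_kernel L x t \<partial>lborel) = 1" unfolding eq by simp
qed

definition walsh_partial :: "nat \<Rightarrow> ((nat \<Rightarrow> real) \<Rightarrow> real) \<Rightarrow> nat \<Rightarrow> (nat \<Rightarrow> real) \<Rightarrow> real"
  where "walsh_partial s H L x = (\<Sum>k\<in>{1..s} \<rightarrow>\<^sub>E {..<2 ^ L}. wal_coeff s H k * (\<Prod>j\<in>{1..s}. wal (k j) (x j)))"

text \<open>The summation over indices acts on each coordinate separately and produces the Walsh
  kernel there.\<close>

lemma walsh_partial_eq:
  assumes H: "smooth_decay s \<kappa> H" "0 < \<kappa>" and x: "\<And>j. j \<in> {1..s} \<Longrightarrow> 0 < x j \<and> x j < 1"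
  shows "walsh_partial s H L x = (\<integral>y. H y * coord_prod s (\<lambda>j. cell_kernel L (x j)) y \<partial>euclid s)"
proof -
  have int: "integrable (euclid s) (\<lambda>y. H y * coord_prod s (\<lambda>i t. wal (k i) (\<Phi> t) * gauss \<sigma> t) y)" for k
    by (rule coord_prod_integrable[OF H exp_bounded1_wal])
  have "walsh_partial s H L x = (\<Sum>k\<in>{1..s} \<rightarrow>\<^sub>E {..<2 ^ L}. \<integral>y. H y * coord_prod s (\<lambda>i t. wal (k i) (\<Phi> t) * gauss \<sigma> t) y * (\<Prod>j\<in>{1..s}. wal (k j) (x j)) \<partial>euclid s)"
    unfolding walsh_partial_def wal_coeff_def by simp
  also have "\<dots> = (\<integral>y. (\<Sum>k\<in>{1..s} \<rightarrow>\<^sub>E {..<2 ^ L}. H y * coord_prod s (\<lambda>i t. wal (k i) (\<Phi> t) * gauss \<sigma> t) y * (\<Prod>j\<in>{1..s}. wal (k j) (x j))) \<partial>euclid s)"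
    by (rule Bochner_Integration.integral_sum[symmetric]) (intro integrable_mult_left int)
  also have "\<dots> = (\<integral>y. H y * coord_prod s (\<lambda>j. cell_kernel L (x j)) y \<partial>euclid s)"
  proof (rule Bochner_Integration.integral_cong[OF refl])
    fix y
    have "(\<Sum>k\<in>{1..s} \<rightarrow>\<^sub>E {..<2 ^ L}. H y * coord_prod s (\<lambda>i t. wal (k i) (\<Phi> t) * gauss \<sigma> t) y * (\<Prod>j\<in>{1..s}. wal (k j) (x j)))
      = H y * (\<Sum>k\<in>{1..s} \<rightarrow>\<^sub>E {..<2 ^ L}. \<Prod>j\<in>{1..s}. wal (k j) (\<Phi> (y j)) * gauss \<sigma> (y j) * wal (k j) (x j))"
      unfolding coord_prod_def sum_distrib_left prod.distrib by (simp add: mult_ac)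
    also have "(\<Sum>k\<in>{1..s} \<rightarrow>\<^sub>E {..<2 ^ L}. \<Prod>j\<in>{1..s}. wal (k j) (\<Phi> (y j)) * gauss \<sigma> (y j) * wal (k j) (x j))
      = (\<Prod>j\<in>{1..s}. \<Sum>k<2 ^ L. wal k (\<Phi> (y j)) * gauss \<sigma> (y j) * wal k (x j))"
      by (rule prod_sum_PiE[symmetric]) auto
    also have "\<dots> = (\<Prod>j\<in>{1..s}. cell_kernel L (x j) (y j))"
    proof (rule prod.cong[OF refl])
      fix j assume j: "j \<in> {1..s}"
      have "(\<Sum>k<2 ^ L. wal k (\<Phi> (y j)) * gauss \<sigma> (y j) * wal k (x j)) = (\<Sum>k<2 ^ L. wal k (x j) * wal k (\<Phi> (y j))) * gauss \<sigma> (y j)"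
        unfolding sum_distrib_right by (rule sum.cong) (auto simp: mult_ac)
      also have "(\<Sum>k<2 ^ L. wal k (x j) * wal k (\<Phi> (y j))) = (if \<lfloor>2 ^ L * x j\<rfloor> = \<lfloor>2 ^ L * \<Phi> (y j)\<rfloor> then 2 ^ L else 0)"
        using x[OF j] Phi_range[of "y j"] by (intro sum_wal_mult) auto
      finally show "(\<Sum>k<2 ^ L. wal k (\<Phi> (y j)) * gauss \<sigma> (y j) * wal k (x j)) = cell_kernel L (x j) (y j)"
        unfolding cell_kernel_def .
    qed
    finally show "(\<Sum>k\<in>{1..s} \<rightarrow>\<^sub>E {..<2 ^ L}. H y * coord_prod s (\<lambda>i t. wal (k i) (\<Phi> t) * gauss \<sigma> t) y * (\<Prod>j\<in>{1..s}. wal (k j) (x j)))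
      = H y * coord_prod s (\<lambda>j. cell_kernel L (x j)) y" unfolding coord_prod_def .
  qed
  finally show ?thesis .
qed

lemma gauss_quantile_point:
  assumes x: "\<And>j. j \<in> {1..s} \<Longrightarrow> 0 < x j \<and> x j < 1"
  shows "gauss_quantile s \<sigma> x \<in> points s" "j \<in> {1..s} \<Longrightarrow> \<Phi> (gauss_quantile s \<sigma> x j) = x j"
  using x Phi_inv unfolding gauss_quantile_def by auto

text \<open>For large L the kernels are nonnegative with mass 1 and live on the cell of x; they form
  an approximate identity, and the Lipschitz bound on H controls the error.\<close>

lemma walsh_partial_tendsto:
  assumes H: "smooth_decay s \<kappa> H" "0 < \<kappa>" and x: "\<And>j. j \<in> {1..s} \<Longrightarrow> 0 < x j \<and> x j < 1"
  shows "(\<lambda>L. walsh_partial s H L x) \<longlonglongrightarrow> H (gauss_quantile s \<sigma> x)"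
proof (rule LIMSEQ_I)
  fix \<epsilon> :: real assume \<epsilon>: "0 < \<epsilon>"
  define z where "z = gauss_quantile s \<sigma> x"
  have z: "z \<in> points s" "\<And>j. j \<in> {1..s} \<Longrightarrow> \<Phi> (z j) = x j"
    unfolding z_def using gauss_quantile_point[OF x] by auto
  obtain B where B: "0 \<le> B" "\<And>y z. y \<in> points s \<Longrightarrow> z \<in> points s \<Longrightarrow> \<bar>H y - H z\<bar> \<le> B * (\<Sum>j\<in>{1..s}. \<bar>y j - z j\<bar>)"
    using smooth_decay_lipschitz[OF H] by blast
  \<comment> \<open>The summand 1 keeps the denominator positive when B * s = 0; the factor 2 makes
    the final error strictly smaller than \<epsilon>.\<close>
  define \<eta> where "\<eta> = \<epsilon> / (2 * (B * real s + 1))"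
  have Bs: "0 \<le> B * real s" using B(1) by simp
  have \<eta>: "0 < \<eta>" unfolding \<eta>_def using Bs \<epsilon> by simp
  have \<eta>2: "B * (real s * \<eta>) \<le> \<epsilon> / 2"
  proof -
    have "B * (real s * \<eta>) \<le> (B * real s + 1) * \<eta>" using \<eta> by (simp add: algebra_simps)
    also have "\<dots> = \<epsilon> / 2" unfolding \<eta>_def using Bs by (simp add: field_simps)
    finally show ?thesis .
  qed
  \<comment> \<open>If the cells are shorter than g, they stay inside (0, 1), and \<Phi> pulls them
    back into the \<eta>-neighbourhood of z j in every coordinate. Inserting 1 keeps the minimum
    defined for s = 0.\<close>
  define g where "g = Min (insert 1 ((\<lambda>j. min (min (x j) (1 - x j)) (min (x j - \<Phi> (z j - \<eta>)) (\<Phi> (z j + \<eta>) - x j))) ` {1..s}))"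
  have g0: "0 < g" unfolding g_def
  proof (subst Min_gr_iff, simp, simp, safe)
    fix j assume j: "j \<in> {1..s}"
    have "\<Phi> (z j - \<eta>) < \<Phi> (z j)" "\<Phi> (z j) < \<Phi> (z j + \<eta>)" using \<eta> by (auto intro!: strict_monoD[OF Phi_strict_mono])
    then show "0 < min (min (x j) (1 - x j)) (min (x j - \<Phi> (z j - \<eta>)) (\<Phi> (z j + \<eta>) - x j))" using x[OF j] z(2)[OF j] by simp
  qed simp
  have gle: "g \<le> x j" "g \<le> 1 - x j" "g \<le> x j - \<Phi> (z j - \<eta>)" "g \<le> \<Phi> (z j + \<eta>) - x j" if "j \<in> {1..s}" for j
  proof -
    have "g \<le> min (min (x j) (1 - x j)) (min (x j - \<Phi> (z j - \<eta>)) (\<Phi> (z j + \<eta>) - x j))"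
      unfolding g_def using that by (intro Min_le) auto
    then show "g \<le> x j" "g \<le> 1 - x j" "g \<le> x j - \<Phi> (z j - \<eta>)" "g \<le> \<Phi> (z j + \<eta>) - x j" by simp_all
  qed
  obtain L0 where L0: "(1/2) ^ L0 < g" using real_arch_pow_inv[OF g0, of "1/2"] by auto
  show "\<exists>L0. \<forall>L\<ge>L0. norm (walsh_partial s H L x - H (gauss_quantile s \<sigma> x)) < \<epsilon>"
  proof (intro exI[of _ L0] allI impI)
    fix L assume "L0 \<le> L"
    have "(1/2::real) ^ L \<le> (1/2) ^ L0" by (rule power_decreasing[OF \<open>L0 \<le> L\<close>]) auto
    then have Lg: "1 / 2 ^ L < g" using L0 by (simp add: power_one_over)
    let ?c = "\<lambda>j. cell_kernel L (x j)"
    have ck: "integrable lborel (?c j)" "(\<integral>t. ?c j t \<partial>lborel) = 1" if "j \<in> {1..s}" for j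
      using integral_cell_kernel[of "x j" L] x[OF that] gle(1,2)[OF that] Lg by auto
    have cpi: "integrable (euclid s) (coord_prod s ?c)"
      unfolding coord_prod_def[abs_def] by (rule lborel_product.product_integrable_prod) (use ck in auto)
    have cp1: "(\<integral>y. coord_prod s ?c y \<partial>euclid s) = 1"
      unfolding coord_prod_def by (subst lborel_product.product_integral_prod) (use ck in auto)
    have cpn: "0 \<le> coord_prod s ?c y" for y unfolding coord_prod_def by (intro prod_nonneg) (auto simp: cell_kernel_nonneg)
    have iH: "integrable (euclid s) (\<lambda>y. H y * coord_prod s ?c y)"
      by (rule coord_prod_integrable[OF H exp_bounded1_cell_kernel])
    have "walsh_partial s H L x - H z = (\<integral>y. H y * coord_prod s ?c y \<partial>euclid s) - H z * (\<integral>y. coord_prod s ?c y \<partial>euclid s)"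
      by (simp only: walsh_partial_eq[OF H x] cp1 mult_1_right)
    also have "\<dots> = (\<integral>y. H y * coord_prod s ?c y - H z * coord_prod s ?c y \<partial>euclid s)"
      using iH cpi by simp
    finally have "norm (walsh_partial s H L x - H z) \<le> (\<integral>y. norm (H y * coord_prod s ?c y - H z * coord_prod s ?c y) \<partial>euclid s)"
      using integral_norm_bound by simp
    also have "\<dots> \<le> (\<integral>y. \<epsilon> / 2 * coord_prod s ?c y \<partial>euclid s)"
    proof (rule integral_mono)
      show "integrable (euclid s) (\<lambda>y. norm (H y * coord_prod s ?c y - H z * coord_prod s ?c y))"
        using iH cpi by simp
      show "integrable (euclid s) (\<lambda>y. \<epsilon> / 2 * coord_prod s ?c y)" using cpi by simp
      fix y assume "y \<in> space (euclid s)"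
      then have y: "y \<in> points s" by simp
      show "norm (H y * coord_prod s ?c y - H z * coord_prod s ?c y) \<le> \<epsilon> / 2 * coord_prod s ?c y"
      proof (cases "\<forall>j\<in>{1..s}. \<lfloor>2 ^ L * x j\<rfloor> = \<lfloor>2 ^ L * \<Phi> (y j)\<rfloor>")
        case False
        then have "coord_prod s ?c y = 0" unfolding coord_prod_def by (intro prod_zero) (auto simp: cell_kernel_def)
        then show ?thesis by simp
      next
        case True
        have "\<bar>y j - z j\<bar> \<le> \<eta>" if j: "j \<in> {1..s}" for j
        proof -
          have "\<bar>2 ^ L * x j - 2 ^ L * \<Phi> (y j)\<bar> < 1"
            using floor_correct[of "2 ^ L * x j"] floor_correct[of "2 ^ L * \<Phi> (y j)"] bspec[OF True j] by linarith
          then have "2 ^ L * \<bar>x j - \<Phi> (y j)\<bar> < 1" unfolding right_diff_distrib[symmetric] abs_mult by simp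
          then have "\<bar>x j - \<Phi> (y j)\<bar> < 1 / 2 ^ L" by (simp add: field_simps)
          then have "\<bar>x j - \<Phi> (y j)\<bar> < g" using Lg by linarith
          then have "\<Phi> (z j - \<eta>) < \<Phi> (y j)" "\<Phi> (y j) < \<Phi> (z j + \<eta>)" using gle(3,4)[OF j] by linarith+
          then show ?thesis unfolding strict_mono_less[OF Phi_strict_mono] by linarith
        qed
        then have "(\<Sum>j\<in>{1..s}. \<bar>y j - z j\<bar>) \<le> real s * \<eta>" using sum_bounded_above[of "{1..s}" "\<lambda>j. \<bar>y j - z j\<bar>" \<eta>] by simp
        then have "B * (\<Sum>j\<in>{1..s}. \<bar>y j - z j\<bar>) \<le> B * (real s * \<eta>)" using B(1) by (rule mult_left_mono)
        then have "\<bar>H y - H z\<bar> \<le> \<epsilon> / 2" using B(2)[OF y z(1)] \<eta>2 by linarith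
        then have "\<bar>H y - H z\<bar> * coord_prod s ?c y \<le> \<epsilon> / 2 * coord_prod s ?c y" using cpn by (rule mult_right_mono)
        then show ?thesis
          unfolding left_diff_distrib[symmetric] real_norm_def abs_mult using cpn[of y] by simp
      qed
    qed
    also have "\<dots> = \<epsilon> / 2" using cp1 by simp
    finally show "norm (walsh_partial s H L x - H (gauss_quantile s \<sigma> x)) < \<epsilon>" using \<epsilon> unfolding z_def by simp
  qed
qed

end

section \<open>Walsh indices and the dual net\<close>

lemma u_of_eq: "u_of v = (\<lambda>j. (j + 1) div 2) ` v"
proof -
  have "nat \<lceil>real j / 2\<rceil> = (j + 1) div 2" for j
  proof (cases "even j")
    case True
    then show ?thesis by (auto elim!: evenE)
  next
    case False
    then obtain r where r: "j = 2 * r + 1" by (rule oddE)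
    have "\<lceil>real j / 2\<rceil> = int r + 1" unfolding r by (intro ceiling_unique) auto
    then show ?thesis unfolding r by simp
  qed
  then show ?thesis unfolding u_of_def by simp
qed

text \<open>The set v whose term in the criterion receives the index k.\<close>

definition nonzero_digits :: "nat \<Rightarrow> (nat \<Rightarrow> nat) \<Rightarrow> nat set"
  where "nonzero_digits s k = {j \<in> {1..2 * s}. deinterlace k j \<noteq> 0}"

lemma deinterlace_pair:
  assumes "1 \<le> j" shows "deinterlace k (2 * j - 1) = even_bits (k j)" "deinterlace k (2 * j) = odd_bits (k j)"
proof -
  have "odd (2 * j - 1)" "(2 * j - 1 + 1) div 2 = j" using assms by auto
  then show "deinterlace k (2 * j - 1) = even_bits (k j)" unfolding deinterlace_def by simp
  show "deinterlace k (2 * j) = odd_bits (k j)" unfolding deinterlace_def by simp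
qed

lemma u_of_nonzero_digits: "u_of (nonzero_digits s k) = {j \<in> {1..s}. k j \<noteq> 0}"
proof (intro set_eqI iffI)
  fix j assume "j \<in> u_of (nonzero_digits s k)"
  then obtain i where i: "i \<in> {1..2 * s}" "deinterlace k i \<noteq> 0" "j = (i + 1) div 2"
    unfolding u_of_eq nonzero_digits_def by auto
  then have "j \<in> {1..s}" by auto
  moreover have "k j \<noteq> 0"
  proof
    assume "k j = 0"
    moreover have "i div 2 = j" if "even i" using that i(3) by auto
    ultimately show False using i(2,3) even_odd_bits_eq_0[of 0] unfolding deinterlace_def by (cases "odd i") auto
  qed
  ultimately show "j \<in> {j \<in> {1..s}. k j \<noteq> 0}" by simp
next
  fix j assume j: "j \<in> {j \<in> {1..s}. k j \<noteq> 0}"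
  then have "even_bits (k j) \<noteq> 0 \<or> odd_bits (k j) \<noteq> 0" using even_odd_bits_eq_0[of "k j"] by auto
  then have "2 * j - 1 \<in> nonzero_digits s k \<or> 2 * j \<in> nonzero_digits s k"
    using j deinterlace_pair[of j k] unfolding nonzero_digits_def by auto
  moreover have "(2 * j - 1 + 1) div 2 = j" "(2 * j + 1) div 2 = j" using j by auto
  ultimately show "j \<in> u_of (nonzero_digits s k)" unfolding u_of_eq by (metis image_eqI)
qed

lemma prod_wal_weight:
  "(\<Prod>j\<in>{j \<in> {1..s}. k j \<noteq> 0}. wal_weight a (k j)) = (\<Prod>i\<in>nonzero_digits s k. walsh_weight a (deinterlace k i))"
proof -
  have w0: "wal_weight a 0 = 1" unfolding wal_weight_def digit_weight_def using even_odd_bits_eq_0[of 0] by simp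
  have "(\<Prod>i\<in>nonzero_digits s k. walsh_weight a (deinterlace k i)) = (\<Prod>i\<in>{1..2 * s}. digit_weight a (deinterlace k i))"
    by (rule prod.mono_neutral_cong_left) (auto simp: nonzero_digits_def digit_weight_def)
  also have "\<dots> = (\<Prod>j\<in>{1..s}. digit_weight a (deinterlace k (2 * j - 1)) * digit_weight a (deinterlace k (2 * j)))"
    by (rule prod_pairs)
  also have "\<dots> = (\<Prod>j\<in>{1..s}. wal_weight a (k j))"
    unfolding wal_weight_def by (intro prod.cong refl) (simp add: deinterlace_pair)
  also have "\<dots> = (\<Prod>j\<in>{j \<in> {1..s}. k j \<noteq> 0}. wal_weight a (k j))"
    by (rule prod.mono_neutral_cong_right) (auto simp: w0)
  finally show ?thesis by simp
qed

lemma deinterlace_in_dual_net: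
  assumes "P dvd lattice_sum s m q (deinterlace k)"
  shows "restrict (deinterlace k) (nonzero_digits s k) \<in> dual_net m P (nonzero_digits s k) q"
proof -
  let ?v = "nonzero_digits s k"
  have "lattice_sum s m q (deinterlace k) = (\<Sum>j\<in>?v. nat_poly (take_bit m (deinterlace k j)) * q j)"
    unfolding lattice_sum_def
    by (rule sum.mono_neutral_cong_right) (auto simp: nonzero_digits_def nat_poly_eq_0_iff)
  also have "\<dots> = (\<Sum>j\<in>?v. nat_poly (take_bit m (restrict (deinterlace k) ?v j)) * q j)" by (intro sum.cong) auto
  finally show ?thesis using assms unfolding dual_net_def nonzero_digits_def by (auto simp: Suc_le_eq)
qed

lemma even_odd_bits_inj: "even_bits k = even_bits k' \<Longrightarrow> odd_bits k = odd_bits k' \<Longrightarrow> k = k'"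
proof -
  assume e: "even_bits k = even_bits k'" "odd_bits k = odd_bits k'"
  have "bit k i = bit k' i" for i
  proof -
    have "bit k (2 * (i div 2)) = bit k' (2 * (i div 2))" "bit k (2 * (i div 2) + 1) = bit k' (2 * (i div 2) + 1)"
      unfolding bit_even_bits[symmetric] bit_odd_bits[symmetric] e by simp_all
    moreover have "i = 2 * (i div 2) \<or> i = 2 * (i div 2) + 1" by presburger
    ultimately show ?thesis by metis
  qed
  then show "k = k'" by (intro bit_eqI) simp
qed

lemma inj_on_deinterlace:
  "inj_on (\<lambda>k. restrict (deinterlace k) v) {k \<in> {1..s} \<rightarrow>\<^sub>E A. nonzero_digits s k = v}"
proof (rule inj_onI)
  fix k k' assume k: "k \<in> {k \<in> {1..s} \<rightarrow>\<^sub>E A. nonzero_digits s k = v}" "k' \<in> {k \<in> {1..s} \<rightarrow>\<^sub>E A. nonzero_digits s k = v}"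
    and eq: "restrict (deinterlace k) v = restrict (deinterlace k') v"
  have d: "deinterlace k i = deinterlace k' i" if i: "i \<in> {1..2 * s}" for i
  proof (cases "i \<in> v")
    case True
    then show ?thesis using fun_cong[OF eq, of i] by simp
  next
    case False
    then have "deinterlace k i = 0" "deinterlace k' i = 0" using k i unfolding nonzero_digits_def by auto
    then show ?thesis by simp
  qed
  have "k j = k' j" if "j \<in> {1..s}" for j
  proof (rule even_odd_bits_inj)
    have j: "1 \<le> j" "2 * j - 1 \<in> {1..2 * s}" "2 * j \<in> {1..2 * s}" using that by auto
    show "even_bits (k j) = even_bits (k' j)" "odd_bits (k j) = odd_bits (k' j)"
      using d[OF j(2)] d[OF j(3)] by (simp_all only: deinterlace_pair[OF j(1)])
  qed
  then show "k = k'" using k by (intro PiE_ext[of k "{1..s}" "\<lambda>_. A" k']) auto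
qed

text \<open>Deinterlacing is injective on indices with the same nonzero components, so the finite
  sum is part of the series over the dual net.\<close>

lemma sum_dual_le_dual_sum:
  assumes a: "1 < a" and K: "finite K" "K \<subseteq> {k \<in> {1..s} \<rightarrow>\<^sub>E A. P dvd lattice_sum s m q (deinterlace k)}"
  shows "(\<Sum>k\<in>{k \<in> K. nonzero_digits s k = v}. \<Prod>i\<in>v. walsh_weight a (deinterlace k i)) \<le> dual_sum a m P v q"
proof (cases "finite v")
  case False
  then have "{k \<in> K. nonzero_digits s k = v} = {}" unfolding nonzero_digits_def by auto
  then show ?thesis by (simp only: sum.empty) (rule dual_sum_nonneg)
next
  case True
  let ?K = "{k \<in> K. nonzero_digits s k = v}" and ?r = "\<lambda>k. restrict (deinterlace k) v"
  have inj: "inj_on ?r ?K" by (rule inj_on_subset[OF inj_on_deinterlace]) (use K in auto)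
  have "(\<Sum>k\<in>?K. \<Prod>i\<in>v. walsh_weight a (deinterlace k i)) = (\<Sum>k\<in>?K. (\<lambda>l. \<Prod>i\<in>v. walsh_weight a (l i)) (?r k))"
    by (intro sum.cong prod.cong) auto
  also have "\<dots> = (\<Sum>l\<in>?r ` ?K. \<Prod>i\<in>v. walsh_weight a (l i))" by (simp add: sum.reindex[OF inj])
  also have "\<dots> \<le> dual_sum a m P v q" unfolding dual_sum_def
  proof (rule finite_sum_le_infsum)
    show "(\<lambda>k. \<Prod>i\<in>v. walsh_weight a (k i)) summable_on dual_net m P v q"
      by (rule walsh_weight_prod_summable[OF a True dual_net_subset])
    show "?r ` ?K \<subseteq> dual_net m P v q" using deinterlace_in_dual_net K(2) by blast
  qed (use K(1) in \<open>auto intro!: prod_nonneg less_imp_le[OF walsh_weight_pos]\<close>)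
  finally show ?thesis .
qed

lemma norm_uv_le_weighted_norm:
  assumes "u \<noteq> {}" "u \<subseteq> {1..s}" "v \<subseteq> u" "0 < \<gamma> u"
  shows "norm_uv s \<phi> \<psi> \<omega> u v H \<le> ennreal (\<gamma> u) * weighted_norm s \<gamma> \<phi> \<psi> \<omega> H"
proof -
  let ?S = "{ennreal (inverse (\<gamma> u)) * norm_uv s \<phi> \<psi> \<omega> u v H | u v. u \<noteq> {} \<and> u \<subseteq> {1..s} \<and> v \<subseteq> u}"
  have "?S \<subseteq> (\<lambda>(u, v). ennreal (inverse (\<gamma> u)) * norm_uv s \<phi> \<psi> \<omega> u v H) ` (Pow {1..s} \<times> Pow {1..s})" by force
  then have "finite ?S" by (rule finite_subset) auto
  then have "ennreal (inverse (\<gamma> u)) * norm_uv s \<phi> \<psi> \<omega> u v H \<le> weighted_norm s \<gamma> \<phi> \<psi> \<omega> H"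
    unfolding weighted_norm_def using assms by (intro Max_ge) auto
  then have "ennreal (\<gamma> u) * (ennreal (inverse (\<gamma> u)) * norm_uv s \<phi> \<psi> \<omega> u v H) \<le> ennreal (\<gamma> u) * weighted_norm s \<gamma> \<phi> \<psi> \<omega> H"
    by (rule mult_left_mono) simp
  moreover have "ennreal (\<gamma> u) * ennreal (inverse (\<gamma> u)) = 1"
    using assms(4) by (simp add: ennreal_mult[symmetric])
  ultimately show ?thesis by (simp add: mult.assoc[symmetric])
qed

context normal_cdf
begin

text \<open>For each cutoff L only coefficients on the dual net survive; grouping them by
  \<open>nonzero_digits\<close> leads to the criterion, with a bound free of L. The number Q
  converts the constant of the coefficient bound into C1 * 2^(2 + \<beta>) and is spent at most once
  per coordinate, hence the power Q^s.\<close>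

lemma quadrature_error:
  assumes H: "smooth_decay s \<kappa> H" "0 < \<kappa>"
    and \<rho>: "0 < \<rho>" and \<delta>: "0 < \<delta>" "0 < \<beta>" "\<beta> \<le> 1" "\<beta> = 1 - \<sigma>\<^sup>2 / \<rho>\<^sup>2 - \<delta>"
    and \<psi>: "\<psi> = (\<lambda>x. gauss \<rho> x / gauss \<sigma> x)"
    and \<gamma>: "\<And>u. u \<subseteq> {1..s} \<Longrightarrow> 0 < \<gamma> u" and C1: "0 < C1"
    and \<Delta>: "\<Delta> \<in> {1..s} \<rightarrow>\<^sub>E {0..<1}" and m: "1 \<le> m" and P: "degree P = m"
    and X: "\<And>n j. n < 2 ^ m \<Longrightarrow> j \<in> {1..s} \<Longrightarrow> 0 < shifted_point s m P q \<Delta> n j \<and> shifted_point s m P q \<Delta> n j < 1"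
    and Q: "Q = max 1 (max 1 (transform_const \<rho> \<delta>) / (C1 * 2 powr (2 + \<beta>)))"
  shows "ennreal \<bar>(\<Sum>n<2 ^ m. H (gauss_quantile s \<sigma> (shifted_point s m P q \<Delta> n))) / 2 ^ m - (\<integral>y. H y * gauss_prod s \<sigma> y \<partial>euclid s)\<bar>
    \<le> ennreal (Q ^ s * criterion \<gamma> C1 \<beta> m P (2 * s) q) * weighted_norm s \<gamma> (gauss \<sigma>) \<psi> \<psi> H"
proof -
  let ?N = "weighted_norm s \<gamma> (gauss \<sigma>) \<psi> \<psi> H"
  let ?x = "shifted_point s m P q \<Delta>"
  define M where "M = max 1 (transform_const \<rho> \<delta>)"
  have M1: "1 \<le> M" unfolding M_def by simp
  define D where "D = C1 * 2 powr (2 + \<beta>)"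
  have D0: "0 < D" unfolding D_def using C1 by simp
  \<comment> \<open>The maximum with 1 in Q allows its exponent to be raised from card (u_of v) to
    s.\<close>
  have QM: "1 \<le> Q" "M \<le> Q * D" unfolding Q M_def[symmetric] D_def[symmetric] using D0
    by (simp_all add: max_def field_simps)
  define I0 where "I0 = (\<integral>y. H y * gauss_prod s \<sigma> y \<partial>euclid s)"
  define supp where "supp k = {j \<in> {1..s}. k j \<noteq> 0}" for k :: "nat \<Rightarrow> nat"
  define bnd where "bnd k = \<gamma> (supp k) * M ^ card (supp k) * (\<Prod>i\<in>nonzero_digits s k. walsh_weight (1 + \<beta>) (deinterlace k i))" for k
  have bnd0: "0 \<le> bnd k" for k
  proof -
    have "supp k \<subseteq> {1..s}" unfolding supp_def by auto
    then show ?thesis unfolding bnd_def using \<gamma>[of "supp k"] M1 less_imp_le[OF walsh_weight_pos] by (intro mult_nonneg_nonneg prod_nonneg) auto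
  qed
  have coeff: "ennreal \<bar>wal_coeff s H k\<bar> \<le> ennreal (bnd k) * ?N" if ne: "supp k \<noteq> {}" for k
  proof -
    have us: "supp k \<subseteq> {1..s}" unfolding supp_def by auto
    obtain v where v: "v \<subseteq> supp k" "ennreal \<bar>wal_coeff s H k\<bar>
      \<le> ennreal (\<Prod>j\<in>supp k. M * wal_weight (1 + \<beta>) (k j)) * norm_uv s (gauss \<sigma>) \<psi> \<psi> (supp k) v H"
      using wal_coeff_bound[OF H \<rho> \<delta>(1) less_imp_le[OF \<delta>(2)] \<delta>(3,4) \<psi> supp_def] unfolding M_def by blast
    have e: "(\<Prod>j\<in>supp k. M * wal_weight (1 + \<beta>) (k j)) = M ^ card (supp k) * (\<Prod>i\<in>nonzero_digits s k. walsh_weight (1 + \<beta>) (deinterlace k i))"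
      unfolding prod.distrib prod_wal_weight[symmetric] supp_def[symmetric] by simp
    note v(2)
    also have "ennreal (\<Prod>j\<in>supp k. M * wal_weight (1 + \<beta>) (k j)) * norm_uv s (gauss \<sigma>) \<psi> \<psi> (supp k) v H
      \<le> ennreal (\<Prod>j\<in>supp k. M * wal_weight (1 + \<beta>) (k j)) * (ennreal (\<gamma> (supp k)) * ?N)"
      by (intro mult_left_mono norm_uv_le_weighted_norm ne us v(1) \<gamma>) simp
    also have "\<dots> = ennreal (bnd k) * ?N"
    proof -
      have p: "0 \<le> (\<Prod>j\<in>supp k. M * wal_weight (1 + \<beta>) (k j))"
        using M1 less_imp_le[OF wal_weight_pos] by (intro prod_nonneg mult_nonneg_nonneg) auto
      have "bnd k = (\<Prod>j\<in>supp k. M * wal_weight (1 + \<beta>) (k j)) * \<gamma> (supp k)" unfolding bnd_def e by simp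
      then have "ennreal (bnd k) = ennreal (\<Prod>j\<in>supp k. M * wal_weight (1 + \<beta>) (k j)) * ennreal (\<gamma> (supp k))"
        using p \<gamma>[OF us] by (simp add: ennreal_mult)
      then show ?thesis by (simp add: mult.assoc)
    qed
    finally show ?thesis .
  qed
  have err: "ennreal \<bar>(\<Sum>n<2 ^ m. walsh_partial s H L (?x n)) / 2 ^ m - I0\<bar> \<le> ennreal (Q ^ s * criterion \<gamma> C1 \<beta> m P (2 * s) q) * ?N" for L
  proof -
    let ?K = "{1..s} \<rightarrow>\<^sub>E {..<(2::nat) ^ L}"
    \<comment> \<open>The coefficient of the zero index is the integral itself, which therefore
      cancels.\<close>
    define k0 where "k0 = (\<lambda>j\<in>{1..s}. 0::nat)"
    define K' where "K' = {k \<in> ?K. k \<noteq> k0 \<and> P dvd lattice_sum s m q (deinterlace k)}"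
    have finK: "finite ?K" by (intro finite_PiE) auto
    have k0: "k0 \<in> ?K" unfolding k0_def by auto
    have finK': "finite K'" unfolding K'_def using finK by auto
    have w0: "wal 0 t = 1" for t unfolding wal_eq_prod by (simp add: bot_fun_def)
    define S where "S k = (\<Sum>n<(2::nat) ^ m. \<Prod>j\<in>{1..s}. wal (k j) (?x n j))" for k
    have S0: "S k0 = 2 ^ m" unfolding S_def k0_def by (simp add: w0)
    have c0: "wal_coeff s H k0 = I0"
      unfolding wal_coeff_def I0_def coord_prod_def gauss_prod_def k0_def
      by (intro Bochner_Integration.integral_cong refl arg_cong2[of _ _ _ _ "(*)"] prod.cong) (auto simp: w0)
    have "(\<Sum>n<(2::nat) ^ m. walsh_partial s H L (?x n)) = (\<Sum>k\<in>?K. wal_coeff s H k * S k)"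
      unfolding walsh_partial_def S_def sum_distrib_left by (rule sum.swap)
    also have "\<dots> = I0 * 2 ^ m + (\<Sum>k\<in>?K - {k0}. wal_coeff s H k * S k)"
      using finK k0 S0 c0 by (simp add: sum.remove)
    finally have "(\<Sum>n<(2::nat) ^ m. walsh_partial s H L (?x n)) / 2 ^ m - I0 = (\<Sum>k\<in>?K - {k0}. wal_coeff s H k * S k) / 2 ^ m"
      by (simp add: add_divide_distrib)
    then have "\<bar>(\<Sum>n<(2::nat) ^ m. walsh_partial s H L (?x n)) / 2 ^ m - I0\<bar> = \<bar>\<Sum>k\<in>?K - {k0}. wal_coeff s H k * S k\<bar> / 2 ^ m"
      by simp
    also have "\<dots> \<le> (\<Sum>k\<in>?K - {k0}. \<bar>wal_coeff s H k\<bar> * \<bar>S k\<bar>) / 2 ^ m"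
      using sum_abs[of "\<lambda>k. wal_coeff s H k * S k" "?K - {k0}"] by (intro divide_right_mono) (auto simp: abs_mult)
    also have "\<dots> \<le> (\<Sum>k\<in>?K - {k0}. \<bar>wal_coeff s H k\<bar> * (if P dvd lattice_sum s m q (deinterlace k) then 2 ^ m else 0)) / 2 ^ m"
      unfolding S_def by (intro divide_right_mono sum_mono mult_left_mono sum_wal_shifted_point[OF \<Delta> m P]) auto
    also have "\<dots> = (\<Sum>k\<in>K'. \<bar>wal_coeff s H k\<bar> * 2 ^ m) / 2 ^ m"
      by (intro arg_cong2[of _ _ _ _ "(/)"] refl sum.mono_neutral_cong_right) (use finK in \<open>auto simp: K'_def\<close>)
    also have "\<dots> = (\<Sum>k\<in>K'. \<bar>wal_coeff s H k\<bar>)" by (simp flip: sum_distrib_right)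
    finally have "ennreal \<bar>(\<Sum>n<(2::nat) ^ m. walsh_partial s H L (?x n)) / 2 ^ m - I0\<bar> \<le> ennreal (\<Sum>k\<in>K'. \<bar>wal_coeff s H k\<bar>)"
      by (rule ennreal_leI)
    also have "\<dots> = (\<Sum>k\<in>K'. ennreal \<bar>wal_coeff s H k\<bar>)" by (rule sum_ennreal[symmetric]) simp
    also have "\<dots> \<le> (\<Sum>k\<in>K'. ennreal (bnd k) * ?N)"
    proof (intro sum_mono coeff)
      fix k assume k: "k \<in> K'"
      show "supp k \<noteq> {}"
      proof
        assume "supp k = {}"
        then have "k = k0" using k unfolding supp_def K'_def k0_def by (intro PiE_ext[of k "{1..s}" "\<lambda>_. {..<2 ^ L}"]) auto
        then show False using k unfolding K'_def by simp
      qed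
    qed
    also have "\<dots> = ennreal (\<Sum>k\<in>K'. bnd k) * ?N"
      unfolding sum_distrib_right[symmetric] by (simp add: sum_ennreal bnd0)
    also have "\<dots> \<le> ennreal (Q ^ s * criterion \<gamma> C1 \<beta> m P (2 * s) q) * ?N"
    proof (intro mult_right_mono ennreal_leI)
      let ?V = "{v. v \<noteq> {} \<and> v \<subseteq> {1..2 * s}}"
      have finV: "finite ?V" by (rule finite_subset[of _ "Pow {1..2 * s}"]) auto
      have map: "nonzero_digits s ` K' \<subseteq> ?V"
      proof (intro image_subsetI CollectI conjI)
        fix k assume k: "k \<in> K'"
        show "nonzero_digits s k \<subseteq> {1..2 * s}" unfolding nonzero_digits_def by auto
        show "nonzero_digits s k \<noteq> {}"
        proof
          assume "nonzero_digits s k = {}"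
          then have "supp k = {}" using u_of_nonzero_digits[of s k] unfolding supp_def u_of_def by simp
          then have "k = k0" using k unfolding supp_def K'_def k0_def by (intro PiE_ext[of k "{1..s}" "\<lambda>_. {..<2 ^ L}"]) auto
          then show False using k unfolding K'_def by simp
        qed
      qed
      have "(\<Sum>k\<in>K'. bnd k) = (\<Sum>v\<in>?V. \<Sum>k\<in>{k \<in> K'. nonzero_digits s k = v}. bnd k)"
        by (rule sum.group[symmetric, OF finK' finV map])
      also have "\<dots> \<le> (\<Sum>v\<in>?V. Q ^ s * (\<gamma> (u_of v) * D ^ card (u_of v) * dual_sum (1 + \<beta>) m P v q))"
      proof (rule sum_mono)
        fix v assume v: "v \<in> ?V"
        have uv: "u_of v \<subseteq> {1..s}" using v by (intro u_of_subset) auto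
        have cu: "card (u_of v) \<le> s" using card_mono[OF _ uv] by simp
        have "bnd k = \<gamma> (u_of v) * M ^ card (u_of v) * (\<Prod>i\<in>v. walsh_weight (1 + \<beta>) (deinterlace k i))" if "nonzero_digits s k = v" for k
          unfolding bnd_def supp_def u_of_nonzero_digits[symmetric] that ..
        then have "(\<Sum>k\<in>{k \<in> K'. nonzero_digits s k = v}. bnd k) = \<gamma> (u_of v) * M ^ card (u_of v) * (\<Sum>k\<in>{k \<in> K'. nonzero_digits s k = v}. \<Prod>i\<in>v. walsh_weight (1 + \<beta>) (deinterlace k i))"
          unfolding sum_distrib_left by (intro sum.cong) auto
        also have "\<dots> \<le> \<gamma> (u_of v) * M ^ card (u_of v) * dual_sum (1 + \<beta>) m P v q"
          by (intro mult_left_mono sum_dual_le_dual_sum[where A="{..<2 ^ L}"] finK')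
            (use \<delta>(2) \<gamma>[OF uv] M1 in \<open>auto simp: K'_def\<close>)
        also have "\<dots> \<le> \<gamma> (u_of v) * (Q ^ s * D ^ card (u_of v)) * dual_sum (1 + \<beta>) m P v q"
        proof (intro mult_right_mono mult_left_mono)
          have "M ^ card (u_of v) \<le> (Q * D) ^ card (u_of v)" using QM M1 by (intro power_mono) auto
          also have "\<dots> = Q ^ card (u_of v) * D ^ card (u_of v)" by (rule power_mult_distrib)
          also have "\<dots> \<le> Q ^ s * D ^ card (u_of v)" using QM(1) cu D0 by (intro mult_right_mono power_increasing) auto
          finally show "M ^ card (u_of v) \<le> Q ^ s * D ^ card (u_of v)" .
        qed (use \<gamma>[OF uv] dual_sum_nonneg in auto)
        finally show "(\<Sum>k\<in>{k \<in> K'. nonzero_digits s k = v}. bnd k) \<le> Q ^ s * (\<gamma> (u_of v) * D ^ card (u_of v) * dual_sum (1 + \<beta>) m P v q)"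
          by (simp add: mult_ac)
      qed
      also have "\<dots> = Q ^ s * criterion \<gamma> C1 \<beta> m P (2 * s) q"
        unfolding criterion_eq D_def sum_distrib_left ..
      finally show "(\<Sum>k\<in>K'. bnd k) \<le> Q ^ s * criterion \<gamma> C1 \<beta> m P (2 * s) q" .
    qed simp
    finally show ?thesis .
  qed
  \<comment> \<open>All nodes lie in the open cube, so the partial sums converge there, and the
    bound uniform in L survives the limit.\<close>
  have "(\<lambda>L. ennreal \<bar>(\<Sum>n<2 ^ m. walsh_partial s H L (?x n)) / 2 ^ m - I0\<bar>) \<longlonglongrightarrow>
    ennreal \<bar>(\<Sum>n<2 ^ m. H (gauss_quantile s \<sigma> (?x n))) / 2 ^ m - I0\<bar>"
    using X by (intro tendsto_intros walsh_partial_tendsto[OF H]) auto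
  then show ?thesis unfolding I0_def[symmetric] by (rule LIMSEQ_le_const2) (use err in blast)
qed

end

subsection \<open>Linear systems with smooth coefficients\<close>

lemma quadratic_insert:
  fixes A :: "nat \<Rightarrow> nat \<Rightarrow> real"
  assumes I: "finite I" "j \<notin> I" and sym: "\<And>i k. i \<in> insert j I \<Longrightarrow> k \<in> insert j I \<Longrightarrow> A i k = A k i"
  shows "(\<Sum>i\<in>insert j I. \<Sum>k\<in>insert j I. x i * x k * A i k)
    = A j j * (x j)\<^sup>2 + 2 * x j * (\<Sum>i\<in>I. x i * A i j) + (\<Sum>i\<in>I. \<Sum>k\<in>I. x i * x k * A i k)"
proof -
  have 1: "(\<Sum>k\<in>insert j I. x i * x k * A i k) = x i * x j * A i j + (\<Sum>k\<in>I. x i * x k * A i k)" for i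
    using I by simp
  have 2: "(\<Sum>k\<in>I. x j * x k * A j k) = x j * (\<Sum>i\<in>I. x i * A i j)"
    unfolding sum_distrib_left by (intro sum.cong) (auto simp: sym[of j] mult.assoc)
  have 3: "(\<Sum>i\<in>I. x i * x j * A i j) = x j * (\<Sum>i\<in>I. x i * A i j)"
    unfolding sum_distrib_left by (intro sum.cong) auto
  have "(\<Sum>i\<in>insert j I. \<Sum>k\<in>insert j I. x i * x k * A i k)
    = (x j * x j * A j j + (\<Sum>k\<in>I. x j * x k * A j k)) + ((\<Sum>i\<in>I. x i * x j * A i j) + (\<Sum>i\<in>I. \<Sum>k\<in>I. x i * x k * A i k))"
    unfolding 1 sum.insert[OF I] sum.distrib by (simp only: add_ac)
  then show ?thesis unfolding 2 3 by (simp add: power2_eq_square)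
qed

lemma quadratic_schur:
  fixes A :: "nat \<Rightarrow> nat \<Rightarrow> real"
  assumes sym: "\<And>i. i \<in> I \<Longrightarrow> A j i = A i j"
  shows "(\<Sum>i\<in>I. \<Sum>k\<in>I. x i * x k * (A i k - A i j * A j k * q))
    = (\<Sum>i\<in>I. \<Sum>k\<in>I. x i * x k * A i k) - q * (\<Sum>i\<in>I. x i * A i j)\<^sup>2"
proof -
  have "(\<Sum>i\<in>I. \<Sum>k\<in>I. x i * x k * (A i k - A i j * A j k * q))
    = (\<Sum>i\<in>I. \<Sum>k\<in>I. x i * x k * A i k - q * ((x i * A i j) * (x k * A k j)))"
    by (intro sum.cong) (auto simp: sym algebra_simps)
  also have "\<dots> = (\<Sum>i\<in>I. \<Sum>k\<in>I. x i * x k * A i k) - q * (\<Sum>i\<in>I. \<Sum>k\<in>I. (x i * A i j) * (x k * A k j))"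
    by (simp only: sum_subtractf sum_distrib_left)
  also have "(\<Sum>i\<in>I. \<Sum>k\<in>I. (x i * A i j) * (x k * A k j)) = (\<Sum>i\<in>I. x i * A i j)\<^sup>2"
    by (simp only: power2_eq_square sum_product)
  finally show ?thesis .
qed

text \<open>Gaussian elimination: the pivot is bounded below by the coercivity estimate, and the Schur
  complement inherits that estimate because it is the minimum of the quadratic form over the
  eliminated variable.\<close>

lemma tame_linear_system:
  fixes A :: "nat \<Rightarrow> nat \<Rightarrow> (nat \<Rightarrow> real) \<Rightarrow> real" and A0 :: "nat \<Rightarrow> nat \<Rightarrow> real"
  assumes "finite I"
    and "\<And>n i k. i \<in> I \<Longrightarrow> k \<in> I \<Longrightarrow> tame s n (A i k)"
    and "\<And>n i. i \<in> I \<Longrightarrow> tame s n (f i)" and "\<And>n i. i \<in> I \<Longrightarrow> tame s n (G i)"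
    and "\<And>y i k. y \<in> points s \<Longrightarrow> i \<in> I \<Longrightarrow> k \<in> I \<Longrightarrow> A i k y = A k i y"
    and "\<And>i k. i \<in> I \<Longrightarrow> k \<in> I \<Longrightarrow> A0 i k = A0 k i"
    and "\<And>x. \<exists>i\<in>I. x i \<noteq> 0 \<Longrightarrow> 0 < (\<Sum>i\<in>I. \<Sum>k\<in>I. x i * x k * A0 i k)"
    and "\<And>y x. y \<in> points s \<Longrightarrow> \<alpha> y * (\<Sum>i\<in>I. \<Sum>k\<in>I. x i * x k * A0 i k) \<le> (\<Sum>i\<in>I. \<Sum>k\<in>I. x i * x k * A i k y)"
    and "\<And>y. y \<in> points s \<Longrightarrow> 0 < \<alpha> y" and "exp_bounded s (\<lambda>y. inverse (\<alpha> y))"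
    and "\<And>y i. y \<in> points s \<Longrightarrow> i \<in> I \<Longrightarrow> (\<Sum>k\<in>I. A i k y * c k y) = f i y"
  shows "tame s n (\<lambda>y. \<Sum>i\<in>I. G i y * c i y)"
  using assms
proof (induction I arbitrary: A A0 f G rule: finite_induct)
  case empty
  show ?case by (simp add: tame_const)
next
  case (insert j I)
  note tA = insert.prems(1) and tf = insert.prems(2) and tG = insert.prems(3) and symA = insert.prems(4)
    and symA0 = insert.prems(5) and pd = insert.prems(6) and low = insert.prems(7) and \<alpha> = insert.prems(8,9)
    and sol = insert.prems(10)
  define q0 where "q0 = A0 j j"
  let ?J = "insert j I"
  define b0 where "b0 x = (\<Sum>i\<in>I. x i * A0 i j)" for x
  define b where "b y x = (\<Sum>i\<in>I. x i * A i j y)" for y x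
  define Q0 where "Q0 x = (\<Sum>i\<in>I. \<Sum>k\<in>I. x i * x k * A0 i k)" for x
  define Q where "Q y x = (\<Sum>i\<in>I. \<Sum>k\<in>I. x i * x k * A i k y)" for y x
  have upd: "(\<Sum>i\<in>I. h ((x(j := t)) i) i) = (\<Sum>i\<in>I. h (x i) i)" for x :: "nat \<Rightarrow> real" and h :: "real \<Rightarrow> nat \<Rightarrow> real" and t
    using insert.hyps(2) by (intro sum.cong) auto
  have updQ: "Q0 (x(j := t)) = Q0 x" "Q y (x(j := t)) = Q y x" "b0 (x(j := t)) = b0 x" "b y (x(j := t)) = b y x" for x t y
    using insert.hyps(2) unfolding Q0_def Q_def b0_def b_def by (auto intro!: sum.cong)
  have ins0: "(\<Sum>i\<in>?J. \<Sum>k\<in>?J. (x(j := t)) i * (x(j := t)) k * A0 i k) = q0 * t\<^sup>2 + 2 * t * b0 x + Q0 x" for x t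
    using quadratic_insert[OF insert.hyps, of A0 "x(j := t)", OF symA0] updQ(1,3)[of x t]
    unfolding q0_def b0_def Q0_def by simp
  have ins: "(\<Sum>i\<in>?J. \<Sum>k\<in>?J. (x(j := t)) i * (x(j := t)) k * A i k y) = A j j y * t\<^sup>2 + 2 * t * b y x + Q y x" if "y \<in> points s" for x t y
    using quadratic_insert[OF insert.hyps, of "\<lambda>i k. A i k y" "x(j := t)", OF symA[OF that]] updQ(2,4)[of y x t]
    unfolding b_def Q_def by simp
  have q0: "0 < q0"
  proof -
    have "0 < q0 * 1\<^sup>2 + 2 * 1 * b0 (\<lambda>_. 0) + Q0 (\<lambda>_. 0)"
      unfolding ins0[symmetric] by (rule pd) auto
    then show ?thesis by (simp add: b0_def Q0_def)
  qed
  have p: "\<alpha> y * q0 \<le> A j j y" if y: "y \<in> points s" for y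
  proof -
    have "\<alpha> y * (q0 * 1\<^sup>2 + 2 * 1 * b0 (\<lambda>_. 0) + Q0 (\<lambda>_. 0)) \<le> A j j y * 1\<^sup>2 + 2 * 1 * b y (\<lambda>_. 0) + Q y (\<lambda>_. 0)"
      unfolding ins0[symmetric] ins[OF y, symmetric] by (rule low[OF y])
    then show ?thesis by (simp add: b0_def Q0_def b_def Q_def)
  qed
  have p0: "0 < A j j y" if "y \<in> points s" for y using p[OF that] \<alpha>(1)[OF that] q0 mult_pos_pos[of "\<alpha> y" q0] by linarith
  define ip where "ip y = inverse (A j j y)" for y
  have "exp_bounded s (\<lambda>y. inverse (A j j y))"
  proof -
    have m: "(\<lambda>y. inverse (A j j y)) \<in> borel_measurable (euclid s)"
      using tA[of j j 0] by (auto simp: exp_bounded_def)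
    obtain C c where C: "0 \<le> C" "0 \<le> c" "\<And>y. y \<in> points s \<Longrightarrow> \<bar>inverse (\<alpha> y)\<bar> \<le> C * exp (c * (\<Sum>j\<in>{1..s}. \<bar>y j\<bar>))"
      using exp_boundedE[OF \<alpha>(2)] by blast
    have "\<bar>inverse (A j j y)\<bar> \<le> (inverse q0 * C) * exp (c * (\<Sum>j\<in>{1..s}. \<bar>y j\<bar>))" if y: "y \<in> points s" for y
    proof -
      have "\<bar>inverse (A j j y)\<bar> = inverse (A j j y)" using p0[OF y] by simp
      also have "\<dots> \<le> inverse (\<alpha> y * q0)" by (rule le_imp_inverse_le[OF p[OF y]]) (simp add: \<alpha>(1)[OF y] q0)
      also have "\<dots> = inverse q0 * \<bar>inverse (\<alpha> y)\<bar>" using \<alpha>(1)[OF y] by simp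
      also have "\<dots> \<le> inverse q0 * (C * exp (c * (\<Sum>j\<in>{1..s}. \<bar>y j\<bar>)))" using C(3)[OF y] q0 by (intro mult_left_mono) auto
      finally show ?thesis by (simp add: mult.assoc)
    qed
    moreover have "0 \<le> inverse q0 * C" using q0 C(1) by simp
    ultimately show ?thesis by (intro exp_boundedI[OF m _ C(2)])
  qed
  then have tip: "tame s n ip" for n
    unfolding ip_def[abs_def] using tA p0 by (intro tame_inverse) (auto simp: less_imp_neq[symmetric])
  define A' where "A' i k y = A i k y - A i j y * A j k y * ip y" for i k y
  define A0' where "A0' i k = A0 i k - A0 i j * A0 j k * inverse q0" for i k
  define f' where "f' i y = f i y - A i j y * f j y * ip y" for i y
  define G' where "G' i y = G i y - G j y * ip y * A j i y" for i y
  have Q0': "(\<Sum>i\<in>I. \<Sum>k\<in>I. x i * x k * A0' i k) = Q0 x - inverse q0 * (b0 x)\<^sup>2" for x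
    unfolding A0'_def Q0_def b0_def by (rule quadratic_schur) (use symA0 in auto)
  have Q': "(\<Sum>i\<in>I. \<Sum>k\<in>I. x i * x k * A' i k y) = Q y x - ip y * (b y x)\<^sup>2" if "y \<in> points s" for x y
    unfolding A'_def Q_def b_def by (rule quadratic_schur[where A="\<lambda>i k. A i k y"]) (use symA[OF that] in auto)
  have "tame s n (\<lambda>y. \<Sum>i\<in>I. G' i y * c i y)"
  proof (rule insert.IH[of A' f' G' A0'])
    show "tame s n (A' i k)" if "i \<in> I" "k \<in> I" for n i k
      unfolding A'_def[abs_def] using that by (intro tame_diff tame_mult tip tA) auto
    show "tame s n (f' i)" if "i \<in> I" for n i
      unfolding f'_def[abs_def] using that by (intro tame_diff tame_mult tip tA tf) auto
    show "tame s n (G' i)" if "i \<in> I" for n i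
      unfolding G'_def[abs_def] using that by (intro tame_diff tame_mult tip tA tG) auto
    show "A' i k y = A' k i y" if "y \<in> points s" "i \<in> I" "k \<in> I" for y i k
      unfolding A'_def using symA[OF that(1), of i k] symA[OF that(1), of i j] symA[OF that(1), of k j] that by simp
    show "A0' i k = A0' k i" if "i \<in> I" "k \<in> I" for i k
      unfolding A0'_def using symA0[of i k] symA0[of i j] symA0[of k j] that by simp
    show "0 < (\<Sum>i\<in>I. \<Sum>k\<in>I. x i * x k * A0' i k)" if "\<exists>i\<in>I. x i \<noteq> 0" for x
    proof -
      \<comment> \<open>The form is evaluated at the minimizer - b0 x / q0 of the quadratic in the
        eliminated variable.\<close>
      have "0 < q0 * (- (inverse q0 * b0 x))\<^sup>2 + 2 * (- (inverse q0 * b0 x)) * b0 x + Q0 x"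
        unfolding ins0[symmetric] using that insert.hyps(2) by (intro pd) (metis fun_upd_other insertI2)
      also have "\<dots> = Q0 x - inverse q0 * (b0 x)\<^sup>2" using q0 by (simp add: power2_eq_square field_simps)
      finally show ?thesis unfolding Q0' .
    qed
    show "\<alpha> y * (\<Sum>i\<in>I. \<Sum>k\<in>I. x i * x k * A0' i k) \<le> (\<Sum>i\<in>I. \<Sum>k\<in>I. x i * x k * A' i k y)" if y: "y \<in> points s" for y x
    proof -
      \<comment> \<open>This t minimizes the form at y. Inserted into the reference form, it gives
        at least the minimum of that form, which is its Schur complement.\<close>
      define t where "t = - (ip y * b y x)"
      have "Q0 x - inverse q0 * (b0 x)\<^sup>2 = (q0 * t\<^sup>2 + 2 * t * b0 x + Q0 x) - q0 * (t + inverse q0 * b0 x)\<^sup>2"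
        using q0 by (simp add: power2_eq_square field_simps)
      also have "\<dots> \<le> q0 * t\<^sup>2 + 2 * t * b0 x + Q0 x" using q0 by simp
      finally have "\<alpha> y * (Q0 x - inverse q0 * (b0 x)\<^sup>2) \<le> \<alpha> y * (q0 * t\<^sup>2 + 2 * t * b0 x + Q0 x)"
        using \<alpha>(1)[OF y] by (intro mult_left_mono) auto
      also have "\<dots> \<le> A j j y * t\<^sup>2 + 2 * t * b y x + Q y x"
        unfolding ins0[symmetric] ins[OF y, symmetric] by (rule low[OF y])
      also have "\<dots> = Q y x - ip y * (b y x)\<^sup>2"
        using p0[OF y] unfolding t_def ip_def by (simp add: power2_eq_square field_simps)
      finally show ?thesis unfolding Q0' Q'[OF y] .
    qed
    show "(\<Sum>k\<in>I. A' i k y * c k y) = f' i y" if y: "y \<in> points s" and i: "i \<in> I" for y i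
    proof -
      have 1: "A i j y * c j y + (\<Sum>k\<in>I. A i k y * c k y) = f i y"
        "A j j y * c j y + (\<Sum>k\<in>I. A j k y * c k y) = f j y"
        using sol[OF y, of i] sol[OF y, of j] i insert.hyps by auto
      have "(\<Sum>k\<in>I. A' i k y * c k y) = (\<Sum>k\<in>I. A i k y * c k y) - A i j y * ip y * (\<Sum>k\<in>I. A j k y * c k y)"
        unfolding A'_def sum_distrib_left sum_subtractf[symmetric] by (intro sum.cong) (auto simp: algebra_simps)
      also have "\<dots> = (f i y - A i j y * c j y) - A i j y * ip y * (f j y - A j j y * c j y)"
        unfolding 1[symmetric] by simp
      also have "\<dots> = f' i y" using p0[OF y] unfolding f'_def ip_def by (simp add: field_simps)
      finally show ?thesis .
    qed
  qed (use \<alpha> in auto)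
  \<comment> \<open>G' is chosen so that eliminating c j from the functional leaves this tame term
    plus the functional of the remaining unknowns.\<close>
  then have "tame s n (\<lambda>y. G j y * f j y * ip y + (\<Sum>i\<in>I. G' i y * c i y))"
    by (intro tame_add tame_mult tG tf tip) auto
  moreover have "G j y * f j y * ip y + (\<Sum>i\<in>I. G' i y * c i y) = (\<Sum>i\<in>?J. G i y * c i y)" if y: "y \<in> points s" for y
  proof -
    have 1: "A j j y * c j y + (\<Sum>k\<in>I. A j k y * c k y) = f j y" using sol[OF y, of j] insert.hyps by auto
    have "(\<Sum>i\<in>I. G' i y * c i y) = (\<Sum>i\<in>I. G i y * c i y) - G j y * ip y * (\<Sum>i\<in>I. A j i y * c i y)"
      unfolding G'_def sum_distrib_left sum_subtractf[symmetric] by (intro sum.cong) (auto simp: algebra_simps)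
    moreover have "G j y * f j y * ip y = G j y * c j y + G j y * ip y * (\<Sum>i\<in>I. A j i y * c i y)"
      unfolding 1[symmetric] ip_def using p0[OF y] by (simp add: field_simps)
    ultimately show ?thesis using insert.hyps by simp
  qed
  ultimately show ?case by (rule tame_cong[rotated])
qed

section \<open>Parameter integrals of exponentials\<close>

lemma abs_integral_le:
  fixes f g :: "'a \<Rightarrow> real"
  assumes "integrable M f" "integrable M g" "\<And>x. x \<in> space M \<Longrightarrow> \<bar>f x\<bar> \<le> g x"
  shows "\<bar>\<integral>x. f x \<partial>M\<bar> \<le> (\<integral>x. g x \<partial>M)"
  by (rule order_trans[OF integral_abs_bound integral_mono]) (use assms in auto)

lemma exp_remainder: "\<bar>exp u - 1 - u\<bar> \<le> u\<^sup>2 * exp \<bar>u\<bar>" for u :: real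
proof -
  have 1: "exp u - 1 \<le> u * exp u"
  proof -
    have "(1 - u) * exp u \<le> exp (- u) * exp u" using exp_ge_add_one_self[of "- u"] by (intro mult_right_mono) auto
    then show ?thesis by (simp add: exp_minus algebra_simps)
  qed
  have "\<bar>exp u - 1\<bar> \<le> \<bar>u\<bar> * exp \<bar>u\<bar>"
  proof (cases "0 \<le> u")
    case False
    have "1 - exp u \<le> \<bar>u\<bar> * 1" using exp_ge_add_one_self[of u] False by linarith
    also have "\<dots> \<le> \<bar>u\<bar> * exp \<bar>u\<bar>" by (intro mult_left_mono) auto
    finally show ?thesis using False by simp
  qed (use 1 in simp)
  then have "\<bar>u\<bar> * \<bar>exp u - 1\<bar> \<le> \<bar>u\<bar> * (\<bar>u\<bar> * exp \<bar>u\<bar>)" by (intro mult_left_mono) auto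
  moreover have "exp u - 1 - u \<le> u * (exp u - 1)" using 1 by (simp add: algebra_simps)
  moreover have "u * (exp u - 1) \<le> \<bar>u\<bar> * \<bar>exp u - 1\<bar>" by (simp flip: abs_mult)
  moreover have "\<bar>u\<bar> * (\<bar>u\<bar> * exp \<bar>u\<bar>) = u\<^sup>2 * exp \<bar>u\<bar>" by (simp add: power2_eq_square flip: mult.assoc)
  moreover have "0 \<le> exp u - 1 - u" using exp_ge_add_one_self[of u] by linarith
  ultimately show ?thesis by linarith
qed

text \<open>The quadratic remainder of exp, integrated against the integrand, bounds the error of
  the difference quotient by a quantity of order |h|.\<close>

lemma has_real_derivative_exp_integral:
  fixes G r :: "'a \<Rightarrow> real"
  assumes G: "integrable M G" and r: "r \<in> borel_measurable M" "\<And>x. x \<in> space M \<Longrightarrow> \<bar>r x\<bar> \<le> R"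
  shows "((\<lambda>t. \<integral>x. G x * exp (r x * t) \<partial>M) has_real_derivative (\<integral>x. G x * r x * exp (r x * t) \<partial>M)) (at t)"
proof -
  have R: "0 \<le> R" if "space M \<noteq> {}" using r(2) that by fastforce
  have i: "integrable M (\<lambda>x. G x * exp (r x * t))" for t
  proof (rule Bochner_Integration.integrable_bound[of _ "\<lambda>x. exp (R * \<bar>t\<bar>) * G x"])
    show "AE x in M. norm (G x * exp (r x * t)) \<le> norm (exp (R * \<bar>t\<bar>) * G x)"
    proof (rule AE_I2)
      fix x assume "x \<in> space M"
      then have "r x * t \<le> R * \<bar>t\<bar>" using r(2)[of x] abs_ge_self[of "r x * t"] mult_right_mono[of "\<bar>r x\<bar>" R "\<bar>t\<bar>"] by (simp add: abs_mult)
      then show "norm (G x * exp (r x * t)) \<le> norm (exp (R * \<bar>t\<bar>) * G x)"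
        by (auto simp: abs_mult mult.commute intro!: mult_left_mono)
    qed
  qed (use G r in auto)
  have i1: "integrable M (\<lambda>x. G x * r x * exp (r x * t))" for t
  proof (rule Bochner_Integration.integrable_bound[of _ "\<lambda>x. R * (G x * exp (r x * t))"])
    show "AE x in M. norm (G x * r x * exp (r x * t)) \<le> norm (R * (G x * exp (r x * t)))"
    proof (rule AE_I2)
      fix x assume "x \<in> space M"
      then have "\<bar>r x\<bar> \<le> \<bar>R\<bar>" using r(2)[of x] by simp
      then have "\<bar>r x\<bar> * \<bar>G x * exp (r x * t)\<bar> \<le> \<bar>R\<bar> * \<bar>G x * exp (r x * t)\<bar>" by (rule mult_right_mono) simp
      then show "norm (G x * r x * exp (r x * t)) \<le> norm (R * (G x * exp (r x * t)))" by (simp add: abs_mult mult_ac)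
    qed
  qed (use G r i in auto)
  define K where "K = (\<integral>x. \<bar>G x * exp (r x * t)\<bar> \<partial>M) * R\<^sup>2"
  let ?\<psi> = "\<lambda>t. \<integral>x. G x * exp (r x * t) \<partial>M" and ?L = "\<integral>x. G x * r x * exp (r x * t) \<partial>M"
  have bound: "\<bar>?\<psi> (t + h) - ?\<psi> t - h * ?L\<bar> \<le> K * h\<^sup>2 * exp (R * \<bar>h\<bar>)" for h
  proof -
    have "?\<psi> (t + h) - ?\<psi> t - h * ?L = (\<integral>x. G x * exp (r x * (t + h)) - G x * exp (r x * t) - h * (G x * r x * exp (r x * t)) \<partial>M)"
      using i i1 by simp
    also have "\<dots> = (\<integral>x. (G x * exp (r x * t)) * (exp (r x * h) - 1 - r x * h) \<partial>M)"
      by (intro Bochner_Integration.integral_cong) (auto simp: algebra_simps exp_add)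
    also have "\<bar>\<dots>\<bar> \<le> (\<integral>x. \<bar>G x * exp (r x * t)\<bar> * (R\<^sup>2 * h\<^sup>2 * exp (R * \<bar>h\<bar>)) \<partial>M)"
    proof (rule abs_integral_le)
      have "integrable M (\<lambda>x. G x * exp (r x * (t + h)) - G x * exp (r x * t) - h * (G x * r x * exp (r x * t)))"
        using i i1 by simp
      then show "integrable M (\<lambda>x. (G x * exp (r x * t)) * (exp (r x * h) - 1 - r x * h))"
        by (rule Bochner_Integration.integrable_cong[THEN iffD1, rotated 2]) (auto simp: algebra_simps exp_add)
      show "integrable M (\<lambda>x. \<bar>G x * exp (r x * t)\<bar> * (R\<^sup>2 * h\<^sup>2 * exp (R * \<bar>h\<bar>)))" using i by simp
      fix x assume x: "x \<in> space M"
      have le: "\<bar>r x * h\<bar> \<le> R * \<bar>h\<bar>" unfolding abs_mult using r(2)[OF x] by (rule mult_right_mono) simp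
      have "\<bar>exp (r x * h) - 1 - r x * h\<bar> \<le> (r x * h)\<^sup>2 * exp \<bar>r x * h\<bar>" by (rule exp_remainder)
      also have "\<dots> \<le> (R * \<bar>h\<bar>)\<^sup>2 * exp (R * \<bar>h\<bar>)"
        using le by (intro mult_mono power_mono[of "\<bar>r x * h\<bar>" _ 2, unfolded power2_abs]) auto
      finally show "\<bar>(G x * exp (r x * t)) * (exp (r x * h) - 1 - r x * h)\<bar> \<le> \<bar>G x * exp (r x * t)\<bar> * (R\<^sup>2 * h\<^sup>2 * exp (R * \<bar>h\<bar>))"
        unfolding abs_mult[of "G x * exp (r x * t)"] by (intro mult_left_mono) (auto simp: power_mult_distrib)
    qed
    also have "\<dots> = K * h\<^sup>2 * exp (R * \<bar>h\<bar>)" unfolding K_def by (simp add: mult_ac)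
    finally show ?thesis .
  qed
  show ?thesis unfolding DERIV_def
  proof (subst LIM_zero_iff[symmetric], rule Lim_null_comparison)
    show "\<forall>\<^sub>F h in at 0. norm ((?\<psi> (t + h) - ?\<psi> t) / h - ?L) \<le> K * \<bar>h\<bar> * exp (R * \<bar>h\<bar>)"
      unfolding eventually_at_filter
    proof (intro always_eventually allI impI)
      fix h :: real assume h: "h \<noteq> 0"
      have "(?\<psi> (t + h) - ?\<psi> t) / h - ?L = (?\<psi> (t + h) - ?\<psi> t - h * ?L) / h" using h by (simp add: field_simps)
      also have "norm \<dots> \<le> (K * h\<^sup>2 * exp (R * \<bar>h\<bar>)) / \<bar>h\<bar>"
        using bound[of h] by (simp only: real_norm_def abs_divide) (intro divide_right_mono, auto)
      also have "\<dots> = K * \<bar>h\<bar> * exp (R * \<bar>h\<bar>)" using h by (simp add: power2_eq_square field_simps)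
      finally show "norm ((?\<psi> (t + h) - ?\<psi> t) / h - ?L) \<le> K * \<bar>h\<bar> * exp (R * \<bar>h\<bar>)" .
    qed
    have "((\<lambda>h. K * \<bar>h\<bar> * exp (R * \<bar>h\<bar>)) \<longlongrightarrow> K * \<bar>0\<bar> * exp (R * \<bar>0\<bar>)) (at 0)"
      by (intro tendsto_intros)
    then show "((\<lambda>h. K * \<bar>h\<bar> * exp (R * \<bar>h\<bar>)) \<longlongrightarrow> 0) (at 0)" by simp
  qed
qed

text \<open>Differentiation in y j multiplies g by the bounded function r j and preserves the shape
  of the integral, so the induction runs over all integrable g.\<close>

lemma tame_exp_integral:
  fixes g :: "'a \<Rightarrow> real" and r :: "nat \<Rightarrow> 'a \<Rightarrow> real"
  assumes M: "sigma_finite_measure M" and R: "0 \<le> R"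
    and r: "\<And>j. j \<in> {1..s} \<Longrightarrow> r j \<in> borel_measurable M" "\<And>j x. j \<in> {1..s} \<Longrightarrow> x \<in> space M \<Longrightarrow> \<bar>r j x\<bar> \<le> R"
  shows "integrable M g \<Longrightarrow> tame s n (\<lambda>y. \<integral>x. g x * exp (\<Sum>j\<in>{1..s}. r j x * y j) \<partial>M)"
proof -
  have le: "(\<Sum>j\<in>{1..s}. r j x * y j) \<le> R * (\<Sum>j\<in>{1..s}. \<bar>y j\<bar>)" if "x \<in> space M" for x y
    unfolding sum_distrib_left
  proof (rule sum_mono)
    fix j assume "j \<in> {1..s}"
    then have "\<bar>r j x\<bar> * \<bar>y j\<bar> \<le> R * \<bar>y j\<bar>" using r(2) that by (intro mult_right_mono) auto
    then show "r j x * y j \<le> R * \<bar>y j\<bar>" using abs_ge_self[of "r j x * y j"] by (simp add: abs_mult)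
  qed
  have mexp: "(\<lambda>x. exp (\<Sum>j\<in>{1..s}. r j x * y j)) \<in> borel_measurable M" for y
    using r(1) by (intro borel_measurable_exp[THEN measurable_compose[rotated]] borel_measurable_sum borel_measurable_times) auto
  have int: "integrable M (\<lambda>x. g x * exp (\<Sum>j\<in>{1..s}. r j x * y j))" if "integrable M g" for g y
  proof (rule Bochner_Integration.integrable_bound[of _ "\<lambda>x. g x * exp (R * (\<Sum>j\<in>{1..s}. \<bar>y j\<bar>))"])
    show "AE x in M. norm (g x * exp (\<Sum>j\<in>{1..s}. r j x * y j)) \<le> norm (g x * exp (R * (\<Sum>j\<in>{1..s}. \<bar>y j\<bar>)))"
      using le by (intro AE_I2) (simp add: abs_mult mult_left_mono)
  qed (use that mexp in auto)
  have bnd: "exp_bounded s (\<lambda>y. \<integral>x. g x * exp (\<Sum>j\<in>{1..s}. r j x * y j) \<partial>M)" if g: "integrable M g" for g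
  proof (rule exp_boundedI[OF _ _ R, of _ _ "\<integral>x. \<bar>g x\<bar> \<partial>M"])
    have gm: "g \<in> borel_measurable M" using g by simp
    have "(\<lambda>(y, x). g x * exp (\<Sum>j\<in>{1..s}. r j x * y j)) \<in> borel_measurable (euclid s \<Otimes>\<^sub>M M)"
      unfolding case_prod_beta
    proof (intro borel_measurable_times borel_measurable_exp[THEN measurable_compose[rotated]] borel_measurable_sum)
      show "(\<lambda>w. g (snd w)) \<in> borel_measurable (euclid s \<Otimes>\<^sub>M M)" by (rule measurable_compose[OF measurable_snd gm])
      fix j assume j: "j \<in> {1..s}"
      show "(\<lambda>w. r j (snd w)) \<in> borel_measurable (euclid s \<Otimes>\<^sub>M M)" by (rule measurable_compose[OF measurable_snd r(1)[OF j]])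
      have "(\<lambda>y. y j) \<in> borel_measurable (euclid s)" using exp_bounded_coord[OF j] unfolding exp_bounded_def by blast
      then show "(\<lambda>w. fst w j) \<in> borel_measurable (euclid s \<Otimes>\<^sub>M M)" by (rule measurable_compose[OF measurable_fst])
    qed
    then show "(\<lambda>y. \<integral>x. g x * exp (\<Sum>j\<in>{1..s}. r j x * y j) \<partial>M) \<in> borel_measurable (euclid s)"
      by (rule sigma_finite_measure.borel_measurable_lebesgue_integral[OF M])
    show "0 \<le> (\<integral>x. \<bar>g x\<bar> \<partial>M)" by simp
    fix y assume "y \<in> points s"
    have "\<bar>\<integral>x. g x * exp (\<Sum>j\<in>{1..s}. r j x * y j) \<partial>M\<bar> \<le> (\<integral>x. \<bar>g x\<bar> * exp (R * (\<Sum>j\<in>{1..s}. \<bar>y j\<bar>)) \<partial>M)"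
      using g le by (intro abs_integral_le int g) (auto simp: abs_mult mult_left_mono)
    then show "\<bar>\<integral>x. g x * exp (\<Sum>j\<in>{1..s}. r j x * y j) \<partial>M\<bar> \<le> (\<integral>x. \<bar>g x\<bar> \<partial>M) * exp (R * (\<Sum>j\<in>{1..s}. \<bar>y j\<bar>))"
      by simp
  qed
  show "integrable M g \<Longrightarrow> tame s n (\<lambda>y. \<integral>x. g x * exp (\<Sum>j\<in>{1..s}. r j x * y j) \<partial>M)"
  proof (induction n arbitrary: g)
    case 0
    then show ?case using bnd by simp
  next
    case (Suc n)
    show ?case
    proof (rule tame_SucI)
      show "exp_bounded s (\<lambda>y. \<integral>x. g x * exp (\<Sum>j\<in>{1..s}. r j x * y j) \<partial>M)" by (rule bnd[OF Suc.prems])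
      fix j assume j: "j \<in> {1..s}"
      have gr: "integrable M (\<lambda>x. g x * r j x)"
      proof (rule Bochner_Integration.integrable_bound[of _ "\<lambda>x. g x * R"])
        show "AE x in M. norm (g x * r j x) \<le> norm (g x * R)"
          using r(2)[OF j] R by (intro AE_I2) (simp add: abs_mult mult_left_mono)
      qed (use Suc.prems r(1)[OF j] in auto)
      have "has_partial s j (\<lambda>y. \<integral>x. g x * exp (\<Sum>j\<in>{1..s}. r j x * y j) \<partial>M)
        (\<lambda>y. \<integral>x. (g x * r j x) * exp (\<Sum>j\<in>{1..s}. r j x * y j) \<partial>M)"
        unfolding has_partial_def
      proof
        fix y assume "y \<in> points s"
        define z where "z = y(j := 0)"
        let ?G = "\<lambda>x. g x * exp (\<Sum>j\<in>{1..s}. r j x * z j)"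
        have sp: "(\<Sum>i\<in>{1..s}. r i x * (y(j := t)) i) = (\<Sum>i\<in>{1..s}. r i x * z i) + r j x * t" for x t
        proof -
          have "(\<Sum>i\<in>{1..s}. r i x * (y(j := t)) i) = (\<Sum>i\<in>{1..s}. r i x * z i + (if i = j then r j x * t else 0))"
            unfolding z_def by (intro sum.cong) auto
          then show ?thesis using j by (simp only: sum.distrib) (simp add: sum.delta)
        qed
        have "((\<lambda>t. \<integral>x. ?G x * exp (r j x * t) \<partial>M) has_real_derivative (\<integral>x. ?G x * r j x * exp (r j x * y j) \<partial>M)) (at (y j))"
          using r j by (intro has_real_derivative_exp_integral[of _ _ _ R] int Suc.prems) auto
        moreover have "(\<integral>x. ?G x * exp (r j x * t) \<partial>M) = (\<integral>x. g x * exp (\<Sum>i\<in>{1..s}. r i x * (y(j := t)) i) \<partial>M)" for t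
          unfolding sp exp_add by (simp only: mult.assoc)
        moreover have "(\<integral>x. ?G x * r j x * exp (r j x * y j) \<partial>M) = (\<integral>x. (g x * r j x) * exp (\<Sum>j\<in>{1..s}. r j x * y j) \<partial>M)"
          using sp[of _ "y j"] by (simp only: fun_upd_triv exp_add mult_ac)
        ultimately show "((\<lambda>t. \<integral>x. g x * exp (\<Sum>ja\<in>{1..s}. r ja x * (y(j := t)) ja) \<partial>M) has_real_derivative
          (\<integral>x. (g x * r j x) * exp (\<Sum>j\<in>{1..s}. r j x * y j) \<partial>M)) (at (y j))" by (simp only:)
      qed
      moreover have "tame s n (\<lambda>y. \<integral>x. (g x * r j x) * exp (\<Sum>j\<in>{1..s}. r j x * y j) \<partial>M)" by (rule Suc.IH[OF gr])
      ultimately show "\<exists>D. tame s n D \<and> has_partial s j (\<lambda>y. \<integral>x. g x * exp (\<Sum>j\<in>{1..s}. r j x * y j) \<partial>M) D"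
        by (intro exI conjI)
    qed
  qed
qed

subsection \<open>The Galerkin solution\<close>

lemma integrable_bounded_mult:
  fixes g h :: "'a \<Rightarrow> real"
  assumes "integrable M g" "h \<in> borel_measurable M" "\<And>x. x \<in> space M \<Longrightarrow> \<bar>h x\<bar> \<le> B"
  shows "integrable M (\<lambda>x. h x * g x)"
proof (rule Bochner_Integration.integrable_bound[of _ "\<lambda>x. B * g x"])
  show "AE x in M. norm (h x * g x) \<le> norm (B * g x)"
  proof (rule AE_I2)
    fix x assume "x \<in> space M"
    then have "\<bar>h x\<bar> \<le> \<bar>B\<bar>" using assms(3)[of x] by linarith
    then show "norm (h x * g x) \<le> norm (B * g x)" by (simp add: abs_mult mult_right_mono)
  qed
qed (use assms in auto)

lemma gram_quadratic:
  fixes w :: "nat \<Rightarrow> 'a \<Rightarrow> 'b::euclidean_space"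
  assumes "\<And>i k. i \<in> I \<Longrightarrow> k \<in> I \<Longrightarrow> integrable M (\<lambda>x. a x * (w i x \<bullet> w k x))"
  shows "integrable M (\<lambda>x. a x * (norm (\<Sum>i\<in>I. c i *\<^sub>R w i x))\<^sup>2)"
    and "(\<Sum>i\<in>I. \<Sum>k\<in>I. c i * c k * (\<integral>x. a x * (w i x \<bullet> w k x) \<partial>M)) = (\<integral>x. a x * (norm (\<Sum>i\<in>I. c i *\<^sub>R w i x))\<^sup>2 \<partial>M)"
proof -
  have eq: "a x * (norm (\<Sum>i\<in>I. c i *\<^sub>R w i x))\<^sup>2 = (\<Sum>i\<in>I. \<Sum>k\<in>I. c i * c k * (a x * (w i x \<bullet> w k x)))" for x
    unfolding power2_norm_eq_inner inner_sum_left inner_sum_right sum_distrib_left inner_scaleR_left inner_scaleR_right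
    by (intro sum.cong refl) (simp add: inner_commute mult_ac)
  show "integrable M (\<lambda>x. a x * (norm (\<Sum>i\<in>I. c i *\<^sub>R w i x))\<^sup>2)"
    unfolding eq by (intro Bochner_Integration.integrable_sum integrable_mult_right assms)
  have "(\<integral>x. a x * (norm (\<Sum>i\<in>I. c i *\<^sub>R w i x))\<^sup>2 \<partial>M) = (\<Sum>i\<in>I. \<integral>x. (\<Sum>k\<in>I. c i * c k * (a x * (w i x \<bullet> w k x))) \<partial>M)"
    unfolding eq by (intro Bochner_Integration.integral_sum Bochner_Integration.integrable_sum integrable_mult_right assms)
  also have "\<dots> = (\<Sum>i\<in>I. \<Sum>k\<in>I. \<integral>x. c i * c k * (a x * (w i x \<bullet> w k x)) \<partial>M)"
    by (intro sum.cong refl Bochner_Integration.integral_sum integrable_mult_right assms)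
  finally show "(\<Sum>i\<in>I. \<Sum>k\<in>I. c i * c k * (\<integral>x. a x * (w i x \<bullet> w k x) \<partial>M)) = (\<integral>x. a x * (norm (\<Sum>i\<in>I. c i *\<^sub>R w i x))\<^sup>2 \<partial>M)"
    by simp
qed

lemma continuous_closure_bounded:
  fixes h :: "'d::euclidean_space \<Rightarrow> real"
  assumes "open D" "bounded D" "continuous_on (closure D) h"
  shows "h \<in> borel_measurable (lebesgue_on D)" "\<exists>B\<ge>0. \<forall>x\<in>D. \<bar>h x\<bar> \<le> B"
proof -
  show "h \<in> borel_measurable (lebesgue_on D)"
    using assms by (intro continuous_imp_measurable_on_sets_lebesgue continuous_on_subset[OF assms(3) closure_subset]) auto
  have "compact (closure D)" using assms(2) by (simp add: compact_closure)
  then have "bounded (h ` closure D)" using assms(3) by (intro compact_imp_bounded compact_continuous_image)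
  then obtain B where B: "\<And>x. x \<in> closure D \<Longrightarrow> \<bar>h x\<bar> \<le> B" unfolding bounded_iff by auto
  have "\<bar>h x\<bar> \<le> \<bar>B\<bar>" if "x \<in> D" for x using B[of x] subsetD[OF closure_subset that] by linarith
  then show "\<exists>B\<ge>0. \<forall>x\<in>D. \<bar>h x\<bar> \<le> B" by (intro exI[of _ "\<bar>B\<bar>"]) auto
qed

text \<open>The functions spanning a finite element space may be dependent, and positive
  definiteness of the Gram matrix of their gradients requires an independent subfamily. A maximal
  one still spans the rest almost everywhere.\<close>

lemma maximal_independent:
  fixes w :: "nat \<Rightarrow> 'a \<Rightarrow> 'b::real_vector"
  obtains I coef where "I \<subseteq> {..<N}"
    "\<And>c. AE x in M. (\<Sum>i\<in>I. c i *\<^sub>R w i x) = 0 \<Longrightarrow> \<forall>i\<in>I. c i = 0"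
    "\<And>j. j < N \<Longrightarrow> AE x in M. w j x = (\<Sum>i\<in>I. coef j i *\<^sub>R w i x)"
proof -
  define indep where "indep J \<longleftrightarrow> (\<forall>c. (AE x in M. (\<Sum>i\<in>J. c i *\<^sub>R w i x) = 0) \<longrightarrow> (\<forall>i\<in>J. c i = 0))" for J
  let ?S = "{J. J \<subseteq> {..<N} \<and> indep J}"
  have fin: "finite ?S" by (rule finite_subset[of _ "Pow {..<N}"]) auto
  have "{} \<in> ?S" by (simp add: indep_def)
  then have ne: "?S \<noteq> {}" by auto
  obtain I where I: "I \<in> ?S" and max: "\<forall>J\<in>?S. I \<subseteq> J \<longrightarrow> I = J"
    using finite_has_maximal[OF fin ne] by (elim bexE)
  have fI: "finite I" using I finite_subset by blast
  have "\<exists>c. AE x in M. w j x = (\<Sum>i\<in>I. c i *\<^sub>R w i x)" if j: "j < N" for j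
  proof (cases "j \<in> I")
    case True
    have "(\<Sum>i\<in>I. (if i = j then 1 else 0) *\<^sub>R w i x) = (\<Sum>i\<in>I. if i = j then w j x else 0)" for x
      by (intro sum.cong) auto
    then have "w j x = (\<Sum>i\<in>I. (if i = j then 1 else 0) *\<^sub>R w i x)" for x using True fI by (simp add: sum.delta)
    then show ?thesis by (intro exI[of _ "\<lambda>i. if i = j then 1 else 0"] AE_I2)
  next
    case False
    then have "insert j I \<notin> ?S" using max by blast
    then obtain c where c: "AE x in M. (\<Sum>i\<in>insert j I. c i *\<^sub>R w i x) = 0" "\<exists>i\<in>insert j I. c i \<noteq> 0"
      using I j unfolding indep_def by auto
    have c': "AE x in M. c j *\<^sub>R w j x + (\<Sum>i\<in>I. c i *\<^sub>R w i x) = 0" using c(1) False fI by simp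
    have cj: "c j \<noteq> 0"
    proof
      assume "c j = 0"
      then have "AE x in M. (\<Sum>i\<in>I. c i *\<^sub>R w i x) = 0" using c' by simp
      then have "\<forall>i\<in>I. c i = 0" using I unfolding indep_def by simp
      then show False using c(2) \<open>c j = 0\<close> by simp
    qed
    have "AE x in M. w j x = (\<Sum>i\<in>I. (- c i / c j) *\<^sub>R w i x)"
      using c'
    proof eventually_elim
      fix x assume "c j *\<^sub>R w j x + (\<Sum>i\<in>I. c i *\<^sub>R w i x) = 0"
      then have T: "(\<Sum>i\<in>I. c i *\<^sub>R w i x) = - (c j *\<^sub>R w j x)" by (simp add: add_eq_0_iff)
      have "(\<Sum>i\<in>I. (- c i / c j) *\<^sub>R w i x) = (- 1 / c j) *\<^sub>R (\<Sum>i\<in>I. c i *\<^sub>R w i x)"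
        unfolding scaleR_sum_right by (intro sum.cong) auto
      then show "w j x = (\<Sum>i\<in>I. (- c i / c j) *\<^sub>R w i x)" unfolding T using cj by simp
    qed
    then show ?thesis by (intro exI[of _ "\<lambda>i. - c i / c j"])
  qed
  then obtain coef where "\<And>j. j < N \<Longrightarrow> AE x in M. w j x = (\<Sum>i\<in>I. coef j i *\<^sub>R w i x)" by metis
  then show ?thesis using I unfolding indep_def by (intro that[of I coef]) auto
qed

text \<open>Functionals are bounded by the norm of the gradient, so they cannot distinguish
  functions whose gradients agree almost everywhere.\<close>

lemma dual_V_AE_zero:
  assumes "g \<in> dual_V D" "v \<in> H10 D" "AE x in lebesgue_on D. wgrad D v x = 0" shows "g v = 0"
proof -
  obtain K where K: "\<And>v. v \<in> H10 D \<Longrightarrow> \<bar>g v\<bar> \<le> K * norm_V D v" using assms(1) unfolding dual_V_def by blast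
  have "in_L2 D (wgrad D v)" using assms(2) unfolding H10_def by (intro wgrad_in_L2) blast
  then have "norm_V D v = norm_L2 D (\<lambda>_. 0 :: 'a)"
    unfolding norm_V_def using assms(3) by (intro in_L2_cong_AE) (auto simp: in_L2_def)
  then have "norm_V D v = 0" by (simp add: norm_L2_def)
  then show ?thesis using K[OF assms(2)] by simp
qed

lemma exp_linear_bounds:
  fixes r y :: "nat \<Rightarrow> real"
  assumes "\<And>j. j \<in> {1..s} \<Longrightarrow> \<bar>r j\<bar> \<le> R"
  shows "exp (\<Sum>j\<in>{1..s}. r j * y j) \<le> exp (R * (\<Sum>j\<in>{1..s}. \<bar>y j\<bar>))"
    and "exp (- (R * (\<Sum>j\<in>{1..s}. \<bar>y j\<bar>))) \<le> exp (\<Sum>j\<in>{1..s}. r j * y j)"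
proof -
  have "\<bar>\<Sum>j\<in>{1..s}. r j * y j\<bar> \<le> (\<Sum>j\<in>{1..s}. \<bar>r j * y j\<bar>)" by (rule sum_abs)
  also have "\<dots> \<le> (\<Sum>j\<in>{1..s}. R * \<bar>y j\<bar>)"
    unfolding abs_mult using assms by (intro sum_mono mult_right_mono) auto
  finally have "\<bar>\<Sum>j\<in>{1..s}. r j * y j\<bar> \<le> R * (\<Sum>j\<in>{1..s}. \<bar>y j\<bar>)" unfolding sum_distrib_left .
  then show "exp (\<Sum>j\<in>{1..s}. r j * y j) \<le> exp (R * (\<Sum>j\<in>{1..s}. \<bar>y j\<bar>))"
    "exp (- (R * (\<Sum>j\<in>{1..s}. \<bar>y j\<bar>))) \<le> exp (\<Sum>j\<in>{1..s}. r j * y j)" by (simp_all only: exp_le_cancel_iff)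
qed

lemma exp_bounded_inverse_decay:
  assumes "0 < m0" "0 \<le> R" shows "exp_bounded s (\<lambda>y. inverse (m0 * exp (- (R * (\<Sum>j\<in>{1..s}. \<bar>y j\<bar>)))))"
proof -
  have "(\<lambda>y. y j) \<in> borel_measurable (euclid s)" if "j \<in> {1..s}" for j
    using exp_bounded_coord[OF that] unfolding exp_bounded_def by blast
  then have "(\<lambda>y. inverse (m0 * exp (- (R * (\<Sum>j\<in>{1..s}. \<bar>y j\<bar>))))) \<in> borel_measurable (euclid s)"
    by (intro borel_measurable_inverse borel_measurable_times borel_measurable_const borel_measurable_uminus
      borel_measurable_exp[THEN measurable_compose[rotated]] borel_measurable_sum borel_measurable_abs)
  moreover have "\<bar>inverse (m0 * exp (- (R * (\<Sum>j\<in>{1..s}. \<bar>y j\<bar>))))\<bar> \<le> inverse m0 * exp (R * (\<Sum>j\<in>{1..s}. \<bar>y j\<bar>))" for y :: "nat \<Rightarrow> real"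
    using assms by (simp add: exp_minus)
  moreover have "0 \<le> inverse m0" using assms by simp
  ultimately show ?thesis by (intro exp_boundedI[OF _ _ assms(2)])
qed

text \<open>The coefficients of the solution with respect to a subfamily with independent gradients
  solve a linear system whose entries are integrals of exponentials in y. Relative to the Gram
  matrix it is coercive with the factor m0 * exp (- R * sum of |y j|), where m0 is the minimum of a0
  on the compact closure of D; the reciprocal of this factor grows only exponentially.\<close>

lemma tame_galerkin:
  fixes D :: "'d::euclidean_space set"
  assumes lp: "lognormal_problem s D Vh f G a_star a0 \<mu> \<xi>"
    and sol: "\<And>y. y \<in> points s \<Longrightarrow> galerkin_solution D Vh f (\<lambda>x. lognormal_coeff s a_star a0 \<mu> \<xi> x y) (u y)"
  shows "tame s n (\<lambda>y. G (u y))"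
proof -
  let ?M = "lebesgue_on D"
  have D: "open D" "bounded D" "D \<noteq> {}" and fG: "f \<in> dual_V D" "G \<in> dual_V D"
    and cont: "continuous_on (closure D) a_star" "continuous_on (closure D) a0"
      "\<And>j. j \<in> {1..s} \<Longrightarrow> continuous_on (closure D) (\<xi> j)"
    and pos: "\<And>x. x \<in> closure D \<Longrightarrow> 0 \<le> a_star x" "\<And>x. x \<in> closure D \<Longrightarrow> 0 < a0 x"
    using lp unfolding lognormal_problem_def by auto
  obtain N e where e: "\<And>i. i < N \<Longrightarrow> e i \<in> H10 D" and Vh: "Vh = {(\<lambda>x. \<Sum>i<(N::nat). c i * e i x) | c. True}"
    using lp unfolding lognormal_problem_def fe_subspace_def by blast
  have sp: "space ?M = D" by (simp add: space_restrict_space)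
  have clD: "x \<in> closure D" if "x \<in> D" for x using subsetD[OF closure_subset that] .
  interpret fm: finite_measure ?M by (rule finite_measure_lebesgue_on[OF D(1,2)])
  define r where "r j x = sqrt (\<mu> j) * \<xi> j x" for j x
  have rm: "r j \<in> borel_measurable ?M" if "j \<in> {1..s}" for j
    unfolding r_def[abs_def] using continuous_closure_bounded(1)[OF D(1,2) cont(3)[OF that]] by simp
  have "\<exists>B\<ge>0. \<forall>x\<in>D. \<bar>r j x\<bar> \<le> B" if "j \<in> {1..s}" for j
    unfolding r_def using cont(3)[OF that] by (intro continuous_closure_bounded(2)[OF D(1,2)] continuous_intros)
  then obtain B where B: "\<And>j. j \<in> {1..s} \<Longrightarrow> 0 \<le> B j" "\<And>j x. j \<in> {1..s} \<Longrightarrow> x \<in> D \<Longrightarrow> \<bar>r j x\<bar> \<le> B j" by metis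
  define R where "R = (\<Sum>j\<in>{1..s}. B j)"
  have R0: "0 \<le> R" unfolding R_def using B(1) by (rule sum_nonneg)
  have rR: "\<bar>r j x\<bar> \<le> R" if "j \<in> {1..s}" "x \<in> D" for j x
  proof -
    have "B j \<le> R" unfolding R_def using B(1) that(1) by (intro member_le_sum) auto
    then show ?thesis using B(2)[OF that] by linarith
  qed
  obtain Bs where Bs: "\<And>x. x \<in> D \<Longrightarrow> \<bar>a_star x\<bar> \<le> Bs" using continuous_closure_bounded(2)[OF D(1,2) cont(1)] by blast
  obtain B0 where B0: "\<And>x. x \<in> D \<Longrightarrow> \<bar>a0 x\<bar> \<le> B0" using continuous_closure_bounded(2)[OF D(1,2) cont(2)] by blast
  note am = continuous_closure_bounded(1)[OF D(1,2) cont(1)] continuous_closure_bounded(1)[OF D(1,2) cont(2)]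
  have "compact (closure D)" "closure D \<noteq> {}" using D by (auto simp: compact_closure)
  then obtain xm where xm: "xm \<in> closure D" "\<And>x. x \<in> closure D \<Longrightarrow> a0 xm \<le> a0 x"
    using continuous_attains_inf[OF _ _ cont(2)] by blast
  define m0 where "m0 = a0 xm"
  have m0: "0 < m0" unfolding m0_def using pos(2)[OF xm(1)] .
  define E where "E x y = exp (\<Sum>j\<in>{1..s}. r j x * y j)" for x and y :: "nat \<Rightarrow> real"
  define a where "a x y = lognormal_coeff s a_star a0 \<mu> \<xi> x y" for x y
  have aE: "a x y = a_star x + a0 x * E x y" for x y unfolding a_def lognormal_coeff_def E_def r_def ..
  have Em: "(\<lambda>x. E x y) \<in> borel_measurable ?M" for y
    unfolding E_def using rm
    by (intro borel_measurable_exp[THEN measurable_compose[rotated]] borel_measurable_sum borel_measurable_times borel_measurable_const) auto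
  have am': "(\<lambda>x. a x y) \<in> borel_measurable ?M" for y unfolding aE by (intro borel_measurable_add borel_measurable_times am Em)
  define w where "w i = wgrad D (e i)" for i
  have wL: "in_L2 D (w i)" if "i < N" for i
    unfolding w_def using e[OF that] unfolding H10_def by (intro wgrad_in_L2) blast
  obtain I coef where I: "I \<subseteq> {..<N}"
    and ind: "\<And>c. AE x in ?M. (\<Sum>i\<in>I. c i *\<^sub>R w i x) = 0 \<Longrightarrow> \<forall>i\<in>I. c i = 0"
    and span: "\<And>j. j < N \<Longrightarrow> AE x in ?M. w j x = (\<Sum>i\<in>I. coef j i *\<^sub>R w i x)"
    using maximal_independent[where N=N and M="?M" and w=w] by blast
  have fI: "finite I" using I finite_subset by blast
  have IN: "i < N" if "i \<in> I" for i using I that by blast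
  have wi: "integrable ?M (\<lambda>x. w i x \<bullet> w k x)" if "i \<in> I" "k \<in> I" for i k
    by (intro in_L2_inner_integrable wL IN that)
  have asi: "integrable ?M (\<lambda>x. a_star x * (w i x \<bullet> w k x))" "integrable ?M (\<lambda>x. a0 x * (w i x \<bullet> w k x))" if "i \<in> I" "k \<in> I" for i k
    using Bs B0 by (auto intro!: integrable_bounded_mult[OF wi[OF that]] am simp: sp)
  have Ei: "integrable ?M (\<lambda>x. (a0 x * (w i x \<bullet> w k x)) * E x y)" if "i \<in> I" "k \<in> I" for i k y
  proof -
    have "integrable ?M (\<lambda>x. E x y * (a0 x * (w i x \<bullet> w k x)))"
      by (rule integrable_bounded_mult[OF asi(2)[OF that] Em, of y "exp (R * (\<Sum>j\<in>{1..s}. \<bar>y j\<bar>))"])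
        (use exp_linear_bounds(1)[of s "\<lambda>j. r j _" R y] rR in \<open>simp add: E_def sp\<close>)
    then show ?thesis by (simp only: mult.commute)
  qed
  have asplit: "a x y * (w i x \<bullet> w k x) = a_star x * (w i x \<bullet> w k x) + (a0 x * (w i x \<bullet> w k x)) * E x y" for x y i k
    unfolding aE by (simp add: algebra_simps)
  have ai: "integrable ?M (\<lambda>x. a x y * (w i x \<bullet> w k x))" if "i \<in> I" "k \<in> I" for i k y
    unfolding asplit by (intro Bochner_Integration.integrable_add asi Ei that)
  define A where "A i k y = (\<integral>x. a x y * (w i x \<bullet> w k x) \<partial>?M)" for i k y
  define A0 where "A0 i k = (\<integral>x. 1 * (w i x \<bullet> w k x) \<partial>?M)" for i k
  define \<alpha> where "\<alpha> y = m0 * exp (- (R * (\<Sum>j\<in>{1..s}. \<bar>y j\<bar>)))" for y :: "nat \<Rightarrow> real"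
  have "\<exists>d. u y = (\<lambda>x. \<Sum>i<N. d i * e i x)" if "y \<in> points s" for y
    using sol[OF that] unfolding galerkin_solution_def Vh by blast
  \<comment> \<open>If the functions e i are dependent, d is an arbitrary choice for each y; only
    the reduced coefficients c are determined by the equations.\<close>
  then obtain d where d: "\<And>y. y \<in> points s \<Longrightarrow> u y = (\<lambda>x. \<Sum>i<N. d y i * e i x)" by metis
  define c where "c k y = (\<Sum>j<N. d y j * coef j k)" for k y
  have uH: "u y \<in> H10 D" and ug: "AE x in ?M. wgrad D (u y) x = (\<Sum>k\<in>I. c k y *\<^sub>R w k x)" if y: "y \<in> points s" for y
  proof -
    show "u y \<in> H10 D" unfolding d[OF y] by (rule H10_sum(1)[OF D(1,2)]) (use e in auto)
    have 1: "AE x in ?M. wgrad D (u y) x = (\<Sum>j<N. d y j *\<^sub>R w j x)"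
      unfolding d[OF y] w_def by (rule H10_sum(2)[OF D(1,2)]) (use e in auto)
    have "AE x in ?M. \<forall>j\<in>{..<N}. w j x = (\<Sum>i\<in>I. coef j i *\<^sub>R w i x)"
      using span by (intro AE_ball_countable[THEN iffD2] ballI) (auto simp: countable_finite)
    with 1 show "AE x in ?M. wgrad D (u y) x = (\<Sum>k\<in>I. c k y *\<^sub>R w k x)"
    proof eventually_elim
      fix x assume 1: "wgrad D (u y) x = (\<Sum>j<N. d y j *\<^sub>R w j x)" and 2: "\<forall>j\<in>{..<N}. w j x = (\<Sum>i\<in>I. coef j i *\<^sub>R w i x)"
      have "wgrad D (u y) x = (\<Sum>j<N. d y j *\<^sub>R (\<Sum>i\<in>I. coef j i *\<^sub>R w i x))"
        unfolding 1 by (rule sum.cong[OF refl]) (use 2 in \<open>metis\<close>)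
      also have "\<dots> = (\<Sum>j<N. \<Sum>i\<in>I. (d y j * coef j i) *\<^sub>R w i x)" by (simp only: scaleR_sum_right scaleR_scaleR)
      also have "\<dots> = (\<Sum>i\<in>I. \<Sum>j<N. (d y j * coef j i) *\<^sub>R w i x)" by (rule sum.swap)
      finally show "wgrad D (u y) x = (\<Sum>k\<in>I. c k y *\<^sub>R w k x)" unfolding c_def scaleR_sum_left .
    qed
  qed
  have "tame s n (\<lambda>y. \<Sum>i\<in>I. G (e i) * c i y)"
  proof (rule tame_linear_system[of I s A "\<lambda>i _. f (e i)" "\<lambda>i _. G (e i)" A0 \<alpha> c])
    show "finite I" by (rule fI)
    show "tame s n (A i k)" if "i \<in> I" "k \<in> I" for n i k
    proof -
      have "A i k = (\<lambda>y. (\<integral>x. a_star x * (w i x \<bullet> w k x) \<partial>?M) + (\<integral>x. (a0 x * (w i x \<bullet> w k x)) * E x y \<partial>?M))"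
        unfolding A_def[abs_def] asplit using asi[OF that] Ei[OF that] by simp
      moreover have "tame s n (\<lambda>y. \<integral>x. (a0 x * (w i x \<bullet> w k x)) * E x y \<partial>?M)"
        unfolding E_def
        by (rule tame_exp_integral[OF fm.sigma_finite_measure_axioms R0 rm _ asi(2)[OF that]]) (use rR in \<open>auto simp: sp\<close>)
      ultimately show ?thesis by (simp only: tame_add[OF tame_const])
    qed
    show "A i k y = A k i y" for i k y unfolding A_def by (simp only: inner_commute)
    show "A0 i k = A0 k i" for i k unfolding A0_def by (simp only: inner_commute)
    have S0: "(\<Sum>i\<in>I. \<Sum>k\<in>I. z i * z k * A0 i k) = (\<integral>x. 1 * (norm (\<Sum>i\<in>I. z i *\<^sub>R w i x))\<^sup>2 \<partial>?M)"
      "integrable ?M (\<lambda>x. 1 * (norm (\<Sum>i\<in>I. z i *\<^sub>R w i x))\<^sup>2)" for z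
      unfolding A0_def
      by (rule gram_quadratic[where a="\<lambda>_. 1"], simp only: mult_1 wi)+
    show "0 < (\<Sum>i\<in>I. \<Sum>k\<in>I. z i * z k * A0 i k)" if z: "\<exists>i\<in>I. z i \<noteq> 0" for z
    proof -
      have "(\<integral>x. 1 * (norm (\<Sum>i\<in>I. z i *\<^sub>R w i x))\<^sup>2 \<partial>?M) \<noteq> 0"
      proof
        assume "(\<integral>x. 1 * (norm (\<Sum>i\<in>I. z i *\<^sub>R w i x))\<^sup>2 \<partial>?M) = 0"
        then have "AE x in ?M. 1 * (norm (\<Sum>i\<in>I. z i *\<^sub>R w i x))\<^sup>2 = 0"
          by (subst (asm) integral_nonneg_eq_0_iff_AE[OF S0(2)]) auto
        then have "AE x in ?M. (\<Sum>i\<in>I. z i *\<^sub>R w i x) = 0" by simp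
        from ind[OF this] z show False by blast
      qed
      moreover have "0 \<le> (\<integral>x. 1 * (norm (\<Sum>i\<in>I. z i *\<^sub>R w i x))\<^sup>2 \<partial>?M)" by (rule integral_nonneg_AE) simp
      ultimately show ?thesis unfolding S0(1) by linarith
    qed
    show "\<alpha> y * (\<Sum>i\<in>I. \<Sum>k\<in>I. z i * z k * A0 i k) \<le> (\<Sum>i\<in>I. \<Sum>k\<in>I. z i * z k * A i k y)" for y z
    proof -
      have "\<alpha> y * (\<Sum>i\<in>I. \<Sum>k\<in>I. z i * z k * A0 i k) = (\<integral>x. \<alpha> y * (1 * (norm (\<Sum>i\<in>I. z i *\<^sub>R w i x))\<^sup>2) \<partial>?M)"
        unfolding S0(1) by (rule integral_mult_right_zero[symmetric])
      also have "\<dots> \<le> (\<integral>x. a x y * (norm (\<Sum>i\<in>I. z i *\<^sub>R w i x))\<^sup>2 \<partial>?M)"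
      proof (rule integral_mono)
        show "integrable ?M (\<lambda>x. \<alpha> y * (1 * (norm (\<Sum>i\<in>I. z i *\<^sub>R w i x))\<^sup>2))" by (intro integrable_mult_right S0(2))
        show "integrable ?M (\<lambda>x. a x y * (norm (\<Sum>i\<in>I. z i *\<^sub>R w i x))\<^sup>2)" by (rule gram_quadratic(1)[OF ai])
        fix x assume "x \<in> space ?M"
        then have x: "x \<in> D" by (simp add: sp)
        \<comment> \<open>The two factors are bounded below separately; a_star is nonnegative and is
          dropped afterwards.\<close>
        have "\<alpha> y \<le> a0 x * E x y"
          unfolding \<alpha>_def E_def m0_def using xm(2)[OF clD[OF x]] pos(2)[OF clD[OF x]] rR[OF _ x]
          by (intro mult_mono exp_linear_bounds(2)) auto
        then have "\<alpha> y \<le> a x y" unfolding aE using pos(1)[OF clD[OF x]] by linarith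
        then show "\<alpha> y * (1 * (norm (\<Sum>i\<in>I. z i *\<^sub>R w i x))\<^sup>2) \<le> a x y * (norm (\<Sum>i\<in>I. z i *\<^sub>R w i x))\<^sup>2"
          unfolding mult_1 by (rule mult_right_mono) simp
      qed
      also have "\<dots> = (\<Sum>i\<in>I. \<Sum>k\<in>I. z i * z k * A i k y)" unfolding A_def by (rule gram_quadratic(2)[OF ai, symmetric])
      finally show ?thesis .
    qed
    show "0 < \<alpha> y" for y unfolding \<alpha>_def using m0 by simp
    show "exp_bounded s (\<lambda>y. inverse (\<alpha> y))" unfolding \<alpha>_def by (rule exp_bounded_inverse_decay[OF m0 R0])
    show "(\<Sum>k\<in>I. A i k y * c k y) = f (e i)" if y: "y \<in> points s" and i: "i \<in> I" for y i
    proof -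
      have "e i \<in> Vh"
      proof -
        have "(\<Sum>l<N. (if l = i then 1 else 0) * e l x) = (\<Sum>l<N. if l = i then e i x else 0)" for x
          by (intro sum.cong) auto
        then have "e i = (\<lambda>x. \<Sum>l<N. (if l = i then 1 else 0) * e l x)" using IN[OF i] by (simp add: sum.delta)
        then show ?thesis unfolding Vh by (intro CollectI exI[of _ "\<lambda>l. if l = i then 1 else 0"] conjI TrueI)
      qed
      then have "f (e i) = (\<integral>x. a x y * (wgrad D (u y) x \<bullet> w i x) \<partial>?M)"
        using sol[OF y] unfolding galerkin_solution_def a_def w_def by simp
      also have "\<dots> = (\<integral>x. (\<Sum>k\<in>I. c k y * (a x y * (w i x \<bullet> w k x))) \<partial>?M)"
      proof (rule integral_cong_AE)
        have m: "wgrad D (u y) \<in> borel_measurable ?M" "w i \<in> borel_measurable ?M"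
          using wgrad_in_L2[of "u y" D] uH[OF y] wL[OF IN[OF i]] unfolding H10_def in_L2_def by auto
        then show "(\<lambda>x. a x y * (wgrad D (u y) x \<bullet> w i x)) \<in> borel_measurable ?M"
          by (intro borel_measurable_times am' borel_measurable_inner)
        show "(\<lambda>x. \<Sum>k\<in>I. c k y * (a x y * (w i x \<bullet> w k x))) \<in> borel_measurable ?M"
          by (intro borel_measurable_sum borel_measurable_times borel_measurable_const borel_measurable_integrable[OF ai[OF i], unfolded mult.assoc[symmetric]]) (use ai[OF i] in auto)
        show "AE x in ?M. a x y * (wgrad D (u y) x \<bullet> w i x) = (\<Sum>k\<in>I. c k y * (a x y * (w i x \<bullet> w k x)))"
          using ug[OF y]
        proof eventually_elim
          fix x assume "wgrad D (u y) x = (\<Sum>k\<in>I. c k y *\<^sub>R w k x)"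
          then show "a x y * (wgrad D (u y) x \<bullet> w i x) = (\<Sum>k\<in>I. c k y * (a x y * (w i x \<bullet> w k x)))"
            by (simp only: inner_sum_left inner_scaleR_left sum_distrib_left)
              (intro sum.cong refl, simp only: mult_ac inner_commute)
        qed
      qed
      also have "\<dots> = (\<Sum>k\<in>I. \<integral>x. c k y * (a x y * (w i x \<bullet> w k x)) \<partial>?M)"
        by (intro Bochner_Integration.integral_sum integrable_mult_right ai i)
      also have "\<dots> = (\<Sum>k\<in>I. A i k y * c k y)" unfolding A_def by (simp add: mult.commute)
      finally show ?thesis by simp
    qed
  qed (simp_all add: tame_const)
  moreover have "(\<Sum>i\<in>I. G (e i) * c i y) = G (u y)" if y: "y \<in> points s" for y
  proof -
    \<comment> \<open>\<open>?v\<close> uses only the independent subfamily and has almost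
      everywhere the same gradient as u y, so G takes the same value on both.\<close>
    let ?v = "\<lambda>x. \<Sum>k\<in>I. c k y * e k x"
    have v: "?v \<in> H10 D" "AE x in ?M. wgrad D ?v x = (\<Sum>k\<in>I. c k y *\<^sub>R w k x)" "G ?v = (\<Sum>k\<in>I. c k y * G (e k))"
      unfolding w_def using e IN by (intro H10_sum[OF D(1,2) fI] fG; blast)+
    have "u y \<in> H1 D" "?v \<in> H1 D" using uH[OF y] v(1) unfolding H10_def by auto
    from H1_lincomb(2)[OF D(1,2) this, of 1 "-1"] ug[OF y] v(2)
    have "AE x in ?M. wgrad D (\<lambda>x. 1 * u y x + (-1) * ?v x) x = 0" by eventually_elim simp
    from dual_V_AE_zero[OF fG(2) H10_lincomb[OF D(1,2) uH[OF y] v(1)] this]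
    have "1 * G (u y) + (-1) * G ?v = 0" unfolding dual_V_lincomb[OF fG(2) uH[OF y] v(1)] .
    then show ?thesis unfolding v(3) by (simp add: mult.commute)
  qed
  ultimately show ?thesis by (rule tame_cong[rotated])
qed

subsection \<open>The error bound\<close>

lemma gauss_ratio:
  assumes "0 < \<sigma>" shows "gauss 1 x / gauss \<sigma> x = \<sigma> * exp (- ((1 - 1 / \<sigma>\<^sup>2) / 2) * x\<^sup>2)"
proof -
  have "sqrt (2 * pi * \<sigma>\<^sup>2) = sqrt (2 * pi) * \<sigma>" using assms by (simp add: real_sqrt_mult)
  then have "gauss 1 x / gauss \<sigma> x = \<sigma> * (exp (- x\<^sup>2 / 2) / exp (- x\<^sup>2 / (2 * \<sigma>\<^sup>2)))"
    using assms by (simp add: normal_density_def)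
  also have "exp (- x\<^sup>2 / 2) / exp (- x\<^sup>2 / (2 * \<sigma>\<^sup>2)) = exp (- x\<^sup>2 / 2 - - x\<^sup>2 / (2 * \<sigma>\<^sup>2))" by (rule exp_diff[symmetric])
  also have "- x\<^sup>2 / 2 - - x\<^sup>2 / (2 * \<sigma>\<^sup>2) = - ((1 - 1 / \<sigma>\<^sup>2) / 2) * x\<^sup>2" using assms by (simp add: field_simps)
  finally show ?thesis .
qed

text \<open>Passing from variance 1 to \<sigma>^2 supplies the Gaussian damping of the integrand;
  its exponent is positive exactly for \<sigma> > 1.\<close>

lemma gauss_prod_ratio:
  assumes "0 < \<sigma>" shows "gauss_prod s 1 y / gauss_prod s \<sigma> y = \<sigma> ^ s * damping s ((1 - 1 / \<sigma>\<^sup>2) / 2) y"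
proof -
  have "gauss_prod s 1 y / gauss_prod s \<sigma> y = (\<Prod>j\<in>{1..s}. gauss 1 (y j) / gauss \<sigma> (y j))"
    unfolding gauss_prod_def by (rule prod_dividef[symmetric])
  also have "\<dots> = (\<Prod>j\<in>{1..s}. \<sigma> * exp (- ((1 - 1 / \<sigma>\<^sup>2) / 2) * (y j)\<^sup>2))" by (simp only: gauss_ratio[OF assms])
  also have "\<dots> = \<sigma> ^ s * damping s ((1 - 1 / \<sigma>\<^sup>2) / 2) y" unfolding damping_def prod.distrib by simp
  finally show ?thesis .
qed

lemma gauss_prod_pos: "0 < \<tau> \<Longrightarrow> 0 < gauss_prod s \<tau> y"
  unfolding gauss_prod_def by (intro prod_pos ballI normal_density_pos)

lemma criterion_nonneg:
  assumes "\<And>u. u \<subseteq> {1..s} \<Longrightarrow> 0 < \<gamma> u" "0 < C1"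
  shows "0 \<le> criterion \<gamma> C1 \<beta> m P (2 * s) q"
  unfolding criterion_eq
proof (intro sum_nonneg mult_nonneg_nonneg dual_sum_nonneg zero_le_power)
  fix v assume "v \<in> {v. v \<noteq> {} \<and> v \<subseteq> {1..2 * s}}"
  then show "0 \<le> \<gamma> (u_of v)" using assms(1)[OF u_of_subset[of v s]] by (simp add: less_imp_le)
qed (use assms(2) in auto)

theorem theorem2:
  fixes \<rho> \<sigma> \<delta> \<beta> :: real and s :: nat and \<gamma> :: "nat set \<Rightarrow> real" and \<psi> :: "real \<Rightarrow> real"
  assumes "1 < \<sigma>" and "\<sigma> \<le> \<rho>" and "1 + 1 / \<rho>\<^sup>2 - 2 / \<sigma>\<^sup>2 > 0"
    and "\<psi> = (\<lambda>x. gauss \<rho> x / gauss \<sigma> x)"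
    and "1 \<le> s"
    and "\<forall>u. u \<subseteq> {1..s} \<longrightarrow> 0 < \<gamma> u"
    and "0 < \<delta>" and "\<delta> < 1 - \<sigma>\<^sup>2 / \<rho>\<^sup>2" and "\<beta> = 1 - \<sigma>\<^sup>2 / \<rho>\<^sup>2 - \<delta>"
  shows
    "(\<exists>C. walsh_constant (gauss \<sigma>) \<psi> \<psi> \<beta> C) \<and>
     (\<forall>C. walsh_constant (gauss \<sigma>) \<psi> \<psi> \<beta> C \<longrightarrow>
       (\<forall>m\<ge>1. \<exists>X. cbc_shifted_point_set \<gamma> (max C (1 / 2)) \<beta> s m X) \<and>
       (\<forall>m\<ge>1. \<forall>X. cbc_shifted_point_set \<gamma> (max C (1 / 2)) \<beta> s m X \<longrightarrow>
          X \<subseteq> {1..s} \<rightarrow>\<^sub>E {0<..<1} \<and> card X = 2 ^ m) \<and>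
       (\<forall>lam. 1 / (1 + \<beta>) < lam \<and> lam \<le> 1 \<longrightarrow>
         (\<exists>K>0. \<forall>m\<ge>1. \<forall>X. cbc_shifted_point_set \<gamma> (max C (1 / 2)) \<beta> s m X \<longrightarrow>
           (\<forall>(D :: 'd::euclidean_space set) Vh f G a_star a0 \<mu> \<xi> u F F\<sigma>.
              lognormal_problem s D Vh f G a_star a0 \<mu> \<xi> \<and>
              (\<forall>y \<in> {1..s} \<rightarrow>\<^sub>E UNIV.
                 galerkin_solution D Vh f (\<lambda>x. lognormal_coeff s a_star a0 \<mu> \<xi> x y) (u y)) \<and>
              F = (\<lambda>y. G (u y)) \<and>
              F\<sigma> = (\<lambda>y. F y * gauss_prod s 1 y / gauss_prod s \<sigma> y) \<longrightarrow>
              (\<integral>y. F y * gauss_prod s 1 y \<partial>(\<Pi>\<^sub>M j\<in>{1..s}. lborel))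
                = (\<integral>y. F\<sigma> y * gauss_prod s \<sigma> y \<partial>(\<Pi>\<^sub>M j\<in>{1..s}. lborel)) \<and>
              ennreal \<bar>(\<integral>y. F\<sigma> y * gauss_prod s \<sigma> y \<partial>(\<Pi>\<^sub>M j\<in>{1..s}. lborel))
                        - (\<Sum>x\<in>X. F\<sigma> (gauss_quantile s \<sigma> x)) / 2 ^ m\<bar>
                \<le> ennreal (K / (2 ^ m) powr (1 / lam)) * weighted_norm s \<gamma> (gauss \<sigma>) \<psi> \<psi> F\<sigma>))))"
proof (intro conjI allI impI, goal_cases)
  case 1
  interpret normal_cdf \<sigma> by standard (use assms(1) in simp)
  have "0 < \<rho>" "0 \<le> \<beta>" using assms(1,2,8,9) by simp_all
  then show ?case using exists_walsh_constant[OF _ assms(7) _ assms(9,4)] by blast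
next
  case (2 C m)
  obtain P :: "bit poly" where P: "irreducible P" "degree P = m" using exists_irreducible_bit_poly[OF 2(2)] by blast
  obtain q where "cbc_vector \<gamma> (max C (1 / 2)) \<beta> s m P q" using exists_cbc_vector[OF 2(2)] by blast
  then show ?case using P unfolding cbc_shifted_point_set_def is_shift_of_def by blast
next
  case (3 C m X)
  then obtain P q where P: "degree P = m" and q: "cbc_vector \<gamma> (max C (1 / 2)) \<beta> s m P q"
    and "is_shift_of s m (interlaced_lattice s m P q) X" unfolding cbc_shifted_point_set_def by blast
  then show ?case by (elim shift_of_interlaced_lattice)
next
  case (4 C m X)
  then obtain P q where P: "degree P = m" and q: "cbc_vector \<gamma> (max C (1 / 2)) \<beta> s m P q"
    and "is_shift_of s m (interlaced_lattice s m P q) X" unfolding cbc_shifted_point_set_def by blast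
  then obtain \<Delta> where \<Delta>: "\<Delta> \<in> {1..s} \<rightarrow>\<^sub>E {0..<1}" and X: "X = shifted_point s m P q \<Delta> ` {..<2 ^ m}"
    by (elim shift_of_interlaced_lattice)
  have "q 1 = 1" using q unfolding cbc_vector_def by blast
  then show ?case unfolding X using card_image[OF inj_shifted_point[OF \<Delta> assms(5) 4(2) P]] by simp
next
  case (5 C lam)
  interpret normal_cdf \<sigma> by standard (use assms(1) in simp)
  define C1 where "C1 = max C (1 / 2)"
  have C1: "0 < C1" unfolding C1_def by simp
  have \<gamma>: "0 < \<gamma> u" if "u \<subseteq> {1..s}" for u using assms(6) that by blast
  have "0 \<le> \<sigma>\<^sup>2 / \<rho>\<^sup>2" by simp
  then have \<beta>: "0 < \<beta>" "\<beta> \<le> 1" and \<rho>: "0 < \<rho>" using assms(1,2,7,8,9) by linarith+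
  have lam: "0 < lam" "lam \<le> 1" "1 < (1 + \<beta>) * lam"
  proof -
    have "1 / (1 + \<beta>) < lam" "lam \<le> 1" using 5(2) by blast+
    moreover have "0 < 1 / (1 + \<beta>)" using \<beta> by simp
    ultimately show "0 < lam" "lam \<le> 1" by linarith+
    show "1 < (1 + \<beta>) * lam" using \<open>1 / (1 + \<beta>) < lam\<close> \<beta> by (simp add: divide_less_eq mult.commute)
  qed
  define Q where "Q = max 1 (max 1 (transform_const \<rho> \<delta>) / (C1 * 2 powr (2 + \<beta>)))"
  have Q: "1 \<le> Q" unfolding Q_def by simp
  \<comment> \<open>The bound for the lam-th power of the criterion before division by 2^m; the
    weight sums in it converge because (1 + \<beta>) * lam > 1.\<close>
  define S where "S = (\<Sum>v\<in>Pow {1..2 * s}. 3 * criterion_weight \<gamma> C1 \<beta> v powr lam * walsh_weight_sum ((1 + \<beta>) * lam) ^ card v)"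
  have S: "0 \<le> S" unfolding S_def by (intro sum_nonneg mult_nonneg_nonneg zero_le_power walsh_weight_sum_nonneg) auto
  \<comment> \<open>The summand 1 keeps K positive in case S = 0.\<close>
  define K where "K = Q ^ s * S powr (1 / lam) + 1"
  have K: "0 < K" unfolding K_def using Q by (simp add: add_nonneg_pos)
  have main: "(\<integral>y. F y * gauss_prod s 1 y \<partial>euclid s) = (\<integral>y. F\<sigma> y * gauss_prod s \<sigma> y \<partial>euclid s) \<and>
      ennreal \<bar>(\<integral>y. F\<sigma> y * gauss_prod s \<sigma> y \<partial>euclid s) - (\<Sum>x\<in>X. F\<sigma> (gauss_quantile s \<sigma> x)) / 2 ^ m\<bar>
        \<le> ennreal (K / (2 ^ m) powr (1 / lam)) * weighted_norm s \<gamma> (gauss \<sigma>) \<psi> \<psi> F\<sigma>"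
    if m: "1 \<le> m" and XX: "cbc_shifted_point_set \<gamma> C1 \<beta> s m X"
      and lp: "lognormal_problem s D Vh f G a_star a0 \<mu> \<xi> \<and>
        (\<forall>y \<in> points s. galerkin_solution D Vh f (\<lambda>x. lognormal_coeff s a_star a0 \<mu> \<xi> x y) (u y)) \<and>
        F = (\<lambda>y. G (u y)) \<and> F\<sigma> = (\<lambda>y. F y * gauss_prod s 1 y / gauss_prod s \<sigma> y)"
    for m X Vh f G a_star a0 \<mu> \<xi> u F F\<sigma> and D :: "'d set"
  proof
    have F: "F = (\<lambda>y. G (u y))" and F\<sigma>: "F\<sigma> = (\<lambda>y. F y * gauss_prod s 1 y / gauss_prod s \<sigma> y)" using lp by blast+
    have lp1: "lognormal_problem s D Vh f G a_star a0 \<mu> \<xi>" using lp by blast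
    have lp2: "galerkin_solution D Vh f (\<lambda>x. lognormal_coeff s a_star a0 \<mu> \<xi> x y) (u y)" if "y \<in> points s" for y
      using lp that by blast
    have "F y * gauss_prod s 1 y = F\<sigma> y * gauss_prod s \<sigma> y" for y
      unfolding F\<sigma> using gauss_prod_pos[OF \<sigma>_pos, of s y] by simp
    then show "(\<integral>y. F y * gauss_prod s 1 y \<partial>euclid s) = (\<integral>y. F\<sigma> y * gauss_prod s \<sigma> y \<partial>euclid s)" by (simp only:)
    obtain P q where P: "irreducible P" "degree P = m" and q: "cbc_vector \<gamma> C1 \<beta> s m P q"
      and "is_shift_of s m (interlaced_lattice s m P q) X" using XX unfolding cbc_shifted_point_set_def by blast
    then obtain \<Delta> where \<Delta>: "\<Delta> \<in> {1..s} \<rightarrow>\<^sub>E {0..<1}" and X: "X = shifted_point s m P q \<Delta> ` {..<2 ^ m}"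
      and X01: "X \<subseteq> {1..s} \<rightarrow>\<^sub>E {0<..<1}" by (elim shift_of_interlaced_lattice)
    have x01: "0 < shifted_point s m P q \<Delta> n j \<and> shifted_point s m P q \<Delta> n j < 1" if "n < 2 ^ m" "j \<in> {1..s}" for n j
    proof -
      have "shifted_point s m P q \<Delta> n \<in> {1..s} \<rightarrow>\<^sub>E {0<..<1}" using X01 that(1) unfolding X by blast
      from PiE_mem[OF this that(2)] show ?thesis by simp
    qed
    have "q 1 = 1" using q unfolding cbc_vector_def by blast
    then have inj: "inj_on (shifted_point s m P q \<Delta>) {..<2 ^ m}" by (rule inj_shifted_point[OF \<Delta> assms(5) m P(2)])
    \<comment> \<open>The rate at which the quotient of the two Gaussian densities decays.\<close>
    define \<kappa> where "\<kappa> = (1 - 1 / \<sigma>\<^sup>2) / 2"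
    have "1 < \<sigma>\<^sup>2" using assms(1) by (simp add: one_less_power)
    then have "1 / \<sigma>\<^sup>2 < 1" by (subst divide_less_eq_1_pos) linarith+
    then have \<kappa>: "0 < \<kappa>" unfolding \<kappa>_def by simp
    have "smooth_decay s \<kappa> F\<sigma>"
      unfolding smooth_decay_def gsmooth_def
    proof (intro allI exI conjI ballI)
      fix n
      show "tame s n (\<lambda>y. \<sigma> ^ s * F y)"
        unfolding F by (intro tame_cmult tame_galerkin[OF lp1 lp2])
      show "F\<sigma> y = \<sigma> ^ s * F y * damping s \<kappa> y" for y
      proof -
        have "F\<sigma> y = F y * (gauss_prod s 1 y / gauss_prod s \<sigma> y)" unfolding F\<sigma> by simp
        then show ?thesis unfolding gauss_prod_ratio[OF \<sigma>_pos] \<kappa>_def by simp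
      qed
    qed
    from quadrature_error[OF this \<kappa> \<rho> assms(7) \<beta> assms(9,4) \<gamma> C1 \<Delta> m P(2) x01 Q_def]
    have err: "ennreal \<bar>(\<Sum>n<2 ^ m. F\<sigma> (gauss_quantile s \<sigma> (shifted_point s m P q \<Delta> n))) / 2 ^ m - (\<integral>y. F\<sigma> y * gauss_prod s \<sigma> y \<partial>euclid s)\<bar>
      \<le> ennreal (Q ^ s * criterion \<gamma> C1 \<beta> m P (2 * s) q) * weighted_norm s \<gamma> (gauss \<sigma>) \<psi> \<psi> F\<sigma>" .
    let ?B = "criterion \<gamma> C1 \<beta> m P (2 * s) q"
    have B0: "0 \<le> ?B" by (rule criterion_nonneg[OF \<gamma> C1])
    have "?B powr lam \<le> S / 2 ^ m"
      unfolding S_def by (rule cbc_criterion_bound[OF \<gamma> C1 lam(3,1,2) m P(2,1) q]) (use assms(5) in auto)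
    \<comment> \<open>Undoing the power lam turns the rate 2^-m into 2^(-m / lam).\<close>
    then have "(?B powr lam) powr (1 / lam) \<le> (S / 2 ^ m) powr (1 / lam)" using lam by (intro powr_mono2) auto
    moreover have "(?B powr lam) powr (1 / lam) = ?B" using B0 lam by (simp add: powr_powr)
    moreover have "(S / 2 ^ m) powr (1 / lam) = S powr (1 / lam) / (2 ^ m) powr (1 / lam)" using S by (simp add: powr_divide)
    ultimately have "Q ^ s * ?B \<le> Q ^ s * (S powr (1 / lam) / (2 ^ m) powr (1 / lam))" using Q by (intro mult_left_mono) auto
    also have "\<dots> \<le> K / (2 ^ m) powr (1 / lam)"
      unfolding K_def times_divide_eq_right by (intro divide_right_mono) auto
    finally have "ennreal (Q ^ s * ?B) * weighted_norm s \<gamma> (gauss \<sigma>) \<psi> \<psi> F\<sigma>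
      \<le> ennreal (K / (2 ^ m) powr (1 / lam)) * weighted_norm s \<gamma> (gauss \<sigma>) \<psi> \<psi> F\<sigma>"
      by (intro mult_right_mono ennreal_leI) auto
    moreover have "(\<Sum>x\<in>X. F\<sigma> (gauss_quantile s \<sigma> x)) = (\<Sum>n<2 ^ m. F\<sigma> (gauss_quantile s \<sigma> (shifted_point s m P q \<Delta> n)))"
      unfolding X by (rule sum.reindex[OF inj, unfolded comp_def])
    ultimately show "ennreal \<bar>(\<integral>y. F\<sigma> y * gauss_prod s \<sigma> y \<partial>euclid s) - (\<Sum>x\<in>X. F\<sigma> (gauss_quantile s \<sigma> x)) / 2 ^ m\<bar>
        \<le> ennreal (K / (2 ^ m) powr (1 / lam)) * weighted_norm s \<gamma> (gauss \<sigma>) \<psi> \<psi> F\<sigma>"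
      using order_trans[OF err] by (simp only: abs_minus_commute)
  qed
  show ?case unfolding C1_def[symmetric]
    by (intro exI[of _ K] conjI[OF K] allI impI) (rule main; assumption)
qed

end
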